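(* Under the assumptions of the continuity theorem (i.e. $M$ compact; $C_1|u|^q+K_1\le L(x,u)\le C_2|u|^2+K_2$; $|\partial L/\partial x|\le C_3|u|^2$; the Hessian of $L$ in $u$ positive definite; $\{X_1,\dots,X_n\}$ $3$-generating; constants $C_1,C_2,C_3,K_1,K_2>0$, $q>1$), there exists a unique constant $h\in\mathbb{R}$ such that the Hamilton–Jacobi equation $H(x,df_x)=-h$ has a viscosity solution $f:M\to\mathbb{R}$.
   Context: $M$ is a compact manifold, $X_0,\dots,X_n$ smooth vector fields, $F(x,u)=X_0(x)+\sum_i u_iX_i(x)$, $L:M\times\mathbb{R}^n\to\mathbb{R}$ smooth. The Hamiltonian is $H(x,\alpha)=\sup_{u\in\mathbb{R}^n}[\alpha(F(x,u))-L(x,u)]$ for $\alpha\in T_x^*M$. $k$-generating: at every point the family together with its iterated Lie brackets of length $\le k$ spans the tangent space. For a continuous $f$, the sub-differential $d^-f_x$ is the set of $p\in T^*_xM$ such that there is a smooth $g$ near $x$ with $dg_x=p$, $g(x)=f(x)$, $f\le g$ near $x$; the super-differential $d^+f_x$ is defined likewise with $f\ge g$ near $x$. A continuous $f$ is a sub-solution of $G(f(x),x,p)=0$ if $G(f(x),x,p)\le 0$ for all $p\in d^-f_x$, a super-solution if $G(f(x),x,p)\ge0$ for all $p\in d^+f_x$, and a viscosity solution if both. Here $G(r,x,p)=H(x,p)+h$.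
   Formalization: M is additionally assumed connected and nonempty (two disjoint circles with L=|u|²/2+c, c=1 on one and 2 on the other, admit no common h); M is taken embedded in a Euclidean space, with the fields and L extended smoothly to it, which Whitney's theorem allows. *)

theory Defs
  imports "HOL-Analysis.Analysis"
begin

fun smooth_k :: "nat \<Rightarrow> ('a::real_normed_vector) set \<Rightarrow> ('a \<Rightarrow> 'b::real_normed_vector) \<Rightarrow> bool" where
  "smooth_k 0 S f = continuous_on S f"
| "smooth_k (Suc k) S f =
     ((\<forall>x\<in>S. f differentiable (at x)) \<and>
      (\<forall>v. smooth_k k S (\<lambda>x. frechet_derivative f (at x) v)))"

definition smooth_on :: "('a::real_normed_vector) set \<Rightarrow> ('a \<Rightarrow> 'b::real_normed_vector) \<Rightarrow> bool" where
  "smooth_on S f \<longleftrightarrow> open S \<and> (\<forall>k. smooth_k k S f)"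

definition smooth_submanifold :: "('a::euclidean_space) set \<Rightarrow> bool" where
  "smooth_submanifold M \<longleftrightarrow> (\<exists>d. d \<le> DIM('a) \<and> (\<forall>x\<in>M. \<exists>U (\<Phi>::'a \<Rightarrow> 'a).
      x \<in> U \<and> smooth_on U \<Phi> \<and>
      (\<forall>y\<in>U. dim (range (frechet_derivative \<Phi> (at y))) = DIM('a) - d) \<and>
      M \<inter> U = {y\<in>U. \<Phi> y = 0}))"

definition tangent_space :: "('a::euclidean_space) set \<Rightarrow> 'a \<Rightarrow> 'a set" where
  "tangent_space M x = {v. \<exists>\<gamma> e. e > 0 \<and> \<gamma> 0 = x \<and> (\<forall>t. \<bar>t\<bar> < e \<longrightarrow> \<gamma> t \<in> M) \<and>
                              (\<gamma> has_vector_derivative v) (at 0)}"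

definition lie_bracket :: "('a::euclidean_space \<Rightarrow> 'a) \<Rightarrow> ('a \<Rightarrow> 'a) \<Rightarrow> 'a \<Rightarrow> 'a" where
  "lie_bracket A B x = frechet_derivative B (at x) (A x) - frechet_derivative A (at x) (B x)"

inductive_set brackets :: "('i \<Rightarrow> ('a::euclidean_space \<Rightarrow> 'a)) \<Rightarrow> (('a \<Rightarrow> 'a) \<times> nat) set"
  for X :: "'i \<Rightarrow> ('a \<Rightarrow> 'a)" where
  gen: "(X i, 1) \<in> brackets X"
| br: "(A, a) \<in> brackets X \<Longrightarrow> (B, b) \<in> brackets X \<Longrightarrow> (lie_bracket A B, a + b) \<in> brackets X"

definition k_generating :: "('a::euclidean_space) set \<Rightarrow> nat \<Rightarrow> ('i \<Rightarrow> ('a \<Rightarrow> 'a)) \<Rightarrow> bool" where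
  "k_generating M k X \<longleftrightarrow>
     (\<forall>x\<in>M. span {A x | A l. (A, l) \<in> brackets X \<and> l \<le> k} = span (tangent_space M x))"

definition ctrl :: "('a::euclidean_space \<Rightarrow> 'a) \<Rightarrow> ('m::finite \<Rightarrow> 'a \<Rightarrow> 'a) \<Rightarrow> 'a \<Rightarrow> real^'m \<Rightarrow> 'a" where
  "ctrl X0 X x u = X0 x + (\<Sum>i\<in>UNIV. (u $ i) *\<^sub>R X i x)"

text \<open>Hamiltonian; a covector at x is given by a (linear) functional alpha.\<close>
definition hamiltonian ::
  "('a::euclidean_space \<Rightarrow> 'a) \<Rightarrow> ('m::finite \<Rightarrow> 'a \<Rightarrow> 'a) \<Rightarrow> ('a \<Rightarrow> real^'m \<Rightarrow> real) \<Rightarrow> 'a \<Rightarrow> ('a \<Rightarrow> real) \<Rightarrow> real" where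
  "hamiltonian X0 X L x \<alpha> = (SUP u. \<alpha> (ctrl X0 X x u) - L x u)"

definition subdiff :: "('a::euclidean_space) set \<Rightarrow> ('a \<Rightarrow> real) \<Rightarrow> 'a \<Rightarrow> ('a \<Rightarrow> real) set" where
  "subdiff M f x = {frechet_derivative g (at x) | g. \<exists>U. x \<in> U \<and> smooth_on U g \<and>
        g x = f x \<and> (\<forall>y\<in>M \<inter> U. f y \<le> g y)}"

definition superdiff :: "('a::euclidean_space) set \<Rightarrow> ('a \<Rightarrow> real) \<Rightarrow> 'a \<Rightarrow> ('a \<Rightarrow> real) set" where
  "superdiff M f x = {frechet_derivative g (at x) | g. \<exists>U. x \<in> U \<and> smooth_on U g \<and>
        g x = f x \<and> (\<forall>y\<in>M \<inter> U. f y \<ge> g y)}"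

definition viscosity_solution ::
  "('a::euclidean_space) set \<Rightarrow> ('a \<Rightarrow> 'a) \<Rightarrow> ('m::finite \<Rightarrow> 'a \<Rightarrow> 'a) \<Rightarrow> ('a \<Rightarrow> real^'m \<Rightarrow> real)
     \<Rightarrow> real \<Rightarrow> ('a \<Rightarrow> real) \<Rightarrow> bool" where
  "viscosity_solution M X0 X L h f \<longleftrightarrow> continuous_on M f \<and>
     (\<forall>x\<in>M. \<forall>p\<in>subdiff M f x. hamiltonian X0 X L x p + h \<le> 0) \<and>
     (\<forall>x\<in>M. \<forall>p\<in>superdiff M f x. hamiltonian X0 X L x p + h \<ge> 0)"

end

theory Submission imports Defs begin

text \<open>
  Existence: a path is a concatenation of flows of constant controls, with cost \<open>\<integral> L\<close>. Words of \<open>24\<close> legs whose expansion consists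
  of a drift and a triple bracket, together with Brouwer's theorem, show that a path can absorb displacements of order \<open>\<sigma>\<^sup>3\<close>
  at small extra cost. Hence any two points are joined in unit time with bounded cost, and the minimal cost \<open>v\<^sub>T(y)\<close> of reaching \<open>y\<close>
  in time \<open>T \<ge> 1\<close> is equicontinuous in \<open>y\<close> and quasi-additive in \<open>T\<close>. So \<open>v\<^sub>T - h T\<close> is bounded for some \<open>h\<close>, and its lower limit
  as \<open>T\<close> tends to infinity is a fixed point of the Lax-Oleinik semigroup, therefore a viscosity solution.

  Uniqueness of \<open>h\<close>: a sub-solution for \<open>h\<close> and a super-solution for \<open>h'\<close> satisfy \<open>h \<le> h'\<close>. The inf- and sup-convolutions in the
  ambient space are compared along Euler polygons; large controls are slowed down, at a small extra cost by convexity of \<open>L\<close> on rays,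
  so that the Lipschitz bound of \<open>L\<close> in space applies.
\<close>

section \<open>Differential inequalities and ordinary differential equations\<close>

text \<open>The obstacle is the gap between the lower growth |u|^q of L and the quadratic growth of
  its upper bound and of its variation in space. The cost of a path controls only the integral of
  |u|^q, so moving a path sideways may be arbitrarily expensive, its variation of L being of size
  |u|^2. Slowing down the controls above R displaces a path by order R^(-q); afterwards L varies
  along it by order R^2 R^(-q) per unit of displacement, and the product R^(2-2q) tends to 0 because
  q > 1. An endpoint error of order R^(-q) is left. In a time slot v^2 the quadratic bound affords
  controls of size K/v at cost of order K^2, small for small K, and their brackets of length at most
  3 cover displacements of order v^3. This forces the choice of R^(-q) of order v^3. The drift X0
  can be neither switched off nor reversed, so every word has to carry it and be balanced against
  it. The geometry stays in the ambient Euclidean space, where fields and test functions live: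
  coordinates serve as test functions in the expansions, quadratics in the comparison.\<close>

text \<open>A one-sided difference inequality is assumed because \<open>D\<close> will be a distance
  to M or the norm of a difference of curves, which need not be differentiable.\<close>

lemma dini_gronwall:
  fixes D :: "real \<Rightarrow> real"
  assumes b: "b \<ge> 0" and cont: "continuous_on {0..b} D"
    and k: "k \<ge> 0" and m: "m \<ge> 0" and D0: "D 0 \<ge> 0"
    and step: "\<And>t e. 0 \<le> t \<Longrightarrow> t < b \<Longrightarrow> e > 0 \<Longrightarrow>
       \<exists>d>0. \<forall>h. 0 < h \<and> h < d \<and> t + h \<le> b \<longrightarrow> D (t + h) \<le> D t + h * (k * D t + m + e)"
  shows "D b \<le> exp (k * b) * (D 0 + m * b)"
proof -
  have main: "D b \<le> exp (k * b) * (D 0 + e + (m + e) * b)" if e: "e > 0" for e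
  proof -
    \<comment> \<open>\<open>U\<close> satisfies U' = k U + exp (k t) (m + e), so it grows at least
      as fast as \<open>step\<close> lets \<open>D\<close> grow. The times up to which
      \<open>D\<close> stays below \<open>U\<close> form an interval that contains its supremum and
      cannot stop before \<open>b\<close>.\<close>
    define U where "U t = exp (k * t) * (D 0 + e + (m + e) * t)" for t
    have contU: "continuous_on S U" for S unfolding U_def by (intro continuous_intros)
    define T where "T = {t\<in>{0..b}. \<forall>r\<in>{0..t}. D r \<le> U r}"
    have T0: "0 \<in> T" using b e D0 by (auto simp: T_def U_def)
    have bdd: "bdd_above T" by (auto simp: T_def bdd_above_def)
    define s where "s = Sup T"
    have s: "0 \<le> s" "s \<le> b"
      using T0 bdd by (auto simp: s_def cSup_upper T_def intro!: cSup_least)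
    have below: "D r \<le> U r" if "0 \<le> r" "r < s" for r
    proof -
      obtain t where "t \<in> T" "r < t" using T0 less_cSupD[of T r] \<open>r < s\<close> unfolding s_def by auto
      then show ?thesis using that by (auto simp: T_def)
    qed
    have at_s: "D s \<le> U s"
    proof (cases "s = 0")
      case True then show ?thesis using e by (simp add: U_def)
    next
      case False
      then have s0: "0 < s" using s by simp
      have cs: "continuous (at s within {0..s}) (\<lambda>t. U t - D t)"
        using cont contU s by (metis atLeastAtMost_iff continuous_on_diff continuous_on_eq_continuous_within continuous_on_subset atLeastatMost_subset_iff order_refl)
      have lim: "((\<lambda>t. U t - D t) \<longlongrightarrow> U s - D s) (at s within {0..<s})"
        using cs unfolding continuous_within by (rule tendsto_within_subset) auto
      have nb: "at s within {0..<s} \<noteq> bot"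
        using islimpt_subset[OF islimpt_greaterThanLessThan2[OF s0], of "{0..<s}"] by (force simp: trivial_limit_within)
      have "eventually (\<lambda>t. 0 \<le> U t - D t) (at s within {0..<s})"
        unfolding eventually_at_filter using below by (intro always_eventually) auto
      from tendsto_lowerbound[OF lim this nb] show ?thesis by simp
    qed
    have sT: "s \<in> T" unfolding T_def mem_Collect_eq
    proof (intro conjI ballI)
      show "D r \<le> U r" if "r \<in> {0..s}" for r
        using that below[of r] at_s by (cases "r = s") auto
    qed (use s in auto)
    have "s = b"
    proof (rule ccontr)
      assume "s \<noteq> b"
      then have sb: "s < b" using s by simp
      obtain d where d: "d > 0" and dd: "\<And>h. 0 < h \<Longrightarrow> h < d \<Longrightarrow> s + h \<le> b \<Longrightarrow> D (s + h) \<le> D s + h * (k * D s + m + e)"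
        using step[OF s(1) sb e] by blast
      define h0 where "h0 = min (d/2) (b - s)"
      have h0: "h0 > 0" using d sb by (simp add: h0_def)
      have ab: "D (s + h) \<le> U (s + h)" if h: "0 < h" "h \<le> h0" for h
      proof -
        have "D (s + h) \<le> D s + h * (k * D s + m + e)" using dd[of h] h d by (auto simp: h0_def)
        also have "\<dots> = (1 + h * k) * D s + h * (m + e)" by (simp add: algebra_simps)
        also have "\<dots> \<le> (1 + h * k) * U s + h * (m + e)"
          using at_s h k by (intro add_right_mono mult_left_mono) auto
        also have "\<dots> \<le> exp (h * k) * U s + exp (k * (s + h)) * ((m + e) * h)"
        proof (intro add_mono mult_right_mono)
          show "1 + h * k \<le> exp (h * k)" by (rule exp_ge_add_one_self)
          show "0 \<le> U s" using D0 e m s by (simp add: U_def)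
          have "1 \<le> exp (k * (s + h))" using k s h by simp
          then have "1 * ((m + e) * h) \<le> exp (k * (s + h)) * ((m + e) * h)"
            using m e h by (intro mult_right_mono) auto
          then show "h * (m + e) \<le> exp (k * (s + h)) * ((m + e) * h)" by (simp add: mult.commute)
        qed
        also have "\<dots> = U (s + h)" by (simp add: U_def algebra_simps exp_add)
        finally show ?thesis .
      qed
      have above: "D r \<le> U r" if "s < r" "r \<le> s + h0" for r
        using that ab[of "r - s"] by simp
      have "s + h0 \<in> T"
        unfolding T_def mem_Collect_eq
      proof (intro conjI ballI)
        show "s + h0 \<in> {0..b}" using s h0 by (auto simp: h0_def)
        show "D r \<le> U r" if "r \<in> {0..s + h0}" for r
          using that above[of r] below[of r] at_s by (cases r s rule: linorder_cases) auto
      qed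
      then have "s + h0 \<le> s" unfolding s_def using bdd by (rule cSup_upper)
      then show False using h0 by simp
    qed
    then show ?thesis using at_s by (simp add: U_def)
  qed
  have "((\<lambda>e. exp (k * b) * (D 0 + e + (m + e) * b)) \<longlongrightarrow> exp (k * b) * (D 0 + 0 + (m + 0) * b)) (at_right 0)"
    by (intro tendsto_intros)
  moreover have "eventually (\<lambda>e. D b \<le> exp (k * b) * (D 0 + e + (m + e) * b)) (at_right 0)"
    unfolding eventually_at_filter by (intro always_eventually) (use main in auto)
  ultimately have "D b \<le> exp (k * b) * (D 0 + 0 + (m + 0) * b)"
    by (intro tendsto_lowerbound) auto
  then show ?thesis by simp
qed

section \<open>Global solutions of Lipschitz differential equations\<close>

lemma integral_power_real:
  assumes "0 \<le> (t::real)"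
  shows "((\<lambda>s. s ^ n) has_integral t ^ Suc n / Suc n) {0..t}"
proof -
  have "((\<lambda>s. s ^ Suc n / Suc n) has_vector_derivative s ^ n) (at s within {0..t})" for s
    by (auto intro!: derivative_eq_intros simp: has_real_derivative_iff_has_vector_derivative[symmetric] simp del: power_Suc)
  then have "((\<lambda>s. s ^ n) has_integral (t ^ Suc n / Suc n - 0 ^ Suc n / Suc n)) {0..t}"
    using assms by (intro fundamental_theorem_of_calculus) auto
  then show ?thesis by simp
qed

text \<open>The factorial bound on the differences of consecutive Picard iterates gives uniform
  convergence on every bounded interval, so the solution is global at once and no short-time
  solutions have to be glued.\<close>

lemma picard_forward:
  fixes G :: "'a::euclidean_space \<Rightarrow> 'a"
  assumes lip: "\<And>x y. norm (G x - G y) \<le> K * norm (x - y)"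
  shows "\<exists>g. g 0 = x \<and> (\<forall>t\<ge>0. (g has_vector_derivative G (g t)) (at t within {0..}))"
proof -
  have K: "K \<ge> 0"
  proof -
    obtain b :: 'a where "b \<in> Basis" using nonempty_Basis by blast
    then have "0 \<le> K * norm (b - 0)" using lip[of b 0] by (meson norm_ge_zero order_trans)
    then show ?thesis using \<open>b \<in> Basis\<close> by simp
  qed
  have contG: "continuous_on S G" for S
    using lipschitz_on_continuous_on[of K S G] by (auto simp: lipschitz_on_def dist_norm K lip)
  define p where "p = rec_nat (\<lambda>t::real. x) (\<lambda>n q t. x + integral {0..t} (\<lambda>s. G (q s)))"
  have p0: "p 0 t = x" and pS: "p (Suc n) t = x + integral {0..t} (\<lambda>s. G (p n s))" for n t
    by (simp_all add: p_def)
  have contp: "continuous_on {0..b} (p n)" for n b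
  proof (induction n)
    case 0 then show ?case by (simp add: p0)
  next
    case (Suc n)
    have "(\<lambda>s. G (p n s)) integrable_on {0..b}"
      by (intro integrable_continuous_interval continuous_on_compose2[OF contG Suc]) auto
    then show ?case unfolding pS
      by (intro continuous_intros indefinite_integral_continuous_1)
  qed
  have intG: "(\<lambda>s. G (p n s)) integrable_on {0..b}" for n b
    by (intro integrable_continuous_interval continuous_on_compose2[OF contG contp]) auto
  define C where "C = norm (G x)"
  have diff: "norm (p (Suc n) t - p n t) \<le> C * K ^ n * t ^ Suc n / fact (Suc n)" if "t \<ge> 0" for n t
    using that
  proof (induction n arbitrary: t)
    case 0
    then show ?case by (simp add: pS p0 C_def)
  next
    case (Suc n)
    have "p (Suc (Suc n)) t - p (Suc n) t = integral {0..t} (\<lambda>s. G (p (Suc n) s) - G (p n s))"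
      unfolding pS[of "Suc n"] pS[of n] using integral_diff[OF intG intG, of t "Suc n" n] by (simp add: pS)
    also have "norm \<dots> \<le> integral {0..t} (\<lambda>s. C * K ^ Suc n / fact (Suc n) * s ^ Suc n)"
    proof (rule integral_norm_bound_integral)
      show "(\<lambda>s. G (p (Suc n) s) - G (p n s)) integrable_on {0..t}"
        by (intro integrable_diff intG)
      show "(\<lambda>s. C * K ^ Suc n / fact (Suc n) * s ^ Suc n) integrable_on {0..t}"
        by (intro integrable_continuous_interval continuous_intros)
      show "norm (G (p (Suc n) s) - G (p n s)) \<le> C * K ^ Suc n / fact (Suc n) * s ^ Suc n" if "s \<in> {0..t}" for s
      proof -
        have "norm (G (p (Suc n) s) - G (p n s)) \<le> K * norm (p (Suc n) s - p n s)" by (rule lip)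
        also have "\<dots> \<le> K * (C * K ^ n * s ^ Suc n / fact (Suc n))"
          using that K by (intro mult_left_mono Suc.IH) auto
        finally show ?thesis by (simp add: algebra_simps)
      qed
    qed
    also have "\<dots> = C * K ^ Suc n / fact (Suc n) * (t ^ Suc (Suc n) / Suc (Suc n))"
      using has_integral_mult_right[OF integral_power_real[OF Suc.prems, of "Suc n"], of "C * K ^ Suc n / fact (Suc n)"]
      by (intro integral_unique)
    also have "\<dots> = C * K ^ Suc n * t ^ Suc (Suc n) / fact (Suc (Suc n))" by (simp add: field_simps)
    finally show ?case .
  qed
  have tele: "(\<Sum>i<n. p (Suc i) t - p i t) = p n t - x" for n t
    using sum_lessThan_telescope[of "\<lambda>i. p i t" n] by (simp add: p0)
  \<comment> \<open>The limit is written as a telescoping series so that the Weierstrass test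
    applies.\<close>
  define g where "g t = x + (\<Sum>i. p (Suc i) t - p i t)" for t
  have ul: "uniform_limit {0..b} p g sequentially" if "b \<ge> 0" for b
  proof -
    have "uniform_limit {0..b} (\<lambda>n t. \<Sum>i<n. p (Suc i) t - p i t) (\<lambda>t. \<Sum>i. p (Suc i) t - p i t) sequentially"
    proof (rule Weierstrass_m_test)
      show "norm (p (Suc n) t - p n t) \<le> C * b * (inverse (fact n) * (K * b) ^ n)" if "t \<in> {0..b}" for n t
      proof -
        have "norm (p (Suc n) t - p n t) \<le> C * K ^ n * t ^ Suc n / fact (Suc n)" using diff that by auto
        also have "\<dots> \<le> C * K ^ n * b ^ Suc n / fact n"
          using that K by (intro frac_le mult_left_mono power_mono fact_mono) (auto simp: C_def)
        finally show ?thesis by (simp add: field_simps)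
      qed
      show "summable (\<lambda>n. C * b * (inverse (fact n) * (K * b) ^ n))"
        by (intro summable_mult summable_exp)
    qed
    then have "uniform_limit {0..b} (\<lambda>n t. x + (\<Sum>i<n. p (Suc i) t - p i t)) g sequentially"
      unfolding g_def by (intro uniform_limit_intros)
    then show ?thesis by (simp add: tele)
  qed
  have contg: "continuous_on {0..b} g" if "b \<ge> 0" for b
    by (rule uniform_limit_theorem[OF _ ul[OF that]]) (auto simp: contp)
  have geq: "g t = x + integral {0..t} (\<lambda>s. G (g s))" if "t \<ge> 0" for t
  proof -
    have "uniform_limit {0..t} (\<lambda>n s. G (p n s)) (\<lambda>s. G (g s)) sequentially"
    proof (rule uniform_limitI)
      fix e :: real assume e: "e > 0"
      have "\<forall>\<^sub>F n in sequentially. \<forall>s\<in>{0..t}. dist (p n s) (g s) < e / (K + 1)"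
        using uniform_limitD[OF ul[OF that], of "e / (K + 1)"] e K by auto
      then show "\<forall>\<^sub>F n in sequentially. \<forall>s\<in>{0..t}. dist (G (p n s)) (G (g s)) < e"
      proof eventually_elim
        case (elim n)
        show ?case
        proof
          fix s assume "s \<in> {0..t}"
          then have "dist (p n s) (g s) * (K + 1) < e" using elim K by (simp add: field_simps)
          moreover have "dist (G (p n s)) (G (g s)) \<le> K * dist (p n s) (g s)" by (simp add: dist_norm lip)
          moreover have "K * dist (p n s) (g s) \<le> dist (p n s) (g s) * (K + 1)" by (simp add: algebra_simps)
          ultimately show "dist (G (p n s)) (G (g s)) < e" by linarith
        qed
      qed
    qed
    from uniform_limit_integral[OF this] obtain I J where
      IJ: "\<And>n. ((\<lambda>s. G (p n s)) has_integral I n) {0..t}" "((\<lambda>s. G (g s)) has_integral J) {0..t}" "I \<longlonglongrightarrow> J"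
      using continuous_on_compose2[OF contG contp] by (metis subset_UNIV sequentially_bot)
    have "(\<lambda>n. p (Suc n) t) \<longlonglongrightarrow> x + J"
      unfolding pS using IJ by (auto intro!: tendsto_intros simp: integral_unique[OF IJ(1)])
    moreover have "(\<lambda>n. p (Suc n) t) \<longlonglongrightarrow> g t"
      using LIMSEQ_Suc[OF tendsto_uniform_limitI[OF ul[OF that], of t]] that by simp
    ultimately show ?thesis using IJ(2) LIMSEQ_unique by (metis integral_unique)
  qed
  show ?thesis
  proof (intro exI[of _ g] conjI allI impI)
    show "g 0 = x" using geq[of 0] by simp
    fix t :: real assume t: "t \<ge> 0"
    have "((\<lambda>u. integral {0..u} (\<lambda>s. G (g s))) has_vector_derivative G (g t)) (at t within {0..t+1})"
      using t by (intro integral_has_vector_derivative continuous_on_compose2[OF contG contg]) auto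
    then have "((\<lambda>u. x + integral {0..u} (\<lambda>s. G (g s))) has_vector_derivative G (g t)) (at t within {0..t+1})"
      by (auto intro!: derivative_eq_intros)
    then have "(g has_vector_derivative G (g t)) (at t within {0..t+1})"
      by (rule has_vector_derivative_transform[rotated 2]) (use t geq in auto)
    moreover have "at t within {0..t+1} = at t within {0..}"
      by (rule at_within_nhd[of _ "{..<t+1}"]) (use t in auto)
    ultimately show "(g has_vector_derivative G (g t)) (at t within {0..})" by simp
  qed
qed

text \<open>The negative half of the solution is a forward solution of the reversed field. Both
  halves have the same value and velocity at 0, so they join to a differentiable curve.\<close>

lemma picard_global:
  fixes G :: "'a::euclidean_space \<Rightarrow> 'a"
  assumes lip: "\<And>x y. norm (G x - G y) \<le> K * norm (x - y)"
  shows "\<exists>g. g 0 = x \<and> (\<forall>t. (g has_vector_derivative G (g t)) (at t))"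
proof -
  obtain p where p0: "p 0 = x" and p: "\<And>t. t \<ge> 0 \<Longrightarrow> (p has_vector_derivative G (p t)) (at t within {0..})"
    using picard_forward[of G, OF lip] by blast
  obtain n where n0: "n 0 = x" and n: "\<And>t. t \<ge> 0 \<Longrightarrow> (n has_vector_derivative - G (n t)) (at t within {0..})"
    using picard_forward[of "\<lambda>x. - G x" K x] lip by (auto simp: norm_minus_commute)
  define g where "g t = (if t \<in> {0..} then p t else n (- t))" for t
  have g0: "g 0 = x" by (simp add: g_def p0)
  have n': "((\<lambda>t. n (- t)) has_vector_derivative G (n (- t))) (at t within {..0})" if "t \<le> 0" for t
  proof -
    have "(n \<circ> uminus has_vector_derivative ((- 1) *\<^sub>R (- G (n (- t))))) (at t within {..0})"
    proof (rule vector_diff_chain_within)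
      show "(uminus has_vector_derivative - 1) (at t within {..0})"
        by (auto intro!: derivative_eq_intros)
      have "uminus ` {..0::real} = {0..}" by auto
      then show "(n has_vector_derivative - G (n (- t))) (at (- t) within uminus ` {..0})"
        using n[of "-t"] that by simp
    qed
    then show ?thesis by (simp add: o_def)
  qed
  have "(g has_vector_derivative G (g t)) (at t)" for t
  proof -
    have "(g has_vector_derivative (if t \<in> {0..} then G (p t) else G (n (- t)))) (at t within {0..} \<union> {..0})"
      unfolding g_def
    proof (rule has_vector_derivative_If_within_closures)
      show "t \<in> {0..} \<union> {..0}" by auto
      show "{0..} \<union> {..0} = {0..} \<union> {..(0::real)}" ..
      show "(p has_vector_derivative G (p t)) (at t within {0..} \<union> closure {0..} \<inter> closure {..0})"
        if "t \<in> {0..} \<union> closure {0..} \<inter> closure {..0}"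
        using that p by (auto simp: insert_absorb)
      show "((\<lambda>t. n (- t)) has_vector_derivative G (n (- t))) (at t within {..0} \<union> closure {0..} \<inter> closure {..0})"
        if "t \<in> {..0} \<union> closure {0..} \<inter> closure {..0}"
        using that n' by (auto simp: insert_absorb)
      show "p t = n (- t)" if "t \<in> closure {0..}" "t \<in> closure {..0}"
        using that p0 n0 by auto
      show "G (p t) = G (n (- t))" if "t \<in> closure {0..}" "t \<in> closure {..0}"
        using that p0 n0 by auto
    qed
    moreover have "{0..} \<union> {..0} = (UNIV :: real set)" by auto
    ultimately show ?thesis by (auto simp: g_def split: if_splits)
  qed
  then show ?thesis using g0 by blast
qed

section \<open>Smooth functions and Lie derivatives\<close>

lemma smooth_k_mono: "smooth_k (Suc k) S f \<Longrightarrow> smooth_k k S f"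
proof (induction k arbitrary: f)
  case 0
  then show ?case
    by (simp add: continuous_at_imp_continuous_on differentiable_imp_continuous_within)
next
  case (Suc k)
  show ?case unfolding smooth_k.simps(2)[of k]
  proof (intro conjI allI)
    show "\<forall>x\<in>S. f differentiable at x" using Suc.prems unfolding smooth_k.simps(2)[of "Suc k"] by blast
    show "smooth_k k S (\<lambda>x. frechet_derivative f (at x) v)" for v
      using Suc.prems Suc.IH unfolding smooth_k.simps(2)[of "Suc k"] by blast
  qed
qed

definition smooth :: "('a::real_normed_vector \<Rightarrow> 'b::real_normed_vector) \<Rightarrow> bool" where
  "smooth f \<longleftrightarrow> (\<forall>k. smooth_k k UNIV f)"

lemma smooth_iff_smooth_on: "smooth f \<longleftrightarrow> smooth_on UNIV f"
  by (simp add: smooth_def smooth_on_def)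

lemma smooth_differentiable: "smooth f \<Longrightarrow> f differentiable at x"
  unfolding smooth_def by (metis UNIV_I smooth_k.simps(2))

lemma smooth_has_derivative: "smooth f \<Longrightarrow> (f has_derivative frechet_derivative f (at x)) (at x)"
  using smooth_differentiable frechet_derivative_works by blast

lemma smooth_frechet_derivative: "smooth f \<Longrightarrow> smooth (\<lambda>x. frechet_derivative f (at x) v)"
  unfolding smooth_def by (metis smooth_k.simps(2))

lemma smooth_continuous_on: "smooth f \<Longrightarrow> continuous_on S f"
  unfolding smooth_def by (metis continuous_on_subset smooth_k.simps(1) subset_UNIV)

lemma smooth_k_const: "smooth_k k UNIV (\<lambda>x. c)"
  by (induction k arbitrary: c) simp_all

lemma smooth_const: "smooth (\<lambda>x. c)"
  by (simp add: smooth_def smooth_k_const)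

lemma smooth_k_bounded_linear_comp:
  assumes T: "bounded_linear T"
  shows "smooth_k k UNIV f \<Longrightarrow> smooth_k k UNIV (\<lambda>x. T (f x))"
proof (induction k arbitrary: f)
  case 0
  then show ?case using T by (simp add: bounded_linear.continuous_on)
next
  case (Suc k)
  have d: "f differentiable at x" for x using Suc.prems by simp
  have D: "((\<lambda>x. T (f x)) has_derivative (\<lambda>v. T (frechet_derivative f (at x) v))) (at x)" for x
    using bounded_linear.has_derivative[OF T] d frechet_derivative_works by blast
  then have "frechet_derivative (\<lambda>x. T (f x)) (at x) = (\<lambda>v. T (frechet_derivative f (at x) v))" for x
    using frechet_derivative_at by metis
  then show ?case using Suc D by (auto simp: differentiable_def)
qed

lemma smooth_bounded_linear_comp: "bounded_linear T \<Longrightarrow> smooth f \<Longrightarrow> smooth (\<lambda>x. T (f x))"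
  by (simp add: smooth_def smooth_k_bounded_linear_comp)

lemma smooth_bounded_linear:
  assumes T: "bounded_linear T" shows "smooth T"
  unfolding smooth_def
proof
  have D: "frechet_derivative T (at x) = T" for x
    using bounded_linear_imp_has_derivative[OF T] frechet_derivative_at by metis
  show "smooth_k k UNIV T" for k
  proof (cases k)
    case 0 then show ?thesis using T by (simp add: linear_continuous_on)
  next
    case (Suc n) then show ?thesis
      using bounded_linear_imp_differentiable[OF T] by (simp add: D smooth_k_const)
  qed
qed

lemma smooth_k_add: "smooth_k k UNIV f \<Longrightarrow> smooth_k k UNIV g \<Longrightarrow> smooth_k k UNIV (\<lambda>x. f x + g x)"
proof (induction k arbitrary: f g)
  case 0 then show ?case by (simp add: continuous_on_add)
next
  case (Suc k)
  have D: "((\<lambda>x. f x + g x) has_derivative (\<lambda>v. frechet_derivative f (at x) v + frechet_derivative g (at x) v)) (at x)" for x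
    using Suc.prems frechet_derivative_works by (intro has_derivative_add) auto
  moreover have "(\<lambda>x. f x + g x) differentiable (at x)" for x using D differentiable_def by blast
  moreover from D have "frechet_derivative (\<lambda>x. f x + g x) (at x) = (\<lambda>v. frechet_derivative f (at x) v + frechet_derivative g (at x) v)" for x
    by (rule frechet_derivative_at[symmetric])
  ultimately show ?case using Suc by simp
qed

lemma smooth_add: "smooth f \<Longrightarrow> smooth g \<Longrightarrow> smooth (\<lambda>x. f x + g x)"
  by (simp add: smooth_def smooth_k_add)

lemma smooth_sum: "(\<And>i. i \<in> I \<Longrightarrow> smooth (f i)) \<Longrightarrow> smooth (\<lambda>x. \<Sum>i\<in>I. f i x)"
  by (induction I rule: infinite_finite_induct) (simp_all add: smooth_const smooth_add)

lemma smooth_k_mult: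
  fixes f g :: "'a::real_normed_vector \<Rightarrow> real"
  shows "smooth_k k UNIV f \<Longrightarrow> smooth_k k UNIV g \<Longrightarrow> smooth_k k UNIV (\<lambda>x. f x * g x)"
proof (induction k arbitrary: f g)
  case 0 then show ?case by (simp add: continuous_on_mult)
next
  case (Suc k)
  have D: "((\<lambda>x. f x * g x) has_derivative (\<lambda>v. f x * frechet_derivative g (at x) v + frechet_derivative f (at x) v * g x)) (at x)" for x
    using Suc.prems frechet_derivative_works by (intro has_derivative_mult) auto
  then have df: "(\<lambda>x. f x * g x) differentiable (at x)" for x using differentiable_def by blast
  from D have "frechet_derivative (\<lambda>x. f x * g x) (at x) = (\<lambda>v. f x * frechet_derivative g (at x) v + frechet_derivative f (at x) v * g x)" for x
    by (rule frechet_derivative_at[symmetric])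
  moreover have "smooth_k k UNIV (\<lambda>x. f x * frechet_derivative g (at x) v + frechet_derivative f (at x) v * g x)" for v
  proof (intro smooth_k_add Suc.IH)
    show "smooth_k k UNIV f" by (rule smooth_k_mono[OF Suc.prems(1)])
    show "smooth_k k UNIV g" by (rule smooth_k_mono[OF Suc.prems(2)])
    show "smooth_k k UNIV (\<lambda>x. frechet_derivative f (at x) v)" "smooth_k k UNIV (\<lambda>x. frechet_derivative g (at x) v)"
      using Suc.prems by simp_all
  qed
  ultimately show ?case using df by simp
qed

lemma smooth_mult:
  fixes f g :: "'a::real_normed_vector \<Rightarrow> real"
  shows "smooth f \<Longrightarrow> smooth g \<Longrightarrow> smooth (\<lambda>x. f x * g x)"
  by (simp add: smooth_def smooth_k_mult)

lemma smooth_inner_const: "smooth f \<Longrightarrow> smooth (\<lambda>x. f x \<bullet> b)"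
  by (rule smooth_bounded_linear_comp[OF bounded_linear_inner_left])

lemma bounded_linear_frechet: "smooth f \<Longrightarrow> bounded_linear (frechet_derivative f (at x))"
  using smooth_has_derivative has_derivative_bounded_linear by blast

lemma linear_frechet: "smooth f \<Longrightarrow> linear (frechet_derivative f (at x))"
  using bounded_linear_frechet bounded_linear.linear by blast

text \<open>\<open>smooth_k\<close> speaks of derivatives in fixed directions. Expanding in the
  basis is how a derivative in a direction that varies with the point is seen to be smooth.\<close>

lemma frechet_expand:
  fixes f :: "'a::euclidean_space \<Rightarrow> 'b::real_normed_vector"
  assumes "smooth f"
  shows "frechet_derivative f (at x) v = (\<Sum>b\<in>Basis. (v \<bullet> b) *\<^sub>R frechet_derivative f (at x) b)"
proof -
  have "frechet_derivative f (at x) (\<Sum>b\<in>Basis. (v \<bullet> b) *\<^sub>R b) = (\<Sum>b\<in>Basis. (v \<bullet> b) *\<^sub>R frechet_derivative f (at x) b)"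
    using linear_frechet[OF assms] by (simp add: linear_sum linear_scale)
  then show ?thesis by (simp add: euclidean_representation)
qed

definition lie :: "('a::euclidean_space \<Rightarrow> 'a) \<Rightarrow> ('a \<Rightarrow> real) \<Rightarrow> 'a \<Rightarrow> real" where
  "lie Y \<phi> x = frechet_derivative \<phi> (at x) (Y x)"

lemma smooth_lie:
  assumes "smooth Y" "smooth \<phi>"
  shows "smooth (lie Y \<phi>)"
proof -
  have "lie Y \<phi> = (\<lambda>x. \<Sum>b\<in>Basis. (Y x \<bullet> b) * frechet_derivative \<phi> (at x) b)"
    unfolding lie_def by (rule ext) (rule frechet_expand[OF assms(2), unfolded real_scaleR_def])
  then show ?thesis
    using assms by (auto intro!: smooth_sum smooth_mult smooth_inner_const smooth_frechet_derivative)
qed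

section \<open>Symmetry of second derivatives, and brackets as commutators\<close>

lemma has_real_derivative_line:
  assumes "smooth (f :: 'a::real_normed_vector \<Rightarrow> real)"
  shows "((\<lambda>r. f (x + r *\<^sub>R a)) has_real_derivative frechet_derivative f (at (x + r *\<^sub>R a)) a) (at r)"
proof -
  have "((\<lambda>r. f (x + r *\<^sub>R a)) has_derivative (\<lambda>h. frechet_derivative f (at (x + r *\<^sub>R a)) (h *\<^sub>R a))) (at r)"
    by (rule has_derivative_compose[OF _ smooth_has_derivative[OF assms], of "\<lambda>r. x + r *\<^sub>R a"])
       (auto intro!: derivative_eq_intros)
  then show ?thesis
    by (simp add: has_field_derivative_def linear_scale[OF linear_frechet[OF assms]] mult.commute[of _ "frechet_derivative _ _ _"])
qed

text \<open>The mean value theorem is applied along \<open>a\<close> and then along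
  \<open>b\<close>. The second difference is symmetric in \<open>a\<close> and \<open>b\<close>, the
  right-hand side is not yet known to be.\<close>

lemma mixed_difference:
  assumes f: "smooth (f :: 'a::real_normed_vector \<Rightarrow> real)" and s: "s > 0"
  shows "\<exists>\<xi>\<in>{0..s}. \<exists>\<eta>\<in>{0..s}. f (x + s *\<^sub>R a + s *\<^sub>R b) - f (x + s *\<^sub>R a) - f (x + s *\<^sub>R b) + f x
     = s\<^sup>2 * frechet_derivative (\<lambda>y. frechet_derivative f (at y) a) (at (x + \<xi> *\<^sub>R a + \<eta> *\<^sub>R b)) b"
proof -
  define g where "g r = f ((x + s *\<^sub>R b) + r *\<^sub>R a) - f (x + r *\<^sub>R a)" for r
  have "\<exists>z. 0 < z \<and> z < s \<and> g s - g 0 = (s - 0) * (frechet_derivative f (at ((x + s *\<^sub>R b) + z *\<^sub>R a)) a - frechet_derivative f (at (x + z *\<^sub>R a)) a)"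
    unfolding g_def by (rule MVT2[OF s]) (intro DERIV_diff has_real_derivative_line f)
  then obtain z where z: "0 < z" "z < s"
    and gz: "g s - g 0 = s * (frechet_derivative f (at ((x + s *\<^sub>R b) + z *\<^sub>R a)) a - frechet_derivative f (at (x + z *\<^sub>R a)) a)"
    by auto
  define h where "h = (\<lambda>y. frechet_derivative f (at y) a)"
  have h: "smooth h" unfolding h_def by (rule smooth_frechet_derivative[OF f])
  have "\<exists>w. 0 < w \<and> w < s \<and> h ((x + z *\<^sub>R a) + s *\<^sub>R b) - h ((x + z *\<^sub>R a) + 0 *\<^sub>R b)
     = (s - 0) * frechet_derivative h (at ((x + z *\<^sub>R a) + w *\<^sub>R b)) b"
    by (rule MVT2[OF s]) (intro has_real_derivative_line h)
  then obtain w where w: "0 < w" "w < s"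
    and hw: "h ((x + z *\<^sub>R a) + s *\<^sub>R b) - h (x + z *\<^sub>R a) = s * frechet_derivative h (at ((x + z *\<^sub>R a) + w *\<^sub>R b)) b"
    by auto
  have "f (x + s *\<^sub>R a + s *\<^sub>R b) - f (x + s *\<^sub>R a) - f (x + s *\<^sub>R b) + f x = g s - g 0"
    by (simp add: g_def algebra_simps)
  also have "\<dots> = s * (s * frechet_derivative h (at ((x + z *\<^sub>R a) + w *\<^sub>R b)) b)"
    unfolding gz hw[symmetric] by (simp add: h_def algebra_simps)
  finally show ?thesis using z w by (intro bexI[of _ z] bexI[of _ w]) (auto simp: h_def power2_eq_square)
qed

text \<open>Schwarz's theorem: the same second difference is evaluated in both orders, at a scale on
  which both second derivatives are nearly constant.\<close>

lemma symmetric_second_derivative: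
  assumes f: "smooth (f :: 'a::real_normed_vector \<Rightarrow> real)"
  shows "frechet_derivative (\<lambda>y. frechet_derivative f (at y) a) (at x) b
       = frechet_derivative (\<lambda>y. frechet_derivative f (at y) b) (at x) a"
proof (rule ccontr)
  define p where "p y = frechet_derivative (\<lambda>y. frechet_derivative f (at y) a) (at y) b" for y
  define q where "q y = frechet_derivative (\<lambda>y. frechet_derivative f (at y) b) (at y) a" for y
  assume "\<not> ?thesis"
  then have e: "\<bar>p x - q x\<bar> / 2 > 0" by (simp add: p_def q_def)
  have "smooth p" "smooth q" unfolding p_def[abs_def] q_def[abs_def]
    by (intro smooth_frechet_derivative f)+
  then have "continuous_on UNIV p" "continuous_on UNIV q" by (auto intro: smooth_continuous_on)
  then obtain d1 d2 where d: "d1 > 0" "\<And>y. dist y x < d1 \<Longrightarrow> dist (p y) (p x) < \<bar>p x - q x\<bar> / 2"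
    "d2 > 0" "\<And>y. dist y x < d2 \<Longrightarrow> dist (q y) (q x) < \<bar>p x - q x\<bar> / 2"
    using e unfolding continuous_on_iff by (metis UNIV_I)
  \<comment> \<open>Both intermediate points stay within the moduli \<open>d1\<close> and
    \<open>d2\<close>; the summand 1 avoids division by zero.\<close>
  define s where "s = min d1 d2 / (2 * (norm a + norm b + 1))"
  have n: "norm a + norm b + 1 > 0" by (simp add: add_nonneg_pos)
  then have s: "s > 0" using d by (simp add: s_def)
  have near: "norm (\<xi> *\<^sub>R a + \<eta> *\<^sub>R b) < min d1 d2" if "\<xi> \<in> {0..s}" "\<eta> \<in> {0..s}" for \<xi> \<eta>
  proof -
    have "norm (\<xi> *\<^sub>R a + \<eta> *\<^sub>R b) \<le> \<xi> * norm a + \<eta> * norm b"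
      using norm_triangle_ineq[of "\<xi> *\<^sub>R a" "\<eta> *\<^sub>R b"] that by simp
    also have "\<dots> \<le> s * norm a + s * norm b" using that by (intro add_mono mult_right_mono) auto
    also have "\<dots> \<le> s * (norm a + norm b + 1)" using s by (simp add: algebra_simps)
    also have "\<dots> = min d1 d2 / 2"
      unfolding s_def times_divide_eq_left nonzero_divide_eq_eq[OF less_imp_neq[OF n, symmetric]]
      using n by (simp add: divide_simps)
    also have "\<dots> < min d1 d2" using d(1,3) by (auto simp: min_def)
    finally show ?thesis .
  qed
  obtain \<xi> \<eta> where 1: "\<xi> \<in> {0..s}" "\<eta> \<in> {0..s}"
    "f (x + s *\<^sub>R a + s *\<^sub>R b) - f (x + s *\<^sub>R a) - f (x + s *\<^sub>R b) + f x = s\<^sup>2 * p (x + \<xi> *\<^sub>R a + \<eta> *\<^sub>R b)"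
    using mixed_difference[OF f s, of x a b] unfolding p_def by blast
  obtain \<xi>' \<eta>' where 2: "\<xi>' \<in> {0..s}" "\<eta>' \<in> {0..s}"
    "f (x + s *\<^sub>R b + s *\<^sub>R a) - f (x + s *\<^sub>R b) - f (x + s *\<^sub>R a) + f x = s\<^sup>2 * q (x + \<xi>' *\<^sub>R b + \<eta>' *\<^sub>R a)"
    using mixed_difference[OF f s, of x b a] unfolding q_def by blast
  have "s\<^sup>2 * p (x + \<xi> *\<^sub>R a + \<eta> *\<^sub>R b) = s\<^sup>2 * q (x + \<xi>' *\<^sub>R b + \<eta>' *\<^sub>R a)"
    unfolding 1(3)[symmetric] 2(3)[symmetric] by (simp add: algebra_simps)
  then have eq: "p (x + \<xi> *\<^sub>R a + \<eta> *\<^sub>R b) = q (x + \<xi>' *\<^sub>R b + \<eta>' *\<^sub>R a)" using s by simp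
  have "dist (p (x + \<xi> *\<^sub>R a + \<eta> *\<^sub>R b)) (p x) < \<bar>p x - q x\<bar> / 2"
    using near[OF 1(1,2)] by (intro d(2)) (simp add: dist_norm add.assoc)
  moreover have "dist (q (x + \<xi>' *\<^sub>R b + \<eta>' *\<^sub>R a)) (q x) < \<bar>p x - q x\<bar> / 2"
    using near[OF 2(2,1)] by (intro d(4)) (simp add: dist_norm add.assoc add.commute)
  ultimately have "\<bar>p x - p (x + \<xi> *\<^sub>R a + \<eta> *\<^sub>R b)\<bar> + \<bar>q (x + \<xi>' *\<^sub>R b + \<eta>' *\<^sub>R a) - q x\<bar> < \<bar>p x - q x\<bar>"
    unfolding dist_real_def by (simp add: abs_minus_commute)
  then show False
    using eq abs_triangle_ineq[of "p x - p (x + \<xi> *\<^sub>R a + \<eta> *\<^sub>R b)" "q (x + \<xi>' *\<^sub>R b + \<eta>' *\<^sub>R a) - q x"] by simp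
qed

text \<open>Separates the second-order part, which is symmetric in \<open>A x\<close> and
  \<open>B x\<close> and cancels in the commutator, from the first-order part, which yields the
  bracket.\<close>

lemma lie_lie:
  assumes A: "smooth A" and B: "smooth B" and \<phi>: "smooth \<phi>"
  shows "lie A (lie B \<phi>) x = frechet_derivative (\<lambda>y. frechet_derivative \<phi> (at y) (B x)) (at x) (A x)
     + frechet_derivative \<phi> (at x) (frechet_derivative B (at x) (A x))"
proof -
  have eq: "lie B \<phi> = (\<lambda>y. \<Sum>b\<in>Basis. (B y \<bullet> b) * frechet_derivative \<phi> (at y) b)"
    unfolding lie_def by (rule ext) (rule frechet_expand[OF \<phi>, unfolded real_scaleR_def])
  have "(lie B \<phi> has_derivative (\<lambda>v. \<Sum>b\<in>Basis. (B x \<bullet> b) * frechet_derivative (\<lambda>y. frechet_derivative \<phi> (at y) b) (at x) v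
      + (frechet_derivative B (at x) v \<bullet> b) * frechet_derivative \<phi> (at x) b)) (at x)"
    unfolding eq
    by (intro has_derivative_sum has_derivative_mult smooth_has_derivative smooth_frechet_derivative \<phi>
        bounded_linear.has_derivative[OF bounded_linear_inner_left] B)
  from frechet_derivative_at[OF this] have "lie A (lie B \<phi>) x = (\<Sum>b\<in>Basis. (B x \<bullet> b) * frechet_derivative (\<lambda>y. frechet_derivative \<phi> (at y) b) (at x) (A x)
      + (frechet_derivative B (at x) (A x) \<bullet> b) * frechet_derivative \<phi> (at x) b)"
    unfolding lie_def[of A] by (rule fun_cong[OF sym])
  also have "\<dots> = (\<Sum>b\<in>Basis. (B x \<bullet> b) * frechet_derivative (\<lambda>y. frechet_derivative \<phi> (at y) (A x)) (at x) b)
      + frechet_derivative \<phi> (at x) (frechet_derivative B (at x) (A x))"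
    unfolding sum.distrib symmetric_second_derivative[OF \<phi>, of _ x "A x"]
      frechet_expand[OF \<phi>, of x "frechet_derivative B (at x) (A x)"] real_scaleR_def ..
  also have "(\<Sum>b\<in>Basis. (B x \<bullet> b) * frechet_derivative (\<lambda>y. frechet_derivative \<phi> (at y) (A x)) (at x) b)
     = frechet_derivative (\<lambda>y. frechet_derivative \<phi> (at y) (A x)) (at x) (B x)"
    by (rule frechet_expand[OF smooth_frechet_derivative[OF \<phi>], unfolded real_scaleR_def, symmetric])
  finally show ?thesis unfolding symmetric_second_derivative[OF \<phi>, of "A x" x "B x"] .
qed

text \<open>Ties the ambient formula for the bracket to the algebra of derivations, in which the
  expansions of words are computed.\<close>

lemma lie_commutator:
  assumes A: "smooth A" and B: "smooth B" and \<phi>: "smooth \<phi>"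
  shows "lie A (lie B \<phi>) x - lie B (lie A \<phi>) x = lie (lie_bracket A B) \<phi> x"
  unfolding lie_lie[OF A B \<phi>] lie_lie[OF B A \<phi>] symmetric_second_derivative[OF \<phi>, of "A x"]
  by (simp add: lie_bracket_def lie_def linear_diff[OF linear_frechet[OF \<phi>]])

lemma smooth_vector_component:
  fixes Y :: "'a::real_normed_vector \<Rightarrow> 'b::euclidean_space"
  assumes "\<And>b. b \<in> Basis \<Longrightarrow> smooth (\<lambda>x. Y x \<bullet> b)"
  shows "smooth Y"
proof -
  have "smooth (\<lambda>x. \<Sum>b\<in>Basis. (Y x \<bullet> b) *\<^sub>R b)"
    by (intro smooth_sum smooth_bounded_linear_comp[OF bounded_linear_scaleR_left] assms)
  then show ?thesis by (simp add: euclidean_representation)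
qed

lemma smooth_frechet_apply:
  fixes A B :: "'a::euclidean_space \<Rightarrow> 'a"
  assumes A: "smooth A" and B: "smooth B"
  shows "smooth (\<lambda>x. frechet_derivative B (at x) (A x))"
proof (rule smooth_vector_component)
  fix b :: 'a assume "b \<in> Basis"
  have "(\<lambda>x. frechet_derivative B (at x) (A x) \<bullet> b) = (\<lambda>x. \<Sum>c\<in>Basis. (A x \<bullet> c) * (frechet_derivative B (at x) c \<bullet> b))"
    by (rule ext) (subst frechet_expand[OF B], simp add: inner_sum_left)
  then show "smooth (\<lambda>x. frechet_derivative B (at x) (A x) \<bullet> b)"
    using A B by (auto intro!: smooth_sum smooth_mult smooth_inner_const smooth_frechet_derivative)
qed

lemma smooth_diff: "smooth f \<Longrightarrow> smooth g \<Longrightarrow> smooth (\<lambda>x. f x - g x)"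
  using smooth_add[of f "\<lambda>x. - g x"] smooth_bounded_linear_comp[OF bounded_linear_minus[OF bounded_linear_ident], of g] by simp

lemma smooth_lie_bracket:
  assumes "smooth A" "smooth B"
  shows "smooth (lie_bracket A B)"
  using smooth_diff[OF smooth_frechet_apply[OF assms] smooth_frechet_apply[OF assms(2,1)]]
  by (simp add: lie_bracket_def[abs_def])

section \<open>Flows of the control fields\<close>

lemma smooth_bounded_on_compact:
  fixes f :: "'a::euclidean_space \<Rightarrow> 'b::real_normed_vector"
  assumes "smooth f" "compact S"
  shows "\<exists>C\<ge>0. \<forall>x\<in>S. norm (f x) \<le> C"
proof -
  have "bounded (f ` S)"
    using assms smooth_continuous_on compact_continuous_image compact_imp_bounded by blast
  then obtain B where "\<forall>x\<in>S. norm (f x) \<le> B" unfolding bounded_iff by blast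
  then show ?thesis by (intro exI[of _ "\<bar>B\<bar>"]) fastforce
qed

lemma smooth_derivative_bounded:
  fixes f :: "'a::euclidean_space \<Rightarrow> 'b::real_normed_vector"
  assumes f: "smooth f" and S: "compact S"
  shows "\<exists>C\<ge>0. \<forall>x\<in>S. \<forall>v. norm (frechet_derivative f (at x) v) \<le> C * norm v"
proof -
  have "\<forall>b. \<exists>C\<ge>0. \<forall>x\<in>S. norm (frechet_derivative f (at x) b) \<le> C"
    using smooth_bounded_on_compact[OF smooth_frechet_derivative[OF f] S] by blast
  then obtain C where C: "\<And>b. C b \<ge> 0" "\<And>b x. x \<in> S \<Longrightarrow> norm (frechet_derivative f (at x) b) \<le> C b" by metis
  have "norm (frechet_derivative f (at x) v) \<le> (\<Sum>b\<in>Basis. C b) * norm v" if x: "x \<in> S" for x v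
  proof -
    have "norm (frechet_derivative f (at x) v) \<le> (\<Sum>b\<in>Basis. norm ((v \<bullet> b) *\<^sub>R frechet_derivative f (at x) b))"
      unfolding frechet_expand[OF f, of x v] by (rule norm_sum)
    also have "\<dots> \<le> (\<Sum>b\<in>Basis. norm v * C b)"
      using C x by (intro sum_mono) (auto intro!: mult_mono simp: Basis_le_norm)
    finally show ?thesis by (simp add: sum_distrib_left mult.commute)
  qed
  moreover have "(\<Sum>b\<in>Basis. C b) \<ge> 0" using C by (simp add: sum_nonneg)
  ultimately show ?thesis by blast
qed

lemma smooth_lipschitz_compact_convex:
  fixes f :: "'a::euclidean_space \<Rightarrow> 'b::real_normed_vector"
  assumes f: "smooth f" and S: "compact S" "convex S"
  shows "\<exists>C\<ge>0. \<forall>x\<in>S. \<forall>y\<in>S. norm (f x - f y) \<le> C * norm (x - y)"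
proof -
  obtain C where C: "C \<ge> 0" "\<And>x v. x \<in> S \<Longrightarrow> norm (frechet_derivative f (at x) v) \<le> C * norm v"
    using smooth_derivative_bounded[OF f S(1)] by blast
  have "norm (f x - f y) \<le> C * norm (x - y)" if "x \<in> S" "y \<in> S" for x y
  proof (rule differentiable_bound[OF S(2) _ _ that])
    show "(f has_derivative frechet_derivative f (at x)) (at x within S)" for x
      using smooth_has_derivative[OF f] has_derivative_at_withinI by blast
    show "onorm (frechet_derivative f (at x)) \<le> C" if "x \<in> S" for x
      using C that by (intro onorm_bound) auto
  qed
  then show ?thesis using C by blast
qed

lemma vector_derivative_bound:
  fixes g :: "real \<Rightarrow> 'a::real_normed_vector"
  assumes "a \<le> b" and g: "\<And>t. a \<le> t \<Longrightarrow> t \<le> b \<Longrightarrow> (g has_vector_derivative g' t) (at t within {a..b})"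
    and B: "\<And>t. a \<le> t \<Longrightarrow> t \<le> b \<Longrightarrow> norm (g' t) \<le> B"
  shows "norm (g b - g a) \<le> B * (b - a)"
proof -
  have "norm (g b - g a) \<le> B * norm (b - a)"
  proof (rule differentiable_bound[of "{a..b}"])
    show "(g has_derivative (\<lambda>h. h *\<^sub>R g' t)) (at t within {a..b})" if "t \<in> {a..b}" for t
      using g that by (simp add: has_vector_derivative_def)
    show "onorm (\<lambda>h. h *\<^sub>R g' t) \<le> B" if "t \<in> {a..b}" for t
      proof (rule onorm_bound)
      show "0 \<le> B" using B[of t] that by (auto intro: order_trans[OF norm_ge_zero])
      show "norm (h *\<^sub>R g' t) \<le> B * norm h" for h
        using mult_right_mono[OF B[of t], of "\<bar>h\<bar>"] that by (simp add: mult.commute)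
    qed
  qed (use assms in auto)
  then show ?thesis using assms by simp
qed

text \<open>The first component scales the drift. Thus the flow of a control \<open>u\<close> for
  time \<open>t\<close> is the time-one flow of \<open>(t, t u)\<close>, and time and control can be
  perturbed together as one vector.\<close>

definition vf :: "('a::euclidean_space \<Rightarrow> 'a) \<Rightarrow> ('m::finite \<Rightarrow> 'a \<Rightarrow> 'a) \<Rightarrow> real \<times> (real^'m) \<Rightarrow> 'a \<Rightarrow> 'a" where
  "vf X0 X y x = fst y *\<^sub>R X0 x + (\<Sum>i\<in>UNIV. (snd y $ i) *\<^sub>R X i x)"

lemma ctrl_eq_vf: "ctrl X0 X x u = vf X0 X (1, u) x"
  by (simp add: ctrl_def vf_def)

lemma vf_scaleR: "vf X0 X (c *\<^sub>R y) x = c *\<^sub>R vf X0 X y x"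
  by (simp add: vf_def scaleR_sum_right scaleR_add_right)

lemma vf_add: "vf X0 X (y + z) x = vf X0 X y x + vf X0 X z x"
  by (simp add: vf_def sum.distrib scaleR_add_left)

lemma vf_minus: "vf X0 X (- y) x = - vf X0 X y x"
  using vf_scaleR[of X0 X "-1" y x] by simp

lemma vf_diff: "vf X0 X (y - z) x = vf X0 X y x - vf X0 X z x"
  using vf_add[of X0 X y "-z" x] vf_minus[of X0 X z x] by simp

lemma has_vector_derivative_little_o:
  fixes g :: "real \<Rightarrow> 'a::real_normed_vector"
  assumes "(g has_vector_derivative v) (at t)" "e > 0"
  shows "\<exists>d>0. \<forall>h. 0 < h \<and> h < d \<longrightarrow> norm (g (t + h) - g t - h *\<^sub>R v) \<le> e * h"
proof -
  obtain d where "d > 0" and d: "\<And>y. norm (y - t) < d \<Longrightarrow> norm (g y - g t - (y - t) *\<^sub>R v) \<le> e * norm (y - t)"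
    using assms unfolding has_vector_derivative_def has_derivative_at_alt by blast
  have "norm (g (t + h) - g t - h *\<^sub>R v) \<le> e * h" if "0 < h" "h < d" for h
    using d[of "t + h"] that by simp
  then show ?thesis using \<open>d > 0\<close> by blast
qed

lemma norm_diff_add3_le: "norm (p - q + r + s) \<le> norm p + norm q + norm r + norm (s::'a::real_normed_vector)"
  using norm_triangle_ineq[of "p - q + r" s] norm_triangle_ineq[of "p - q" r] norm_triangle_ineq4[of p q] by linarith

text \<open>Tangency is assumed for all linear combinations at once; that tangent spaces are closed
  under them is a property of submanifolds, supplied when the locale is interpreted.\<close>

locale control_fields =
  fixes M :: "'a::euclidean_space set" and X0 :: "'a \<Rightarrow> 'a" and X :: "'m::finite \<Rightarrow> 'a \<Rightarrow> 'a"
  assumes M_compact: "compact M" and M_nonempty: "M \<noteq> {}"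
    and X0_smooth: "smooth X0" and X_smooth: "\<And>i. smooth (X i)"
    and V_tangent: "\<And>x y. x \<in> M \<Longrightarrow> vf X0 X y x \<in> tangent_space M x"
begin

abbreviation "V \<equiv> vf X0 X"

text \<open>The bounds are taken on a ball around M, because passing from a derivative bound to a
  Lipschitz bound needs a convex set.\<close>

lemma V_bounds_ex: "\<exists>r K. K > 0 \<and> M \<subseteq> cball 0 r \<and> (\<forall>y. \<forall>x\<in>cball 0 r. norm (V y x) \<le> K * norm y) \<and>
   (\<forall>y. \<forall>x\<in>cball 0 r. \<forall>x'\<in>cball 0 r. norm (V y x - V y x') \<le> K * norm y * norm (x - x'))"
proof -
  obtain r where "\<forall>x\<in>M. norm x \<le> r" using compact_imp_bounded[OF M_compact] unfolding bounded_iff by blast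
  then have r: "M \<subseteq> cball 0 r" by auto
  define S where "S = cball (0::'a) r"
  have S: "compact S" "convex S" by (simp_all add: S_def)
  define Y where "Y p = (case p of None \<Rightarrow> X0 | Some i \<Rightarrow> X i)" for p
  have Y: "smooth (Y p)" for p using X0_smooth X_smooth by (simp add: Y_def split: option.split)
  obtain A where A: "\<And>p. A p \<ge> 0" "\<And>p x. x \<in> S \<Longrightarrow> norm (Y p x) \<le> A p"
    using smooth_bounded_on_compact[OF Y S(1)] by metis
  obtain B where B: "\<And>p. B p \<ge> 0" "\<And>p x y. x \<in> S \<Longrightarrow> y \<in> S \<Longrightarrow> norm (Y p x - Y p y) \<le> B p * norm (x - y)"
    using smooth_lipschitz_compact_convex[OF Y S] by metis
  define c where "c y p = (case p of None \<Rightarrow> fst y | Some i \<Rightarrow> snd y $ i)" for y :: "real \<times> (real^'m)" and p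
  have c: "\<bar>c y p\<bar> \<le> norm y" for y p
    using norm_fst_le[of "fst y" "snd y"] component_le_norm_cart[of "snd y"] norm_snd_le[of "snd y" "fst y"]
    by (auto simp: c_def split: option.split intro: order_trans)
  have VY: "V y x = (\<Sum>p\<in>UNIV. c y p *\<^sub>R Y p x)" for y x
    by (simp add: vf_def c_def Y_def UNIV_option_conv sum.reindex)
  define K where "K = 1 + (\<Sum>p\<in>UNIV. A p + B p)"
  have K0: "K > 0" using A B by (auto simp: K_def intro!: add_pos_nonneg sum_nonneg)
  have b1: "norm (V y x) \<le> K * norm y" if "x \<in> S" for x y
  proof -
    have "norm (V y x) \<le> (\<Sum>p\<in>UNIV. norm (c y p *\<^sub>R Y p x))" unfolding VY by (rule norm_sum)
    also have "\<dots> \<le> (\<Sum>p\<in>UNIV. norm y * (A p + B p))"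
    proof (intro sum_mono)
      fix p
      have "norm (Y p x) \<le> A p + B p" using A(2)[OF that, of p] B(1)[of p] by simp
      then show "norm (c y p *\<^sub>R Y p x) \<le> norm y * (A p + B p)"
        unfolding norm_scaleR using c[of y p] by (intro mult_mono) auto
    qed
    also have "\<dots> = norm y * (\<Sum>p\<in>UNIV. A p + B p)" by (simp only: sum_distrib_left)
    also have "\<dots> \<le> K * norm y" by (simp add: K_def algebra_simps)
    finally show ?thesis .
  qed
  have b2: "norm (V y x - V y x') \<le> K * norm y * norm (x - x')" if "x \<in> S" "x' \<in> S" for x x' y
  proof -
    have "V y x - V y x' = (\<Sum>p\<in>UNIV. c y p *\<^sub>R (Y p x - Y p x'))"
      by (simp add: VY sum_subtractf scaleR_diff_right)
    then have "norm (V y x - V y x') \<le> (\<Sum>p\<in>UNIV. norm (c y p *\<^sub>R (Y p x - Y p x')))" by (metis norm_sum)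
    also have "\<dots> \<le> (\<Sum>p\<in>UNIV. norm y * ((A p + B p) * norm (x - x')))"
    proof (intro sum_mono)
      fix p
      have "norm (Y p x - Y p x') \<le> (A p + B p) * norm (x - x')"
        using order_trans[OF B(2)[OF that, of p] mult_right_mono[of "B p" "A p + B p"]] A(1)[of p] by simp
      then show "norm (c y p *\<^sub>R (Y p x - Y p x')) \<le> norm y * ((A p + B p) * norm (x - x'))"
        unfolding norm_scaleR using c[of y p] by (intro mult_mono) auto
    qed
    also have "\<dots> = norm y * ((\<Sum>p\<in>UNIV. A p + B p) * norm (x - x'))"
      by (simp only: sum_distrib_left sum_distrib_right)
    also have "\<dots> \<le> norm y * (K * norm (x - x'))"
      by (intro mult_left_mono mult_right_mono) (auto simp: K_def)
    also have "\<dots> = K * norm y * norm (x - x')" by simp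
    finally show ?thesis .
  qed
  show ?thesis using r K0 b1 b2 unfolding S_def by blast
qed

text \<open>Per unit of \<open>norm y\<close>, this constant is both the speed bound and the
  Lipschitz constant of the fields.\<close>

definition "\<Lambda> = (SOME K. \<exists>r. K > 0 \<and> M \<subseteq> cball 0 r \<and> (\<forall>y. \<forall>x\<in>cball 0 r. norm (V y x) \<le> K * norm y) \<and>
   (\<forall>y. \<forall>x\<in>cball 0 r. \<forall>x'\<in>cball 0 r. norm (V y x - V y x') \<le> K * norm y * norm (x - x')))"

definition "rad = (SOME r. \<Lambda> > 0 \<and> M \<subseteq> cball 0 r \<and> (\<forall>y. \<forall>x\<in>cball 0 r. norm (V y x) \<le> \<Lambda> * norm y) \<and>
   (\<forall>y. \<forall>x\<in>cball 0 r. \<forall>x'\<in>cball 0 r. norm (V y x - V y x') \<le> \<Lambda> * norm y * norm (x - x')))"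

lemma \<Lambda>_rad: "\<Lambda> > 0 \<and> M \<subseteq> cball 0 rad \<and> (\<forall>y. \<forall>x\<in>cball 0 rad. norm (V y x) \<le> \<Lambda> * norm y) \<and>
   (\<forall>y. \<forall>x\<in>cball 0 rad. \<forall>x'\<in>cball 0 rad. norm (V y x - V y x') \<le> \<Lambda> * norm y * norm (x - x'))"
proof -
  have "\<exists>r. \<Lambda> > 0 \<and> M \<subseteq> cball 0 r \<and> (\<forall>y. \<forall>x\<in>cball 0 r. norm (V y x) \<le> \<Lambda> * norm y) \<and>
   (\<forall>y. \<forall>x\<in>cball 0 r. \<forall>x'\<in>cball 0 r. norm (V y x - V y x') \<le> \<Lambda> * norm y * norm (x - x'))"
    unfolding \<Lambda>_def by (rule someI_ex) (use V_bounds_ex in blast)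
  then show ?thesis unfolding rad_def by (rule someI_ex)
qed

lemma \<Lambda>_pos: "\<Lambda> > 0" using \<Lambda>_rad by blast

lemma V_bound: "x \<in> M \<Longrightarrow> norm (V y x) \<le> \<Lambda> * norm y" using \<Lambda>_rad by blast

lemma V_lipschitz: "x \<in> M \<Longrightarrow> x' \<in> M \<Longrightarrow> norm (V y x - V y x') \<le> \<Lambda> * norm y * norm (x - x')"
  using \<Lambda>_rad by blast

text \<open>Picard iteration needs a globally Lipschitz field on the whole space, so the fields are composed
  with the projection to a ball containing \<open>M\<close>; solutions starting in \<open>M\<close> stay there because the fields are tangent.\<close>

definition "clip = closest_point (cball (0::'a) rad)"

lemma clip_in: "clip x \<in> cball 0 rad"
  unfolding clip_def by (rule closest_point_in_set) (use \<Lambda>_rad M_nonempty in auto)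

lemma clip_M: "x \<in> M \<Longrightarrow> clip x = x"
  unfolding clip_def using \<Lambda>_rad by (intro closest_point_self) auto

lemma clip_lipschitz: "norm (clip x - clip y) \<le> norm (x - y)"
  unfolding clip_def dist_norm[symmetric] by (rule closest_point_lipschitz) (use \<Lambda>_rad M_nonempty in auto)

lemma Vclip_lipschitz: "norm (V y (clip x) - V y (clip x')) \<le> \<Lambda> * norm y * norm (x - x')"
proof -
  have "norm (V y (clip x) - V y (clip x')) \<le> \<Lambda> * norm y * norm (clip x - clip x')"
    using \<Lambda>_rad clip_in by blast
  also have "\<dots> \<le> \<Lambda> * norm y * norm (x - x')"
    using clip_lipschitz \<Lambda>_pos by (intro mult_left_mono) auto
  finally show ?thesis .
qed

text \<open>Nagumo's argument: from a nearest point of M a curve in M leaves with velocity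
  \<open>V y z\<close>, which differs from the velocity of \<open>g\<close> by at most a constant
  times the distance. So the distance to M obeys a Gronwall inequality with initial value 0.\<close>

lemma invariance_forward:
  assumes g: "\<And>t. (g has_vector_derivative V y (clip (g t))) (at t)" and g0: "g 0 \<in> M" and b: "b \<ge> 0"
  shows "g b \<in> M"
proof -
  have cM: "closed M" using M_compact compact_imp_closed by blast
  define D where "D t = infdist (g t) M" for t
  have "D b \<le> exp (\<Lambda> * norm y * b) * (D 0 + 0 * b)"
  proof (rule dini_gronwall[OF b])
    show "continuous_on {0..b} D"
      unfolding D_def
      by (intro continuous_on_infdist continuous_at_imp_continuous_on ballI)
         (use g has_vector_derivative_continuous in blast)
    fix t e :: real assume t: "0 \<le> t" "t < b" and e: "e > 0"
    obtain z where z: "z \<in> M" "D t = dist (g t) z"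
      using infdist_attains_inf[OF cM M_nonempty] unfolding D_def by blast
    from V_tangent[OF z(1), of y] obtain c a where c: "a > 0" "c 0 = z" "\<And>t. \<bar>t\<bar> < a \<Longrightarrow> c t \<in> M"
      "(c has_vector_derivative V y z) (at 0)"
      unfolding tangent_space_def by blast
    obtain d1 where d1: "d1 > 0" "\<And>h. 0 < h \<Longrightarrow> h < d1 \<Longrightarrow> norm (g (t + h) - g t - h *\<^sub>R V y (clip (g t))) \<le> e / 2 * h"
      using has_vector_derivative_little_o[OF g[of t], of "e/2"] e by auto
    obtain d2 where d2: "d2 > 0" "\<And>h. 0 < h \<Longrightarrow> h < d2 \<Longrightarrow> norm (c (0 + h) - c 0 - h *\<^sub>R V y z) \<le> e / 2 * h"
      using has_vector_derivative_little_o[OF c(4), of "e/2"] e by auto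
    show "\<exists>d>0. \<forall>h. 0 < h \<and> h < d \<and> t + h \<le> b \<longrightarrow> D (t + h) \<le> D t + h * (\<Lambda> * norm y * D t + 0 + e)"
    proof (intro exI[of _ "min a (min d1 d2)"] conjI allI impI)
      show "0 < min a (min d1 d2)" using c d1 d2 by simp
      fix h assume h: "0 < h \<and> h < min a (min d1 d2) \<and> t + h \<le> b"
      have "c h \<in> M" using c(3)[of h] h by simp
      then have "D (t + h) \<le> norm (g (t + h) - c h)" unfolding D_def dist_norm[symmetric] by (rule infdist_le)
      also have "g (t + h) - c h = (g (t + h) - g t - h *\<^sub>R V y (clip (g t))) - (c (0 + h) - c 0 - h *\<^sub>R V y z)
          + (g t - z) + h *\<^sub>R (V y (clip (g t)) - V y (clip z))"
        by (simp add: c(2) clip_M[OF z(1)] algebra_simps)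
      also have "norm \<dots> \<le> (e / 2 * h + e / 2 * h) + norm (g t - z) + h * (\<Lambda> * norm y * norm (g t - z))"
      proof (rule order_trans[OF norm_diff_add3_le], intro add_mono)
        show "norm (g (t + h) - g t - h *\<^sub>R V y (clip (g t))) \<le> e / 2 * h" using d1(2)[of h] h by simp
        show "norm (c (0 + h) - c 0 - h *\<^sub>R V y z) \<le> e / 2 * h" using d2(2)[of h] h by simp
        show "norm (h *\<^sub>R (V y (clip (g t)) - V y (clip z))) \<le> h * (\<Lambda> * norm y * norm (g t - z))"
          using h mult_left_mono[OF Vclip_lipschitz[of y "g t" z], of h] by simp
      qed simp
      finally show "D (t + h) \<le> D t + h * (\<Lambda> * norm y * D t + 0 + e)"
        by (simp add: z(2) dist_norm algebra_simps)
    qed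
  qed (use \<Lambda>_pos in \<open>auto simp: D_def infdist_nonneg\<close>)
  moreover have "D 0 = 0" using g0 by (simp add: D_def)
  ultimately have "D b = 0" unfolding D_def using infdist_nonneg[of "g b" M] by simp
  then show ?thesis using in_closed_iff_infdist_zero[OF cM M_nonempty] by (simp add: D_def)
qed

section \<open>Flows on M: existence, comparison and group laws\<close>

definition solves :: "real \<times> (real^'m) \<Rightarrow> (real \<Rightarrow> 'a) \<Rightarrow> bool" where
  "solves y g \<longleftrightarrow> (\<forall>t. g t \<in> M \<and> (g has_vector_derivative V y (g t)) (at t))"

lemma reflect_derivative:
  fixes g :: "real \<Rightarrow> 'a"
  assumes "\<And>t. (g has_vector_derivative f t) (at t)"
  shows "((\<lambda>t. g (- t)) has_vector_derivative - f (- t)) (at t)"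
proof -
  have "(g \<circ> uminus has_vector_derivative (- 1) *\<^sub>R f (- t)) (at t)"
    by (rule vector_diff_chain_at) (auto intro!: derivative_eq_intros assms)
  then show ?thesis by (simp add: o_def)
qed

lemma flow_exists:
  assumes "x \<in> M" shows "\<exists>g. g 0 = x \<and> solves y g"
proof -
  obtain g where g: "g 0 = x" "\<And>t. (g has_vector_derivative V y (clip (g t))) (at t)"
    using picard_global[of "\<lambda>x. V y (clip x)", OF Vclip_lipschitz] by blast
  have "((\<lambda>t. g (- t)) has_vector_derivative V (- y) (clip (g (- t)))) (at t)" for t
    using reflect_derivative[OF g(2)] by (simp add: vf_minus)
  then have "g (- b) \<in> M" if "b \<ge> 0" for b using invariance_forward[of "\<lambda>t. g (- t)" "- y" b] that assms g(1) by simp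
  moreover have "g b \<in> M" if "b \<ge> 0" for b using invariance_forward[of g y b] g assms that by simp
  ultimately have "g t \<in> M" for t by (metis linear minus_minus neg_0_le_iff_le)
  then show ?thesis using g clip_M by (metis solves_def)
qed

text \<open>One estimate covers a change of the initial point and a change of the driving vector;
  uniqueness is the case of equal data.\<close>

lemma solves_compare_forward:
  assumes g: "solves y g" and h: "solves y' h" and b: "b \<ge> 0"
  shows "norm (g b - h b) \<le> exp (\<Lambda> * norm y * b) * (norm (g 0 - h 0) + \<Lambda> * norm (y - y') * b)"
proof (rule dini_gronwall[OF b, where D = "\<lambda>t. norm (g t - h t)"])
  show "continuous_on {0..b} (\<lambda>t. norm (g t - h t))"
    using g h unfolding solves_def
    by (intro continuous_intros continuous_at_imp_continuous_on ballI) (blast intro: has_vector_derivative_continuous)+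
  fix t e :: real assume t: "0 \<le> t" "t < b" and e: "e > 0"
  have "((\<lambda>t. g t - h t) has_vector_derivative V y (g t) - V y' (h t)) (at t)"
    using g h by (intro has_vector_derivative_diff) (auto simp: solves_def)
  from has_vector_derivative_little_o[OF this e] obtain d where
    d: "d > 0" "\<And>s. 0 < s \<Longrightarrow> s < d \<Longrightarrow> norm (g (t + s) - h (t + s) - (g t - h t) - s *\<^sub>R (V y (g t) - V y' (h t))) \<le> e * s"
    by blast
  have "norm (V y (g t) - V y (h t) + V (y - y') (h t)) \<le> \<Lambda> * norm y * norm (g t - h t) + \<Lambda> * norm (y - y')"
    using g h by (intro norm_triangle_le add_mono V_lipschitz V_bound) (auto simp: solves_def)
  then have *: "norm (V y (g t) - V y' (h t)) \<le> \<Lambda> * norm y * norm (g t - h t) + \<Lambda> * norm (y - y')"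
    by (simp add: vf_diff)
  show "\<exists>d>0. \<forall>s. 0 < s \<and> s < d \<and> t + s \<le> b \<longrightarrow>
       norm (g (t + s) - h (t + s)) \<le> norm (g t - h t) + s * (\<Lambda> * norm y * norm (g t - h t) + \<Lambda> * norm (y - y') + e)"
  proof (intro exI[of _ d] conjI allI impI)
    fix s assume s: "0 < s \<and> s < d \<and> t + s \<le> b"
    have "norm (g (t + s) - h (t + s)) \<le> e * s + norm (g t - h t) + s * norm (V y (g t) - V y' (h t))"
      using norm_diff_add3_le[of "g (t + s) - h (t + s) - (g t - h t) - s *\<^sub>R (V y (g t) - V y' (h t))" 0 "g t - h t" "s *\<^sub>R (V y (g t) - V y' (h t))"]
        d(2)[of s] s by simp
    also have "\<dots> \<le> e * s + norm (g t - h t) + s * (\<Lambda> * norm y * norm (g t - h t) + \<Lambda> * norm (y - y'))"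
      using mult_left_mono[OF *, of s] s by simp
    finally show "norm (g (t + s) - h (t + s)) \<le> norm (g t - h t) + s * (\<Lambda> * norm y * norm (g t - h t) + \<Lambda> * norm (y - y') + e)"
      by (simp add: algebra_simps)
  qed (use d in auto)
qed (use \<Lambda>_pos in auto)

lemma solves_reflect: "solves y g \<Longrightarrow> solves (- y) (\<lambda>t. g (- t))"
  unfolding solves_def using reflect_derivative[of g "\<lambda>t. V y (g t)"] by (simp add: vf_minus)

lemma solves_compare:
  assumes g: "solves y g" and h: "solves y' h"
  shows "norm (g b - h b) \<le> exp (\<Lambda> * norm y * \<bar>b\<bar>) * (norm (g 0 - h 0) + \<Lambda> * norm (y - y') * \<bar>b\<bar>)"
proof (cases "b \<ge> 0")
  case True then show ?thesis using solves_compare_forward[OF g h] by simp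
next
  case False
  then show ?thesis using solves_compare_forward[OF solves_reflect[OF g] solves_reflect[OF h], of "- b"]
    by (simp add: norm_minus_commute)
qed

definition flow :: "real \<times> (real^'m) \<Rightarrow> 'a \<Rightarrow> real \<Rightarrow> 'a" where
  "flow y x = (SOME g. g 0 = x \<and> solves y g)"

lemma flow: assumes "x \<in> M" shows "flow y x 0 = x" "solves y (flow y x)"
  using someI_ex[OF flow_exists[OF assms, of y]] by (auto simp: flow_def)

lemma flow_in: "x \<in> M \<Longrightarrow> flow y x t \<in> M"
  using flow(2) by (auto simp: solves_def)

lemma flow_deriv: "x \<in> M \<Longrightarrow> (flow y x has_vector_derivative V y (flow y x t)) (at t)"
  using flow(2) by (auto simp: solves_def)

lemma flow_deriv_within: "x \<in> M \<Longrightarrow> (flow y x has_vector_derivative V y (flow y x t)) (at t within S)"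
  using flow_deriv has_vector_derivative_at_within by blast

lemma flow_unique: "solves y g \<Longrightarrow> g t = flow y (g 0) t"
  using solves_compare[of y g y "flow y (g 0)" t] flow[of "g 0" y] by (auto simp: solves_def)

lemma flow_compare:
  "x \<in> M \<Longrightarrow> x' \<in> M \<Longrightarrow> norm (flow y x t - flow y' x' t) \<le> exp (\<Lambda> * norm y * \<bar>t\<bar>) * (norm (x - x') + \<Lambda> * norm (y - y') * \<bar>t\<bar>)"
  using solves_compare[OF flow(2)[of x y] flow(2)[of x' y'], of t] by (simp add: flow(1))

lemma flow_add:
  assumes "x \<in> M" shows "flow y x (s + t) = flow y (flow y x s) t"
proof -
  have "solves y (\<lambda>t. flow y x (s + t))"
    unfolding solves_def
  proof (intro allI conjI)
    fix t
    show "flow y x (s + t) \<in> M" by (rule flow_in[OF assms])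
    have "(flow y x \<circ> (\<lambda>t. s + t) has_vector_derivative 1 *\<^sub>R V y (flow y x (s + t))) (at t)"
      by (rule vector_diff_chain_at) (auto intro!: derivative_eq_intros flow_deriv assms)
    then show "((\<lambda>t. flow y x (s + t)) has_vector_derivative V y (flow y x (s + t))) (at t)" by (simp add: o_def)
  qed
  from flow_unique[OF this, of t] show ?thesis by simp
qed

lemma flow_scale:
  assumes "x \<in> M" shows "flow (c *\<^sub>R y) x t = flow y x (c * t)"
proof -
  have "solves (c *\<^sub>R y) (\<lambda>t. flow y x (c * t))"
    unfolding solves_def
  proof (intro allI conjI)
    fix t
    show "flow y x (c * t) \<in> M" by (rule flow_in[OF assms])
    have "(flow y x \<circ> (\<lambda>t. c * t) has_vector_derivative c *\<^sub>R V y (flow y x (c * t))) (at t)"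
      by (rule vector_diff_chain_at) (auto intro!: derivative_eq_intros flow_deriv assms)
    then show "((\<lambda>t. flow y x (c * t)) has_vector_derivative V (c *\<^sub>R y) (flow y x (c * t))) (at t)" by (simp add: o_def vf_scaleR)
  qed
  from flow_unique[OF this, of t] show ?thesis by (simp add: flow(1)[OF assms])
qed

lemma flow_minus: "x \<in> M \<Longrightarrow> flow (- y) x t = flow y x (- t)"
  using flow_scale[of x "-1" y t] by simp

lemma flow_inverse: "x \<in> M \<Longrightarrow> flow y (flow y x t) (- t) = x"
  using flow_add[of x y t "-t"] by (simp add: flow(1))

lemma flow_continuous_on: "x \<in> M \<Longrightarrow> continuous_on S (flow y x)"
  by (intro continuous_at_imp_continuous_on ballI) (rule has_vector_derivative_continuous[OF flow_deriv])

lemma flow_move1: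
  assumes x: "x \<in> M" shows "norm (flow y x 1 - x) \<le> \<Lambda> * norm y"
proof -
  have "norm (flow y x 1 - flow y x 0) \<le> \<Lambda> * norm y * (1 - 0)"
    by (rule vector_derivative_bound[OF _ flow_deriv_within[OF x]]) (auto intro: V_bound flow_in x)
  then show ?thesis by (simp add: flow(1) x)
qed

lemma flow_move: "x \<in> M \<Longrightarrow> norm (flow y x t - x) \<le> \<Lambda> * (norm y * \<bar>t\<bar>)"
  using flow_move1[of x "t *\<^sub>R y"] flow_scale[of x t y 1] by (simp add: mult.commute)

text \<open>This is the local error of an Euler step. Over a short slot it reduces a path to its
  accumulated control.\<close>

lemma flow_second_order:
  assumes x: "x \<in> M" shows "norm (flow y x 1 - x - V y x) \<le> \<Lambda>\<^sup>2 * (norm y)\<^sup>2"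
proof -
  have "norm ((flow y x 1 - 1 *\<^sub>R V y x) - (flow y x 0 - 0 *\<^sub>R V y x)) \<le> \<Lambda>\<^sup>2 * (norm y)\<^sup>2 * (1 - 0)"
  proof (rule vector_derivative_bound)
    show "((\<lambda>t. flow y x t - t *\<^sub>R V y x) has_vector_derivative V y (flow y x t) - V y x) (at t within {0..1})" for t
      using has_vector_derivative_diff[OF flow_deriv_within[OF x]
          bounded_linear.has_vector_derivative[OF bounded_linear_scaleR_left has_vector_derivative_id]] by simp
    fix t :: real assume t: "0 \<le> t" "t \<le> 1"
    have "norm (V y (flow y x t) - V y x) \<le> \<Lambda> * norm y * norm (flow y x t - x)" by (intro V_lipschitz flow_in x)
    also have "\<dots> \<le> \<Lambda> * norm y * (\<Lambda> * (norm y * 1))"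
      using t \<Lambda>_pos by (intro mult_left_mono order_trans[OF flow_move[OF x]]) (auto intro: mult_left_mono)
    finally show "norm (V y (flow y x t) - V y x) \<le> \<Lambda>\<^sup>2 * (norm y)\<^sup>2" by (simp add: power2_eq_square mult_ac)
  qed auto
  then show ?thesis by (simp add: flow(1)[OF x] algebra_simps)
qed

end

section \<open>Truncated signatures of words of flows\<close>

text \<open>A leg \<open>(e1, e2, e3)\<close> stands for the time-one flow of \<open>\<Sum>p. (e1 p + e2 p + e3 p) Y\<^sub>p\<close>, where \<open>e1\<close>, \<open>e2\<close>, \<open>e3\<close> have
  sizes \<open>\<sigma>\<close>, \<open>\<sigma>\<^sup>2\<close>, \<open>\<sigma>\<^sup>3\<close>. The signature of a word of legs collects the coefficients of the iterated Lie derivatives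
  up to order \<open>\<sigma>\<^sup>3\<close>: \<open>sA\<close> has order \<open>\<sigma>\<close>; \<open>sB\<close> (second derivatives) and \<open>sz\<close> (first derivatives, from \<open>e2\<close>) have order \<open>\<sigma>\<^sup>2\<close>;
  \<open>sC\<close>, \<open>sD\<close> (mixed products of \<open>e1\<close> and \<open>e2\<close>) and \<open>sg\<close> have order \<open>\<sigma>\<^sup>3\<close>.\<close>

datatype 'p sgn = Sgn (sA: "'p \<Rightarrow> real") (sB: "'p \<Rightarrow> 'p \<Rightarrow> real") (sz: "'p \<Rightarrow> real")
  (sC: "'p \<Rightarrow> 'p \<Rightarrow> 'p \<Rightarrow> real") (sD: "'p \<Rightarrow> 'p \<Rightarrow> real") (sg: "'p \<Rightarrow> real")

definition sig_one :: "'p sgn" where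
  "sig_one = Sgn (\<lambda>p. 0) (\<lambda>p q. 0) (\<lambda>p. 0) (\<lambda>p q r. 0) (\<lambda>p q. 0) (\<lambda>p. 0)"

text \<open>The product of the free associative algebra, truncated above weight 3, when letters from
  \<open>e1\<close>, \<open>e2\<close>, \<open>e3\<close> have weights 1, 2, 3 and the mixed
  products of weights 1 and 2 are collected in \<open>sD\<close>.\<close>

definition sig_mult :: "'p sgn \<Rightarrow> 'p sgn \<Rightarrow> 'p sgn" where
  "sig_mult s t = Sgn (\<lambda>p. sA s p + sA t p)
     (\<lambda>p q. sB s p q + sB t p q + sA s p * sA t q)
     (\<lambda>p. sz s p + sz t p)
     (\<lambda>p q r. sC s p q r + sC t p q r + sA s p * sB t q r + sB s p q * sA t r)
     (\<lambda>p q. sD s p q + sD t p q + sA s p * sz t q + sz s p * sA t q)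
     (\<lambda>p. sg s p + sg t p)"

type_synonym 'p leg = "('p \<Rightarrow> real) \<times> ('p \<Rightarrow> real) \<times> ('p \<Rightarrow> real)"

text \<open>The exponential series of e1 + e2 + e3, sorted by weight and truncated above 3; hence
  the factors 1/2 and 1/6.\<close>

definition leg_sig :: "'p leg \<Rightarrow> 'p sgn" where
  "leg_sig l = (case l of (e1, e2, e3) \<Rightarrow> Sgn e1 (\<lambda>p q. e1 p * e1 q / 2) e2 (\<lambda>p q r. e1 p * e1 q * e1 r / 6)
     (\<lambda>p q. (e1 p * e2 q + e2 p * e1 q) / 2) e3)"

lemma sig_mult_assoc: "sig_mult (sig_mult s t) u = sig_mult s (sig_mult t u)"
  by (simp add: sig_mult_def fun_eq_iff algebra_simps)

lemma sig_mult_one: "sig_mult sig_one s = s" "sig_mult s sig_one = s"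
  by (simp_all add: sig_mult_def sig_one_def)

fun word_sig :: "'p leg list \<Rightarrow> 'p sgn" where
  "word_sig [] = sig_one"
| "word_sig (l # ls) = sig_mult (leg_sig l) (word_sig ls)"

lemma word_sig_append: "word_sig (xs @ ys) = sig_mult (word_sig xs) (word_sig ys)"
  by (induction xs) (simp_all add: sig_mult_one sig_mult_assoc)

text \<open>These words carry the same drift \<open>f\<close> of order \<open>\<sigma>\<^sup>2\<close> in each leg and are balanced so that the drift interacts with nothing
  up to order \<open>\<sigma>\<^sup>3\<close>: besides the total drift, only one bracket (of order \<open>\<sigma>\<^sup>3\<close>) survives.\<close>

definition word6 :: "('p \<Rightarrow> real) \<Rightarrow> ('p \<Rightarrow> real) \<Rightarrow> ('p \<Rightarrow> real) \<Rightarrow> ('p \<Rightarrow> real) \<Rightarrow> 'p leg list" where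
  "word6 a b c f = [(a, f, \<lambda>p. 0), (b, f, \<lambda>p. 0), (c, f, \<lambda>p. 0),
     (\<lambda>p. - a p, f, \<lambda>p. 0), (\<lambda>p. - b p, f, \<lambda>p. 0), (\<lambda>p. - c p, f, \<lambda>p. 0)]"

definition word24 :: "('p \<Rightarrow> real) \<Rightarrow> ('p \<Rightarrow> real) \<Rightarrow> ('p \<Rightarrow> real) \<Rightarrow> ('p \<Rightarrow> real) \<Rightarrow> 'p leg list" where
  "word24 a b c f = word6 a b c f @ word6 a (\<lambda>p. - b p) (\<lambda>p. - c p) f
     @ word6 (\<lambda>p. - a p) b (\<lambda>p. - c p) f @ word6 (\<lambda>p. - a p) (\<lambda>p. - b p) c f"

definition word8 :: "('p \<Rightarrow> real) \<Rightarrow> ('p \<Rightarrow> real) \<Rightarrow> ('p \<Rightarrow> real) \<Rightarrow> 'p leg list" where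
  "word8 a b f = [(a, f, \<lambda>p. 0), (\<lambda>p. 0, \<lambda>p. f p + b p, \<lambda>p. 0), (\<lambda>p. - a p, f, \<lambda>p. 0), (\<lambda>p. 0, \<lambda>p. f p - b p, \<lambda>p. 0),
     (\<lambda>p. - a p, f, \<lambda>p. 0), (\<lambda>p. 0, \<lambda>p. f p - b p, \<lambda>p. 0), (a, f, \<lambda>p. 0), (\<lambda>p. 0, \<lambda>p. f p + b p, \<lambda>p. 0)]"

text \<open>The commutator word a, b, -a, -b is followed by the same word with both signs changed.
  The bracket of \<open>a\<close> and \<open>b\<close> keeps its sign and doubles, whereas that of
  \<open>a\<close> and the drift \<open>f\<close> changes sign and cancels.\<close>

lemma word8_sig: "word_sig (word8 a b f) = Sgn (\<lambda>p. 0) (\<lambda>p q. 0) (\<lambda>p. 8 * f p) (\<lambda>p q r. 0)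
   (\<lambda>p q. 2 * (a p * b q - b p * a q)) (\<lambda>p. 0)"
  by (simp add: word8_def sig_mult_def leg_sig_def sig_one_def fun_eq_iff algebra_simps add_divide_distrib diff_divide_distrib)

lemma word6_A: "sA (word_sig (word6 a b c f)) = (\<lambda>p. 0)"
  by (simp add: word6_def sig_mult_def leg_sig_def sig_one_def fun_eq_iff)

lemma word6_z: "sz (word_sig (word6 a b c f)) = (\<lambda>p. 6 * f p)"
  by (simp add: word6_def sig_mult_def leg_sig_def sig_one_def fun_eq_iff)

lemma word6_g: "sg (word_sig (word6 a b c f)) = (\<lambda>p. 0)"
  by (simp add: word6_def sig_mult_def leg_sig_def sig_one_def fun_eq_iff)

lemma word6_B: "sB (word_sig (word6 a b c f)) = (\<lambda>p q. a p * b q - b p * a q + (a p * c q - c p * a q) + (b p * c q - c p * b q))"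
  by (simp add: word6_def sig_mult_def leg_sig_def sig_one_def fun_eq_iff algebra_simps)

lemma word6_D: "sD (word_sig (word6 a b c f)) = (\<lambda>p q. 3 * (a p * f q - f p * a q) + 3 * (b p * f q - f p * b q) + 3 * (c p * f q - f p * c q))"
  by (simp add: word6_def sig_mult_def leg_sig_def sig_one_def fun_eq_iff algebra_simps add_divide_distrib diff_divide_distrib)

text \<open>The four sign patterns have product +1, and they sum to zero for every single letter and
  every pair of letters. So only terms containing each of \<open>a\<close>, \<open>b\<close>,
  \<open>c\<close> once survive, and they form four times the nested bracket [[c, a], b].\<close>

lemma word24_C: "sC (word_sig (word6 a b c f)) p q r + sC (word_sig (word6 a (\<lambda>p. - b p) (\<lambda>p. - c p) f)) p q r
   + sC (word_sig (word6 (\<lambda>p. - a p) b (\<lambda>p. - c p) f)) p q r + sC (word_sig (word6 (\<lambda>p. - a p) (\<lambda>p. - b p) c f)) p q r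
   = 4 * ((c p * a q - a p * c q) * b r - b p * (c q * a r - a q * c r))"
  by (simp add: word6_def sig_mult_def leg_sig_def sig_one_def algebra_simps add_divide_distrib diff_divide_distrib)

lemma word24_sig: "word_sig (word24 a b c f) = Sgn (\<lambda>p. 0) (\<lambda>p q. 0) (\<lambda>p. 24 * f p)
   (\<lambda>p q r. 4 * ((c p * a q - a p * c q) * b r - b p * (c q * a r - a q * c r))) (\<lambda>p q. 0) (\<lambda>p. 0)"
proof -
  \<comment> \<open>Each of the four subwords closes up at first order, so their signatures simply
    add.\<close>
  have m: "sig_mult s t = Sgn (\<lambda>p. 0) (\<lambda>p q. sB s p q + sB t p q) (\<lambda>p. sz s p + sz t p) (\<lambda>p q r. sC s p q r + sC t p q r)
     (\<lambda>p q. sD s p q + sD t p q) (\<lambda>p. sg s p + sg t p)" if "sA s = (\<lambda>p. 0)" "sA t = (\<lambda>p. 0)" for s t :: "'a sgn"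
    using that by (simp add: sig_mult_def)
  show ?thesis
    unfolding word24_def word_sig_append
    using word24_C[of a b c f]
    by (simp add: m word6_A word6_B word6_z word6_D word6_g fun_eq_iff algebra_simps)
qed

section \<open>Expansion of words of flows\<close>

context control_fields
begin

text \<open>The index \<open>None\<close> is the drift field \<open>X0\<close>.\<close>

definition Yf :: "'m option \<Rightarrow> 'a \<Rightarrow> 'a" where
  "Yf p = (case p of None \<Rightarrow> X0 | Some i \<Rightarrow> X i)"

definition coords :: "real \<times> (real^'m) \<Rightarrow> 'm option \<Rightarrow> real" where
  "coords y p = (case p of None \<Rightarrow> fst y | Some i \<Rightarrow> snd y $ i)"

definition of_coords :: "('m option \<Rightarrow> real) \<Rightarrow> real \<times> (real^'m)" where
  "of_coords e = (e None, \<chi> i. e (Some i))"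

lemma coords_of_coords [simp]: "coords (of_coords e) = e"
  by (auto simp: coords_def of_coords_def fun_eq_iff split: option.split)

lemma smooth_Yf: "smooth (Yf p)"
  using X0_smooth X_smooth by (simp add: Yf_def split: option.split)

lemma V_eq_sum: "V y x = (\<Sum>p\<in>UNIV. coords y p *\<^sub>R Yf p x)"
  by (simp add: vf_def coords_def Yf_def UNIV_option_conv sum.reindex)

abbreviation "LD p \<equiv> lie (Yf p)"

lemma smooth_LD: "smooth \<phi> \<Longrightarrow> smooth (LD p \<phi>)"
  by (rule smooth_lie[OF smooth_Yf])

lemma frechet_V: "smooth \<phi> \<Longrightarrow> frechet_derivative \<phi> (at x) (V y x) = (\<Sum>p\<in>UNIV. coords y p * LD p \<phi> x)"
  using linear_frechet[of \<phi> x] by (simp add: V_eq_sum linear_sum linear_scale lie_def)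

section \<open>Iterated Lie derivatives and Taylor's formula along a flow\<close>

lemma deriv_along_flow:
  assumes \<phi>: "smooth \<phi>" and x: "x \<in> M"
  shows "((\<lambda>t. \<phi> (flow y x t)) has_real_derivative (\<Sum>p\<in>UNIV. coords y p * LD p \<phi> (flow y x t))) (at t)"
proof -
  have "((\<lambda>t. \<phi> (flow y x t)) has_derivative (\<lambda>h. frechet_derivative \<phi> (at (flow y x t)) (h *\<^sub>R V y (flow y x t)))) (at t)"
    by (rule has_derivative_compose[OF _ smooth_has_derivative[OF \<phi>]])
       (use flow_deriv[OF x] in \<open>simp add: has_vector_derivative_def\<close>)
  then show ?thesis
    by (simp add: has_field_derivative_def linear_scale[OF linear_frechet[OF \<phi>]] frechet_V[OF \<phi>] mult.commute[of _ "sum _ _"])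
qed

text \<open>Differential operators whose coefficients will come from signatures. The first index
  belongs to the leg that runs first and to the derivative that is applied last.\<close>

definition T1 where "T1 a \<phi> x = (\<Sum>p\<in>UNIV. a p * LD p \<phi> x)"
definition T2 where "T2 a \<phi> x = (\<Sum>p\<in>UNIV. \<Sum>q\<in>UNIV. a p q * LD p (LD q \<phi>) x)"
definition T3 where "T3 a \<phi> x = (\<Sum>p\<in>UNIV. \<Sum>q\<in>UNIV. \<Sum>r\<in>UNIV. a p q r * LD p (LD q (LD r \<phi>)) x)"
definition T4 where "T4 a \<phi> x = (\<Sum>p\<in>UNIV. \<Sum>q\<in>UNIV. \<Sum>r\<in>UNIV. \<Sum>s\<in>UNIV. a p q r s * LD p (LD q (LD r (LD s \<phi>))) x)"

lemma T1_add: "T1 (\<lambda>p. a p + b p) \<phi> x = T1 a \<phi> x + T1 b \<phi> x"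
  by (simp add: T1_def sum.distrib algebra_simps)
lemma T2_add: "T2 (\<lambda>p q. a p q + b p q) \<phi> x = T2 a \<phi> x + T2 b \<phi> x"
  by (simp add: T2_def sum.distrib algebra_simps)
lemma T3_add: "T3 (\<lambda>p q r. a p q r + b p q r) \<phi> x = T3 a \<phi> x + T3 b \<phi> x"
  by (simp add: T3_def sum.distrib algebra_simps)

lemma T2_nest: "T2 (\<lambda>p q. a p * b q) \<phi> x = (\<Sum>q\<in>UNIV. b q * T1 a (LD q \<phi>) x)"
  unfolding T2_def T1_def by (subst sum.swap) (simp add: sum_distrib_left algebra_simps)

lemma T3_nest21: "T3 (\<lambda>p q r. a p q * b r) \<phi> x = (\<Sum>r\<in>UNIV. b r * T2 a (LD r \<phi>) x)"
proof -
  have "T3 (\<lambda>p q r. a p q * b r) \<phi> x = (\<Sum>p\<in>UNIV. \<Sum>r\<in>UNIV. \<Sum>q\<in>UNIV. a p q * b r * LD p (LD q (LD r \<phi>)) x)"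
    unfolding T3_def by (rule sum.cong[OF refl]) (rule sum.swap)
  also have "\<dots> = (\<Sum>r\<in>UNIV. \<Sum>p\<in>UNIV. \<Sum>q\<in>UNIV. a p q * b r * LD p (LD q (LD r \<phi>)) x)" by (rule sum.swap)
  finally show ?thesis by (simp add: T2_def sum_distrib_left algebra_simps)
qed

lemma T3_nest12: "T3 (\<lambda>p q r. a p * b q r) \<phi> x = (\<Sum>q\<in>UNIV. \<Sum>r\<in>UNIV. b q r * T1 a (LD q (LD r \<phi>)) x)"
proof -
  have "T3 (\<lambda>p q r. a p * b q r) \<phi> x = (\<Sum>q\<in>UNIV. \<Sum>p\<in>UNIV. \<Sum>r\<in>UNIV. a p * b q r * LD p (LD q (LD r \<phi>)) x)"
    unfolding T3_def by (rule sum.swap)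
  also have "\<dots> = (\<Sum>q\<in>UNIV. \<Sum>r\<in>UNIV. \<Sum>p\<in>UNIV. a p * b q r * LD p (LD q (LD r \<phi>)) x)"
    by (rule sum.cong[OF refl]) (rule sum.swap)
  finally show ?thesis by (simp add: T1_def sum_distrib_left algebra_simps)
qed

lemma bounded_on_M: "smooth (\<psi> :: 'a \<Rightarrow> real) \<Longrightarrow> \<exists>C\<ge>0. \<forall>x\<in>M. \<bar>\<psi> x\<bar> \<le> C"
  using smooth_bounded_on_compact[OF _ M_compact, of \<psi>] unfolding real_norm_def .

lemma T1_bound: assumes "smooth \<phi>"
  shows "\<exists>C\<ge>0. \<forall>a b x. (\<forall>p. \<bar>a p\<bar> \<le> b) \<longrightarrow> x \<in> M \<longrightarrow> \<bar>T1 a \<phi> x\<bar> \<le> C * b"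
proof -
  obtain C where C: "\<And>p. C p \<ge> 0" "\<And>p x. x \<in> M \<Longrightarrow> \<bar>LD p \<phi> x\<bar> \<le> C p"
    using bounded_on_M[OF smooth_LD[OF assms]] by metis
  have "\<bar>T1 a \<phi> x\<bar> \<le> (\<Sum>p\<in>UNIV. C p) * b" if "\<forall>p. \<bar>a p\<bar> \<le> b" "x \<in> M" for a b x
    unfolding T1_def sum_distrib_right
    using C that by (intro order_trans[OF sum_abs] sum_mono) (metis abs_ge_zero abs_mult mult.commute mult_mono' )
  then show ?thesis using C by (intro exI[of _ "\<Sum>p\<in>UNIV. C p"]) (auto simp: sum_nonneg)
qed

lemma T2_bound: assumes "smooth \<phi>"
  shows "\<exists>C\<ge>0. \<forall>a b x. (\<forall>p q. \<bar>a p q\<bar> \<le> b) \<longrightarrow> x \<in> M \<longrightarrow> \<bar>T2 a \<phi> x\<bar> \<le> C * b"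
proof -
  obtain C where C: "\<And>q. C q \<ge> 0" "\<And>q a b x. (\<forall>p. \<bar>a p\<bar> \<le> b) \<Longrightarrow> x \<in> M \<Longrightarrow> \<bar>T1 a (LD q \<phi>) x\<bar> \<le> C q * b"
    using T1_bound[OF smooth_LD[OF assms]] by metis
  have eq: "T2 a \<phi> x = (\<Sum>q\<in>UNIV. T1 (\<lambda>p. a p q) (LD q \<phi>) x)" for a x
    unfolding T2_def T1_def by (rule sum.swap)
  have "\<bar>T2 a \<phi> x\<bar> \<le> (\<Sum>p\<in>UNIV. C p) * b" if "\<forall>p q. \<bar>a p q\<bar> \<le> b" "x \<in> M" for a b x
    unfolding eq sum_distrib_right using C that by (intro order_trans[OF sum_abs] sum_mono) auto
  then show ?thesis using C by (intro exI[of _ "\<Sum>p\<in>UNIV. C p"]) (auto simp: sum_nonneg)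
qed

lemma T3_bound: assumes "smooth \<phi>"
  shows "\<exists>C\<ge>0. \<forall>a b x. (\<forall>p q r. \<bar>a p q r\<bar> \<le> b) \<longrightarrow> x \<in> M \<longrightarrow> \<bar>T3 a \<phi> x\<bar> \<le> C * b"
proof -
  obtain C where C: "\<And>q. C q \<ge> 0" "\<And>q a b x. (\<forall>p r. \<bar>a p r\<bar> \<le> b) \<Longrightarrow> x \<in> M \<Longrightarrow> \<bar>T2 a (LD q \<phi>) x\<bar> \<le> C q * b"
    using T2_bound[OF smooth_LD[OF assms]] by metis
  have eq: "T3 a \<phi> x = (\<Sum>r\<in>UNIV. T2 (\<lambda>p q. a p q r) (LD r \<phi>) x)" for a x
  proof -
    have "T3 a \<phi> x = (\<Sum>p\<in>UNIV. \<Sum>r\<in>UNIV. \<Sum>q\<in>UNIV. a p q r * LD p (LD q (LD r \<phi>)) x)"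
      unfolding T3_def by (rule sum.cong[OF refl]) (rule sum.swap)
    also have "\<dots> = (\<Sum>r\<in>UNIV. \<Sum>p\<in>UNIV. \<Sum>q\<in>UNIV. a p q r * LD p (LD q (LD r \<phi>)) x)" by (rule sum.swap)
    finally show ?thesis by (simp add: T2_def)
  qed
  have "\<bar>T3 a \<phi> x\<bar> \<le> (\<Sum>p\<in>UNIV. C p) * b" if "\<forall>p q r. \<bar>a p q r\<bar> \<le> b" "x \<in> M" for a b x
    unfolding eq sum_distrib_right using C that by (intro order_trans[OF sum_abs] sum_mono) auto
  then show ?thesis using C by (intro exI[of _ "\<Sum>p\<in>UNIV. C p"]) (auto simp: sum_nonneg)
qed

lemma T4_bound: assumes "smooth \<phi>"
  shows "\<exists>C\<ge>0. \<forall>a b x. (\<forall>p q r s. \<bar>a p q r s\<bar> \<le> b) \<longrightarrow> x \<in> M \<longrightarrow> \<bar>T4 a \<phi> x\<bar> \<le> C * b"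
proof -
  obtain C where C: "\<And>p q r s. C p q r s \<ge> 0" "\<And>p q r s x. x \<in> M \<Longrightarrow> \<bar>LD p (LD q (LD r (LD s \<phi>))) x\<bar> \<le> C p q r s"
    using bounded_on_M[OF smooth_LD[OF smooth_LD[OF smooth_LD[OF smooth_LD[OF assms]]]]] by metis
  have "\<bar>T4 a \<phi> x\<bar> \<le> (\<Sum>p\<in>UNIV. \<Sum>q\<in>UNIV. \<Sum>r\<in>UNIV. \<Sum>s\<in>UNIV. C p q r s) * b"
    if "\<forall>p q r s. \<bar>a p q r s\<bar> \<le> b" "x \<in> M" for a b x
  proof -
    have "\<bar>a p q r s * LD p (LD q (LD r (LD s \<phi>))) x\<bar> \<le> C p q r s * b" for p q r s
      unfolding abs_mult using C that by (subst mult.commute) (intro mult_mono, auto)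
    then show ?thesis
      unfolding T4_def sum_distrib_right by (intro order_trans[OF sum_abs] sum_mono) auto
  qed
  then show ?thesis using C by (intro exI[of _ "\<Sum>p\<in>UNIV. \<Sum>q\<in>UNIV. \<Sum>r\<in>UNIV. \<Sum>s\<in>UNIV. C p q r s"]) (auto simp: sum_nonneg)
qed

text \<open>Differentiating along the flow is applying the Lie derivative of a combination of the
  fields with constant coefficients. So each derivative is again an operator of the same kind, and
  Taylor's formula with Lagrange remainder applies.\<close>

lemma flow_taylor:
  assumes \<phi>: "smooth \<phi>" and x: "x \<in> M"
  shows "\<exists>t. \<phi> (flow y x 1) = \<phi> x + T1 (coords y) \<phi> x + T2 (\<lambda>p q. coords y p * coords y q / 2) \<phi> x
     + T3 (\<lambda>p q r. coords y p * coords y q * coords y r / 6) \<phi> x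
     + T4 (\<lambda>p q r s. coords y p * coords y q * coords y r * coords y s / 24) \<phi> (flow y x t)"
proof -
  define c where "c = coords y"
  define d0 where "d0 t = \<phi> (flow y x t)" for t
  define d1 where "d1 t = T1 c \<phi> (flow y x t)" for t
  define d2 where "d2 t = T2 (\<lambda>p q. c p * c q) \<phi> (flow y x t)" for t
  define d3 where "d3 t = T3 (\<lambda>p q r. c p * c q * c r) \<phi> (flow y x t)" for t
  define d4 where "d4 t = T4 (\<lambda>p q r s. c p * c q * c r * c s) \<phi> (flow y x t)" for t
  have D0: "(d0 has_real_derivative d1 t) (at t)" for t
    using deriv_along_flow[OF \<phi> x] by (simp add: d0_def[abs_def] d1_def T1_def c_def)
  have D1: "(d1 has_real_derivative d2 t) (at t)" for t
  proof -
    have "(d1 has_real_derivative (\<Sum>p\<in>UNIV. c p * T1 c (LD p \<phi>) (flow y x t))) (at t)"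
      unfolding d1_def[abs_def] T1_def c_def
      by (intro DERIV_sum DERIV_cmult deriv_along_flow smooth_LD \<phi> x)
    then show ?thesis by (simp add: d2_def T2_nest)
  qed
  have D2: "(d2 has_real_derivative d3 t) (at t)" for t
  proof -
    have "(d2 has_real_derivative (\<Sum>p\<in>UNIV. \<Sum>q\<in>UNIV. (c p * c q) * T1 c (LD p (LD q \<phi>)) (flow y x t))) (at t)"
      unfolding d2_def[abs_def] T2_def T1_def c_def
      by (intro DERIV_sum DERIV_cmult deriv_along_flow smooth_LD \<phi> x)
    then show ?thesis using T3_nest12[of c "\<lambda>p q. c p * c q"] by (simp add: d3_def mult.assoc)
  qed
  have D3: "(d3 has_real_derivative d4 t) (at t)" for t
  proof -
    have "(d3 has_real_derivative (\<Sum>p\<in>UNIV. \<Sum>q\<in>UNIV. \<Sum>r\<in>UNIV. (c p * c q * c r) * T1 c (LD p (LD q (LD r \<phi>))) (flow y x t))) (at t)"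
      unfolding d3_def[abs_def] T3_def T1_def c_def
      by (intro DERIV_sum DERIV_cmult deriv_along_flow smooth_LD \<phi> x)
    \<comment> \<open>The new derivative enters next to the point of evaluation, that is, as the
      first index; the sums are reordered until the summation over the last index stands
      outermost.\<close>
    also have "(\<Sum>p\<in>UNIV. \<Sum>q\<in>UNIV. \<Sum>r\<in>UNIV. (c p * c q * c r) * T1 c (LD p (LD q (LD r \<phi>))) (flow y x t))
      = (\<Sum>p\<in>UNIV. c p * T3 (\<lambda>a b d. c a * (c b * c d)) (LD p \<phi>) (flow y x t))" (is "?l = _")
    proof -
      have "?l = (\<Sum>r\<in>UNIV. c r * (\<Sum>p\<in>UNIV. \<Sum>q\<in>UNIV. (c p * c q) * T1 c (LD p (LD q (LD r \<phi>))) (flow y x t)))"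
      proof -
        have "?l = (\<Sum>p\<in>UNIV. \<Sum>r\<in>UNIV. \<Sum>q\<in>UNIV. (c p * c q * c r) * T1 c (LD p (LD q (LD r \<phi>))) (flow y x t))"
          by (rule sum.cong[OF refl]) (rule sum.swap)
        also have "\<dots> = (\<Sum>r\<in>UNIV. \<Sum>p\<in>UNIV. \<Sum>q\<in>UNIV. (c p * c q * c r) * T1 c (LD p (LD q (LD r \<phi>))) (flow y x t))"
          by (rule sum.swap)
        finally show ?thesis by (simp add: sum_distrib_left mult_ac)
      qed
      then show ?thesis unfolding T3_nest12[of c "\<lambda>p q. c p * c q"] .
    qed
    also have "\<dots> = d4 t"
    proof -
      have "d4 t = (\<Sum>s\<in>UNIV. c s * T3 (\<lambda>p q r. c p * (c q * c r)) (LD s \<phi>) (flow y x t))"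
      proof -
        have "d4 t = (\<Sum>p\<in>UNIV. \<Sum>q\<in>UNIV. \<Sum>s\<in>UNIV. \<Sum>r\<in>UNIV. c p * c q * c r * c s * LD p (LD q (LD r (LD s \<phi>))) (flow y x t))"
          unfolding d4_def T4_def by (intro sum.cong[OF refl] sum.swap)
        also have "\<dots> = (\<Sum>p\<in>UNIV. \<Sum>s\<in>UNIV. \<Sum>q\<in>UNIV. \<Sum>r\<in>UNIV. c p * c q * c r * c s * LD p (LD q (LD r (LD s \<phi>))) (flow y x t))"
          by (intro sum.cong[OF refl] sum.swap)
        also have "\<dots> = (\<Sum>s\<in>UNIV. \<Sum>p\<in>UNIV. \<Sum>q\<in>UNIV. \<Sum>r\<in>UNIV. c p * c q * c r * c s * LD p (LD q (LD r (LD s \<phi>))) (flow y x t))"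
          by (rule sum.swap)
        finally show ?thesis by (simp add: T3_def sum_distrib_left mult_ac)
      qed
      then show ?thesis by simp
    qed
    finally show ?thesis .
  qed
  define diff where "diff n = (if n = 0 then d0 else if n = 1 then d1 else if n = 2 then d2 else if n = 3 then d3 else d4)" for n :: nat
  have "\<exists>t>0. t < 1 \<and> d0 1 = (\<Sum>m<4. diff m 0 / fact m * 1 ^ m) + diff 4 t / fact 4 * 1 ^ 4"
  proof (rule Maclaurin)
    show "\<forall>m t. m < 4 \<and> 0 \<le> t \<and> t \<le> 1 \<longrightarrow> (diff m has_real_derivative diff (Suc m) t) (at t)"
    proof (intro allI impI)
      fix m :: nat and t :: real assume "m < 4 \<and> 0 \<le> t \<and> t \<le> 1"
      then have "m = 0 \<or> m = 1 \<or> m = 2 \<or> m = 3" by auto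
      then show "(diff m has_real_derivative diff (Suc m) t) (at t)"
        using D0 D1 D2 D3 by (auto simp: diff_def)
    qed
  qed (auto simp: diff_def)
  then obtain t where "d0 1 = (\<Sum>m<4. diff m 0 / fact m) + diff 4 t / fact 4" by auto
  then have "d0 1 = d0 0 + d1 0 + d2 0 / 2 + d3 0 / 6 + d4 t / 24"
    by (simp add: diff_def eval_nat_numeral)
  then show ?thesis
    by (intro exI[of _ t])
       (simp add: d0_def d1_def d2_def d3_def d4_def c_def flow(1)[OF x] T2_def T3_def T4_def sum_divide_distrib)
qed

end

section \<open>Sizes of signatures and of the terms that they drop\<close>

definition leg_le :: "real \<Rightarrow> real \<Rightarrow> 'p leg \<Rightarrow> bool" where
  "leg_le Q \<sigma> l \<longleftrightarrow> (\<forall>p. \<bar>fst l p\<bar> \<le> Q * \<sigma> \<and> \<bar>fst (snd l) p\<bar> \<le> Q * \<sigma>^2 \<and> \<bar>snd (snd l) p\<bar> \<le> Q * \<sigma>^3)"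

definition sgn_le :: "real \<Rightarrow> real \<Rightarrow> 'p sgn \<Rightarrow> bool" where
  "sgn_le K \<sigma> s \<longleftrightarrow> (\<forall>p q r. \<bar>sA s p\<bar> \<le> K * \<sigma> \<and> \<bar>sB s p q\<bar> \<le> K * \<sigma>^2 \<and> \<bar>sz s p\<bar> \<le> K * \<sigma>^2
     \<and> \<bar>sC s p q r\<bar> \<le> K * \<sigma>^3 \<and> \<bar>sD s p q\<bar> \<le> K * \<sigma>^3 \<and> \<bar>sg s p\<bar> \<le> K * \<sigma>^3)"

lemma abs_mult_le: "\<bar>a\<bar> \<le> A \<Longrightarrow> \<bar>b\<bar> \<le> B \<Longrightarrow> \<bar>a * b\<bar> \<le> A * (B::real)"
  by (simp add: abs_mult mult_mono')

text \<open>Weights add under multiplication, so the size by weight is preserved with a constant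
  that does not involve \<open>\<sigma>\<close>.\<close>

lemma sgn_le_sig_mult:
  assumes "sgn_le K \<sigma> s" "sgn_le L \<sigma> t" "K \<ge> 0" "L \<ge> 0" "0 \<le> \<sigma>" "\<sigma> \<le> 1"
  shows "sgn_le (K + L + 2 * K * L) \<sigma> (sig_mult s t)"
proof -
  have s: "\<bar>sA s p\<bar> \<le> K * \<sigma>" "\<bar>sB s p q\<bar> \<le> K * \<sigma>^2" "\<bar>sz s p\<bar> \<le> K * \<sigma>^2"
    "\<bar>sC s p q r\<bar> \<le> K * \<sigma>^3" "\<bar>sD s p q\<bar> \<le> K * \<sigma>^3" "\<bar>sg s p\<bar> \<le> K * \<sigma>^3" for p q r
    using assms(1) unfolding sgn_le_def by blast+
  have t: "\<bar>sA t p\<bar> \<le> L * \<sigma>" "\<bar>sB t p q\<bar> \<le> L * \<sigma>^2" "\<bar>sz t p\<bar> \<le> L * \<sigma>^2"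
    "\<bar>sC t p q r\<bar> \<le> L * \<sigma>^3" "\<bar>sD t p q\<bar> \<le> L * \<sigma>^3" "\<bar>sg t p\<bar> \<le> L * \<sigma>^3" for p q r
    using assms(2) unfolding sgn_le_def by blast+
  have KL: "0 \<le> K * L * \<sigma>" "0 \<le> K * L * \<sigma>^2" "0 \<le> K * L * \<sigma>^3" using assms by simp_all
  show ?thesis unfolding sgn_le_def
  proof (intro allI conjI)
    fix p q r
    show "\<bar>sA (sig_mult s t) p\<bar> \<le> (K + L + 2 * K * L) * \<sigma>"
      using abs_triangle_ineq[of "sA s p" "sA t p"] s(1)[of p] t(1)[of p] KL by (simp add: sig_mult_def algebra_simps)
    have "\<bar>sA s p * sA t q\<bar> \<le> K * \<sigma> * (L * \<sigma>)" by (intro abs_mult_le s t)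
    then show "\<bar>sB (sig_mult s t) p q\<bar> \<le> (K + L + 2 * K * L) * \<sigma>^2"
      using abs_triangle_ineq[of "sB s p q + sB t p q" "sA s p * sA t q"] abs_triangle_ineq[of "sB s p q" "sB t p q"] s(2)[of p q] t(2)[of p q] KL
      by (simp add: sig_mult_def algebra_simps power2_eq_square)
    show "\<bar>sz (sig_mult s t) p\<bar> \<le> (K + L + 2 * K * L) * \<sigma>^2"
      using abs_triangle_ineq[of "sz s p" "sz t p"] s(3)[of p] t(3)[of p] KL by (simp add: sig_mult_def algebra_simps)
    have "\<bar>sA s p * sB t q r\<bar> \<le> K * \<sigma> * (L * \<sigma>^2)" "\<bar>sB s p q * sA t r\<bar> \<le> K * \<sigma>^2 * (L * \<sigma>)" by (intro abs_mult_le s t)+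
    then show "\<bar>sC (sig_mult s t) p q r\<bar> \<le> (K + L + 2 * K * L) * \<sigma>^3"
      using abs_triangle_ineq[of "sC s p q r + sC t p q r + sA s p * sB t q r" "sB s p q * sA t r"]
        abs_triangle_ineq[of "sC s p q r + sC t p q r" "sA s p * sB t q r"] abs_triangle_ineq[of "sC s p q r" "sC t p q r"] s(4)[of p q r] t(4)[of p q r]
      by (simp add: sig_mult_def algebra_simps power2_eq_square power3_eq_cube)
    have "\<bar>sA s p * sz t q\<bar> \<le> K * \<sigma> * (L * \<sigma>^2)" "\<bar>sz s p * sA t q\<bar> \<le> K * \<sigma>^2 * (L * \<sigma>)" by (intro abs_mult_le s t)+
    then show "\<bar>sD (sig_mult s t) p q\<bar> \<le> (K + L + 2 * K * L) * \<sigma>^3"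
      using abs_triangle_ineq[of "sD s p q + sD t p q + sA s p * sz t q" "sz s p * sA t q"]
        abs_triangle_ineq[of "sD s p q + sD t p q" "sA s p * sz t q"] abs_triangle_ineq[of "sD s p q" "sD t p q"] s(5)[of p q] t(5)[of p q]
      by (simp add: sig_mult_def algebra_simps power2_eq_square power3_eq_cube)
    show "\<bar>sg (sig_mult s t) p\<bar> \<le> (K + L + 2 * K * L) * \<sigma>^3"
      using abs_triangle_ineq[of "sg s p" "sg t p"] s(6)[of p] t(6)[of p] KL by (simp add: sig_mult_def algebra_simps)
  qed
qed

lemma sgn_le_leg_sig:
  assumes l: "leg_le Q \<sigma> l" and Q: "Q \<ge> 0" and s: "0 \<le> \<sigma>"
  shows "sgn_le (Q + Q^2 + Q^3) \<sigma> (leg_sig l)"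
proof -
  obtain e1 e2 e3 where le: "l = (e1, e2, e3)" by (cases l)
  have b: "\<bar>e1 p\<bar> \<le> Q * \<sigma>" "\<bar>e2 p\<bar> \<le> Q * \<sigma>^2" "\<bar>e3 p\<bar> \<le> Q * \<sigma>^3" for p
    using l unfolding leg_le_def le by auto
  have c: "\<bar>e1 p * e1 q\<bar> \<le> Q * \<sigma> * (Q * \<sigma>)" "\<bar>e1 p * e1 q * e1 r\<bar> \<le> Q * \<sigma> * (Q * \<sigma>) * (Q * \<sigma>)"
    "\<bar>e1 p * e2 q\<bar> \<le> Q * \<sigma> * (Q * \<sigma>^2)" "\<bar>e2 p * e1 q\<bar> \<le> Q * \<sigma>^2 * (Q * \<sigma>)" for p q r
    by (intro abs_mult_le b)+
  have n: "0 \<le> Q * \<sigma>" "0 \<le> Q^2 * \<sigma>" "0 \<le> Q^3 * \<sigma>" "0 \<le> Q * \<sigma>^2" "0 \<le> Q^2 * \<sigma>^2" "0 \<le> Q^3 * \<sigma>^2"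
     "0 \<le> Q * \<sigma>^3" "0 \<le> Q^2 * \<sigma>^3" "0 \<le> Q^3 * \<sigma>^3" using Q s by simp_all
  show ?thesis unfolding sgn_le_def le leg_sig_def
  proof (intro allI conjI; simp only: prod.case sgn.sel)
    fix p q r
    show "\<bar>e1 p\<bar> \<le> (Q + Q^2 + Q^3) * \<sigma>" unfolding distrib_right using b(1)[of p] n by linarith
    have "\<bar>e1 p * e1 q\<bar> \<le> Q^2 * \<sigma>^2" using c(1)[of p q] by (simp add: power2_eq_square mult_ac)
    then show "\<bar>e1 p * e1 q / 2\<bar> \<le> (Q + Q^2 + Q^3) * \<sigma>^2" unfolding distrib_right using n by linarith
    show "\<bar>e2 p\<bar> \<le> (Q + Q^2 + Q^3) * \<sigma>^2" unfolding distrib_right using b(2)[of p] n by linarith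
    have "\<bar>e1 p * e1 q * e1 r\<bar> \<le> Q^3 * \<sigma>^3" using c(2)[of p q r] by (simp add: power3_eq_cube mult_ac)
    then show "\<bar>e1 p * e1 q * e1 r / 6\<bar> \<le> (Q + Q^2 + Q^3) * \<sigma>^3" unfolding distrib_right using n by linarith
    have "\<bar>e1 p * e2 q\<bar> \<le> Q^2 * \<sigma>^3" "\<bar>e2 p * e1 q\<bar> \<le> Q^2 * \<sigma>^3"
      using c(3)[of p q] c(4)[of p q] by (simp_all add: power2_eq_square power3_eq_cube mult_ac)
    then have "\<bar>(e1 p * e2 q + e2 p * e1 q) / 2\<bar> \<le> Q^2 * \<sigma>^3"
      using abs_triangle_ineq[of "e1 p * e2 q" "e2 p * e1 q"] by (simp only: abs_divide) simp
    then show "\<bar>(e1 p * e2 q + e2 p * e1 q) / 2\<bar> \<le> (Q + Q^2 + Q^3) * \<sigma>^3"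
      unfolding distrib_right using n by linarith
    show "\<bar>e3 p\<bar> \<le> (Q + Q^2 + Q^3) * \<sigma>^3" unfolding distrib_right using b(3)[of p] n by linarith
  qed
qed

lemma sgn_le_word_sig:
  assumes Q: "Q \<ge> 0"
  shows "\<exists>K\<ge>0. \<forall>ls \<sigma>. length ls = n \<longrightarrow> 0 \<le> \<sigma> \<longrightarrow> \<sigma> \<le> 1 \<longrightarrow> (\<forall>l\<in>set ls. leg_le Q \<sigma> l) \<longrightarrow> sgn_le K \<sigma> (word_sig ls :: 'p sgn)"
proof (induction n)
  case 0
  then show ?case by (intro exI[of _ 0]) (auto simp: sgn_le_def sig_one_def)
next
  case (Suc n)
  then obtain K where K: "K \<ge> 0" "\<And>ls \<sigma>. length ls = n \<Longrightarrow> 0 \<le> \<sigma> \<Longrightarrow> \<sigma> \<le> 1 \<Longrightarrow> (\<forall>l\<in>set ls. leg_le Q \<sigma> l) \<Longrightarrow> sgn_le K \<sigma> (word_sig ls :: 'p sgn)"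
    by blast
  define P where "P = Q + Q^2 + Q^3"
  have P: "P \<ge> 0" using Q by (simp add: P_def)
  show ?case
  proof (intro exI[of _ "P + K + 2 * P * K"] conjI allI impI)
    fix ls :: "'p leg list" and \<sigma> :: real
    assume a: "length ls = Suc n" "0 \<le> \<sigma>" "\<sigma> \<le> 1" "\<forall>l\<in>set ls. leg_le Q \<sigma> l"
    then obtain l ls' where ls: "ls = l # ls'" by (cases ls) auto
    show "sgn_le (P + K + 2 * P * K) \<sigma> (word_sig ls)"
      unfolding ls word_sig.simps using a ls K P sgn_le_leg_sig[OF _ Q, of \<sigma> l]
      by (intro sgn_le_sig_mult) (auto simp: P_def)
  qed (use P K in simp)
qed

text \<open>The products that the signature drops from the square have weights 4, 5 and 6.\<close>

lemma quad_rest_bound: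
  fixes a b c a' b' c' :: real
  assumes "\<bar>a\<bar> \<le> Q * \<sigma>" "\<bar>b\<bar> \<le> Q * \<sigma>^2" "\<bar>c\<bar> \<le> Q * \<sigma>^3" "\<bar>a'\<bar> \<le> Q * \<sigma>" "\<bar>b'\<bar> \<le> Q * \<sigma>^2" "\<bar>c'\<bar> \<le> Q * \<sigma>^3"
    and "0 \<le> \<sigma>" "\<sigma> \<le> 1"
  shows "\<bar>(a + b + c) * (a' + b' + c') / 2 - (a * a' / 2 + (a * b' + b * a') / 2)\<bar> \<le> 3 * Q^2 * \<sigma>^4"
proof -
  have eq: "(a + b + c) * (a' + b' + c') / 2 - (a * a' / 2 + (a * b' + b * a') / 2) = (a * c' + c * a' + b * b' + b * c' + c * b' + c * c') / 2"
    by (simp add: field_simps)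
  have p: "\<sigma>^5 \<le> \<sigma>^4" "\<sigma>^6 \<le> \<sigma>^4" using assms(7,8) by (auto intro: power_decreasing)
  have "\<bar>a * c'\<bar> \<le> Q^2 * \<sigma>^4" "\<bar>c * a'\<bar> \<le> Q^2 * \<sigma>^4" "\<bar>b * b'\<bar> \<le> Q^2 * \<sigma>^4"
    using abs_mult_le[OF assms(1,6)] abs_mult_le[OF assms(3,4)] abs_mult_le[OF assms(2,5)]
    by (simp_all add: power2_eq_square eval_nat_numeral mult_ac)
  moreover have "\<bar>b * c'\<bar> \<le> Q^2 * \<sigma>^5" "\<bar>c * b'\<bar> \<le> Q^2 * \<sigma>^5" "\<bar>c * c'\<bar> \<le> Q^2 * \<sigma>^6"
    using abs_mult_le[OF assms(2,6)] abs_mult_le[OF assms(3,5)] abs_mult_le[OF assms(3,6)]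
    by (simp_all add: power2_eq_square eval_nat_numeral mult_ac)
  moreover have "Q^2 * \<sigma>^5 \<le> Q^2 * \<sigma>^4" "Q^2 * \<sigma>^6 \<le> Q^2 * \<sigma>^4" using p by (auto intro: mult_left_mono)
  ultimately have "\<bar>a * c' + c * a' + b * b' + b * c' + c * b' + c * c'\<bar> \<le> 6 * (Q^2 * \<sigma>^4)" by linarith
  then show ?thesis unfolding eq by simp
qed

text \<open>Exchanging one factor at a time for its part of weight 1 changes the triple product at
  weight 4.\<close>

lemma cubic_rest_bound:
  fixes a b c d e f :: real
  assumes "\<bar>a\<bar> \<le> Q * \<sigma>" "\<bar>b\<bar> \<le> Q * \<sigma>" "\<bar>c\<bar> \<le> Q * \<sigma>" "\<bar>d - a\<bar> \<le> 2 * Q * \<sigma>^2" "\<bar>e - b\<bar> \<le> 2 * Q * \<sigma>^2" "\<bar>f - c\<bar> \<le> 2 * Q * \<sigma>^2"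
    "\<bar>d\<bar> \<le> 3 * Q * \<sigma>" "\<bar>e\<bar> \<le> 3 * Q * \<sigma>" "\<bar>f\<bar> \<le> 3 * Q * \<sigma>"
  shows "\<bar>d * e * f / 6 - a * b * c / 6\<bar> \<le> 5 * Q^3 * \<sigma>^4"
proof -
  have eq: "d * e * f - a * b * c = (d - a) * e * f + a * (e - b) * f + a * b * (f - c)" by (simp add: algebra_simps)
  have "\<bar>(d - a) * e * f\<bar> \<le> 2 * Q * \<sigma>^2 * (3 * Q * \<sigma>) * (3 * Q * \<sigma>)" "\<bar>a * (e - b) * f\<bar> \<le> Q * \<sigma> * (2 * Q * \<sigma>^2) * (3 * Q * \<sigma>)"
    "\<bar>a * b * (f - c)\<bar> \<le> Q * \<sigma> * (Q * \<sigma>) * (2 * Q * \<sigma>^2)"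
    by (intro abs_mult_le assms)+
  then have "\<bar>d * e * f - a * b * c\<bar> \<le> 26 * (Q^3 * \<sigma>^4)" unfolding eq
    by (simp add: power2_eq_square eval_nat_numeral algebra_simps)
  moreover have "0 \<le> Q^3 * \<sigma>^4"
    using order_trans[OF abs_ge_zero abs_mult_le[OF abs_mult_le[OF abs_mult_le[OF assms(1,1)] assms(1)] assms(1)]]
  proof -
    have "0 \<le> Q * \<sigma>" using assms(1) by linarith
    have "0 \<le> 2 * Q * \<sigma>^2" using assms(4) by linarith
    then have "0 \<le> (Q * \<sigma>) * (Q * \<sigma>) * (Q * \<sigma>^2)" using \<open>0 \<le> Q * \<sigma>\<close> by simp
    then show ?thesis by (simp add: power2_eq_square eval_nat_numeral algebra_simps)
  qed
  ultimately have "\<bar>d * e * f - a * b * c\<bar> \<le> 30 * (Q^3 * \<sigma>^4)" by linarith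
  moreover have "\<bar>d * e * f / 6 - a * b * c / 6\<bar> = \<bar>d * e * f - a * b * c\<bar> / 6" by (simp add: diff_divide_distrib[symmetric])
  ultimately show ?thesis by linarith
qed

context control_fields
begin

section \<open>Expansion of a composed word\<close>

definition w1 where "w1 s \<phi> x = T1 (sA s) \<phi> x"
definition w2 where "w2 s \<phi> x = T2 (sB s) \<phi> x + T1 (sz s) \<phi> x"
definition w3 where "w3 s \<phi> x = T3 (sC s) \<phi> x + T2 (sD s) \<phi> x + T1 (sg s) \<phi> x"

definition leg_vector :: "('m option) leg \<Rightarrow> real \<times> (real^'m)" where
  "leg_vector l = of_coords (\<lambda>p. fst l p + fst (snd l) p + snd (snd l) p)"

fun run :: "('m option) leg list \<Rightarrow> 'a \<Rightarrow> 'a" where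
  "run [] x = x"
| "run (l # ls) x = run ls (flow (leg_vector l) x 1)"

lemma run_in: "x \<in> M \<Longrightarrow> run ls x \<in> M"
  by (induction ls arbitrary: x) (auto intro: flow_in)

text \<open>The right-hand side is the expansion along \<open>t\<close> in which every function is
  replaced by its expansion along \<open>s\<close>, cut off so that the total weight does not exceed
  3. In this form the leg estimates can be substituted term by term.\<close>

lemma w_sig_mult:
  "\<phi> x + w1 (sig_mult s t) \<phi> x + w2 (sig_mult s t) \<phi> x + w3 (sig_mult s t) \<phi> x =
   (\<phi> x + w1 s \<phi> x + w2 s \<phi> x + w3 s \<phi> x)
   + (\<Sum>p\<in>UNIV. sA t p * (LD p \<phi> x + w1 s (LD p \<phi>) x + w2 s (LD p \<phi>) x))
   + (\<Sum>p\<in>UNIV. \<Sum>q\<in>UNIV. sB t p q * (LD p (LD q \<phi>) x + w1 s (LD p (LD q \<phi>)) x))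
   + (\<Sum>p\<in>UNIV. sz t p * (LD p \<phi> x + w1 s (LD p \<phi>) x))
   + w3 t \<phi> x"
proof -
  have "w1 (sig_mult s t) \<phi> x = w1 s \<phi> x + T1 (sA t) \<phi> x"
    by (simp add: w1_def sig_mult_def T1_add)
  moreover have "w2 (sig_mult s t) \<phi> x = w2 s \<phi> x + T2 (sB t) \<phi> x + T1 (sz t) \<phi> x + (\<Sum>q\<in>UNIV. sA t q * w1 s (LD q \<phi>) x)"
    by (simp add: w2_def w1_def sig_mult_def T1_add T2_add T2_nest)
  moreover have "w3 (sig_mult s t) \<phi> x = w3 s \<phi> x + w3 t \<phi> x + (\<Sum>q\<in>UNIV. sA t q * w2 s (LD q \<phi>) x)
      + (\<Sum>p\<in>UNIV. \<Sum>q\<in>UNIV. sB t p q * w1 s (LD p (LD q \<phi>)) x) + (\<Sum>p\<in>UNIV. sz t p * w1 s (LD p \<phi>) x)"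
    by (simp add: w3_def w2_def w1_def sig_mult_def T1_add T2_add T3_add T3_nest12 T3_nest21 T2_nest sum.distrib distrib_left)
  ultimately show ?thesis
    by (simp add: sum.distrib distrib_left T1_def[of "sA t"] T1_def[of "sz t"] T2_def[of "sB t"])
qed

lemma leg_expansion3:
  assumes \<phi>: "smooth \<phi>" and Q: "Q \<ge> 0"
  shows "\<exists>K\<ge>0. \<forall>l \<sigma> x. 0 \<le> \<sigma> \<longrightarrow> \<sigma> \<le> 1 \<longrightarrow> leg_le Q \<sigma> l \<longrightarrow> x \<in> M \<longrightarrow>
     \<bar>\<phi> (flow (leg_vector l) x 1) - (\<phi> x + w1 (leg_sig l) \<phi> x + w2 (leg_sig l) \<phi> x + w3 (leg_sig l) \<phi> x)\<bar> \<le> K * \<sigma>^4"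
proof -
  obtain C2 where C2: "C2 \<ge> 0" "\<And>a b x. (\<forall>p q. \<bar>a p q\<bar> \<le> b) \<Longrightarrow> x \<in> M \<Longrightarrow> \<bar>T2 a \<phi> x\<bar> \<le> C2 * b" using T2_bound[OF \<phi>] by metis
  obtain C3 where C3: "C3 \<ge> 0" "\<And>a b x. (\<forall>p q r. \<bar>a p q r\<bar> \<le> b) \<Longrightarrow> x \<in> M \<Longrightarrow> \<bar>T3 a \<phi> x\<bar> \<le> C3 * b" using T3_bound[OF \<phi>] by metis
  obtain C4 where C4: "C4 \<ge> 0" "\<And>a b x. (\<forall>p q r s. \<bar>a p q r s\<bar> \<le> b) \<Longrightarrow> x \<in> M \<Longrightarrow> \<bar>T4 a \<phi> x\<bar> \<le> C4 * b" using T4_bound[OF \<phi>] by metis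
  define K where "K = C2 * (3 * Q^2) + C3 * (5 * Q^3) + C4 * (81 * Q^4)"
  have "\<bar>\<phi> (flow (leg_vector l) x 1) - (\<phi> x + w1 (leg_sig l) \<phi> x + w2 (leg_sig l) \<phi> x + w3 (leg_sig l) \<phi> x)\<bar> \<le> K * \<sigma>^4"
    if s: "0 \<le> \<sigma>" "\<sigma> \<le> 1" and l: "leg_le Q \<sigma> l" and x: "x \<in> M" for l \<sigma> x
  proof -
    obtain e1 e2 e3 where le: "l = (e1, e2, e3)" by (cases l)
    have b: "\<bar>e1 p\<bar> \<le> Q * \<sigma>" "\<bar>e2 p\<bar> \<le> Q * \<sigma>^2" "\<bar>e3 p\<bar> \<le> Q * \<sigma>^3" for p
      using l unfolding leg_le_def le by auto
    define c where "c p = e1 p + e2 p + e3 p" for p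
    have s2: "\<sigma>^2 \<le> \<sigma>" "\<sigma>^3 \<le> \<sigma>^2" using s power_decreasing[of 1 2 \<sigma>] power_decreasing[of 2 3 \<sigma>] by auto
    have Qs: "Q * \<sigma>^2 \<le> Q * \<sigma>" "Q * \<sigma>^3 \<le> Q * \<sigma>^2" using s2 Q by (auto intro: mult_left_mono)
    have cb: "\<bar>c p\<bar> \<le> 3 * Q * \<sigma>" "\<bar>c p - e1 p\<bar> \<le> 2 * Q * \<sigma>^2" for p
      using b[of p] Qs unfolding c_def by linarith+
    obtain t where t: "\<phi> (flow (leg_vector l) x 1) = \<phi> x + T1 c \<phi> x + T2 (\<lambda>p q. c p * c q / 2) \<phi> x
     + T3 (\<lambda>p q r. c p * c q * c r / 6) \<phi> x + T4 (\<lambda>p q r s. c p * c q * c r * c s / 24) \<phi> (flow (leg_vector l) x t)"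
      using flow_taylor[OF \<phi> x, of "leg_vector l"] by (auto simp: leg_vector_def le c_def[abs_def])
    define r2 where "r2 p q = c p * c q / 2 - (e1 p * e1 q / 2 + (e1 p * e2 q + e2 p * e1 q) / 2)" for p q
    define r3 where "r3 p q r = c p * c q * c r / 6 - e1 p * e1 q * e1 r / 6" for p q r
    have "T1 c \<phi> x = T1 e1 \<phi> x + T1 e2 \<phi> x + T1 e3 \<phi> x" unfolding c_def by (simp add: T1_add)
    moreover have "T2 (\<lambda>p q. c p * c q / 2) \<phi> x = T2 (\<lambda>p q. e1 p * e1 q / 2) \<phi> x + T2 (\<lambda>p q. (e1 p * e2 q + e2 p * e1 q) / 2) \<phi> x + T2 r2 \<phi> x"
      unfolding T2_add[symmetric] r2_def by simp
    moreover have "T3 (\<lambda>p q r. c p * c q * c r / 6) \<phi> x = T3 (\<lambda>p q r. e1 p * e1 q * e1 r / 6) \<phi> x + T3 r3 \<phi> x"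
      unfolding T3_add[symmetric] r3_def by simp
    ultimately have "\<phi> (flow (leg_vector l) x 1) - (\<phi> x + w1 (leg_sig l) \<phi> x + w2 (leg_sig l) \<phi> x + w3 (leg_sig l) \<phi> x)
      = T2 r2 \<phi> x + T3 r3 \<phi> x + T4 (\<lambda>p q r s. c p * c q * c r * c s / 24) \<phi> (flow (leg_vector l) x t)"
      unfolding t unfolding w1_def w2_def w3_def le leg_sig_def by simp
    moreover have "\<bar>T2 r2 \<phi> x\<bar> \<le> C2 * (3 * Q^2 * \<sigma>^4)"
      using b s unfolding r2_def c_def by (intro C2(2)[OF _ x] allI quad_rest_bound)
    moreover have "\<bar>T3 r3 \<phi> x\<bar> \<le> C3 * (5 * Q^3 * \<sigma>^4)"
      using b cb unfolding r3_def by (intro C3(2)[OF _ x] allI cubic_rest_bound) auto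
    moreover have "\<bar>T4 (\<lambda>p q r s. c p * c q * c r * c s / 24) \<phi> (flow (leg_vector l) x t)\<bar> \<le> C4 * (81 * Q^4 * \<sigma>^4)"
    proof (intro C4(2) allI flow_in x)
      fix p q r s
      have "\<bar>c p * c q * c r * c s\<bar> \<le> 3 * Q * \<sigma> * (3 * Q * \<sigma>) * (3 * Q * \<sigma>) * (3 * Q * \<sigma>)" by (intro abs_mult_le cb)
      then show "\<bar>c p * c q * c r * c s / 24\<bar> \<le> 81 * Q^4 * \<sigma>^4"
        by (simp add: eval_nat_numeral algebra_simps)
    qed
    ultimately show ?thesis unfolding K_def by (simp add: algebra_simps)
  qed
  moreover have "K \<ge> 0" using Q C2 C3 C4 by (simp add: K_def)
  ultimately show ?thesis by blast
qed

lemma w_bounds: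
  assumes \<phi>: "smooth \<phi>" and K: "K \<ge> 0"
  shows "\<exists>C\<ge>0. \<forall>s \<sigma> x. sgn_le K \<sigma> s \<longrightarrow> x \<in> M \<longrightarrow> \<bar>w1 s \<phi> x\<bar> \<le> C * \<sigma> \<and> \<bar>w2 s \<phi> x\<bar> \<le> C * \<sigma>^2 \<and> \<bar>w3 s \<phi> x\<bar> \<le> C * \<sigma>^3"
proof -
  obtain C1 where C1: "C1 \<ge> 0" "\<And>a b x. (\<forall>p. \<bar>a p\<bar> \<le> b) \<Longrightarrow> x \<in> M \<Longrightarrow> \<bar>T1 a \<phi> x\<bar> \<le> C1 * b" using T1_bound[OF \<phi>] by metis
  obtain C2 where C2: "C2 \<ge> 0" "\<And>a b x. (\<forall>p q. \<bar>a p q\<bar> \<le> b) \<Longrightarrow> x \<in> M \<Longrightarrow> \<bar>T2 a \<phi> x\<bar> \<le> C2 * b" using T2_bound[OF \<phi>] by metis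
  obtain C3 where C3: "C3 \<ge> 0" "\<And>a b x. (\<forall>p q r. \<bar>a p q r\<bar> \<le> b) \<Longrightarrow> x \<in> M \<Longrightarrow> \<bar>T3 a \<phi> x\<bar> \<le> C3 * b" using T3_bound[OF \<phi>] by metis
  have "\<bar>w1 s \<phi> x\<bar> \<le> (C1 + C2 + C3) * K * \<sigma> \<and> \<bar>w2 s \<phi> x\<bar> \<le> (C1 + C2 + C3) * K * \<sigma>^2 \<and> \<bar>w3 s \<phi> x\<bar> \<le> (C1 + C2 + C3) * K * \<sigma>^3"
    if s: "sgn_le K \<sigma> s" and x: "x \<in> M" for s \<sigma> x
  proof -
    have b: "\<bar>sA s p\<bar> \<le> K * \<sigma>" "\<bar>sB s p q\<bar> \<le> K * \<sigma>^2" "\<bar>sz s p\<bar> \<le> K * \<sigma>^2"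
      "\<bar>sC s p q r\<bar> \<le> K * \<sigma>^3" "\<bar>sD s p q\<bar> \<le> K * \<sigma>^3" "\<bar>sg s p\<bar> \<le> K * \<sigma>^3" for p q r
      using s unfolding sgn_le_def by blast+
    have n: "0 \<le> K * \<sigma>" "0 \<le> K * \<sigma>^2" "0 \<le> K * \<sigma>^3" using b(1)[of None] b(3)[of None] b(6)[of None] by linarith+
    have c: "\<bar>T1 (sA s) \<phi> x\<bar> \<le> C1 * (K * \<sigma>)" "\<bar>T2 (sB s) \<phi> x\<bar> \<le> C2 * (K * \<sigma>^2)" "\<bar>T1 (sz s) \<phi> x\<bar> \<le> C1 * (K * \<sigma>^2)"
      "\<bar>T3 (sC s) \<phi> x\<bar> \<le> C3 * (K * \<sigma>^3)" "\<bar>T2 (sD s) \<phi> x\<bar> \<le> C2 * (K * \<sigma>^3)" "\<bar>T1 (sg s) \<phi> x\<bar> \<le> C1 * (K * \<sigma>^3)"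
      using b x by (auto intro: C1 C2 C3)
    have m: "0 \<le> C * (K * \<sigma>)" "0 \<le> C * (K * \<sigma>^2)" "0 \<le> C * (K * \<sigma>^3)" if "C \<ge> 0" for C
      using that n by (simp_all only: mult_nonneg_nonneg)
    have e: "(C1 + C2 + C3) * K * z = C1 * (K * z) + C2 * (K * z) + C3 * (K * z)" for z by (simp add: algebra_simps)
    show ?thesis unfolding w1_def w2_def w3_def e
      using c m[OF C1(1)] m[OF C2(1)] m[OF C3(1)] by (intro conjI) linarith+
  qed
  then show ?thesis using C1 C2 C3 K by (intro exI[of _ "(C1 + C2 + C3) * K"]) auto
qed

text \<open>All four orders of precision occur: a coefficient of weight j in the rest of the word
  multiplies an expansion known up to order 4 - j.\<close>

lemma leg_expansions:
  assumes \<phi>: "smooth \<phi>" and Q: "Q \<ge> 0"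
  shows "\<exists>K\<ge>0. \<forall>l \<sigma> x. 0 \<le> \<sigma> \<longrightarrow> \<sigma> \<le> 1 \<longrightarrow> leg_le Q \<sigma> l \<longrightarrow> x \<in> M \<longrightarrow>
     \<bar>\<phi> (flow (leg_vector l) x 1) - (\<phi> x + w1 (leg_sig l) \<phi> x + w2 (leg_sig l) \<phi> x + w3 (leg_sig l) \<phi> x)\<bar> \<le> K * \<sigma>^4
   \<and> \<bar>\<phi> (flow (leg_vector l) x 1) - (\<phi> x + w1 (leg_sig l) \<phi> x + w2 (leg_sig l) \<phi> x)\<bar> \<le> K * \<sigma>^3
   \<and> \<bar>\<phi> (flow (leg_vector l) x 1) - (\<phi> x + w1 (leg_sig l) \<phi> x)\<bar> \<le> K * \<sigma>^2
   \<and> \<bar>\<phi> (flow (leg_vector l) x 1) - \<phi> x\<bar> \<le> K * \<sigma>"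
proof -
  define P where "P = Q + Q^2 + Q^3"
  have P: "P \<ge> 0" using Q by (simp add: P_def)
  obtain K where K: "K \<ge> 0" "\<And>l \<sigma> x. 0 \<le> \<sigma> \<Longrightarrow> \<sigma> \<le> 1 \<Longrightarrow> leg_le Q \<sigma> l \<Longrightarrow> x \<in> M \<Longrightarrow>
     \<bar>\<phi> (flow (leg_vector l) x 1) - (\<phi> x + w1 (leg_sig l) \<phi> x + w2 (leg_sig l) \<phi> x + w3 (leg_sig l) \<phi> x)\<bar> \<le> K * \<sigma>^4"
    using leg_expansion3[OF \<phi> Q] by blast
  obtain C where C: "C \<ge> 0" "\<And>s \<sigma> x. sgn_le P \<sigma> s \<Longrightarrow> x \<in> M \<Longrightarrow> \<bar>w1 s \<phi> x\<bar> \<le> C * \<sigma> \<and> \<bar>w2 s \<phi> x\<bar> \<le> C * \<sigma>^2 \<and> \<bar>w3 s \<phi> x\<bar> \<le> C * \<sigma>^3"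
    using w_bounds[OF \<phi> P] by blast
  show ?thesis
  proof (intro exI[of _ "K + 3 * C"] conjI[OF _ allI] allI impI)
    fix l :: "'m option leg" and \<sigma> x assume s: "0 \<le> \<sigma>" "\<sigma> \<le> 1" and l: "leg_le Q \<sigma> l" and x: "x \<in> (M::'a set)"
    note a = K(2)[OF s l x]
    note b = C(2)[OF sgn_le_leg_sig[OF l Q s(1), folded P_def] x]
    have p: "\<sigma>^4 \<le> \<sigma>^3" "\<sigma>^3 \<le> \<sigma>^2" "\<sigma>^2 \<le> \<sigma>" "0 \<le> \<sigma>^4"
      using s power_decreasing[of 1 2 \<sigma>] by (auto intro: power_decreasing)
    have m: "c * \<sigma>^4 \<le> c * \<sigma>^3" "c * \<sigma>^3 \<le> c * \<sigma>^2" "c * \<sigma>^2 \<le> c * \<sigma>" "0 \<le> c * \<sigma>^4" if "c \<ge> 0" for c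
      using p that by (auto intro: mult_left_mono)
    show "\<bar>\<phi> (flow (leg_vector l) x 1) - (\<phi> x + w1 (leg_sig l) \<phi> x + w2 (leg_sig l) \<phi> x + w3 (leg_sig l) \<phi> x)\<bar> \<le> (K + 3 * C) * \<sigma>^4
   \<and> \<bar>\<phi> (flow (leg_vector l) x 1) - (\<phi> x + w1 (leg_sig l) \<phi> x + w2 (leg_sig l) \<phi> x)\<bar> \<le> (K + 3 * C) * \<sigma>^3
   \<and> \<bar>\<phi> (flow (leg_vector l) x 1) - (\<phi> x + w1 (leg_sig l) \<phi> x)\<bar> \<le> (K + 3 * C) * \<sigma>^2
   \<and> \<bar>\<phi> (flow (leg_vector l) x 1) - \<phi> x\<bar> \<le> (K + 3 * C) * \<sigma>"
      using a b m[OF K(1)] m[OF C(1)] unfolding distrib_right mult.assoc by (intro conjI) linarith+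
  qed (use K C in auto)
qed

lemma sum_approx:
  fixes a u v :: "'i::finite \<Rightarrow> real"
  assumes "\<And>i. \<bar>a i\<bar> \<le> A" "\<And>i. \<bar>u i - v i\<bar> \<le> K i * e"
  shows "\<bar>(\<Sum>i\<in>UNIV. a i * u i) - (\<Sum>i\<in>UNIV. a i * v i)\<bar> \<le> A * (\<Sum>i\<in>UNIV. K i) * e"
proof -
  have "(\<Sum>i\<in>UNIV. a i * u i) - (\<Sum>i\<in>UNIV. a i * v i) = (\<Sum>i\<in>UNIV. a i * (u i - v i))"
    by (simp add: sum_subtractf right_diff_distrib)
  also have "\<bar>\<dots>\<bar> \<le> (\<Sum>i\<in>UNIV. A * (K i * e))"
    by (intro order_trans[OF sum_abs] sum_mono abs_mult_le assms)
  finally show ?thesis by (simp add: sum_distrib_left sum_distrib_right mult.assoc)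
qed

text \<open>The tail is expanded at the endpoint of the first leg, and each Lie derivative occurring
  there is then expanded back to the starting point, with just the precision that its coefficient
  leaves to be provided.\<close>

theorem run_expansion:
  assumes Q: "Q \<ge> 0"
  shows "smooth \<phi> \<Longrightarrow> \<exists>K\<ge>0. \<forall>ls \<sigma> x. length ls = n \<longrightarrow> 0 \<le> \<sigma> \<longrightarrow> \<sigma> \<le> 1 \<longrightarrow> (\<forall>l\<in>set ls. leg_le Q \<sigma> l) \<longrightarrow> x \<in> M \<longrightarrow>
     \<bar>\<phi> (run ls x) - (\<phi> x + w1 (word_sig ls) \<phi> x + w2 (word_sig ls) \<phi> x + w3 (word_sig ls) \<phi> x)\<bar> \<le> K * \<sigma>^4"
proof (induction n arbitrary: \<phi>)
  case 0
  show ?case by (intro exI[of _ 0]) (auto simp: w1_def w2_def w3_def sig_one_def T1_def T2_def T3_def)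
next
  case (Suc n)
  note \<phi> = Suc.prems
  obtain K0 where K0: "K0 \<ge> 0" "\<And>ls \<sigma> x. length ls = n \<Longrightarrow> 0 \<le> \<sigma> \<Longrightarrow> \<sigma> \<le> 1 \<Longrightarrow> (\<forall>l\<in>set ls. leg_le Q \<sigma> l) \<Longrightarrow> x \<in> M \<Longrightarrow>
     \<bar>\<phi> (run ls x) - (\<phi> x + w1 (word_sig ls) \<phi> x + w2 (word_sig ls) \<phi> x + w3 (word_sig ls) \<phi> x)\<bar> \<le> K0 * \<sigma>^4"
    using Suc.IH[OF \<phi>] by blast
  obtain S where S: "S \<ge> 0" "\<And>ls \<sigma>. length ls = n \<Longrightarrow> 0 \<le> \<sigma> \<Longrightarrow> \<sigma> \<le> 1 \<Longrightarrow> (\<forall>l\<in>set ls. leg_le Q \<sigma> l) \<Longrightarrow> sgn_le S \<sigma> (word_sig ls :: 'm option sgn)"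
    using sgn_le_word_sig[OF Q, of n] by blast
  let ?E = "\<lambda>\<psi> K. \<forall>l \<sigma> x. 0 \<le> \<sigma> \<longrightarrow> \<sigma> \<le> 1 \<longrightarrow> leg_le Q \<sigma> l \<longrightarrow> x \<in> M \<longrightarrow>
     \<bar>\<psi> (flow (leg_vector l) x 1) - (\<psi> x + w1 (leg_sig l) \<psi> x + w2 (leg_sig l) \<psi> x + w3 (leg_sig l) \<psi> x)\<bar> \<le> K * \<sigma>^4
   \<and> \<bar>\<psi> (flow (leg_vector l) x 1) - (\<psi> x + w1 (leg_sig l) \<psi> x + w2 (leg_sig l) \<psi> x)\<bar> \<le> K * \<sigma>^3
   \<and> \<bar>\<psi> (flow (leg_vector l) x 1) - (\<psi> x + w1 (leg_sig l) \<psi> x)\<bar> \<le> K * \<sigma>^2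
   \<and> \<bar>\<psi> (flow (leg_vector l) x 1) - \<psi> x\<bar> \<le> K * \<sigma>"
  have E: "\<exists>K\<ge>0. ?E \<psi> K" if "smooth \<psi>" for \<psi> using leg_expansions[OF that Q] .
  obtain L0 where L0: "L0 \<ge> 0" "?E \<phi> L0" using E[OF \<phi>] by blast
  obtain L1 where L1: "\<And>p. L1 p \<ge> 0" "\<And>p. ?E (LD p \<phi>) (L1 p)" using E[OF smooth_LD[OF \<phi>]] by metis
  obtain L2 where L2: "\<And>p q. L2 p q \<ge> 0" "\<And>p q. ?E (LD p (LD q \<phi>)) (L2 p q)" using E[OF smooth_LD[OF smooth_LD[OF \<phi>]]] by metis
  obtain L3 where L3: "\<And>p q r. L3 p q r \<ge> 0" "\<And>p q r. ?E (LD p (LD q (LD r \<phi>))) (L3 p q r)"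
    using E[OF smooth_LD[OF smooth_LD[OF smooth_LD[OF \<phi>]]]] by metis
  define N1 where "N1 = (\<Sum>p\<in>UNIV. L1 p)"
  define N2 where "N2 = (\<Sum>p\<in>UNIV. \<Sum>q\<in>UNIV. L2 p q)"
  define N3 where "N3 = (\<Sum>p\<in>UNIV. \<Sum>q\<in>UNIV. \<Sum>r\<in>UNIV. L3 p q r)"
  have N: "N1 \<ge> 0" "N2 \<ge> 0" "N3 \<ge> 0" unfolding N1_def N2_def N3_def using L1 L2 L3 by (auto intro!: sum_nonneg)
  define K where "K = K0 + L0 + S * (3 * N1 + 2 * N2 + N3)"
  have "\<bar>\<phi> (run ls x) - (\<phi> x + w1 (word_sig ls) \<phi> x + w2 (word_sig ls) \<phi> x + w3 (word_sig ls) \<phi> x)\<bar> \<le> K * \<sigma>^4"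
    if len: "length ls = Suc n" and s: "0 \<le> \<sigma>" "\<sigma> \<le> 1" and b: "\<forall>l\<in>set ls. leg_le Q \<sigma> l" and x: "x \<in> M" for ls \<sigma> x
  proof -
    obtain l ls' where ls: "ls = l # ls'" using len by (cases ls) auto
    have l: "leg_le Q \<sigma> l" and b': "\<forall>l\<in>set ls'. leg_le Q \<sigma> l" and len': "length ls' = n" using b len ls by auto
    define t where "t = word_sig ls'"
    define u where "u = leg_sig l"
    define x1 where "x1 = flow (leg_vector l) x 1"
    have x1: "x1 \<in> M" unfolding x1_def by (rule flow_in[OF x])
    have tb: "\<bar>sA t p\<bar> \<le> S * \<sigma>" "\<bar>sB t p q\<bar> \<le> S * \<sigma>^2" "\<bar>sz t p\<bar> \<le> S * \<sigma>^2"
      "\<bar>sC t p q r\<bar> \<le> S * \<sigma>^3" "\<bar>sD t p q\<bar> \<le> S * \<sigma>^3" "\<bar>sg t p\<bar> \<le> S * \<sigma>^3" for p q r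
      using S(2)[OF len' s b'] unfolding sgn_le_def t_def by blast+
    have h0: "\<bar>\<phi> (run ls x) - (\<phi> x1 + w1 t \<phi> x1 + w2 t \<phi> x1 + w3 t \<phi> x1)\<bar> \<le> K0 * \<sigma>^4"
      using K0(2)[OF len' s b' x1] by (simp add: ls t_def x1_def)
    have h1: "\<bar>\<phi> x1 - (\<phi> x + w1 u \<phi> x + w2 u \<phi> x + w3 u \<phi> x)\<bar> \<le> L0 * \<sigma>^4"
      using L0(2) s l x unfolding x1_def u_def by blast
    have hA: "\<bar>T1 (sA t) \<phi> x1 - (\<Sum>p\<in>UNIV. sA t p * (LD p \<phi> x + w1 u (LD p \<phi>) x + w2 u (LD p \<phi>) x))\<bar> \<le> S * \<sigma> * N1 * \<sigma>^3"
      unfolding T1_def N1_def x1_def u_def by (rule sum_approx[OF tb(1)]) (use L1(2) s l x in blast)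
    have hz: "\<bar>T1 (sz t) \<phi> x1 - (\<Sum>p\<in>UNIV. sz t p * (LD p \<phi> x + w1 u (LD p \<phi>) x))\<bar> \<le> S * \<sigma>^2 * N1 * \<sigma>^2"
      unfolding T1_def N1_def x1_def u_def by (rule sum_approx[OF tb(3)]) (use L1(2) s l x in blast)
    have hg: "\<bar>T1 (sg t) \<phi> x1 - T1 (sg t) \<phi> x\<bar> \<le> S * \<sigma>^3 * N1 * \<sigma>"
      unfolding T1_def N1_def x1_def u_def by (rule sum_approx[OF tb(6)]) (use L1(2) s l x in blast)
    \<comment> \<open>Multiple sums become single sums over tuples, to which
      \<open>sum_approx\<close> applies.\<close>
    have two: "(\<Sum>p\<in>UNIV. \<Sum>q\<in>UNIV. f p q) = (\<Sum>i\<in>UNIV. f (fst i) (snd i))" for f :: "'m option \<Rightarrow> 'm option \<Rightarrow> real"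
      by (simp add: sum.cartesian_product case_prod_beta)
    have three: "(\<Sum>p\<in>UNIV. \<Sum>q\<in>UNIV. \<Sum>r\<in>UNIV. f p q r) = (\<Sum>i\<in>UNIV. f (fst i) (fst (snd i)) (snd (snd i)))" for f :: "'m option \<Rightarrow> 'm option \<Rightarrow> 'm option \<Rightarrow> real"
      by (simp add: sum.cartesian_product case_prod_beta)
    have hB: "\<bar>T2 (sB t) \<phi> x1 - (\<Sum>p\<in>UNIV. \<Sum>q\<in>UNIV. sB t p q * (LD p (LD q \<phi>) x + w1 u (LD p (LD q \<phi>)) x))\<bar> \<le> S * \<sigma>^2 * N2 * \<sigma>^2"
      unfolding T2_def N2_def x1_def u_def two by (rule sum_approx[OF tb(2)]) (use L2(2) s l x in blast)
    have hD: "\<bar>T2 (sD t) \<phi> x1 - T2 (sD t) \<phi> x\<bar> \<le> S * \<sigma>^3 * N2 * \<sigma>"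
      unfolding T2_def N2_def x1_def u_def two by (rule sum_approx[OF tb(5)]) (use L2(2) s l x in blast)
    have hC: "\<bar>T3 (sC t) \<phi> x1 - T3 (sC t) \<phi> x\<bar> \<le> S * \<sigma>^3 * N3 * \<sigma>"
      unfolding T3_def N3_def x1_def u_def three by (rule sum_approx[OF tb(4)]) (use L3(2) s l x in blast)
    have p: "S * \<sigma> * N1 * \<sigma>^3 = S * N1 * \<sigma>^4" "S * \<sigma>^2 * N1 * \<sigma>^2 = S * N1 * \<sigma>^4" "S * \<sigma>^3 * N1 * \<sigma> = S * N1 * \<sigma>^4"
      "S * \<sigma>^2 * N2 * \<sigma>^2 = S * N2 * \<sigma>^4" "S * \<sigma>^3 * N2 * \<sigma> = S * N2 * \<sigma>^4" "S * \<sigma>^3 * N3 * \<sigma> = S * N3 * \<sigma>^4"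
      by (simp_all add: eval_nat_numeral)
    have Kp: "K * \<sigma>^4 = K0 * \<sigma>^4 + L0 * \<sigma>^4 + S * N1 * \<sigma>^4 + S * N1 * \<sigma>^4 + S * N1 * \<sigma>^4 + S * N2 * \<sigma>^4 + S * N2 * \<sigma>^4 + S * N3 * \<sigma>^4"
      by (simp add: K_def algebra_simps)
    show ?thesis
      unfolding ls word_sig.simps(2) t_def[symmetric] u_def[symmetric] w_sig_mult
      using h0 h1 hA hz hg hB hD hC unfolding p Kp w1_def[of t] w2_def[of t] w3_def[of t] ls abs_le_iff
      by (elim conjE, intro conjI; linarith)
  qed
  moreover have "K \<ge> 0" using K0 L0 S N by (simp add: K_def)
  ultimately show ?case by blast
qed

end

section \<open>Words realising prescribed combinations of brackets\<close>

type_synonym 'm bidx = "'m + ('m \<times> 'm) + ('m \<times> 'm \<times> 'm)"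

definition unitc :: "'m \<Rightarrow> 'm option \<Rightarrow> real" where
  "unitc i p = (if p = Some i then 1 else 0)"

text \<open>The factors 1/2 and 1/4 undo the factors 2 and 4 in the signatures, so every word
  displaces by \<open>\<sigma>^3 * c\<close> times its bracket. A field is inserted with weight 3, a
  bracket of two pairs weights 1 and 2, and a bracket of three uses weight 1 throughout.\<close>

fun word :: "real \<Rightarrow> real \<Rightarrow> ('m option \<Rightarrow> real) \<Rightarrow> 'm bidx \<Rightarrow> ('m option) leg list" where
  "word \<sigma> c f (Inl i) = [(\<lambda>p. 0, f, \<lambda>p. \<sigma>^3 * c * unitc i p)]"
| "word \<sigma> c f (Inr (Inl (i, j))) = word8 (\<lambda>p. \<sigma> * unitc i p) (\<lambda>p. \<sigma>^2 * (c / 2) * unitc j p) f"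
| "word \<sigma> c f (Inr (Inr (k, i, j))) = word24 (\<lambda>p. \<sigma> * unitc i p) (\<lambda>p. \<sigma> * unitc j p) (\<lambda>p. \<sigma> * (c / 4) * unitc k p) f"

fun wlen :: "'m bidx \<Rightarrow> nat" where
  "wlen (Inl i) = 1" | "wlen (Inr (Inl p)) = 8" | "wlen (Inr (Inr p)) = 24"

lemma length_word: "length (word \<sigma> c f \<alpha>) = wlen \<alpha>"
  by (cases "(\<sigma>, c, f, \<alpha>)" rule: word.cases) (auto simp: word8_def word24_def word6_def)

text \<open>Flat words do not interact up to weight 3: composing them adds their drifts and their
  brackets.\<close>

definition flat :: "'p sgn \<Rightarrow> bool" where "flat s \<longleftrightarrow> sA s = (\<lambda>p. 0) \<and> sB s = (\<lambda>p q. 0)"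

lemma flat_word: "flat (word_sig (word \<sigma> c f \<alpha>))"
  by (cases "(\<sigma>, c, f, \<alpha>)" rule: word.cases)
     (auto simp: flat_def word8_sig word24_sig leg_sig_def sig_mult_one)

lemma sz_word: "sz (word_sig (word \<sigma> c f \<alpha>)) = (\<lambda>p. real (wlen \<alpha>) * f p)"
  by (cases "(\<sigma>, c, f, \<alpha>)" rule: word.cases)
     (auto simp: word8_sig word24_sig leg_sig_def sig_mult_one)

lemma leg_le_word:
  assumes "0 \<le> \<sigma>" "\<sigma> \<le> 1" "\<bar>c\<bar> \<le> 1" "\<And>p. \<bar>f p\<bar> \<le> Z * \<sigma>^2" "Z \<ge> 0" "l \<in> set (word \<sigma> c f \<alpha>)"
  shows "leg_le (Z + 1) \<sigma> l"
proof -
  have u: "\<bar>unitc i p\<bar> \<le> 1" for i :: 'a and p by (simp add: unitc_def)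
  have n: "0 \<le> Z * \<sigma>" "0 \<le> Z * \<sigma>^2" "0 \<le> Z * \<sigma>^3" using assms by simp_all
  have a: "\<bar>\<sigma> * unitc i p\<bar> \<le> \<sigma>" "\<bar>\<sigma> * (c / 4) * unitc i p\<bar> \<le> \<sigma>" "\<bar>\<sigma>^2 * (c / 2) * unitc i p\<bar> \<le> \<sigma>^2"
    "\<bar>\<sigma>^3 * c * unitc i p\<bar> \<le> \<sigma>^3" for i :: 'a and p
    using abs_mult_le[of \<sigma> \<sigma> "unitc i p" 1] abs_mult_le[OF abs_mult_le[of \<sigma> \<sigma> "c / 4" 1], of "unitc i p" 1]
       abs_mult_le[OF abs_mult_le[of "\<sigma>^2" "\<sigma>^2" "c / 2" 1], of "unitc i p" 1]
       abs_mult_le[OF abs_mult_le[of "\<sigma>^3" "\<sigma>^3" "c" 1], of "unitc i p" 1] assms u[of i p] by auto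
  have e1: "\<bar>e\<bar> \<le> (Z + 1) * \<sigma>" if "\<bar>e\<bar> \<le> \<sigma>" for e using that n by (simp add: algebra_simps)
  have e1': "\<bar>- e\<bar> \<le> (Z + 1) * \<sigma>" if "\<bar>e\<bar> \<le> \<sigma>" for e using e1[OF that] by simp
  have e3: "\<bar>e\<bar> \<le> (Z + 1) * \<sigma>^3" if "\<bar>e\<bar> \<le> \<sigma>^3" for e using that n by (simp add: algebra_simps)
  have z: "0 \<le> (Z + 1) * \<sigma>" "0 \<le> (Z + 1) * \<sigma>^2" "0 \<le> (Z + 1) * \<sigma>^3" using assms by simp_all
  have f: "\<bar>f p\<bar> \<le> (Z + 1) * \<sigma>^2" for p using assms(4)[of p] zero_le_power2[of \<sigma>] unfolding distrib_right by linarith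
  have fp: "\<bar>f p + e\<bar> \<le> (Z + 1) * \<sigma>^2" "\<bar>f p - e\<bar> \<le> (Z + 1) * \<sigma>^2" if "\<bar>e\<bar> \<le> \<sigma>^2" for p e
    using assms(4)[of p] that abs_triangle_ineq[of "f p" e] abs_triangle_ineq4[of "f p" e] by (simp_all add: algebra_simps)
  show ?thesis using assms(6)
  proof (cases "(\<sigma>, c, f, \<alpha>)" rule: word.cases)
    case (1 \<sigma>' c' f' i)
    then have l: "l = (\<lambda>p. 0, f, \<lambda>p. \<sigma>^3 * c * unitc i p)" using assms(6) by simp
    show ?thesis unfolding l leg_le_def using z f e3[OF a(4)] by simp
  next
    case (2 \<sigma>' c' f' i j)
    have *: "leg_le (Z + 1) \<sigma> (\<lambda>p. \<sigma> * unitc i p, f, \<lambda>p. 0)" "leg_le (Z + 1) \<sigma> (\<lambda>p. - (\<sigma> * unitc i p), f, \<lambda>p. 0)"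
      "leg_le (Z + 1) \<sigma> (\<lambda>p. 0, \<lambda>p. f p + \<sigma>^2 * (c / 2) * unitc j p, \<lambda>p. 0)"
      "leg_le (Z + 1) \<sigma> (\<lambda>p. 0, \<lambda>p. f p - \<sigma>^2 * (c / 2) * unitc j p, \<lambda>p. 0)"
      unfolding leg_le_def using z f e1[OF a(1)] e1'[OF a(1)] fp[OF a(3)] by simp_all
    have "l \<in> set (word8 (\<lambda>p. \<sigma> * unitc i p) (\<lambda>p. \<sigma>^2 * (c / 2) * unitc j p) f)" using assms(6) 2 by simp
    then show ?thesis
      unfolding word8_def list.set insert_iff empty_iff
      using * by (elim disjE) simp_all
  next
    case (3 \<sigma>' c' f' k i j)
    have *: "leg_le (Z + 1) \<sigma> (\<lambda>p. \<sigma> * unitc i p, f, \<lambda>p. 0)" "leg_le (Z + 1) \<sigma> (\<lambda>p. - (\<sigma> * unitc i p), f, \<lambda>p. 0)"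
      "leg_le (Z + 1) \<sigma> (\<lambda>p. \<sigma> * (c / 4) * unitc i p, f, \<lambda>p. 0)" "leg_le (Z + 1) \<sigma> (\<lambda>p. - (\<sigma> * (c / 4) * unitc i p), f, \<lambda>p. 0)" for i
      unfolding leg_le_def using z f e1[OF a(1)] e1'[OF a(1)] e1[OF a(2)] e1'[OF a(2)] by simp_all
    have "l \<in> set (word24 (\<lambda>p. \<sigma> * unitc i p) (\<lambda>p. \<sigma> * unitc j p) (\<lambda>p. \<sigma> * (c / 4) * unitc k p) f)" using assms(6) 3 by simp
    then show ?thesis
      unfolding word24_def word6_def append.simps list.set insert_iff empty_iff minus_minus
      using * by (elim disjE) simp_all
  qed
qed

definition bracket_indices :: "('m::finite) bidx list" where
  "bracket_indices = (SOME xs. set xs = UNIV \<and> distinct xs)"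

lemma bracket_indices: "set bracket_indices = (UNIV :: ('m::finite) bidx set)" "distinct (bracket_indices :: 'm bidx list)"
proof -
  have "\<exists>xs. set xs = (UNIV :: 'm bidx set) \<and> distinct xs" by (rule finite_distinct_list) simp
  from someI_ex[OF this] show "set bracket_indices = (UNIV :: 'm bidx set)" "distinct (bracket_indices :: 'm bidx list)"
    by (auto simp: bracket_indices_def)
qed

definition bracket_word :: "real \<Rightarrow> ('m::finite bidx \<Rightarrow> real) \<Rightarrow> ('m option \<Rightarrow> real) \<Rightarrow> ('m option) leg list" where
  "bracket_word \<sigma> c f = concat (map (\<lambda>\<alpha>. word \<sigma> (c \<alpha>) f \<alpha>) bracket_indices)"

context control_fields
begin

fun W :: "'m bidx \<Rightarrow> 'a \<Rightarrow> 'a" where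
  "W (Inl i) = X i"
| "W (Inr (Inl (i, j))) = lie_bracket (X i) (X j)"
| "W (Inr (Inr (k, i, j))) = lie_bracket (lie_bracket (X k) (X i)) (X j)"

lemma smooth_W: "smooth (W \<alpha>)"
  by (cases \<alpha> rule: W.cases) (auto intro: X_smooth smooth_lie_bracket)

text \<open>Each leg of a bracket word carries the drift \<open>f\<close>, so the word as a whole
  carries \<open>nlegs\<close> times \<open>f\<close>.\<close>

definition nlegs :: nat where "nlegs = sum_list (map wlen (bracket_indices :: 'm bidx list))"

lemma length_bracket_word: "length (bracket_word \<sigma> c f :: 'm option leg list) = nlegs"
  by (simp add: bracket_word_def nlegs_def length_concat o_def length_word)

lemma nlegs_pos: "nlegs \<ge> 1"
proof -
  have "wlen (Inl undefined :: 'm bidx) \<in> set (map wlen (bracket_indices :: 'm bidx list))"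
    using bracket_indices(1) by (metis UNIV_I image_eqI list.set_map)
  then have "wlen (Inl undefined :: 'm bidx) \<le> nlegs" unfolding nlegs_def by (intro member_le_sum_list) auto
  then show ?thesis by simp
qed

lemma T1_unit: "T1 (\<lambda>p. s * unitc i p) \<phi> x = s * LD (Some i) \<phi> x"
  unfolding T1_def unitc_def by (simp add: if_distrib[of "\<lambda>a. s * a"] if_distrib[of "\<lambda>a. a * _"] cong: if_cong)

lemma sum_unit: "(\<Sum>q\<in>UNIV. s * unitc i q * g q) = s * g (Some i)" for g :: "'m option \<Rightarrow> real"
  unfolding unitc_def by (simp add: if_distrib[of "\<lambda>a. s * a"] if_distrib[of "\<lambda>a. a * _"] cong: if_cong)

lemma T2_unit: "T2 (\<lambda>p q. (s * unitc i p) * (t * unitc j q)) \<phi> x = s * t * LD (Some i) (LD (Some j) \<phi>) x"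
  by (simp only: T2_nest sum_unit T1_unit) simp

lemma T3_unit: "T3 (\<lambda>p q r. (s * unitc i p) * (t * unitc j q) * (u * unitc k r)) \<phi> x
  = s * t * u * LD (Some i) (LD (Some j) (LD (Some k) \<phi>)) x"
  by (simp only: T3_nest21[of "\<lambda>p q. (s * unitc i p) * (t * unitc j q)"] sum_unit T2_unit) simp

lemma T2_cmult: "T2 (\<lambda>p q. k * a p q) \<phi> x = k * T2 a \<phi> x"
  by (simp add: T2_def sum_distrib_left mult.assoc)
lemma T2_diff: "T2 (\<lambda>p q. a p q - b p q) \<phi> x = T2 a \<phi> x - T2 b \<phi> x"
  by (simp add: T2_def sum_subtractf algebra_simps)
lemma T3_cmult: "T3 (\<lambda>p q r. k * a p q r) \<phi> x = k * T3 a \<phi> x"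
  by (simp add: T3_def sum_distrib_left mult.assoc)
lemma T3_diff: "T3 (\<lambda>p q r. a p q r - b p q r) \<phi> x = T3 a \<phi> x - T3 b \<phi> x"
  by (simp add: T3_def sum_subtractf algebra_simps)
lemma T_zero: "T1 (\<lambda>p. 0) \<phi> x = 0" "T2 (\<lambda>p q. 0) \<phi> x = 0" "T3 (\<lambda>p q r. 0) \<phi> x = 0"
  by (simp_all add: T1_def T2_def T3_def)

lemma LD_Some: "LD (Some i) \<phi> = lie (X i) \<phi>" by (simp add: Yf_def)

text \<open>The antisymmetrised coefficients of the signature become commutators of derivations,
  hence brackets of the fields.\<close>

lemma w3_word:
  assumes \<phi>: "smooth \<phi>"
  shows "w3 (word_sig (word \<sigma> c f \<alpha>)) \<phi> x = \<sigma>^3 * c * lie (W \<alpha>) \<phi> x"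
proof (cases "(\<sigma>, c, f, \<alpha>)" rule: word.cases)
  case (1 \<sigma>' c' f' i)
  then show ?thesis by (simp add: w3_def leg_sig_def sig_mult_one T_zero T1_unit LD_Some)
next
  case (2 \<sigma>' c' f' i j)
  have "w3 (word_sig (word \<sigma> c f \<alpha>)) \<phi> x = 2 * (T2 (\<lambda>p q. (\<sigma> * unitc i p) * (\<sigma>^2 * (c / 2) * unitc j q)) \<phi> x
     - T2 (\<lambda>p q. (\<sigma>^2 * (c / 2) * unitc j p) * (\<sigma> * unitc i q)) \<phi> x)"
    using 2 by (simp only: w3_def prod.inject word.simps word8_sig sgn.sel T_zero T2_cmult[of 2] T2_diff add_0_left add_0_right)
  also have "\<dots> = \<sigma>^3 * c * (lie (X i) (lie (X j) \<phi>) x - lie (X j) (lie (X i) \<phi>) x)"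
    unfolding T2_unit LD_Some by (simp add: power3_eq_cube power2_eq_square algebra_simps)
  also have "\<dots> = \<sigma>^3 * c * lie (W \<alpha>) \<phi> x"
    using 2 lie_commutator[OF X_smooth[of i] X_smooth[of j] \<phi>] by simp
  finally show ?thesis .
next
  case (3 \<sigma>' c' f' k i j)
  let ?a = "\<lambda>p. \<sigma> * unitc i p" and ?b = "\<lambda>p. \<sigma> * unitc j p" and ?c = "\<lambda>p. \<sigma> * (c / 4) * unitc k p"
  have "w3 (word_sig (word \<sigma> c f \<alpha>)) \<phi> x = T3 (\<lambda>p q r. 4 * ((?c p * ?a q * ?b r - ?a p * ?c q * ?b r) - (?b p * ?c q * ?a r - ?b p * ?a q * ?c r))) \<phi> x"
  proof -
    have "(\<lambda>p q r. 4 * ((?c p * ?a q - ?a p * ?c q) * ?b r - ?b p * (?c q * ?a r - ?a q * ?c r)))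
      = (\<lambda>p q r. 4 * ((?c p * ?a q * ?b r - ?a p * ?c q * ?b r) - (?b p * ?c q * ?a r - ?b p * ?a q * ?c r)))"
      by (simp add: fun_eq_iff algebra_simps)
    then show ?thesis
      using 3 by (simp only: w3_def prod.inject word.simps word24_sig sgn.sel T_zero add_0_left add_0_right)
  qed
  also have "\<dots> = 4 * ((T3 (\<lambda>p q r. ?c p * ?a q * ?b r) \<phi> x - T3 (\<lambda>p q r. ?a p * ?c q * ?b r) \<phi> x)
      - (T3 (\<lambda>p q r. ?b p * ?c q * ?a r) \<phi> x - T3 (\<lambda>p q r. ?b p * ?a q * ?c r) \<phi> x))"
    by (simp only: T3_cmult T3_diff)
  also have "\<dots> = \<sigma>^3 * c * ((lie (X k) (lie (X i) (lie (X j) \<phi>)) x - lie (X i) (lie (X k) (lie (X j) \<phi>)) x)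
      - (lie (X j) (lie (X k) (lie (X i) \<phi>)) x - lie (X j) (lie (X i) (lie (X k) \<phi>)) x))"
    unfolding T3_unit LD_Some by (simp add: power3_eq_cube algebra_simps)
  also have "lie (X k) (lie (X i) (lie (X j) \<phi>)) x - lie (X i) (lie (X k) (lie (X j) \<phi>)) x = lie (lie_bracket (X k) (X i)) (lie (X j) \<phi>) x"
    by (rule lie_commutator) (intro X_smooth smooth_lie \<phi>)+
  \<comment> \<open>Here the commutator identity stands under a further derivative, so it is used as
    an equality of functions.\<close>
  also have "lie (X j) (lie (X k) (lie (X i) \<phi>)) x - lie (X j) (lie (X i) (lie (X k) \<phi>)) x = lie (X j) (lie (lie_bracket (X k) (X i)) \<phi>) x"
  proof -
    have "lie (lie_bracket (X k) (X i)) \<phi> = (\<lambda>y. lie (X k) (lie (X i) \<phi>) y - lie (X i) (lie (X k) \<phi>) y)"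
      using lie_commutator[OF X_smooth[of k] X_smooth[of i] \<phi>] by auto
    moreover have "frechet_derivative (\<lambda>y. lie (X k) (lie (X i) \<phi>) y - lie (X i) (lie (X k) \<phi>) y) (at x)
       = (\<lambda>v. frechet_derivative (lie (X k) (lie (X i) \<phi>)) (at x) v - frechet_derivative (lie (X i) (lie (X k) \<phi>)) (at x) v)"
      by (rule frechet_derivative_at[symmetric], intro has_derivative_diff smooth_has_derivative smooth_lie X_smooth \<phi>)
    ultimately show ?thesis by (simp add: lie_def[of "X j"])
  qed
  also have "lie (lie_bracket (X k) (X i)) (lie (X j) \<phi>) x - lie (X j) (lie (lie_bracket (X k) (X i)) \<phi>) x = lie (W \<alpha>) \<phi> x"
    using 3 lie_commutator[OF smooth_lie_bracket[OF X_smooth[of k] X_smooth[of i]] X_smooth[of j] \<phi>] by simp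
  finally show ?thesis .
qed

lemma flat_sig_mult: "flat s \<Longrightarrow> flat t \<Longrightarrow> flat (sig_mult s t)"
  by (simp add: flat_def sig_mult_def)

lemma w3_sig_mult_flat: "flat s \<Longrightarrow> flat t \<Longrightarrow> w3 (sig_mult s t) \<phi> x = w3 s \<phi> x + w3 t \<phi> x"
  by (simp add: flat_def sig_mult_def w3_def T1_add T2_add T3_add)

lemma sig_words:
  assumes \<phi>: "smooth \<phi>"
  shows "flat (word_sig (concat (map (\<lambda>\<alpha>. word \<sigma> (c \<alpha>) f \<alpha>) as))) \<and>
    sz (word_sig (concat (map (\<lambda>\<alpha>. word \<sigma> (c \<alpha>) f \<alpha>) as))) = (\<lambda>p. real (sum_list (map wlen as)) * f p) \<and>
    w3 (word_sig (concat (map (\<lambda>\<alpha>. word \<sigma> (c \<alpha>) f \<alpha>) as))) \<phi> x = (\<Sum>\<alpha>\<leftarrow>as. \<sigma>^3 * c \<alpha> * lie (W \<alpha>) \<phi> x)"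
proof (induction as)
  case Nil
  then show ?case by (simp add: flat_def sig_one_def w3_def T_zero)
next
  case (Cons \<alpha> as)
  then show ?case
    by (simp add: word_sig_append flat_sig_mult flat_word w3_sig_mult_flat w3_word[OF \<phi>])
       (simp add: sig_mult_def sz_word algebra_simps)
qed

lemma sum_list_bracket_indices: "(\<Sum>\<alpha>\<leftarrow>bracket_indices. g \<alpha>) = (\<Sum>\<alpha>\<in>UNIV. g \<alpha>)" for g :: "'m bidx \<Rightarrow> real"
  using bracket_indices by (metis sum_list_distinct_conv_sum_set)

text \<open>The total drift, run as one leg, has the same terms of weights 1 and 2 as the bracket
  word and no term of weight 3. Comparing the two expansions leaves the brackets alone.\<close>

lemma word_expansion_scalar:
  assumes \<phi>: "smooth \<phi>" and Z: "Z \<ge> 0"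
  shows "\<exists>K\<ge>0. \<forall>\<sigma> c f x. 0 \<le> \<sigma> \<longrightarrow> \<sigma> \<le> 1 \<longrightarrow> (\<forall>\<alpha>. \<bar>c \<alpha>\<bar> \<le> 1) \<longrightarrow> (\<forall>p. \<bar>f p\<bar> \<le> Z * \<sigma>^2) \<longrightarrow> x \<in> M \<longrightarrow>
    \<bar>\<phi> (run (bracket_word \<sigma> c f) x) - \<phi> (flow (of_coords (\<lambda>p. real nlegs * f p)) x 1) - \<sigma>^3 * (\<Sum>\<alpha>\<in>UNIV. c \<alpha> * lie (W \<alpha>) \<phi> x)\<bar> \<le> K * \<sigma>^4"
proof -
  obtain K1 where K1: "K1 \<ge> 0" "\<And>ls \<sigma> x. length ls = nlegs \<Longrightarrow> 0 \<le> \<sigma> \<Longrightarrow> \<sigma> \<le> 1 \<Longrightarrow> (\<forall>l\<in>set ls. leg_le (Z + 1) \<sigma> l) \<Longrightarrow> x \<in> M \<Longrightarrow>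
     \<bar>\<phi> (run ls x) - (\<phi> x + w1 (word_sig ls) \<phi> x + w2 (word_sig ls) \<phi> x + w3 (word_sig ls) \<phi> x)\<bar> \<le> K1 * \<sigma>^4"
    using run_expansion[of "Z + 1" \<phi> nlegs] Z \<phi> by auto
  obtain K2 where K2: "K2 \<ge> 0" "\<And>ls \<sigma> x. length ls = 1 \<Longrightarrow> 0 \<le> \<sigma> \<Longrightarrow> \<sigma> \<le> 1 \<Longrightarrow> (\<forall>l\<in>set ls. leg_le (real nlegs * Z) \<sigma> l) \<Longrightarrow> x \<in> M \<Longrightarrow>
     \<bar>\<phi> (run ls x) - (\<phi> x + w1 (word_sig ls) \<phi> x + w2 (word_sig ls) \<phi> x + w3 (word_sig ls) \<phi> x)\<bar> \<le> K2 * \<sigma>^4"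
    using run_expansion[of "real nlegs * Z" \<phi> 1] Z \<phi> by auto
  have "\<bar>\<phi> (run (bracket_word \<sigma> c f) x) - \<phi> (flow (of_coords (\<lambda>p. real nlegs * f p)) x 1) - \<sigma>^3 * (\<Sum>\<alpha>\<in>UNIV. c \<alpha> * lie (W \<alpha>) \<phi> x)\<bar> \<le> (K1 + K2) * \<sigma>^4"
    if s: "0 \<le> \<sigma>" "\<sigma> \<le> 1" and c: "\<forall>\<alpha>. \<bar>c \<alpha>\<bar> \<le> 1" and f: "\<forall>p. \<bar>f p\<bar> \<le> Z * \<sigma>^2" and x: "x \<in> M" for \<sigma> c f x
  proof -
    define s0 where "s0 = word_sig (bracket_word \<sigma> c f)"
    define r where "r = [(\<lambda>p. 0, (\<lambda>p. real nlegs * f p), \<lambda>p. 0) :: 'm option leg]"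
    have "\<forall>l\<in>set (bracket_word \<sigma> c f). leg_le (Z + 1) \<sigma> l"
      unfolding bracket_word_def using leg_le_word[OF s, of "c _" f Z] c f Z by auto
    from K1(2)[OF length_bracket_word s this x]
    have 1: "\<bar>\<phi> (run (bracket_word \<sigma> c f) x) - (\<phi> x + w1 s0 \<phi> x + w2 s0 \<phi> x + w3 s0 \<phi> x)\<bar> \<le> K1 * \<sigma>^4" by (simp add: s0_def)
    have "\<bar>real nlegs * f p\<bar> \<le> real nlegs * Z * \<sigma>^2" for p
      using f by (simp add: abs_mult mult.assoc mult_left_mono)
    then have "\<forall>l\<in>set r. leg_le (real nlegs * Z) \<sigma> l"
      using s Z by (auto simp: r_def leg_le_def)
    from K2(2)[OF _ s this x]
    have 2: "\<bar>\<phi> (run r x) - (\<phi> x + w1 (word_sig r) \<phi> x + w2 (word_sig r) \<phi> x + w3 (word_sig r) \<phi> x)\<bar> \<le> K2 * \<sigma>^4" by (simp add: r_def)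
    have run_r: "run r x = flow (of_coords (\<lambda>p. real nlegs * f p)) x 1" by (simp add: r_def leg_vector_def)
    have sr: "word_sig r = Sgn (\<lambda>p. 0) (\<lambda>p q. 0) (\<lambda>p. real nlegs * f p) (\<lambda>p q r. 0) (\<lambda>p q. 0) (\<lambda>p. 0)"
      by (simp add: r_def leg_sig_def sig_mult_one)
    have ss: "flat s0" "sz s0 = (\<lambda>p. real nlegs * f p)" "w3 s0 \<phi> x = (\<Sum>\<alpha>\<in>UNIV. \<sigma>^3 * c \<alpha> * lie (W \<alpha>) \<phi> x)"
      using sig_words[OF \<phi>, of \<sigma> c f bracket_indices x] unfolding s0_def bracket_word_def nlegs_def sum_list_bracket_indices by auto
    have "w1 s0 \<phi> x = w1 (word_sig r) \<phi> x" "w2 s0 \<phi> x = w2 (word_sig r) \<phi> x" "w3 (word_sig r) \<phi> x = 0"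
      using ss(1,2) by (auto simp: sr flat_def w1_def w2_def w3_def T_zero)
    moreover have "w3 s0 \<phi> x = \<sigma>^3 * (\<Sum>\<alpha>\<in>UNIV. c \<alpha> * lie (W \<alpha>) \<phi> x)"
      unfolding ss(3) by (simp add: sum_distrib_left mult.assoc)
    ultimately show ?thesis using 1 2 unfolding run_r distrib_right by linarith
  qed
  then show ?thesis using K1 K2 by (intro exI[of _ "K1 + K2"]) auto
qed

theorem word_expansion:
  assumes Z: "Z \<ge> 0"
  shows "\<exists>K\<ge>0. \<forall>\<sigma> c f x. 0 \<le> \<sigma> \<longrightarrow> \<sigma> \<le> 1 \<longrightarrow> (\<forall>\<alpha>. \<bar>c \<alpha>\<bar> \<le> 1) \<longrightarrow> (\<forall>p. \<bar>f p\<bar> \<le> Z * \<sigma>^2) \<longrightarrow> x \<in> M \<longrightarrow>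
    norm (run (bracket_word \<sigma> c f) x - flow (of_coords (\<lambda>p. real nlegs * f p)) x 1 - \<sigma>^3 *\<^sub>R (\<Sum>\<alpha>\<in>UNIV. c \<alpha> *\<^sub>R W \<alpha> x)) \<le> K * \<sigma>^4"
proof -
  \<comment> \<open>Coordinate functions serve as test functions: the Lie derivative of a coordinate
    along a field is that coordinate of the field.\<close>
  have sm: "smooth (\<lambda>x::'a. x \<bullet> b)" for b
    by (rule smooth_bounded_linear[OF bounded_linear_inner_left])
  have lieb: "lie Y (\<lambda>x. x \<bullet> b) x = Y x \<bullet> b" for Y :: "'a \<Rightarrow> 'a" and b x
    unfolding lie_def by (rule fun_cong[OF frechet_derivative_at[OF bounded_linear_imp_has_derivative[OF bounded_linear_inner_left], symmetric]])
  obtain K where K: "\<And>b. K b \<ge> 0" "\<And>b \<sigma> c f x. 0 \<le> \<sigma> \<Longrightarrow> \<sigma> \<le> 1 \<Longrightarrow> (\<forall>\<alpha>. \<bar>c \<alpha>\<bar> \<le> 1) \<Longrightarrow> (\<forall>p. \<bar>f p\<bar> \<le> Z * \<sigma>^2) \<Longrightarrow> x \<in> M \<Longrightarrow>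
    \<bar>run (bracket_word \<sigma> c f) x \<bullet> b - flow (of_coords (\<lambda>p. real nlegs * f p)) x 1 \<bullet> b - \<sigma>^3 * (\<Sum>\<alpha>\<in>UNIV. c \<alpha> * lie (W \<alpha>) (\<lambda>x. x \<bullet> b) x)\<bar> \<le> K b * \<sigma>^4"
  proof -
    have "\<forall>b. \<exists>K\<ge>0. \<forall>\<sigma> c f x. 0 \<le> \<sigma> \<longrightarrow> \<sigma> \<le> 1 \<longrightarrow> (\<forall>\<alpha>. \<bar>c \<alpha>\<bar> \<le> 1) \<longrightarrow> (\<forall>p. \<bar>f p\<bar> \<le> Z * \<sigma>^2) \<longrightarrow> x \<in> M \<longrightarrow>
      \<bar>run (bracket_word \<sigma> c f) x \<bullet> b - flow (of_coords (\<lambda>p. real nlegs * f p)) x 1 \<bullet> b - \<sigma>^3 * (\<Sum>\<alpha>\<in>UNIV. c \<alpha> * lie (W \<alpha>) (\<lambda>x. x \<bullet> b) x)\<bar> \<le> K * \<sigma>^4"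
      using word_expansion_scalar[OF sm Z] by blast
    from choice[OF this] show thesis using that by blast
  qed
  show ?thesis
  proof (intro exI[of _ "\<Sum>b\<in>(Basis::'a set). K b"] conjI allI impI)
    fix \<sigma> :: real and c :: "'m bidx \<Rightarrow> real" and f :: "'m option \<Rightarrow> real" and x :: 'a
    assume a: "0 \<le> \<sigma>" "\<sigma> \<le> 1" "\<forall>\<alpha>. \<bar>c \<alpha>\<bar> \<le> 1" "\<forall>p. \<bar>f p\<bar> \<le> Z * \<sigma>^2" "x \<in> M"
    show "norm (run (bracket_word \<sigma> c f) x - flow (of_coords (\<lambda>p. real nlegs * f p)) x 1 - \<sigma>^3 *\<^sub>R (\<Sum>\<alpha>\<in>UNIV. c \<alpha> *\<^sub>R W \<alpha> x)) \<le> (\<Sum>b\<in>(Basis::'a set). K b) * \<sigma>^4"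
      unfolding sum_distrib_right
      by (rule order_trans[OF norm_le_l1 sum_mono])
         (use K(2)[OF a] in \<open>simp add: inner_diff_left inner_sum_left lieb\<close>)
  qed (use K in \<open>simp add: sum_nonneg\<close>)
qed

section \<open>Continuity of words in their coefficients\<close>

lemma flow_continuous_joint:
  assumes Y: "continuous_on S Yc" and Xc: "continuous_on S Xc" and M: "\<And>c. c \<in> S \<Longrightarrow> Xc c \<in> M"
  shows "continuous_on S (\<lambda>c. flow (Yc c) (Xc c) 1)"
  unfolding continuous_on_def
proof
  fix c assume c: "c \<in> S"
  have "((\<lambda>d. exp (\<Lambda> * norm (Yc c)) * (norm (Xc c - Xc d) + \<Lambda> * norm (Yc c - Yc d))) \<longlongrightarrow> exp (\<Lambda> * norm (Yc c)) * (norm (Xc c - Xc c) + \<Lambda> * norm (Yc c - Yc c))) (at c within S)"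
    using Y Xc c by (intro tendsto_intros) (auto simp: continuous_on_def)
  then have "((\<lambda>d. exp (\<Lambda> * norm (Yc c)) * (norm (Xc c - Xc d) + \<Lambda> * norm (Yc c - Yc d))) \<longlongrightarrow> 0) (at c within S)" by simp
  moreover have "eventually (\<lambda>d. norm (flow (Yc d) (Xc d) 1 - flow (Yc c) (Xc c) 1) \<le> exp (\<Lambda> * norm (Yc c)) * (norm (Xc c - Xc d) + \<Lambda> * norm (Yc c - Yc d))) (at c within S)"
    unfolding eventually_at_filter
  proof (intro always_eventually allI impI)
    fix d assume "d \<in> S"
    then show "norm (flow (Yc d) (Xc d) 1 - flow (Yc c) (Xc c) 1) \<le> exp (\<Lambda> * norm (Yc c)) * (norm (Xc c - Xc d) + \<Lambda> * norm (Yc c - Yc d))"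
      using flow_compare[OF M[OF c] M, of d "Yc c" 1 "Yc d"] by (simp add: norm_minus_commute)
  qed
  ultimately have "((\<lambda>d. flow (Yc d) (Xc d) 1 - flow (Yc c) (Xc c) 1) \<longlongrightarrow> 0) (at c within S)"
    by (rule Lim_null_comparison[rotated])
  then show "((\<lambda>c. flow (Yc c) (Xc c) 1) \<longlongrightarrow> flow (Yc c) (Xc c) 1) (at c within S)" by (simp add: LIM_zero_iff)
qed

text \<open>The number of legs is the same for all parameters, so continuity can be stated leg by
  leg. The resulting continuity of the endpoint is what Brouwer's theorem requires.\<close>

definition cont_legs :: "('c::topological_space \<Rightarrow> 'm option leg list) \<Rightarrow> bool" where
  "cont_legs F \<longleftrightarrow> (\<exists>gs. (\<forall>c. F c = map (\<lambda>g. g c) gs) \<and> (\<forall>g\<in>set gs. continuous_on UNIV (\<lambda>c. leg_vector (g c))))"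

lemma cont_legs_Nil: "cont_legs (\<lambda>c. [])"
  unfolding cont_legs_def by (intro exI[of _ "[]"]) simp

lemma cont_legs_append: "cont_legs F \<Longrightarrow> cont_legs G \<Longrightarrow> cont_legs (\<lambda>c. F c @ G c)"
proof -
  assume "cont_legs F" "cont_legs G"
  then obtain gs hs where "\<forall>c. F c = map (\<lambda>g. g c) gs" "\<forall>g\<in>set gs. continuous_on UNIV (\<lambda>c. leg_vector (g c))"
    "\<forall>c. G c = map (\<lambda>g. g c) hs" "\<forall>g\<in>set hs. continuous_on UNIV (\<lambda>c. leg_vector (g c))"
    unfolding cont_legs_def by blast
  then show ?thesis unfolding cont_legs_def by (intro exI[of _ "gs @ hs"]) auto
qed

lemma cont_legs_Cons: "continuous_on UNIV (\<lambda>c. leg_vector (g c)) \<Longrightarrow> cont_legs G \<Longrightarrow> cont_legs (\<lambda>c. g c # G c)"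
proof -
  assume g: "continuous_on UNIV (\<lambda>c. leg_vector (g c))" and "cont_legs G"
  then obtain gs where "\<forall>c. G c = map (\<lambda>g. g c) gs" "\<forall>g\<in>set gs. continuous_on UNIV (\<lambda>c. leg_vector (g c))"
    unfolding cont_legs_def by blast
  then show ?thesis using g unfolding cont_legs_def by (intro exI[of _ "g # gs"]) auto
qed

lemma cont_legs_concat: "(\<And>a. a \<in> set as \<Longrightarrow> cont_legs (\<lambda>c. F c a)) \<Longrightarrow> cont_legs (\<lambda>c. concat (map (F c) as))"
  by (induction as) (auto intro: cont_legs_Nil cont_legs_append)

lemma run_cont:
  assumes "\<forall>g\<in>set gs. continuous_on UNIV (\<lambda>c. leg_vector (g c))" "continuous_on UNIV Xc" "\<And>c. Xc c \<in> M"
  shows "continuous_on UNIV (\<lambda>c. run (map (\<lambda>g. g c) gs) (Xc c))"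
  using assms
proof (induction gs arbitrary: Xc)
  case (Cons g gs)
  have "continuous_on UNIV (\<lambda>c. flow (leg_vector (g c)) (Xc c) 1)" using Cons.prems by (intro flow_continuous_joint) auto
  then show ?case using Cons.IH[of "\<lambda>c. flow (leg_vector (g c)) (Xc c) 1"] Cons.prems by (auto intro: flow_in)
qed auto

lemma cont_legs_run: "cont_legs F \<Longrightarrow> x \<in> M \<Longrightarrow> continuous_on UNIV (\<lambda>c. run (F c) x)"
proof -
  assume "cont_legs F" and x: "x \<in> M"
  then obtain gs where gs: "\<forall>c. F c = map (\<lambda>g. g c) gs" "\<forall>g\<in>set gs. continuous_on UNIV (\<lambda>c. leg_vector (g c))"
    unfolding cont_legs_def by blast
  show ?thesis using run_cont[OF gs(2), of "\<lambda>c. x"] x by (simp add: gs(1))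
qed

lemma leg_vector_continuous:
  assumes "\<And>p. continuous_on UNIV (\<lambda>c. fst (g c) p + fst (snd (g c)) p + snd (snd (g c)) p)"
  shows "continuous_on UNIV (\<lambda>c. leg_vector (g c))"
  unfolding leg_vector_def of_coords_def by (intro continuous_on_Pair continuous_on_vec_lambda assms)

lemma cont_legs_word:
  assumes "continuous_on UNIV c"
  shows "cont_legs (\<lambda>z. word \<sigma> (c z) f \<alpha>)"
  \<comment> \<open>The case distinction concerns \<open>\<alpha>\<close> alone; the coefficient
    varies with the parameter, and an arbitrary value stands in for it.\<close>
  by (cases "(\<sigma>, undefined::real, f, \<alpha>)" rule: word.cases)
     (auto simp: word8_def word24_def word6_def intro!: cont_legs_Cons cont_legs_Nil leg_vector_continuous continuous_intros assms)

lemma run_bracket_word_continuous: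
  assumes "\<And>\<alpha>. continuous_on UNIV (\<lambda>z. c z \<alpha>)" "x \<in> M"
  shows "continuous_on UNIV (\<lambda>z. run (bracket_word \<sigma> (c z) f) x)"
  unfolding bracket_word_def by (intro cont_legs_run cont_legs_concat cont_legs_word assms)

end

section \<open>Local structure of submanifolds\<close>

lemma submanifold_local:
  fixes M :: "'a::euclidean_space set"
  assumes "smooth_submanifold M" "x0 \<in> M"
  obtains U and \<Phi> :: "'a \<Rightarrow> 'a" and d where "open U" "x0 \<in> U" "d \<le> DIM('a)"
    "\<And>y. y \<in> U \<Longrightarrow> (\<Phi> has_derivative frechet_derivative \<Phi> (at y)) (at y)"
    "\<And>v. continuous_on U (\<lambda>y. frechet_derivative \<Phi> (at y) v)"
    "\<And>y. y \<in> U \<Longrightarrow> dim (range (frechet_derivative \<Phi> (at y))) = DIM('a) - d"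
    "M \<inter> U = {y\<in>U. \<Phi> y = 0}"
proof -
  obtain d U and \<Phi> :: "'a \<Rightarrow> 'a" where *: "d \<le> DIM('a)" "x0 \<in> U" "smooth_on U \<Phi>"
    "\<forall>y\<in>U. dim (range (frechet_derivative \<Phi> (at y))) = DIM('a) - d" "M \<inter> U = {y\<in>U. \<Phi> y = 0}"
    using assms unfolding smooth_submanifold_def by blast
  have "smooth_k (Suc 0) U \<Phi>" "open U" using *(3) by (auto simp only: smooth_on_def)
  then show thesis
    using * frechet_derivative_works[of \<Phi>, THEN iffD1] by (intro that[of U d \<Phi>]) auto
qed

text \<open>Continuity in each basis direction suffices for continuity in operator norm, as the
  dimension is finite.\<close>

lemma derivative_continuity_uniform:
  fixes D :: "'a::euclidean_space \<Rightarrow> 'a \<Rightarrow> 'b::real_normed_vector"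
  assumes U: "open U" "x0 \<in> U" and lin: "\<And>y. y \<in> U \<Longrightarrow> linear (D y)"
    and cont: "\<And>v. continuous_on U (\<lambda>y. D y v)" and e: "e > 0"
  shows "\<exists>\<rho>>0. ball x0 \<rho> \<subseteq> U \<and> (\<forall>y\<in>ball x0 \<rho>. \<forall>v. norm (D y v - D x0 v) \<le> e * norm v)"
proof -
  obtain \<rho>0 where \<rho>0: "\<rho>0 > 0" "ball x0 \<rho>0 \<subseteq> U" using U open_contains_ball by blast
  define e' where "e' = e / DIM('a)"
  have e': "e' > 0" using e by (simp add: e'_def)
  have "\<exists>\<rho>>0. \<forall>y\<in>U. dist y x0 < \<rho> \<longrightarrow> norm (D y b - D x0 b) < e'" for b
    using cont[of b] U(2) e' unfolding continuous_on_iff dist_norm by blast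
  then obtain \<rho> where \<rho>: "\<And>b. \<rho> b > 0" "\<And>b y. y \<in> U \<Longrightarrow> dist y x0 < \<rho> b \<Longrightarrow> norm (D y b - D x0 b) < e'" by metis
  define r where "r = min \<rho>0 (Min (\<rho> ` Basis))"
  have r: "r > 0" using \<rho>0 \<rho> by (simp add: r_def)
  have "norm (D y v - D x0 v) \<le> e * norm v" if y: "y \<in> ball x0 r" for y v
  proof -
    have yU: "y \<in> U" using y \<rho>0 by (auto simp: r_def)
    have db: "norm (D y b - D x0 b) \<le> e'" if "b \<in> Basis" for b
      using \<rho>(2)[OF yU, of b] y that by (force simp: r_def dist_commute)
    have exp: "D z v = (\<Sum>b\<in>Basis. (v \<bullet> b) *\<^sub>R D z b)" if "z \<in> U" for z
    proof -
      have "D z v = D z (\<Sum>b\<in>Basis. (v \<bullet> b) *\<^sub>R b)" by (simp add: euclidean_representation)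
      also have "\<dots> = (\<Sum>b\<in>Basis. (v \<bullet> b) *\<^sub>R D z b)"
        using lin[OF that] by (simp add: linear_sum linear_scale)
      finally show ?thesis .
    qed
    have "D y v - D x0 v = (\<Sum>b\<in>Basis. (v \<bullet> b) *\<^sub>R (D y b - D x0 b))"
      unfolding exp[OF yU] exp[OF U(2)] by (simp add: sum_subtractf scaleR_diff_right)
    also have "norm \<dots> \<le> (\<Sum>b\<in>(Basis::'a set). norm v * e')"
      by (intro order_trans[OF norm_sum] sum_mono) (auto simp: Basis_le_norm intro!: mult_mono db)
    also have "\<dots> = e * norm v" by (simp add: e'_def)
    finally show ?thesis .
  qed
  then show ?thesis using r \<rho>0 by (intro exI[of _ r]) (auto simp: r_def)
qed

lemma linear_near_identity_bound:
  assumes "norm (T v - v) \<le> norm v / 2"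
  shows "norm v \<le> 2 * norm (T v)"
  using norm_triangle_ineq2[of v "T v"] assms by (simp add: norm_minus_commute)

lemma const_derivative_zero:
  fixes h :: "real \<Rightarrow> 'b::real_normed_vector"
  assumes "\<And>t. 0 \<le> t \<Longrightarrow> t \<le> 1 \<Longrightarrow> (h has_vector_derivative 0) (at t)"
  shows "h 1 = h 0"
  using vector_derivative_bound[of 0 1 h "\<lambda>t. 0" 0] assms by (auto intro: has_vector_derivative_at_within)

lemma rank_nullity:
  fixes f :: "'a::euclidean_space \<Rightarrow> 'b::euclidean_space"
  assumes f: "linear f"
  shows "dim {v. f v = 0} + dim (range f) = DIM('a)"
proof -
  define K where "K = {v. f v = 0}"
  define Kp where "Kp = {y. \<forall>k\<in>K. orthogonal k y}"
  have K: "subspace K" unfolding K_def by (rule linear_subspace_kernel[OF f])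
  have Kp: "subspace Kp" unfolding Kp_def by (rule subspace_orthogonal_to_vectors)
  have inj: "inj_on f Kp"
    using linear_injective_on_subspace_0[OF f Kp] by (auto simp: K_def Kp_def orthogonal_self)
  have "range f = f ` Kp"
  proof
    show "range f \<subseteq> f ` Kp"
    proof clarify
      fix v
      obtain k w where "k \<in> span K" "\<And>z. z \<in> span K \<Longrightarrow> orthogonal w z" "v = k + w"
        using orthogonal_subspace_decomp_exists[of K v] by metis
      moreover have sp: "span K = K" using K by (simp add: span_eq_iff)
      ultimately have kw: "k \<in> K" "\<And>z. z \<in> K \<Longrightarrow> orthogonal z w" "v = k + w" by (auto simp: orthogonal_commute)
      have "w \<in> Kp" using kw(2) by (simp add: Kp_def)
      moreover have "f k = 0" using kw(1) by (simp add: K_def)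
      then have "f v = f w" using linear_add[OF f, of k w] by (simp add: kw(3))
      ultimately show "f v \<in> f ` Kp" by blast
    qed
  qed auto
  then have "dim (range f) = dim Kp"
    using dim_image_eq[OF f, of Kp] inj Kp by (simp add: span_eq_iff[THEN iffD2])
  moreover have "dim Kp + dim K = DIM('a)"
    using dim_subspace_orthogonal_to_vectors[OF K subspace_UNIV] by (simp add: Kp_def)
  ultimately show ?thesis by (simp add: K_def)
qed

text \<open>The defining map has constant rank but need not be onto, so the implicit function
  theorem cannot be applied to it directly. \<open>B\<close> inverts its derivative at
  \<open>x0\<close> on the orthogonal complement of the kernel \<open>K\<close>; the map P + B
  \<Phi> is then a local diffeomorphism, and its inverse carries a neighbourhood of 0 in
  \<open>K\<close> into M.\<close>

lemma submanifold_chart: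
  fixes M :: "'a::euclidean_space set"
  assumes M: "smooth_submanifold M" and x0: "x0 \<in> M"
  obtains K :: "'a set" and g g' P r C \<rho> where
    "subspace K" "r > 0" "C \<ge> 0" "\<rho> > 0" "g 0 = x0"
    "\<And>k. k \<in> K \<Longrightarrow> norm k < r \<Longrightarrow> g k \<in> M"
    "\<And>k. norm k < r \<Longrightarrow> (g has_derivative g' k) (at k)"
    "\<And>k v. norm k < r \<Longrightarrow> norm (g' k v) \<le> 2 * norm v"
    "\<And>v. g' 0 v = v"
    "\<And>y. y \<in> M \<Longrightarrow> dist y x0 < \<rho> \<Longrightarrow> P y \<in> K \<and> norm (P y) < r \<and> g (P y) = y"
    "\<And>y z. norm (P y - P z) \<le> C * norm (y - z)"
    "\<And>y z. y \<in> M \<Longrightarrow> z \<in> M \<Longrightarrow> dist y x0 < \<rho> \<Longrightarrow> dist z x0 < \<rho> \<Longrightarrow> (\<And>k. k \<in> K \<Longrightarrow> (y - z) \<bullet> k = 0) \<Longrightarrow> y = z"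
    "K = tangent_space M x0"
proof -
  obtain U and \<Phi> :: "'a \<Rightarrow> 'a" and d where U: "open U" "x0 \<in> U" and d: "d \<le> DIM('a)"
    and D0: "\<And>y. y \<in> U \<Longrightarrow> (\<Phi> has_derivative frechet_derivative \<Phi> (at y)) (at y)"
    and cD0: "\<And>v. continuous_on U (\<lambda>y. frechet_derivative \<Phi> (at y) v)"
    and rk0: "\<And>y. y \<in> U \<Longrightarrow> dim (range (frechet_derivative \<Phi> (at y))) = DIM('a) - d"
    and MU: "M \<inter> U = {y\<in>U. \<Phi> y = 0}"
    by (rule submanifold_local[OF M x0]) blast
  define D where "D y = frechet_derivative \<Phi> (at y)" for y
  note D = D0[folded D_def] and cD = cD0[folded D_def] and rk = rk0[folded D_def]
  have linD: "linear (D y)" if "y \<in> U" for y using D[OF that] has_derivative_linear by blast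
  define A where "A = D x0"
  have linA: "linear A" using linD U by (simp add: A_def)
  define K where "K = {v. A v = 0}"
  have K: "subspace K" unfolding K_def by (rule linear_subspace_kernel[OF linA])
  define Kp where "Kp = {y. \<forall>k\<in>K. orthogonal k y}"
  have Kp: "subspace Kp" unfolding Kp_def by (rule subspace_orthogonal_to_vectors)
  have decomp: "\<exists>k\<in>K. \<exists>w\<in>Kp. v = k + w" for v
  proof -
    obtain k w where "k \<in> span K" "\<And>z. z \<in> span K \<Longrightarrow> orthogonal w z" "v = k + w"
      using orthogonal_subspace_decomp_exists[of K v] by metis
    moreover have "span K = K" using K by (simp add: span_eq_iff)
    ultimately show ?thesis by (intro bexI[of _ k] bexI[of _ w]) (auto simp: Kp_def orthogonal_commute)
  qed
  have KKp: "v = 0" if "v \<in> K" "v \<in> Kp" for v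
    using that by (auto simp: Kp_def orthogonal_self)
  have injA: "inj_on A Kp"
    unfolding linear_injective_on_subspace_0[OF linA Kp] using KKp unfolding K_def by blast
  obtain B where B: "range B \<subseteq> Kp" "linear B" "\<And>w. w \<in> Kp \<Longrightarrow> B (A w) = w"
    using linear_exists_left_inverse_on[OF linA Kp injA] by blast
  have linBA: "linear (\<lambda>v. B (A v))" using linear_compose[OF linA B(2)] by (simp add: o_def)
  have BAK: "B (A k) = 0" if "k \<in> K" for k using that B(2) by (simp add: K_def linear_0)
  have BB: "B (A (B z)) = B z" for z using B by blast
  \<comment> \<open>By the decomposition into \<open>K\<close> and \<open>Kp\<close>, this is the
    orthogonal projection of \<open>y - x0\<close> to \<open>K\<close>.\<close>
  define P where "P y = (y - x0) - B (A (y - x0))" for y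
  have PK: "P y \<in> K" for y
  proof -
    obtain k w where kw: "k \<in> K" "w \<in> Kp" "y - x0 = k + w" using decomp by blast
    then have "P y = k" unfolding P_def kw(3) using linear_add[OF linBA, of k w] B(3)[OF kw(2)] BAK[OF kw(1)] by simp
    then show ?thesis using kw by simp
  qed
  have bB: "bounded_linear B" and bBA: "bounded_linear (\<lambda>v. B (A v))"
    using B(2) linBA by (auto simp: linear_linear)
  obtain CB where CB: "CB > 0" "\<And>z. norm (B z) \<le> norm z * CB" using bounded_linear.pos_bounded[OF bB] by blast
  obtain CA where CA: "CA > 0" "\<And>z. norm (B (A z)) \<le> norm z * CA" using bounded_linear.pos_bounded[OF bBA] by blast
  obtain \<rho>1 where \<rho>1: "\<rho>1 > 0" "ball x0 \<rho>1 \<subseteq> U"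
    "\<And>y v. y \<in> ball x0 \<rho>1 \<Longrightarrow> norm (D y v - D x0 v) \<le> 1 / (2 * CB) * norm v"
    using derivative_continuity_uniform[OF U, of D "1 / (2 * CB)"] linD cD CB by auto
  define U1 where "U1 = ball x0 \<rho>1"
  have U1: "open U1" "x0 \<in> U1" "U1 \<subseteq> U" "convex U1" using \<rho>1 by (auto simp: U1_def)
  have near: "norm (B (D y v) - B (A v)) \<le> norm v / 2" if "y \<in> U1" for y v
  proof -
    have "norm (B (D y v) - B (A v)) = norm (B (D y v - A v))" by (simp add: linear_diff[OF B(2)])
    also have "\<dots> \<le> norm (D y v - A v) * CB" by (rule CB)
    also have "\<dots> \<le> 1 / (2 * CB) * norm v * CB"
      using \<rho>1(3)[of y v] that CB(1) by (intro mult_right_mono) (auto simp: U1_def A_def)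
    finally show ?thesis using CB(1) by simp
  qed
  \<comment> \<open>Constant rank enters here. Near \<open>x0\<close> the kernel of B after D y
    meets \<open>Kp\<close> only in 0, so its dimension is at most d; it contains the kernel of D y,
    whose dimension is d.\<close>
  have kerT: "D y v = 0" if y: "y \<in> U1" and v: "B (D y v) = 0" for y v
  proof -
    have yU: "y \<in> U" using y U1 by blast
    have linT: "linear (\<lambda>v. B (D y v))" using linear_compose[OF linD[OF yU] B(2)] by (simp add: o_def)
    define N where "N = {v. B (D y v) = 0}"
    define N0 where "N0 = {v. D y v = 0}"
    have sN: "subspace N" "subspace N0" unfolding N_def N0_def
      by (rule linear_subspace_kernel linT linD[OF yU])+
    have NKp: "N \<inter> Kp \<subseteq> {0}"
    proof
      fix w assume w: "w \<in> N \<inter> Kp"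
      then have "norm w \<le> norm w / 2" using near[OF y, of w] B(3)[of w] by (simp add: N_def)
      then show "w \<in> {0}" by simp
    qed
    have "N0 \<subseteq> N" using B(2) by (auto simp: N0_def N_def linear_0)
    moreover have "dim N0 = d" using rank_nullity[OF linD[OF yU]] rk[OF yU] d by (simp add: N0_def)
    moreover have "dim K = d" using rank_nullity[OF linA] rk[OF U(2)] d by (simp add: K_def A_def)
    moreover have "dim Kp + dim K = DIM('a)"
      using dim_subspace_orthogonal_to_vectors[OF K subspace_UNIV] by (simp add: Kp_def)
    moreover have "dim N + dim Kp \<le> DIM('a)"
    proof -
      have "dim (N \<inter> Kp) = 0" using NKp by (simp add: dim_eq_0)
      then show ?thesis using dim_sums_Int[OF sN(1) Kp] dim_subset_UNIV[of "{x + y |x y. x \<in> N \<and> y \<in> Kp}"] by linarith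
    qed
    ultimately have "N0 = N" using subspace_dim_equal[OF sN(2,1)] by simp
    then show ?thesis using v by (auto simp: N_def N0_def)
  qed
  define G where "G y = P y + B (\<Phi> y)" for y
  define G' where "G' y v = v - B (A v) + B (D y v)" for y v
  have derG: "(G has_derivative G' y) (at y)" if "y \<in> U" for y
    unfolding G_def[abs_def] G'_def[abs_def] P_def[abs_def]
    by (rule derivative_eq_intros bounded_linear.has_derivative[OF bB] bounded_linear.has_derivative[OF bBA] D that refl)+ (simp add: fun_eq_iff)
  have bG': "bounded_linear (G' y)" if "y \<in> U" for y using derG[OF that] has_derivative_bounded_linear by blast
  have G'near: "norm (G' y v - v) \<le> norm v / 2" if "y \<in> U1" for y v
    using near[OF that, of v] by (simp add: G'_def norm_minus_commute)
  have G'x0: "G' x0 v = v" for v by (simp add: G'_def A_def)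
  have Gx0: "G x0 = 0"
  proof -
    have "\<Phi> x0 = 0" using MU x0 U(2) by blast
    then show ?thesis by (simp add: G_def P_def linear_0[OF B(2)] linear_0[OF linA])
  qed
  define f' where "f' y = Blinfun (G' y)" for y
  have f': "blinfun_apply (f' y) = G' y" if "y \<in> U" for y
    unfolding f'_def using bG'[OF that] by (rule bounded_linear_Blinfun_apply)
  obtain U' V g g' where inv: "open U'" "U' \<subseteq> U1" "x0 \<in> U'" "open V" "G x0 \<in> V" "homeomorphism U' V G g"
    and dg: "\<And>y. y \<in> V \<Longrightarrow> (g has_derivative (g' y)) (at y)"
    and g'eq: "\<And>y. y \<in> V \<Longrightarrow> g' y = inv (blinfun_apply (f' (g y)))"
    and g'bij: "\<And>y. y \<in> V \<Longrightarrow> bij (blinfun_apply (f' (g y)))"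
  proof (rule inverse_function_theorem[of U1 G f' x0 id_blinfun])
    show "open U1" "x0 \<in> U1" by (rule U1)+
    show "(G has_derivative blinfun_apply (f' x)) (at x)" if "x \<in> U1" for x
      using derG f' that U1 by (metis subsetD)
    show "continuous_on U1 f'"
    proof (rule continuous_on_blinfun_componentwise)
      fix b :: 'a assume "b \<in> Basis"
      have "continuous_on U1 (\<lambda>y. b - B (A b) + B (D y b))"
        by (intro continuous_intros bounded_linear.continuous_on[OF bB] continuous_on_subset[OF cD U1(3)])
      then show "continuous_on U1 (\<lambda>x. blinfun_apply (f' x) b)"
        using f' U1 by (subst continuous_on_cong[OF refl, where g = "\<lambda>y. b - B (A b) + B (D y b)"]) (auto simp: G'_def)
    qed
    show "id_blinfun o\<^sub>L f' x0 = id_blinfun"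
      by (rule blinfun_eqI) (simp add: f'[OF U(2)] G'x0)
  qed blast
  have gU: "g k \<in> U'" and Gg: "G (g k) = k" if "k \<in> V" for k
    using inv(6) that by (auto simp: homeomorphism_def)
  have gG: "g (G y) = y" if "y \<in> U'" for y using inv(6) that by (auto simp: homeomorphism_def)
  have G'g': "G' (g k) (g' k v) = v" if "k \<in> V" for k v
  proof -
    have "g k \<in> U" using gU[OF that] inv U1 by blast
    then show ?thesis using g'eq[OF that] g'bij[OF that] f' by (metis bij_inv_eq_iff)
  qed
  obtain r where r: "r > 0" "ball 0 r \<subseteq> V" using inv(4,5) Gx0 open_contains_ball by metis
  have g0: "g 0 = x0" using gG[OF inv(3)] Gx0 by simp
  have rV: "k \<in> V" if "norm k < r" for k using r that by auto
  have g'bound: "norm (g' k v) \<le> 2 * norm v" if "norm k < r" for k v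
    using linear_near_identity_bound[of "G' (g k)" "g' k v"] G'near[of "g k" "g' k v"] gU[OF rV[OF that]] inv(2) G'g'[OF rV[OF that]]
    by auto
  have g'0: "g' 0 v = v" for v
  proof -
    have "0 \<in> V" using rV[of 0] r by simp
    from G'g'[OF this, of v] show ?thesis by (simp add: g0 G'x0)
  qed
  \<comment> \<open>Along the ray through \<open>k\<close>, the velocity of \<open>g\<close> is
    annihilated by B after D, hence by D itself. So \<Phi> remains constant on the ray and keeps its
    value 0 at \<open>x0\<close>.\<close>
  have gM: "g k \<in> M" if k: "k \<in> K" "norm k < r" for k
  proof -
    have tk: "norm (t *\<^sub>R k) < r" if "0 \<le> t" "t \<le> 1" for t
      using that k mult_left_le_one_le[of "norm k" t] by (simp add: order_le_less_trans)
    have "((\<lambda>t. \<Phi> (g (t *\<^sub>R k))) has_vector_derivative 0) (at t)" if t: "0 \<le> t" "t \<le> 1" for t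
    proof -
      define y where "y = g (t *\<^sub>R k)"
      define w where "w = g' (t *\<^sub>R k) k"
      have tV: "t *\<^sub>R k \<in> V" using rV tk t by blast
      have yU1: "y \<in> U1" using gU[OF tV] inv(2) by (auto simp: y_def)
      then have yU: "y \<in> U" using U1 by blast
      have "w - B (A w) + B (D y w) = k" using G'g'[OF tV, of k] by (simp add: y_def w_def G'_def)
      then have "B (A (w - B (A w) + B (D y w))) = B (A k)" by simp
      then have "B (D y w) = 0"
        using BAK[OF k(1)] by (simp add: linear_add[OF linBA] linear_diff[OF linBA] BB)
      then have Dw: "D y w = 0" by (rule kerT[OF yU1])
      have "((\<lambda>t. g (t *\<^sub>R k)) has_derivative (\<lambda>h. g' (t *\<^sub>R k) (h *\<^sub>R k))) (at t)"
        using has_derivative_compose[OF bounded_linear_imp_has_derivative[OF bounded_linear_scaleR_left], of g "g' (t *\<^sub>R k)" t k UNIV] dg[OF tV]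
        by simp
      from has_derivative_compose[OF this D[OF yU, unfolded y_def]]
      have "((\<lambda>t. \<Phi> (g (t *\<^sub>R k))) has_derivative (\<lambda>h. D y (g' (t *\<^sub>R k) (h *\<^sub>R k)))) (at t)" by (simp add: y_def)
      moreover have "D y (g' (t *\<^sub>R k) (h *\<^sub>R k)) = 0" for h
      proof -
        have "linear (g' (t *\<^sub>R k))" using dg[OF tV] has_derivative_linear by blast
        then have "g' (t *\<^sub>R k) (h *\<^sub>R k) = h *\<^sub>R w" by (simp add: linear_scale w_def)
        then show ?thesis using linear_scale[OF linD[OF yU], of h w] Dw by simp
      qed
      ultimately show ?thesis by (simp add: has_vector_derivative_def)
    qed
    from const_derivative_zero[OF this] have "\<Phi> (g k) = \<Phi> x0" by (simp add: g0)
    also have "\<dots> = 0" using MU x0 U by blast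
    finally have "\<Phi> (g k) = 0" .
    moreover have "g k \<in> U" using gU[OF rV[OF k(2)]] inv U1 by blast
    ultimately show ?thesis using MU by blast
  qed
  have Pbound: "norm (P y - P z) \<le> (1 + CA) * norm (y - z)" for y z
  proof -
    have "P y - P z = (y - z) - B (A (y - z))"
      unfolding P_def by (simp add: linear_diff[OF linA] linear_diff[OF B(2)])
    then have "norm (P y - P z) \<le> norm (y - z) + norm (B (A (y - z)))" by (metis norm_triangle_ineq4)
    then show ?thesis using CA(2)[of "y - z"] by (simp add: algebra_simps)
  qed
  obtain \<rho>2 where \<rho>2: "\<rho>2 > 0" "ball x0 \<rho>2 \<subseteq> U'" using inv(1,3) open_contains_ball by blast
  define \<rho> where "\<rho> = min \<rho>2 (r / (1 + CA))"
  have \<rho>: "\<rho> > 0" using \<rho>2 r CA by (simp add: \<rho>_def)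
  have chart: "P y \<in> K \<and> norm (P y) < r \<and> g (P y) = y" if y: "y \<in> M" "dist y x0 < \<rho>" for y
  proof -
    have yU': "y \<in> U'" using y \<rho>2 by (auto simp: \<rho>_def dist_commute)
    then have "y \<in> U" using inv U1 by blast
    then have "\<Phi> y = 0" using MU y by blast
    then have "G y = P y" using B(2) by (simp add: G_def linear_0)
    then have "g (P y) = y" using gG[OF yU'] by simp
    moreover have "norm (P y - P x0) \<le> (1 + CA) * norm (y - x0)" by (rule Pbound)
    moreover have "P x0 = 0" by (simp add: P_def linear_0[OF linA] linear_0[OF B(2)])
    moreover have "(1 + CA) * norm (y - x0) < r"
      using y(2) CA(1) by (simp add: \<rho>_def dist_norm field_simps)
    ultimately show ?thesis using PK by simp
  qed
  \<comment> \<open>On \<open>Kp\<close> the derivative at \<open>x0\<close> is bounded below by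
    means of \<open>B\<close>, while the nonlinear part of \<Phi> is Lipschitz with half of that
    bound; two zeros of \<Phi> cannot differ in such a direction.\<close>
  have unique: "y = z" if yz: "y \<in> M" "z \<in> M" "dist y x0 < \<rho>" "dist z x0 < \<rho>" and o: "\<And>k. k \<in> K \<Longrightarrow> (y - z) \<bullet> k = 0" for y z
  proof -
    have y: "y \<in> U'" "z \<in> U'" using yz \<rho>2 by (auto simp: \<rho>_def dist_commute)
    then have yU: "y \<in> U1" "z \<in> U1" using inv by auto
    have w: "y - z \<in> Kp" using o by (auto simp: Kp_def orthogonal_def inner_commute)
    have "norm ((\<lambda>u. \<Phi> u - A u) y - (\<lambda>u. \<Phi> u - A u) z) \<le> 1 / (2 * CB) * norm (y - z)"
    proof (rule differentiable_bound[OF U1(4) _ _ yU])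
      show "((\<lambda>u. \<Phi> u - A u) has_derivative (\<lambda>v. D u v - A v)) (at u within U1)" if "u \<in> U1" for u
        using that U1 linA by (intro has_derivative_diff has_derivative_at_withinI[OF D] linear_imp_has_derivative) auto
      show "onorm (\<lambda>v. D u v - A v) \<le> 1 / (2 * CB)" if "u \<in> U1" for u
        using \<rho>1(3)[of u] that CB(1) by (intro onorm_bound) (auto simp: U1_def A_def)
    qed
    moreover have "\<Phi> y = 0" "\<Phi> z = 0" using MU yz yU U1 by blast+
    ultimately have "norm (A (y - z)) \<le> 1 / (2 * CB) * norm (y - z)" by (simp add: linear_diff[OF linA] norm_minus_commute)
    then have "norm (A (y - z)) * CB \<le> norm (y - z) / 2" using CB(1) by (simp add: field_simps)
    moreover have "norm (y - z) = norm (B (A (y - z)))" using B(3)[OF w] by simp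
    ultimately have "norm (y - z) \<le> norm (y - z) / 2" using CB(2)[of "A (y - z)"] by linarith
    then show ?thesis by simp
  qed
  have tan: "K = tangent_space M x0"
  proof (intro set_eqI iffI)
    fix v assume v: "v \<in> K"
    define e where "e = r / (norm v + 1)"
    have nv: "norm v + 1 > 0" by (simp add: add_nonneg_pos)
    have e: "e > 0" using r nv by (simp add: e_def)
    have "norm (t *\<^sub>R v) < r" if "\<bar>t\<bar> < e" for t
    proof -
      have "norm (t *\<^sub>R v) \<le> \<bar>t\<bar> * (norm v + 1)" by (simp add: algebra_simps)
      also have "\<dots> < e * (norm v + 1)" using that nv by (intro mult_strict_right_mono)
      finally show ?thesis using nv by (simp add: e_def)
    qed
    then have inM: "g (t *\<^sub>R v) \<in> M" if "\<bar>t\<bar> < e" for t using gM subspace_scale[OF K v] that by blast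
    have "0 \<in> V" using rV[of 0] r by simp
    then have "((\<lambda>t. g (t *\<^sub>R v)) has_derivative (\<lambda>h. g' 0 (h *\<^sub>R v))) (at (0::real))"
      by (intro has_derivative_compose[of "\<lambda>t. t *\<^sub>R v" _ 0 UNIV g]) (auto intro!: derivative_eq_intros dg)
    then have "((\<lambda>t. g (t *\<^sub>R v)) has_vector_derivative v) (at 0)" by (simp add: g'0 has_vector_derivative_def)
    then show "v \<in> tangent_space M x0"
      unfolding tangent_space_def using e inM by (intro CollectI exI[of _ "\<lambda>t. g (t *\<^sub>R v)"] exI[of _ e]) (auto simp: g0)
  next
    fix v assume "v \<in> tangent_space M x0"
    then obtain c e where c: "e > 0" "c 0 = x0" "\<And>t. \<bar>t\<bar> < e \<Longrightarrow> c t \<in> M" "(c has_vector_derivative v) (at 0)"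
      unfolding tangent_space_def by blast
    have "(c has_derivative (\<lambda>h. h *\<^sub>R v)) (at 0)" using c(4) by (simp add: has_vector_derivative_def)
    from has_derivative_compose[OF this, of \<Phi> "D x0"] D[OF U(2)]
    have 1: "((\<lambda>t. \<Phi> (c t)) has_derivative (\<lambda>h. A (h *\<^sub>R v))) (at 0)" by (simp add: c(2) A_def)
    have "isCont c 0" using c(4) has_vector_derivative_continuous by blast
    then have "eventually (\<lambda>t. c t \<in> U) (nhds 0)"
      using U c(2) by (metis isCont_def tendsto_at_iff_tendsto_nhds topological_tendstoD)
    moreover have "eventually (\<lambda>t. \<bar>t\<bar> < e) (nhds (0::real))"
      using c(1) by (auto simp: eventually_nhds_metric dist_real_def)
    ultimately have ev: "eventually (\<lambda>t. \<Phi> (c t) = 0) (nhds 0)"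
      by eventually_elim (use c(3) MU in blast)
    have 2: "((\<lambda>t. \<Phi> (c t)) has_derivative (\<lambda>h. 0)) (at 0)"
      by (rule has_derivative_transform_eventually[of "\<lambda>t. 0"])
         (use ev eventually_nhds_x_imp_x[OF ev] in \<open>auto simp: eventually_at_filter elim: eventually_mono\<close>)
    have "A (1 *\<^sub>R v) = 0" using has_derivative_unique[OF 1 2] by meson
    then show "v \<in> K" by (simp add: K_def)
  qed
  show thesis
    by (rule that[of K r "1 + CA" \<rho> g g' P]) (use K r CA \<rho> g0 gM dg rV g'bound g'0 chart Pbound unique tan in auto)
qed

lemma tangent_space_subspace: "smooth_submanifold M \<Longrightarrow> x \<in> M \<Longrightarrow> subspace (tangent_space M x)"
  by (erule (1) submanifold_chart) simp

text \<open>The curves are images of straight segments in a chart, so their speed is comparable to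
  the ambient distance of the endpoints. They serve to integrate the bound on tangential derivatives
  of L.\<close>

lemma submanifold_local_paths:
  fixes M :: "'a::euclidean_space set"
  assumes M: "smooth_submanifold M" and x0: "x0 \<in> M"
  shows "\<exists>\<rho>>0. \<exists>C\<ge>0. \<forall>y\<in>M. \<forall>z\<in>M. dist y x0 < \<rho> \<longrightarrow> dist z x0 < \<rho> \<longrightarrow>
    (\<exists>c. c 0 = y \<and> c 1 = z \<and> (\<forall>t\<in>{0..1::real}. c t \<in> M \<and> (\<exists>v\<in>tangent_space M (c t). (c has_vector_derivative v) (at t) \<and> norm v \<le> C * norm (y - z))))"
proof -
  obtain K :: "'a set" and g g' P r C \<rho> where K: "subspace K" and r: "r > 0" and C: "C \<ge> 0" and \<rho>: "\<rho> > 0"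
    and gM: "\<And>k. k \<in> K \<Longrightarrow> norm k < r \<Longrightarrow> g k \<in> M"
    and dg: "\<And>k. norm k < r \<Longrightarrow> (g has_derivative g' k) (at k)"
    and g': "\<And>k v. norm k < r \<Longrightarrow> norm (g' k v) \<le> 2 * norm v"
    and chart: "\<And>y. y \<in> M \<Longrightarrow> dist y x0 < \<rho> \<Longrightarrow> P y \<in> K \<and> norm (P y) < r \<and> g (P y) = y"
    and Pb: "\<And>y z. norm (P y - P z) \<le> C * norm (y - z)"
    by (rule submanifold_chart[OF M x0]) blast
  have "\<exists>c. c 0 = y \<and> c 1 = z \<and> (\<forall>t\<in>{0..1::real}. c t \<in> M \<and> (\<exists>v\<in>tangent_space M (c t). (c has_vector_derivative v) (at t) \<and> norm v \<le> 2 * C * norm (y - z)))"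
    if yz: "y \<in> M" "z \<in> M" "dist y x0 < \<rho>" "dist z x0 < \<rho>" for y z
  proof -
    define k where "k t = P y + t *\<^sub>R (P z - P y)" for t
    have kK: "k t \<in> K" for t unfolding k_def using K chart yz by (intro subspace_add subspace_scale subspace_diff) auto
    have k01: "norm (k t) < r" if "t \<in> {0..1}" for t
    proof -
      have "k t \<in> ball 0 r"
        using convexD_alt[OF convex_ball[of 0 r], of "P y" "P z" t] chart yz that
        by (auto simp: k_def algebra_simps)
      then show ?thesis by simp
    qed
    have contk: "continuous_on UNIV k" unfolding k_def by (intro continuous_intros)
    have openk: "open {t. norm (k t) < r}"
      by (rule open_Collect_less) (intro continuous_intros contk)+
    define c where "c t = g (k t)" for t
    have dc: "(c has_vector_derivative g' (k t) (P z - P y)) (at t)" if "norm (k t) < r" for t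
    proof -
      have "(c has_derivative (\<lambda>h. g' (k t) (h *\<^sub>R (P z - P y)))) (at t)"
      proof -
        have "(k has_derivative (\<lambda>h. 0 + h *\<^sub>R (P z - P y))) (at t)"
          unfolding k_def[abs_def]
          by (intro has_derivative_add has_derivative_const bounded_linear_imp_has_derivative[OF bounded_linear_scaleR_left])
        then have "(k has_derivative (\<lambda>h. h *\<^sub>R (P z - P y))) (at t)" by simp
        from has_derivative_compose[OF this dg[OF that]] show ?thesis by (simp add: c_def[abs_def])
      qed
      moreover have "linear (g' (k t))" using dg[OF that] has_derivative_linear by blast
      ultimately show ?thesis by (simp add: has_vector_derivative_def linear_scale)
    qed
    have "c t \<in> M \<and> (\<exists>v\<in>tangent_space M (c t). (c has_vector_derivative v) (at t) \<and> norm v \<le> 2 * C * norm (y - z))"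
      if t: "t \<in> {0..1}" for t
    proof (intro conjI bexI[of _ "g' (k t) (P z - P y)"])
      show "c t \<in> M" unfolding c_def using gM kK k01[OF t] by blast
      show "(c has_vector_derivative g' (k t) (P z - P y)) (at t)" by (rule dc[OF k01[OF t]])
      have "norm (g' (k t) (P z - P y)) \<le> 2 * norm (P z - P y)" by (rule g'[OF k01[OF t]])
      also have "\<dots> \<le> 2 * (C * norm (z - y))" using Pb by simp
      finally show "norm (g' (k t) (P z - P y)) \<le> 2 * C * norm (y - z)" by (simp add: norm_minus_commute)
      \<comment> \<open>The segment can be continued a little beyond each point inside the chart, so
        the velocity is two-sided and tangent also at the endpoints.\<close>
      obtain e where e: "e > 0" "\<And>s. dist s t < e \<Longrightarrow> norm (k s) < r"
        using openk k01[OF t] unfolding open_dist by blast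
      have "((\<lambda>s. c (t + s)) has_vector_derivative g' (k t) (P z - P y)) (at 0)"
      proof -
        have "(c \<circ> (\<lambda>s. t + s) has_vector_derivative 1 *\<^sub>R g' (k t) (P z - P y)) (at 0)"
          by (rule vector_diff_chain_at) (auto intro!: derivative_eq_intros dc k01[OF t])
        then show ?thesis by (simp add: o_def)
      qed
      moreover have "c (t + s) \<in> M" if "\<bar>s\<bar> < e" for s
        unfolding c_def using gM kK e(2)[of "t + s"] that by (simp add: dist_real_def)
      ultimately show "g' (k t) (P z - P y) \<in> tangent_space M (c t)"
        unfolding tangent_space_def using e(1) by (intro CollectI exI[of _ "\<lambda>s. c (t + s)"] exI[of _ e]) auto
    qed
    moreover have "c 0 = y" "c 1 = z" unfolding c_def k_def using chart yz by auto
    ultimately show ?thesis by blast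
  qed
  then show ?thesis using \<rho> C by (intro exI[of _ \<rho>] conjI exI[of _ "2 * C"]) auto
qed

section \<open>Reaching a neighbourhood by bracket words\<close>

lemma linear_component_sum: "linear (\<lambda>c::real^'i::finite. \<Sum>\<alpha>\<in>UNIV. (c $ \<alpha>) *\<^sub>R w \<alpha>)"
  by (rule linearI) (simp_all add: sum.distrib scaleR_add_left scaleR_sum_right)

lemma range_component_sum: "range (\<lambda>c::real^'i::finite. \<Sum>\<alpha>\<in>UNIV. (c $ \<alpha>) *\<^sub>R w \<alpha>) = span (range w)"
proof
  show "range (\<lambda>c::real^'i. \<Sum>\<alpha>\<in>UNIV. (c $ \<alpha>) *\<^sub>R w \<alpha>) \<subseteq> span (range w)"
    by (auto intro!: span_sum span_scale intro: span_base)
  have "w \<alpha> \<in> range (\<lambda>c::real^'i. \<Sum>\<alpha>\<in>UNIV. (c $ \<alpha>) *\<^sub>R w \<alpha>)" for \<alpha>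
  proof
    show "w \<alpha> = (\<Sum>\<beta>\<in>UNIV. (axis \<alpha> (1::real) $ \<beta>) *\<^sub>R w \<beta>)"
      by (simp add: axis_def if_distrib[of "\<lambda>a. a *\<^sub>R _"] cong: if_cong)
  qed simp
  moreover have "subspace (range (\<lambda>c::real^'i. \<Sum>\<alpha>\<in>UNIV. (c $ \<alpha>) *\<^sub>R w \<alpha>))"
    using linear_subspace_image[OF linear_component_sum subspace_UNIV] .
  ultimately show "span (range w) \<subseteq> range (\<lambda>c::real^'i. \<Sum>\<alpha>\<in>UNIV. (c $ \<alpha>) *\<^sub>R w \<alpha>)"
    by (intro span_minimal) auto
qed

text \<open>The last clause, that the kernel is orthogonal to \<open>T\<close>, matches the
  hypothesis under which a chart determines a point of M.\<close>

lemma orthogonal_projection_ex: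
  assumes T: "subspace (T :: 'a::euclidean_space set)"
  shows "\<exists>\<pi>. linear \<pi> \<and> range \<pi> \<subseteq> T \<and> (\<forall>v\<in>T. \<pi> v = v) \<and> (\<forall>w. \<pi> w = 0 \<longrightarrow> (\<forall>k\<in>T. w \<bullet> k = 0))"
proof -
  obtain B where B: "B \<subseteq> T" "pairwise orthogonal B" "\<And>x. x \<in> B \<Longrightarrow> norm x = 1" "independent B" "span B = T"
    using orthonormal_basis_subspace[OF T] by metis
  have fB: "finite B" using B(4) by (rule independent_imp_finite)
  define \<pi> where "\<pi> v = (\<Sum>b\<in>B. (v \<bullet> b) *\<^sub>R b)" for v
  have lin: "linear \<pi>"
    by (rule linearI) (simp_all add: \<pi>_def sum.distrib scaleR_add_left scaleR_sum_right inner_add_left)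
  have pb: "\<pi> v \<bullet> c = v \<bullet> c" if "c \<in> B" for v c
  proof -
    have "\<pi> v \<bullet> c = (\<Sum>b\<in>B. (v \<bullet> b) * (b \<bullet> c))" by (simp add: \<pi>_def inner_sum_left)
    also have "\<dots> = (\<Sum>b\<in>B. if b = c then v \<bullet> c else 0)"
    proof (rule sum.cong[OF refl])
      fix b assume b: "b \<in> B"
      show "(v \<bullet> b) * (b \<bullet> c) = (if b = c then v \<bullet> c else 0)"
      proof (cases "b = c")
        case True
        then have "b \<bullet> c = 1" using B(3)[OF b] by (simp add: dot_square_norm)
        then show ?thesis using True by simp
      next
        case False
        then have "b \<bullet> c = 0" using pairwiseD[OF B(2) b \<open>c \<in> B\<close>] by (simp add: orthogonal_def)
        then show ?thesis using False by simp
      qed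
    qed
    finally show ?thesis using that fB by simp
  qed
  have rg: "\<pi> v \<in> T" for v
    unfolding \<pi>_def using B(1) T by (intro subspace_sum subspace_scale) auto
  have orth: "w \<bullet> k = 0" if "\<And>b. b \<in> B \<Longrightarrow> w \<bullet> b = 0" "k \<in> T" for w k
  proof -
    have "orthogonal w k" using orthogonal_to_span[of k B w] that unfolding B(5) orthogonal_def by blast
    then show ?thesis by (simp add: orthogonal_def)
  qed
  have "\<pi> v = v" if v: "v \<in> T" for v
  proof -
    have "(\<pi> v - v) \<bullet> (\<pi> v - v) = 0"
    proof (rule orth)
      show "(\<pi> v - v) \<bullet> b = 0" if "b \<in> B" for b using pb[OF that] by (simp add: inner_diff_left)
      show "\<pi> v - v \<in> T" by (rule subspace_diff[OF T rg v])
    qed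
    then show ?thesis by simp
  qed
  moreover have "\<forall>k\<in>T. w \<bullet> k = 0" if "\<pi> w = 0" for w
    using orth[of w] pb[of _ w] that by auto
  ultimately show ?thesis using lin rg by blast
qed

locale generating_fields = control_fields M X0 X
  for M :: "'a::euclidean_space set" and X0 and X :: "'m::finite \<Rightarrow> 'a \<Rightarrow> 'a" +
  assumes M_submanifold: "smooth_submanifold M"
    and X_generating: "k_generating M 3 X"
begin

lemma bracket_classification:
  "(A, l) \<in> brackets X \<Longrightarrow> l \<ge> 1 \<and> (l = 1 \<longrightarrow> (\<exists>i. A = X i)) \<and> (l = 2 \<longrightarrow> (\<exists>i j. A = lie_bracket (X i) (X j)))
    \<and> (l = 3 \<longrightarrow> (\<exists>k i j. A = lie_bracket (lie_bracket (X k) (X i)) (X j) \<or> A = lie_bracket (X j) (lie_bracket (X k) (X i))))"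
proof (induction A l rule: brackets.induct)
  case (br A a B b)
  have ab: "a \<ge> 1" "b \<ge> 1" using br.IH by blast+
  show ?case
  proof (intro conjI impI)
    show "1 \<le> a + b" using ab by simp
  next
    assume "a + b = 1"
    then show "\<exists>i. lie_bracket A B = X i" using ab by simp
  next
    assume "a + b = 2"
    then have "a = 1" "b = 1" using ab by auto
    then show "\<exists>i j. lie_bracket A B = lie_bracket (X i) (X j)" using br.IH by blast
  next
    assume "a + b = 3"
    then have "a = 1 \<and> b = 2 \<or> a = 2 \<and> b = 1" using ab by auto
    then show "\<exists>k i j. lie_bracket A B = lie_bracket (lie_bracket (X k) (X i)) (X j) \<or> lie_bracket A B = lie_bracket (X j) (lie_bracket (X k) (X i))"
    proof
      assume "a = 1 \<and> b = 2"
      then obtain j k i where "A = X j" "B = lie_bracket (X k) (X i)" using br.IH by blast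
      then show ?thesis by blast
    next
      assume "a = 2 \<and> b = 1"
      then obtain j k i where "B = X j" "A = lie_bracket (X k) (X i)" using br.IH by blast
      then show ?thesis by blast
    qed
  qed
qed auto

lemma lie_bracket_anti: "lie_bracket A B x = - lie_bracket B A x"
  by (simp add: lie_bracket_def)

text \<open>The family \<open>W\<close> contains the triple brackets nested to the left; those
  nested to the right differ from them by a sign.\<close>

lemma bracket_in_span:
  assumes "(A, l) \<in> brackets X" "l \<le> 3"
  shows "A x \<in> span (range (\<lambda>\<alpha>. W \<alpha> x))"
proof -
  have b: "W \<alpha> x \<in> span (range (\<lambda>\<alpha>. W \<alpha> x))" for \<alpha> by (auto intro: span_base)
  have "l = 1 \<or> l = 2 \<or> l = 3" using bracket_classification[OF assms(1)] assms(2) by auto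
  then consider i where "A = X i" | i j where "A = lie_bracket (X i) (X j)"
    | k i j where "A = lie_bracket (lie_bracket (X k) (X i)) (X j)" | k i j where "A = lie_bracket (X j) (lie_bracket (X k) (X i))"
    using bracket_classification[OF assms(1)] by blast
  then show ?thesis
  proof cases
    case 1 then show ?thesis using b[of "Inl i"] by simp
  next
    case 2 then show ?thesis using b[of "Inr (Inl (i, j))"] by simp
  next
    case 3 then show ?thesis using b[of "Inr (Inr (k, i, j))"] by simp
  next
    case 4 then show ?thesis using span_neg[OF b[of "Inr (Inr (k, i, j))"]] lie_bracket_anti[of "X j"] by simp
  qed
qed

lemma tangent_subset_span_W:
  assumes x: "x \<in> M" shows "tangent_space M x \<subseteq> span (range (\<lambda>\<alpha>. W \<alpha> x))"
proof -
  have "tangent_space M x \<subseteq> span (tangent_space M x)" by (rule span_superset)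
  also have "\<dots> = span {A x | A l. (A, l) \<in> brackets X \<and> l \<le> 3}"
    using X_generating x unfolding k_generating_def by blast
  also have "\<dots> \<subseteq> span (range (\<lambda>\<alpha>. W \<alpha> x))"
    by (rule span_minimal) (auto intro: bracket_in_span)
  finally show ?thesis .
qed

text \<open>By the word expansion, the endpoint is the drift endpoint plus \<open>\<sigma>\<^sup>3\<close> times a linear map of \<open>c\<close> that is onto the
  tangent space, plus \<open>O(\<sigma>\<^sup>4)\<close>; Brouwer's fixed point theorem solves for \<open>c\<close>.\<close>

lemma reach_ball_local:
  assumes x0: "x0 \<in> M"
  shows "\<exists>\<rho>>0. \<exists>\<kappa>>0. \<forall>Z\<ge>0. \<exists>s0>0. \<forall>s f x z. 0 < s \<longrightarrow> s \<le> s0 \<longrightarrow> (\<forall>p. \<bar>f p\<bar> \<le> Z * s^2) \<longrightarrow> x \<in> M \<longrightarrow> dist x x0 < \<rho> \<longrightarrow> z \<in> M \<longrightarrow>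
    norm (z - flow (of_coords (\<lambda>p. real nlegs * f p)) x 1) \<le> \<kappa> * s^3 \<longrightarrow> (\<exists>c. (\<forall>\<alpha>. \<bar>c \<alpha>\<bar> \<le> 1) \<and> run (bracket_word s c f) x = z)"
proof -
  obtain T :: "'a set" and \<rho>1 where T: "subspace T" "T = tangent_space M x0" and \<rho>1: "\<rho>1 > 0"
    and uniq: "\<And>y z. y \<in> M \<Longrightarrow> z \<in> M \<Longrightarrow> dist y x0 < \<rho>1 \<Longrightarrow> dist z x0 < \<rho>1 \<Longrightarrow> (\<And>k. k \<in> T \<Longrightarrow> (y - z) \<bullet> k = 0) \<Longrightarrow> y = z"
    by (rule submanifold_chart[OF M_submanifold x0]) blast
  obtain \<pi> where \<pi>: "linear \<pi>" "range \<pi> \<subseteq> T" "\<And>v. v \<in> T \<Longrightarrow> \<pi> v = v" "\<And>w k. \<pi> w = 0 \<Longrightarrow> k \<in> T \<Longrightarrow> w \<bullet> k = 0"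
    using orthogonal_projection_ex[OF T(1)] by blast
  define S where "S x c = (\<Sum>\<alpha>\<in>UNIV. (c $ \<alpha>) *\<^sub>R W \<alpha> x)" for x and c :: "real^('m bidx)"
  have linS: "linear (S x)" for x unfolding S_def by (rule linear_component_sum)
  have TS: "T \<subseteq> range (S x0)"
    unfolding S_def range_component_sum T(2) by (rule tangent_subset_span_W[OF x0])
  obtain R where R: "linear R" "\<And>v. v \<in> range (S x0) \<Longrightarrow> S x0 (R v) = v"
    using linear_exists_right_inverse_on[OF linS subspace_UNIV, of x0] by blast
  have SR: "S x0 (R v) = v" if "v \<in> T" for v using R(2) TS that by blast
  obtain CR where CR: "CR > 0" "\<And>v. norm (R v) \<le> norm v * CR"
    using bounded_linear.pos_bounded[OF R(1)[unfolded linear_conv_bounded_linear]] by blast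
  obtain C\<pi> where C\<pi>: "C\<pi> > 0" "\<And>v. norm (\<pi> v) \<le> norm v * C\<pi>"
    using bounded_linear.pos_bounded[OF \<pi>(1)[unfolded linear_conv_bounded_linear]] by blast
  \<comment> \<open>On the ball of this radius the coefficients \<open>R v\<close> stay between -1
    and 1.\<close>
  define \<delta> where "\<delta> = 1 / CR"
  have \<delta>: "\<delta> > 0" using CR by (simp add: \<delta>_def)
  have Rb: "norm (R v) \<le> 1" if "norm v \<le> \<delta>" for v
    using CR(2)[of v] mult_right_mono[OF that, of CR] CR(1) by (simp add: \<delta>_def)
  have comp: "\<bar>R v $ \<alpha>\<bar> \<le> 1" if "norm v \<le> \<delta>" for v \<alpha>
    using component_le_norm_cart[of "R v" \<alpha>] Rb[OF that] by linarith
  \<comment> \<open>Three errors of this size, enlarged by the projection, must fit into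
    \<open>\<delta>\<close>: the variation of the brackets near \<open>x0\<close>, the error of the
    expansion, and the distance of the target.\<close>
  define e where "e = \<delta> / (4 * C\<pi>)"
  have e: "e > 0" using \<delta> C\<pi> by (simp add: e_def)
  define \<omega> where "\<omega> x = (\<Sum>\<alpha>\<in>UNIV. norm (W \<alpha> x - W \<alpha> x0))" for x
  have "continuous_on UNIV \<omega>" unfolding \<omega>_def
    by (intro continuous_intros smooth_continuous_on smooth_W)
  moreover have "\<omega> x0 = 0" by (simp add: \<omega>_def)
  ultimately obtain \<rho>2 where \<rho>2: "\<rho>2 > 0" "\<And>x. dist x x0 < \<rho>2 \<Longrightarrow> dist (\<omega> x) 0 < e"
    using e unfolding continuous_on_iff by (metis UNIV_I)
  have \<omega>e: "\<omega> x \<le> e" if "dist x x0 < \<rho>2" for x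
    using \<rho>2(2)[OF that] by (simp add: dist_real_def)
  have Sdiff: "norm (S x (R v) - v) \<le> e" if v: "v \<in> T" "norm v \<le> \<delta>" and x: "dist x x0 < \<rho>2" for x v
  proof -
    have "S x (R v) - v = S x (R v) - S x0 (R v)" using SR v by simp
    also have "\<dots> = (\<Sum>\<alpha>\<in>UNIV. (R v $ \<alpha>) *\<^sub>R (W \<alpha> x - W \<alpha> x0))" by (simp add: S_def sum_subtractf scaleR_diff_right)
    also have "norm \<dots> \<le> (\<Sum>\<alpha>\<in>UNIV. 1 * norm (W \<alpha> x - W \<alpha> x0))"
    proof (intro order_trans[OF norm_sum] sum_mono)
      fix \<alpha> :: "'m bidx"
      show "norm ((R v $ \<alpha>) *\<^sub>R (W \<alpha> x - W \<alpha> x0)) \<le> 1 * norm (W \<alpha> x - W \<alpha> x0)"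
        unfolding norm_scaleR real_norm_def by (intro mult_right_mono comp v(2) norm_ge_zero)
    qed
    also have "\<dots> \<le> e" using \<omega>e[OF x] by (simp add: \<omega>_def)
    finally show ?thesis .
  qed
  define \<rho> where "\<rho> = min (\<rho>1 / 2) \<rho>2"
  have \<rho>: "\<rho> > 0" using \<rho>1 \<rho>2 by (simp add: \<rho>_def)
  have main: "\<exists>s0>0. \<forall>s f x z. 0 < s \<longrightarrow> s \<le> s0 \<longrightarrow> (\<forall>p. \<bar>f p\<bar> \<le> Z * s^2) \<longrightarrow> x \<in> M \<longrightarrow> dist x x0 < \<rho> \<longrightarrow> z \<in> M \<longrightarrow>
    norm (z - flow (of_coords (\<lambda>p. real nlegs * f p)) x 1) \<le> e * s^3 \<longrightarrow> (\<exists>c. (\<forall>\<alpha>. \<bar>c \<alpha>\<bar> \<le> 1) \<and> run (bracket_word s c f) x = z)"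
    if Z: "Z \<ge> 0" for Z
  proof -
    obtain K where K: "K \<ge> 0" "\<And>\<sigma> c f x. 0 \<le> \<sigma> \<Longrightarrow> \<sigma> \<le> 1 \<Longrightarrow> (\<forall>\<alpha>. \<bar>c \<alpha>\<bar> \<le> 1) \<Longrightarrow> (\<forall>p. \<bar>f p\<bar> \<le> Z * \<sigma>^2) \<Longrightarrow> x \<in> M \<Longrightarrow>
      norm (run (bracket_word \<sigma> c f) x - flow (of_coords (\<lambda>p. real nlegs * f p)) x 1 - \<sigma>^3 *\<^sub>R (\<Sum>\<alpha>\<in>UNIV. c \<alpha> *\<^sub>R W \<alpha> x)) \<le> K * \<sigma>^4"
      using word_expansion[OF Z] by blast
    define Y where "Y = \<Lambda> * (real nlegs * (Z * (real CARD('m) + 1)))"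
    have Y: "Y \<ge> 0" using \<Lambda>_pos Z by (simp add: Y_def)
    define B where "B = Y + e + K + (\<delta> + e)"
    have B: "B > 0" using Y e K \<delta> by (simp add: B_def)
    \<comment> \<open>The conditions are K s \<le> e for the expansion error and B s < \<rho>1 / 2,
      which keeps endpoint and target where M is determined by its tangential projection.\<close>
    define s0 where "s0 = min 1 (min (e / (K + 1)) (\<rho>1 / (2 * (B + 1))))"
    have s0: "s0 > 0" using e K \<rho>1 B by (simp add: s0_def)
    have "\<exists>c. (\<forall>\<alpha>. \<bar>c \<alpha>\<bar> \<le> 1) \<and> run (bracket_word s c f) x = z"
      if s: "0 < s" "s \<le> s0" and f: "\<forall>p. \<bar>f p\<bar> \<le> Z * s^2" and x: "x \<in> M" "dist x x0 < \<rho>" and z: "z \<in> M"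
        "norm (z - flow (of_coords (\<lambda>p. real nlegs * f p)) x 1) \<le> e * s^3" for s f x z
    proof -
      have s1: "s \<le> 1" using s by (simp add: s0_def)
      have Ks: "K * s \<le> e"
      proof -
        have "s \<le> e / (K + 1)" using s by (simp add: s0_def)
        then have "s * (K + 1) \<le> e" using K(1) by (simp add: field_simps)
        then show ?thesis using s by (simp add: algebra_simps)
      qed
      have Bs: "B * s < \<rho>1 / 2"
      proof -
        have "s \<le> \<rho>1 / (2 * (B + 1))" using s by (simp add: s0_def)
        then have "s * (B + 1) \<le> \<rho>1 / 2" using B by (simp add: field_simps)
        then show ?thesis using s B by (simp add: algebra_simps)
      qed
      define zx where "zx = flow (of_coords (\<lambda>p. real nlegs * f p)) x 1"
      define E where "E v = run (bracket_word s (\<lambda>\<alpha>. R v $ \<alpha>) f) x" for v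
      have EM: "E v \<in> M" for v unfolding E_def by (rule run_in[OF x(1)])
      have Eexp: "norm (E v - zx - s^3 *\<^sub>R S x (R v)) \<le> K * s^4" if "norm v \<le> \<delta>" for v
        using K(2)[of s "\<lambda>\<alpha>. R v $ \<alpha>" f x] s s1 f x comp[OF that] by (simp add: E_def zx_def S_def)
      have s3: "s^3 > 0" "s^3 \<le> s" "s^4 = s^3 * s"
        using s s1 power_decreasing[of 1 3 s] by (auto simp: eval_nat_numeral)
      \<comment> \<open>A fixed point means that the endpoint and \<open>z\<close> have the same
        projection to the tangent space; both being points of M near \<open>x0\<close>, they
        coincide.\<close>
      define F where "F v = v - (1 / s^3) *\<^sub>R \<pi> (E v - z)" for v
      have contE: "continuous_on UNIV E"
        unfolding E_def using linear_continuous_on[OF R(1)[unfolded linear_conv_bounded_linear], of UNIV]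
        by (intro run_bracket_word_continuous x continuous_intros)
      have contF: "continuous_on A F" for A
        unfolding F_def
        by (intro continuous_intros bounded_linear.continuous_on[OF \<pi>(1)[unfolded linear_conv_bounded_linear]] continuous_on_subset[OF contE]) auto
      have Fin: "F v \<in> T \<inter> cball 0 \<delta>" if v: "v \<in> T \<inter> cball 0 \<delta>" for v
      proof -
        have least_cost: "v \<in> T" "norm v \<le> \<delta>" using v by auto
        have "F v \<in> T" unfolding F_def using \<pi>(2) T(1) least_cost by (intro subspace_diff subspace_scale) auto
        moreover have "norm (F v) \<le> \<delta>"
        proof -
          define u where "u = v - (1 / s^3) *\<^sub>R (E v - z)"
          have Fu: "F v = \<pi> u" unfolding F_def u_def
            using \<pi>(3)[OF least_cost(1)] by (simp add: linear_diff[OF \<pi>(1)] linear_scale[OF \<pi>(1)])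
          have "u = (v - S x (R v)) - (1 / s^3) *\<^sub>R (E v - zx - s^3 *\<^sub>R S x (R v)) + (1 / s^3) *\<^sub>R (z - zx)"
            unfolding u_def using s3(1) by (simp add: algebra_simps)
          then have "norm u \<le> norm (v - S x (R v)) + norm ((1 / s^3) *\<^sub>R (E v - zx - s^3 *\<^sub>R S x (R v))) + norm ((1 / s^3) *\<^sub>R (z - zx))"
            using norm_diff_add3_le[of "v - S x (R v)" "(1 / s^3) *\<^sub>R (E v - zx - s^3 *\<^sub>R S x (R v))" "(1 / s^3) *\<^sub>R (z - zx)" 0] by simp
          also have "\<dots> \<le> e + e + e"
          proof (intro add_mono)
            show "norm (v - S x (R v)) \<le> e" using Sdiff[OF least_cost, of x] x by (simp add: norm_minus_commute \<rho>_def)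
            have "norm ((1 / s^3) *\<^sub>R (E v - zx - s^3 *\<^sub>R S x (R v))) \<le> (1 / s^3) * (K * s^4)"
              using mult_left_mono[OF Eexp[OF least_cost(2)], of "1 / s^3"] s3(1) by simp
            also have "\<dots> = K * s" using s3(1) unfolding s3(3) by simp
            finally show "norm ((1 / s^3) *\<^sub>R (E v - zx - s^3 *\<^sub>R S x (R v))) \<le> e" using Ks by simp
            have "norm ((1 / s^3) *\<^sub>R (z - zx)) \<le> (1 / s^3) * (e * s^3)"
              using mult_left_mono[OF z(2), of "1 / s^3"] s3(1) by (simp add: zx_def)
            then show "norm ((1 / s^3) *\<^sub>R (z - zx)) \<le> e" using s3 s by simp
          qed
          finally have "norm u \<le> 3 * e" by simp
          then have "norm u * C\<pi> \<le> 3 * e * C\<pi>" using C\<pi>(1) by (intro mult_right_mono) auto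
          also have "\<dots> \<le> \<delta>" using C\<pi>(1) \<delta> by (simp add: e_def)
          finally show ?thesis unfolding Fu using C\<pi>(2)[of u] by linarith
        qed
        ultimately show ?thesis by simp
      qed
      obtain v where v: "v \<in> T \<inter> cball 0 \<delta>" "F v = v"
      proof (rule brouwer[of "T \<inter> cball 0 \<delta>" F])
        show "compact (T \<inter> cball 0 \<delta>)" using closed_subspace[OF T(1)] by (intro closed_Int_compact) auto
        show "convex (T \<inter> cball 0 \<delta>)" using subspace_imp_convex[OF T(1)] by (intro convex_Int) auto
        show "T \<inter> cball 0 \<delta> \<noteq> {}" using subspace_0[OF T(1)] \<delta> by auto
      qed (use contF Fin in auto)
      then have least_cost: "v \<in> T" "norm v \<le> \<delta>" by auto
      have "\<pi> (E v - z) = 0" using v(2) s3(1) s by (simp add: F_def)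
      then have orth: "(E v - z) \<bullet> k = 0" if "k \<in> T" for k using \<pi>(4) that by blast
      have zxx: "norm (zx - x) \<le> Y * s"
      proof -
        have "norm (of_coords (\<lambda>p. real nlegs * f p)) \<le> norm (real nlegs * f None) + norm (\<chi> i. real nlegs * f (Some i))"
          unfolding of_coords_def by (rule norm_Pair_le)
        also have "\<dots> \<le> real nlegs * (Z * s^2) + (\<Sum>i\<in>(UNIV::'m set). real nlegs * (Z * s^2))"
        proof (intro add_mono)
          have *: "\<bar>real nlegs * f p\<bar> \<le> real nlegs * (Z * s^2)" for p
            using f by (simp add: abs_mult mult_left_mono)
          show "norm (real nlegs * f None) \<le> real nlegs * (Z * s^2)" using * by simp
          show "norm (\<chi> i. real nlegs * f (Some i)) \<le> (\<Sum>i\<in>(UNIV::'m set). real nlegs * (Z * s^2))"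
            using * by (intro order_trans[OF norm_le_l1_cart] sum_mono) auto
        qed
        also have "\<dots> = real nlegs * (Z * (real CARD('m) + 1)) * s^2" by (simp add: algebra_simps)
        also have "\<dots> \<le> real nlegs * (Z * (real CARD('m) + 1)) * s"
          using Z s s1 power_decreasing[of 1 2 s] by (intro mult_left_mono) auto
        finally have "\<Lambda> * norm (of_coords (\<lambda>p. real nlegs * f p)) \<le> Y * s"
          using \<Lambda>_pos by (simp add: Y_def mult.assoc mult_left_mono)
        then show ?thesis using flow_move1[OF x(1), of "of_coords (\<lambda>p. real nlegs * f p)"] by (simp add: zx_def)
      qed
      have near: "dist y x0 < \<rho>1" if y: "norm (y - zx) \<le> (e + K + (\<delta> + e)) * s" for y
      proof -
        have "dist y x0 \<le> norm (y - zx) + norm (zx - x) + dist x x0"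
          using dist_triangle[of y x0 zx] dist_triangle[of zx x0 x] by (simp add: dist_norm)
        also have "\<dots> < (e + K + (\<delta> + e)) * s + Y * s + \<rho>1 / 2" using y zxx x(2) by (simp add: \<rho>_def)
        also have "\<dots> = B * s + \<rho>1 / 2" by (simp add: B_def algebra_simps)
        finally show ?thesis using Bs by simp
      qed
      have "E v = z"
      proof (rule uniq[OF EM z(1) near near orth])
        have "e * s^3 \<le> e * s" using s3 e by simp
        moreover have "0 \<le> (K + (\<delta> + e)) * s" using K \<delta> e s by simp
        ultimately show "norm (z - zx) \<le> (e + K + (\<delta> + e)) * s" using z(2) by (simp add: zx_def algebra_simps)
        have "norm (S x (R v)) \<le> \<delta> + e"
          using norm_triangle_sub[of "S x (R v)" v] Sdiff[OF least_cost, of x] x least_cost by (simp add: \<rho>_def)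
        then have "norm (s^3 *\<^sub>R S x (R v)) \<le> s^3 * (\<delta> + e)" using s3 by (simp add: mult_left_mono)
        also have "\<dots> \<le> s * (\<delta> + e)" using s3 \<delta> e by (intro mult_right_mono) auto
        finally have 1: "norm (s^3 *\<^sub>R S x (R v)) \<le> s * (\<delta> + e)" .
        have "K * s^4 \<le> K * s" using s s1 K power_decreasing[of 1 4 s] by (intro mult_left_mono) auto
        then have "norm (E v - zx) \<le> K * s + s * (\<delta> + e)"
          using norm_triangle_sub[of "E v - zx" "s^3 *\<^sub>R S x (R v)"] Eexp[OF least_cost(2)] 1 by linarith
        moreover have "0 \<le> e * s" using e s by simp
        ultimately show "norm (E v - zx) \<le> (e + K + (\<delta> + e)) * s" by (simp add: algebra_simps)
      qed
      then show ?thesis using comp[OF least_cost(2)] by (intro exI[of _ "\<lambda>\<alpha>. R v $ \<alpha>"]) (auto simp: E_def)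
    qed
    then show ?thesis using s0 by (intro exI[of _ s0]) auto
  qed
  show ?thesis using \<rho> e main by blast
qed

text \<open>The local radius and \<open>\<kappa>\<close> do not depend on \<open>Z\<close>, so one
  finite cover of M serves every \<open>Z\<close>, and only the threshold \<open>s0\<close> is
  chosen anew.\<close>

theorem reach_ball:
  "\<exists>\<kappa>>0. \<forall>Z\<ge>0. \<exists>s0>0. \<forall>s f x z. 0 < s \<longrightarrow> s \<le> s0 \<longrightarrow> (\<forall>p. \<bar>f p\<bar> \<le> Z * s^2) \<longrightarrow> x \<in> M \<longrightarrow> z \<in> M \<longrightarrow>
    norm (z - flow (of_coords (\<lambda>p. real nlegs * f p)) x 1) \<le> \<kappa> * s^3 \<longrightarrow> (\<exists>c. (\<forall>\<alpha>. \<bar>c \<alpha>\<bar> \<le> 1) \<and> run (bracket_word s c f) x = z)"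
proof -
  let ?P = "\<lambda>x0 \<rho> \<kappa> Z s0. \<forall>s f x z. 0 < s \<longrightarrow> s \<le> s0 \<longrightarrow> (\<forall>p. \<bar>f p\<bar> \<le> Z * s^2) \<longrightarrow> x \<in> M \<longrightarrow> dist x x0 < \<rho> \<longrightarrow> z \<in> M \<longrightarrow>
    norm (z - flow (of_coords (\<lambda>p. real nlegs * f p)) x 1) \<le> \<kappa> * s^3 \<longrightarrow> (\<exists>c. (\<forall>\<alpha>. \<bar>c \<alpha>\<bar> \<le> 1) \<and> run (bracket_word s c f) x = z)"
  have "\<forall>x0\<in>M. \<exists>r. fst r > 0 \<and> snd r > 0 \<and> (\<forall>Z\<ge>0. \<exists>s0>0. ?P x0 (fst r) (snd r) Z s0)"
  proof
    fix x0 assume "x0 \<in> M"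
    from reach_ball_local[OF this] obtain \<rho> \<kappa> where "\<rho> > 0" "\<kappa> > 0" "\<forall>Z\<ge>0. \<exists>s0>0. ?P x0 \<rho> \<kappa> Z s0" by blast
    then show "\<exists>r. fst r > 0 \<and> snd r > 0 \<and> (\<forall>Z\<ge>0. \<exists>s0>0. ?P x0 (fst r) (snd r) Z s0)"
      by (intro exI[of _ "(\<rho>, \<kappa>)"]) simp
  qed
  from bchoice[OF this] obtain F where F: "\<forall>x0\<in>M. fst (F x0) > 0 \<and> snd (F x0) > 0 \<and> (\<forall>Z\<ge>0. \<exists>s0>0. ?P x0 (fst (F x0)) (snd (F x0)) Z s0)"
    by blast
  define \<rho> where "\<rho> x0 = fst (F x0)" for x0
  define \<kappa> where "\<kappa> x0 = snd (F x0)" for x0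
  have rk: "\<rho> x0 > 0" "\<kappa> x0 > 0" "\<forall>Z\<ge>0. \<exists>s0>0. ?P x0 (\<rho> x0) (\<kappa> x0) Z s0" if "x0 \<in> M" for x0
    using bspec[OF F that] unfolding \<rho>_def \<kappa>_def by blast+
  have "M \<subseteq> (\<Union>x0\<in>M. ball x0 (\<rho> x0))" using rk by auto
  then obtain D where D: "D \<subseteq> M" "finite D" "M \<subseteq> (\<Union>x0\<in>D. ball x0 (\<rho> x0))"
    using compactE_image[OF M_compact, of M "\<lambda>x0. ball x0 (\<rho> x0)"] by auto
  have Dne: "D \<noteq> {}" using D(3) M_nonempty by auto
  define k where "k = Min (\<kappa> ` D)"
  have k: "k > 0" using D Dne rk by (auto simp: k_def)
  have "\<exists>s0>0. \<forall>s f x z. 0 < s \<longrightarrow> s \<le> s0 \<longrightarrow> (\<forall>p. \<bar>f p\<bar> \<le> Z * s^2) \<longrightarrow> x \<in> M \<longrightarrow> z \<in> M \<longrightarrow>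
    norm (z - flow (of_coords (\<lambda>p. real nlegs * f p)) x 1) \<le> k * s^3 \<longrightarrow> (\<exists>c. (\<forall>\<alpha>. \<bar>c \<alpha>\<bar> \<le> 1) \<and> run (bracket_word s c f) x = z)"
    if Z: "Z \<ge> 0" for Z
  proof -
    have "\<forall>x0\<in>M. \<exists>s0>0. ?P x0 (\<rho> x0) (\<kappa> x0) Z s0" using rk(3) Z by blast
    from bchoice[OF this] obtain \<sigma> where \<sigma>': "\<forall>x0\<in>M. \<sigma> x0 > 0 \<and> ?P x0 (\<rho> x0) (\<kappa> x0) Z (\<sigma> x0)" by blast
    have \<sigma>: "\<sigma> x0 > 0" "?P x0 (\<rho> x0) (\<kappa> x0) Z (\<sigma> x0)" if "x0 \<in> M" for x0 using bspec[OF \<sigma>' that] by blast+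
    define s0 where "s0 = Min (\<sigma> ` D)"
    have s0: "s0 > 0" using D Dne \<sigma> by (auto simp: s0_def)
    show ?thesis
    proof (intro exI[of _ s0] conjI allI impI s0)
      fix s :: real and f and x z :: 'a
      assume a: "0 < s" "s \<le> s0" "\<forall>p. \<bar>f p\<bar> \<le> Z * s^2" "x \<in> M" "z \<in> M"
        "norm (z - flow (of_coords (\<lambda>p. real nlegs * f p)) x 1) \<le> k * s^3"
      obtain x0 where x0: "x0 \<in> D" "dist x x0 < \<rho> x0" using D(3) a(4) by (auto simp: dist_commute)
      have "Min (\<sigma> ` D) \<le> \<sigma> x0" using D(2) x0(1) by simp
      then have "s \<le> \<sigma> x0" using a(2) unfolding s0_def by linarith
      moreover have "k * s^3 \<le> \<kappa> x0 * s^3" using a(1) x0 D(2) by (intro mult_right_mono) (auto simp: k_def)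
      ultimately have le: "norm (z - flow (of_coords (\<lambda>p. real nlegs * f p)) x 1) \<le> \<kappa> x0 * s^3" "s \<le> \<sigma> x0" "x0 \<in> M"
        using a(6) x0(1) D(1) by auto
      show "\<exists>c. (\<forall>\<alpha>. \<bar>c \<alpha>\<bar> \<le> 1) \<and> run (bracket_word s c f) x = z"
        using \<sigma>(2)[OF le(3), THEN spec, THEN spec, THEN spec, THEN spec, of s f x z] a le x0(2) by simp
    qed
  qed
  then show ?thesis using k by blast
qed

text \<open>The coordinate \<open>None\<close> of each leg is exactly that of the drift. So every
  leg lasts the same positive time and becomes an admissible control after division by it.\<close>

lemma word_control:
  assumes "l \<in> set (word \<sigma> c f (\<alpha> :: 'm bidx))" "0 \<le> \<sigma>" "\<sigma> \<le> 1" "\<bar>c\<bar> \<le> 1"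
  shows "\<bar>fst l p + fst (snd l) p + snd (snd l) p - f p\<bar> \<le> (if p = None then 0 else \<sigma>)"
proof -
  have u: "\<bar>unitc i p\<bar> \<le> (if p = None then 0 else 1)" for i :: 'm by (simp add: unitc_def)
  have s: "\<sigma>^2 \<le> \<sigma>" "\<sigma>^3 \<le> \<sigma>" using assms power_decreasing[of 1 2 \<sigma>] power_decreasing[of 1 3 \<sigma>] by auto
  have a: "\<bar>\<sigma> * unitc i p\<bar> \<le> (if p = None then 0 else \<sigma>)" "\<bar>\<sigma> * (c / 4) * unitc i p\<bar> \<le> (if p = None then 0 else \<sigma>)"
     "\<bar>\<sigma>^2 * (c / 2) * unitc i p\<bar> \<le> (if p = None then 0 else \<sigma>)"
    "\<bar>\<sigma>^3 * c * unitc i p\<bar> \<le> (if p = None then 0 else \<sigma>)" for i :: 'm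
    using abs_mult_le[of \<sigma> \<sigma>, OF _ u[of i]] abs_mult_le[OF abs_mult_le[of \<sigma> \<sigma> "c / 4" 1] u[of i]]
       abs_mult_le[OF abs_mult_le[of "\<sigma>^2" "\<sigma>^2" "c / 2" 1] u[of i]]
       abs_mult_le[OF abs_mult_le[of "\<sigma>^3" "\<sigma>^3" "c" 1] u[of i]] assms s by (auto split: if_splits)
  show ?thesis
  proof (cases "(\<sigma>, c, f, \<alpha>)" rule: word.cases)
    case (1 \<sigma>' c' f' i)
    then have l: "l = (\<lambda>p. 0, f, \<lambda>p. \<sigma>^3 * c * unitc i p)" using assms(1) by simp
    show ?thesis unfolding l using a(4) by simp
  next
    case (2 \<sigma>' c' f' i j)
    have "l \<in> set (word8 (\<lambda>p. \<sigma> * unitc i p) (\<lambda>p. \<sigma>^2 * (c / 2) * unitc j p) f)" using assms(1) 2 by simp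
    then show ?thesis
      unfolding word8_def list.set insert_iff empty_iff
      using a(1)[of i] a(3)[of j] by (elim disjE) simp_all
  next
    case (3 \<sigma>' c' f' k i j)
    have "l \<in> set (word24 (\<lambda>p. \<sigma> * unitc i p) (\<lambda>p. \<sigma> * unitc j p) (\<lambda>p. \<sigma> * (c / 4) * unitc k p) f)" using assms(1) 3 by simp
    then show ?thesis
      unfolding word24_def word6_def append.simps list.set insert_iff empty_iff minus_minus
      using a(1)[of i] a(1)[of j] a(2)[of k] by (elim disjE) simp_all
  qed
qed

lemma bracket_word_control:
  assumes l: "l \<in> set (bracket_word \<sigma> c (coords y))" and "0 \<le> \<sigma>" "\<sigma> \<le> 1" "\<forall>\<alpha>. \<bar>c \<alpha>\<bar> \<le> 1"
  shows "fst (leg_vector l) = fst y" "norm (snd (leg_vector l) - snd y) \<le> real CARD('m) * \<sigma>"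
proof -
  obtain \<alpha> where "l \<in> set (word \<sigma> (c \<alpha>) (coords y) \<alpha>)" using l by (auto simp: bracket_word_def)
  note w = word_control[OF this assms(2,3) spec[OF assms(4)]]
  show "fst (leg_vector l) = fst y" using w[of None] by (simp add: leg_vector_def of_coords_def coords_def)
  have "norm (snd (leg_vector l) - snd y) \<le> (\<Sum>i\<in>(UNIV::'m set). \<bar>(snd (leg_vector l) - snd y) $ i\<bar>)" by (rule norm_le_l1_cart)
  also have "\<dots> \<le> (\<Sum>i\<in>(UNIV::'m set). \<sigma>)"
  proof (rule sum_mono)
    fix i :: 'm
    show "\<bar>(snd (leg_vector l) - snd y) $ i\<bar> \<le> \<sigma>" using w[of "Some i"] by (simp add: leg_vector_def of_coords_def coords_def)
  qed
  finally show "norm (snd (leg_vector l) - snd y) \<le> real CARD('m) * \<sigma>" by simp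
qed

end

section \<open>Paths and their cost\<close>

text \<open>\<open>\<mu>\<close> is the factor by which a control of size \<open>n\<close> is slowed
  down to size at most \<open>R\<close>. Extra time and remaining quadratic cost are both dominated
  by n^q: large \<open>n\<close> uses q > 1, small \<open>n\<close> uses q \<le> 2.\<close>

lemma truncation_estimates:
  fixes R q n :: real
  assumes R: "R \<ge> 1" and q: "1 < q" "q \<le> 2" and n: "n \<ge> 0"
  defines "\<mu> \<equiv> max 1 (n / R)"
  shows "\<mu> \<ge> 1" "\<mu> - 1 \<le> R powr (-q) * n powr q" "n / \<mu> \<le> R" "\<mu> * (n / \<mu>)^2 \<le> R^2 * R powr (-q) * n powr q"
proof -
  show m1: "\<mu> \<ge> 1" by (simp add: \<mu>_def)
  have eq: "R powr (-q) * n powr q = (n / R) powr q"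
    using R n by (simp add: powr_divide powr_minus field_simps)
  show "\<mu> - 1 \<le> R powr (-q) * n powr q"
  proof (cases "n \<le> R")
    case True then show ?thesis using R by (simp add: \<mu>_def)
  next
    case False
    then have g: "n / R \<ge> 1" using R by simp
    then have "n / R \<le> (n / R) powr q" using powr_mono[of 1 q "n / R"] q g n R by simp
    then show ?thesis using g unfolding eq \<mu>_def by simp
  qed
  show "n / \<mu> \<le> R"
  proof (cases "n \<le> R")
    case True then show ?thesis using R by (simp add: \<mu>_def max_def)
  next
    case False then show ?thesis using R n by (simp add: \<mu>_def max_def)
  qed
  show "\<mu> * (n / \<mu>)^2 \<le> R^2 * R powr (-q) * n powr q"
  proof (cases "n \<le> R")
    case True
    then have "n / R \<le> 1" using R by simp
    then have "(n / R) powr 2 \<le> (n / R) powr q" using powr_mono'[of q 2 "n / R"] q n R by simp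
    then have "(n / R)^2 \<le> (n / R) powr q" using n R by (simp add: powr_numeral)
    then have "R^2 * (n / R)^2 \<le> R^2 * (n / R) powr q" by (intro mult_left_mono) auto
    moreover have "\<mu> = 1" using True R by (simp add: \<mu>_def)
    moreover have "R^2 * (n / R)^2 = n^2" using R by (simp add: power_divide)
    ultimately show ?thesis unfolding mult.assoc eq by simp
  next
    case False
    then have g: "n / R \<ge> 1" using R by simp
    then have "n / R \<le> (n / R) powr q" using powr_mono[of 1 q "n / R"] q g n R by simp
    then have "R^2 * (n / R) \<le> R^2 * (n / R) powr q" by (intro mult_left_mono) auto
    moreover have "\<mu> = n / R" using g by (simp add: \<mu>_def)
    moreover have "n / R * (n / (n / R))^2 = R^2 * (n / R)" using False R by (simp add: power2_eq_square)
    ultimately show ?thesis unfolding mult.assoc eq by (simp only:)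
  qed
qed

text \<open>The Hessian enters as convexity on segments ending at 0, the form in which slowing down
  a control uses it; the derivative bound in x enters as a local Lipschitz bound.\<close>

locale lagrangian_system = generating_fields M X0 X
  for M :: "'a::euclidean_space set" and X0 and X :: "'m::finite \<Rightarrow> 'a \<Rightarrow> 'a" +
  fixes L :: "'a \<Rightarrow> real^'m \<Rightarrow> real" and C1 C2 K1 K2 q CL \<rho>L :: real
  assumes M_connected: "connected M"
    and L_continuous: "continuous_on (M \<times> UNIV) (\<lambda>z. L (fst z) (snd z))"
    and L_lower: "\<And>x u. x \<in> M \<Longrightarrow> C1 * norm u powr q + K1 \<le> L x u"
    and L_upper: "\<And>x u. x \<in> M \<Longrightarrow> L x u \<le> C2 * (norm u)\<^sup>2 + K2"
    and L_lipschitz: "\<And>x y u. x \<in> M \<Longrightarrow> y \<in> M \<Longrightarrow> dist x y < \<rho>L \<Longrightarrow> \<bar>L x u - L y u\<bar> \<le> CL * (norm u)\<^sup>2 * dist x y"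
    and L_convex0: "\<And>x u l. x \<in> M \<Longrightarrow> 0 \<le> l \<Longrightarrow> l \<le> 1 \<Longrightarrow> L x (l *\<^sub>R u) \<le> l * L x u + (1 - l) * L x 0"
    and const_pos: "C1 > 0" "C2 > 0" "K1 > 0" "K2 > 0" "q > 1" "CL \<ge> 0" "\<rho>L > 0"
begin

text \<open>Otherwise the lower bound would overtake the upper one for large controls. The size
  \<open>t\<close> is chosen with t^(q-2) equal to \<open>a\<close>, which is large enough for the
  contradiction.\<close>

lemma q_le_2: "q \<le> 2"
proof (rule ccontr)
  assume "\<not> q \<le> 2"
  then have q: "q - 2 > 0" by simp
  obtain x where x: "x \<in> M" using M_nonempty by blast
  define a where "a = (C2 + K2) / C1 + 1"
  have a: "a > 1" using const_pos by (simp add: a_def)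
  define t where "t = a powr (1 / (q - 2))"
  have t: "t \<ge> 1" using a q by (simp add: t_def ge_one_powr_ge_zero)
  define u where "u = t *\<^sub>R (axis undefined 1 :: real^'m)"
  have nu: "norm u = t" using t by (simp add: u_def)
  have "t powr q = t powr (q - 2) * t powr 2" by (simp add: powr_add[symmetric])
  also have "t powr (q - 2) = a" using a q by (simp add: t_def powr_powr)
  also have "t powr 2 = t^2" using t by (simp add: powr_numeral)
  finally have tq: "t powr q = a * t^2" .
  have "C1 * (a * t^2) + K1 \<le> C2 * t^2 + K2"
    using order_trans[OF L_lower[OF x, of u] L_upper[OF x, of u]] by (simp add: nu tq)
  moreover have "C1 * (a * t^2) = (C2 + K2 + C1) * t^2" using const_pos by (simp add: a_def field_simps)
  moreover have "K2 * t^2 \<ge> K2" using t const_pos by simp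
  moreover have "C1 * t^2 > 0" using t const_pos by simp
  ultimately show False using const_pos by (simp add: algebra_simps)
qed

text \<open>With \<open>L_ge_kk\<close>, the cost divided by \<open>kk\<close> bounds the integral
  of 1 + |u|, hence, up to \<open>\<Lambda>\<close>, the length of a path.\<close>

definition kk :: real where "kk = min C1 (K1 / 2)"

lemma kk_pos: "kk > 0" using const_pos by (simp add: kk_def)

lemma L_ge_kk: assumes x: "x \<in> M" shows "kk * (1 + norm u) \<le> L x u"
proof -
  have "norm u \<le> 1 + norm u powr q"
  proof (cases "norm u \<le> 1")
    case False
    then show ?thesis using powr_mono[of 1 q "norm u"] const_pos by simp
  qed (simp add: add_increasing2)
  then have "kk * (1 + norm u) \<le> kk * (2 + norm u powr q)" using kk_pos by (intro mult_left_mono) auto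
  also have "\<dots> = 2 * kk + kk * norm u powr q" by (simp add: algebra_simps)
  also have "\<dots> \<le> K1 + C1 * norm u powr q" by (intro add_mono mult_right_mono) (auto simp: kk_def)
  finally show ?thesis using L_lower[OF x, of u] by simp
qed

definition leg_cost :: "real \<Rightarrow> real^'m \<Rightarrow> 'a \<Rightarrow> real \<Rightarrow> real" where
  "leg_cost dr u x t = integral {0..t} (\<lambda>s. L (flow (1, u) x (dr * s)) u)"

lemma L_flow_continuous:
  assumes x: "x \<in> M" shows "continuous_on S (\<lambda>s. L (flow (1, u) x (dr * s)) u)"
proof -
  have "continuous_on S (\<lambda>s. (flow (1, u) x (dr * s), u))"
    by (intro continuous_intros continuous_on_compose2[OF flow_continuous_on[OF x, of UNIV]]) auto
  from continuous_on_compose2[OF L_continuous this] show ?thesis using flow_in[OF x] by auto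
qed

lemma leg_cost_integrable: "x \<in> M \<Longrightarrow> (\<lambda>s. L (flow (1, u) x (dr * s)) u) integrable_on {a..b}"
  by (intro integrable_continuous_interval L_flow_continuous)

lemma leg_cost_ge:
  assumes x: "x \<in> M" and t: "t \<ge> 0" and b: "\<And>y. y \<in> M \<Longrightarrow> b \<le> L y u" shows "b * t \<le> leg_cost dr u x t"
proof -
  have "integral {0..t} (\<lambda>s. b) \<le> leg_cost dr u x t"
    unfolding leg_cost_def by (intro integral_le leg_cost_integrable x) (auto intro: b flow_in x)
  then show ?thesis using t by (simp add: mult.commute)
qed

lemma leg_cost_le:
  assumes x: "x \<in> M" and t: "t \<ge> 0" and b: "\<And>y. y \<in> M \<Longrightarrow> L y u \<le> b" shows "leg_cost dr u x t \<le> b * t"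
proof -
  have "leg_cost dr u x t \<le> integral {0..t} (\<lambda>s. b)"
    unfolding leg_cost_def by (intro integral_le leg_cost_integrable x) (auto intro: b flow_in x)
  then show ?thesis using t by (simp add: mult.commute)
qed

lemma leg_cost_kk: "x \<in> M \<Longrightarrow> t \<ge> 0 \<Longrightarrow> t * (1 + norm u) \<le> leg_cost dr u x t / kk"
  using leg_cost_ge[of x t "kk * (1 + norm u)" u dr] L_ge_kk kk_pos by (simp add: field_simps)

lemma leg_cost_deriv:
  assumes x: "x \<in> M" and t: "0 \<le> t" "t \<le> b"
  shows "((\<lambda>t. leg_cost dr u x t) has_real_derivative L (flow (1, u) x (dr * t)) u) (at t within {0..b})"
  unfolding leg_cost_def has_real_derivative_iff_has_vector_derivative
  using t by (intro integral_has_vector_derivative L_flow_continuous x) auto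

lemma leg_cost_add:
  assumes x: "x \<in> M" and st: "s \<ge> 0" "t \<ge> 0"
  shows "leg_cost dr u x (s + t) = leg_cost dr u x s + leg_cost dr u (flow (1, u) x (dr * s)) t"
proof -
  let ?f = "\<lambda>r. L (flow (1, u) x (dr * r)) u"
  have "leg_cost dr u x (s + t) = integral {0..s} ?f + integral {s..s + t} ?f"
    unfolding leg_cost_def using st by (intro Henstock_Kurzweil_Integration.integral_combine[symmetric] leg_cost_integrable x) auto
  also have "integral {s..s + t} ?f = integral {0..t} (?f \<circ> (\<lambda>r. r + s))"
    using integral_shift[of 0 s t ?f] L_flow_continuous[OF x] by (simp add: add.commute)
  also have "?f \<circ> (\<lambda>r. r + s) = (\<lambda>r. L (flow (1, u) (flow (1, u) x (dr * s)) (dr * r)) u)"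
    using flow_add[OF x, of "(1, u)" "dr * s"] by (auto simp: algebra_simps)
  finally show ?thesis by (simp add: leg_cost_def)
qed

lemma leg_cost_reverse:
  assumes x: "x \<in> M" and t: "t \<ge> 0"
  shows "leg_cost (- dr) u (flow (1, u) x (dr * t)) t = leg_cost dr u x t"
proof -
  let ?f = "\<lambda>r. L (flow (1, u) x (dr * r)) u"
  have c: "continuous_on S (\<lambda>r. ?f (- r))" for S
    by (intro continuous_on_compose2[OF L_flow_continuous[OF x, of UNIV]] continuous_intros) auto
  have "(\<lambda>r. L (flow (1, u) (flow (1, u) x (dr * t)) (- dr * r)) u) = (\<lambda>r. ?f (- r)) \<circ> (\<lambda>r. r + (- t))"
    using flow_add[OF x, of "(1, u)" "dr * t", symmetric] by (auto simp: algebra_simps)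
  then have "leg_cost (- dr) u (flow (1, u) x (dr * t)) t = integral {0 + (-t)..t + (-t)} (\<lambda>r. ?f (- r))"
    unfolding leg_cost_def using integral_shift[of 0 "-t" t "\<lambda>r. ?f (- r)"] c by simp
  also have "\<dots> = integral {- t..- 0} (\<lambda>r. ?f (- r))" by simp
  also have "\<dots> = leg_cost dr u x t" unfolding leg_cost_def by (rule Henstock_Kurzweil_Integration.integral_reflect_real)
  finally show ?thesis .
qed

text \<open>Piecewise constant controls suffice. The direction \<open>dr\<close> is \<open>1\<close> or \<open>-1\<close>; duration and cost are counted positively in both.\<close>

inductive path :: "real \<Rightarrow> 'a \<Rightarrow> 'a \<Rightarrow> real \<Rightarrow> real \<Rightarrow> bool" for dr :: real where
  path_refl: "x \<in> M \<Longrightarrow> path dr x x 0 0"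
| path_step: "path dr x y T c \<Longrightarrow> t \<ge> 0 \<Longrightarrow> path dr x (flow (1, u) y (dr * t)) (T + t) (c + leg_cost dr u y t)"

lemma path_in: "path dr x y T c \<Longrightarrow> x \<in> M \<and> y \<in> M"
  by (induction rule: path.induct) (auto intro: flow_in)

lemma leg_cost_nonneg: assumes "x \<in> M" "t \<ge> 0" shows "leg_cost dr u x t \<ge> K1 * t" "leg_cost dr u x t \<ge> 0"
proof -
  show 1: "leg_cost dr u x t \<ge> K1 * t"
  proof (rule leg_cost_ge[OF assms])
    fix y assume "y \<in> M"
    then show "K1 \<le> L y u" using L_lower[of y u] const_pos(1) by (smt (verit) mult_nonneg_nonneg powr_ge_zero)
  qed
  show "leg_cost dr u x t \<ge> 0" using 1 assms(2) const_pos by (smt (verit) mult_nonneg_nonneg)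
qed

lemma path_nonneg: "path dr x y T c \<Longrightarrow> T \<ge> 0 \<and> c \<ge> 0 \<and> c \<ge> K1 * T"
proof (induction rule: path.induct)
  case (path_step x y T c t u)
  then show ?case using leg_cost_nonneg[of y t dr u] path_in[of dr x y T c] by (auto simp: algebra_simps)
qed auto

lemma path_single: "x \<in> M \<Longrightarrow> t \<ge> 0 \<Longrightarrow> path dr x (flow (1, u) x (dr * t)) t (leg_cost dr u x t)"
  using path_step[OF path_refl, of x t dr u] by simp

lemma path_trans: "path dr y z S d \<Longrightarrow> path dr x y T c \<Longrightarrow> path dr x z (T + S) (c + d)"
proof (induction rule: path.induct)
  case (path_step y z S d t u)
  show ?case using path.path_step[OF path_step.IH[OF path_step.prems] path_step.hyps(2)] by (simp add: add.assoc)
qed simp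

lemma path_rev: "path dr x y T c \<Longrightarrow> path (- dr) y x T c"
proof (induction rule: path.induct)
  case (path_refl x) then show ?case by (rule path.path_refl)
next
  case (path_step x y T c t u)
  have y: "y \<in> M" using path_step.hyps path_in by blast
  have "path (- dr) (flow (1, u) y (dr * t)) (flow (1, u) (flow (1, u) y (dr * t)) (- dr * t)) t (leg_cost (- dr) u (flow (1, u) y (dr * t)) t)"
    by (rule path_single[OF flow_in[OF y] path_step.hyps(2)])
  then have "path (- dr) (flow (1, u) y (dr * t)) y t (leg_cost dr u y t)"
    using leg_cost_reverse[OF y path_step.hyps(2)] flow_inverse[OF y, of "(1, u)" "dr * t"] by simp
  from path_trans[OF path_step.IH this] show ?case by (simp add: add.commute)
qed

lemma path_split:
  "path dr x y T c \<Longrightarrow> 0 \<le> S \<Longrightarrow> S \<le> T \<Longrightarrow> \<exists>z c1 c2. path dr x z S c1 \<and> path dr z y (T - S) c2 \<and> c = c1 + c2"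
proof (induction arbitrary: S rule: path.induct)
  case (path_refl x)
  then show ?case using path.path_refl[of x dr] by (intro exI[of _ x] exI[of _ 0]) auto
next
  case (path_step x y T c t u)
  have y: "y \<in> M" using path_step.hyps path_in by blast
  show ?case
  proof (cases "S \<le> T")
    case True
    then obtain z c1 c2 where "path dr x z S c1" "path dr z y (T - S) c2" "c = c1 + c2"
      using path_step.IH path_step.prems by blast
    then show ?thesis using path.path_step[of dr z y "T - S" c2 t u] path_step.hyps(2)
      by (intro exI[of _ z] exI[of _ c1] exI[of _ "c2 + leg_cost dr u y t"]) (auto simp: algebra_simps)
  next
    case False
    define s where "s = S - T"
    have s: "s \<ge> 0" "t - s \<ge> 0" using False path_step.prems by (auto simp: s_def)
    define z where "z = flow (1, u) y (dr * s)"
    have z: "z \<in> M" unfolding z_def by (rule flow_in[OF y])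
    have 1: "path dr x z (T + s) (c + leg_cost dr u y s)" unfolding z_def by (rule path.path_step[OF path_step.hyps(1) s(1)])
    have "flow (1, u) z (dr * (t - s)) = flow (1, u) y (dr * t)"
      unfolding z_def using flow_add[OF y, of "(1, u)" "dr * s" "dr * (t - s)"] by (simp add: algebra_simps)
    then have 2: "path dr z (flow (1, u) y (dr * t)) (t - s) (leg_cost dr u z (t - s))"
      using path_single[OF z s(2), of dr u] by simp
    have "leg_cost dr u y t = leg_cost dr u y s + leg_cost dr u z (t - s)"
      using leg_cost_add[OF y s, of dr u] by (simp add: z_def)
    then show ?thesis using 1 2
      by (intro exI[of _ z] exI[of _ "c + leg_cost dr u y s"] exI[of _ "leg_cost dr u z (t - s)"]) (auto simp: s_def algebra_simps)
  qed
qed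

lemma leg_flow: "y \<in> M \<Longrightarrow> flow (1, u) y t = flow (t, t *\<^sub>R u) y 1"
  using flow_scale[of y t "(1, u)" 1] by simp

lemma norm_leg: "norm (t, t *\<^sub>R u) \<le> \<bar>t\<bar> * (1 + norm (u::real^'m))"
  using norm_Pair_le[of t "t *\<^sub>R u"] by (simp add: algebra_simps)

lemma leg_kk:
  assumes "y \<in> M" "t \<ge> 0" "\<bar>dr\<bar> = 1"
  shows "norm (dr * t, (dr * t) *\<^sub>R u) \<le> leg_cost dr u y t / kk"
  using norm_leg[of "dr * t" u] leg_cost_kk[OF assms(1,2), of u dr] assms by (simp add: abs_mult)

lemma path_displacement:
  "path dr x y T c \<Longrightarrow> \<bar>dr\<bar> = 1 \<Longrightarrow> norm (y - x) \<le> \<Lambda> * (c / kk)"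
proof (induction rule: path.induct)
  case (path_step x y T c t u)
  have y: "y \<in> M" using path_step.hyps path_in by blast
  have "norm (flow (1, u) y (dr * t) - y) \<le> \<Lambda> * norm (dr * t, (dr * t) *\<^sub>R u)"
    unfolding leg_flow[OF y] by (rule flow_move1[OF y])
  also have "\<dots> \<le> \<Lambda> * (leg_cost dr u y t / kk)"
    using leg_kk[OF y path_step.hyps(2) path_step.prems] \<Lambda>_pos by (intro mult_left_mono) auto
  finally have "norm (flow (1, u) y (dr * t) - x) \<le> \<Lambda> * (leg_cost dr u y t / kk) + \<Lambda> * (c / kk)"
    using path_step.IH[OF path_step.prems] norm_triangle_ineq[of "flow (1, u) y (dr * t) - y" "y - x"] by simp
  then show ?case by (simp add: algebra_simps add_divide_distrib)
qed simp

text \<open>To first order a path depends only on its accumulated control \<open>U\<close>; the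
  order in which the controls are applied shows up quadratically in the cost.\<close>

lemma path_second_order:
  "path dr x y T c \<Longrightarrow> \<bar>dr\<bar> = 1 \<Longrightarrow> \<exists>U. T + norm U \<le> c / kk \<and> norm (y - x - V (dr * T, dr *\<^sub>R U) x) \<le> \<Lambda>\<^sup>2 * (c / kk)\<^sup>2"
proof (induction rule: path.induct)
  case (path_refl x)
  show ?case by (rule exI[of _ 0]) (simp add: vf_def)
next
  case (path_step x y T c t u)
  have xy: "x \<in> M" "y \<in> M" using path_step.hyps path_in by blast+
  define m where "m = c / kk"
  define d where "d = leg_cost dr u y t / kk"
  have m0: "m \<ge> 0" "d \<ge> 0" using path_nonneg[OF path_step.hyps(1)] leg_cost_nonneg[OF xy(2) path_step.hyps(2)] kk_pos by (auto simp: m_def d_def)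
  obtain U where U: "T + norm U \<le> m" "norm (y - x - V (dr * T, dr *\<^sub>R U) x) \<le> \<Lambda>\<^sup>2 * m\<^sup>2"
    using path_step.IH[OF path_step.prems] unfolding m_def by blast
  define w where "w = (dr * t, (dr * t) *\<^sub>R u)"
  have w: "norm w \<le> d" unfolding w_def d_def by (rule leg_kk[OF xy(2) path_step.hyps(2) path_step.prems])
  define y' where "y' = flow (1, u) y (dr * t)"
  have y': "y' = flow w y 1" unfolding y'_def w_def by (rule leg_flow[OF xy(2)])
  have a: "norm (y' - y - V w y) \<le> \<Lambda>\<^sup>2 * d\<^sup>2"
    unfolding y' using flow_second_order[OF xy(2), of w] power_mono[OF w norm_ge_zero, of 2]
    by (meson mult_left_mono order_trans zero_le_power2)
  have b: "norm (V w y - V w x) \<le> \<Lambda> * d * (\<Lambda> * m)"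
  proof -
    have "norm (V w y - V w x) \<le> \<Lambda> * norm w * norm (y - x)" by (rule V_lipschitz[OF xy(2,1)])
    also have "\<dots> \<le> \<Lambda> * d * (\<Lambda> * m)"
      using w path_displacement[OF path_step.hyps(1) path_step.prems] \<Lambda>_pos m0
      by (intro mult_mono) (auto simp: m_def intro: mult_left_mono)
    finally show ?thesis .
  qed
  have vs: "V (dr * (T + t), dr *\<^sub>R (U + t *\<^sub>R u)) x = V (dr * T, dr *\<^sub>R U) x + V w x"
    unfolding vf_add[symmetric] w_def by (simp add: algebra_simps)
  have eq: "y' - x - V (dr * (T + t), dr *\<^sub>R (U + t *\<^sub>R u)) x = (y' - y - V w y) - 0 + (V w y - V w x) + (y - x - V (dr * T, dr *\<^sub>R U) x)"
    unfolding vs by simp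
  have "norm (y' - x - V (dr * (T + t), dr *\<^sub>R (U + t *\<^sub>R u)) x) \<le> \<Lambda>\<^sup>2 * d\<^sup>2 + \<Lambda> * d * (\<Lambda> * m) + \<Lambda>\<^sup>2 * m\<^sup>2"
    unfolding eq by (rule order_trans[OF norm_diff_add3_le]) (use a b U(2) in simp)
  also have "\<dots> \<le> \<Lambda>\<^sup>2 * (m + d)\<^sup>2"
    using m0 \<Lambda>_pos by (simp add: power2_eq_square algebra_simps)
  also have "m + d = (c + leg_cost dr u y t) / kk" by (simp add: m_def d_def add_divide_distrib)
  finally have 1: "norm (y' - x - V (dr * (T + t), dr *\<^sub>R (U + t *\<^sub>R u)) x) \<le> \<Lambda>\<^sup>2 * ((c + leg_cost dr u y t) / kk)\<^sup>2" .
  have "T + t + norm (U + t *\<^sub>R u) \<le> (T + norm U) + t * (1 + norm u)"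
    using norm_triangle_ineq[of U "t *\<^sub>R u"] path_step.hyps(2) by (simp add: algebra_simps)
  also have "\<dots> \<le> m + d" using U(1) leg_cost_kk[OF xy(2) path_step.hyps(2), of u dr] by (simp add: d_def)
  finally show ?case using 1 unfolding y'_def
    by (intro exI[of _ "U + t *\<^sub>R u"]) (simp add: m_def d_def add_divide_distrib)
qed

text \<open>The mean value theorem is applied to the difference of the costs in the common parameter
  \<open>s\<close>. Slowing down multiplies L (u / \<mu>) by \<mu>, which convexity towards 0 bounds
  by L u plus \<mu> - 1 times L 0.\<close>

lemma leg_cost_compare:
  assumes y: "y \<in> M" and y2: "y2 \<in> M" and t: "t \<ge> 0" and \<mu>: "\<mu> \<ge> 1"
    and near: "\<And>s. 0 \<le> s \<Longrightarrow> s \<le> t \<Longrightarrow> dist (flow (1, u /\<^sub>R \<mu>) y2 (dr * (\<mu> * s))) (flow (1, u) y (dr * s)) \<le> D" and D: "D < \<rho>L"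
  shows "leg_cost dr (u /\<^sub>R \<mu>) y2 (\<mu> * t) \<le> leg_cost dr u y t + t * ((\<mu> - 1) * K2 + CL * (\<mu> * (norm u / \<mu>)^2) * D)"
proof (cases "t = 0")
  case True then show ?thesis by (simp add: leg_cost_def)
next
  case False
  then have tp: "0 < t" using t by simp
  let ?A = "\<lambda>s. leg_cost dr (u /\<^sub>R \<mu>) y2 (\<mu> * s) - leg_cost dr u y s"
  let ?d = "\<lambda>s. \<mu> * L (flow (1, u /\<^sub>R \<mu>) y2 (dr * (\<mu> * s))) (u /\<^sub>R \<mu>) - L (flow (1, u) y (dr * s)) u"
  have der: "(?A has_derivative (\<lambda>h. ?d s * h)) (at s within {0..t})" if s: "s \<in> {0..t}" for s
  proof -
    have "((\<lambda>s. leg_cost dr (u /\<^sub>R \<mu>) y2 s) has_real_derivative L (flow (1, u /\<^sub>R \<mu>) y2 (dr * (\<mu> * s))) (u /\<^sub>R \<mu>)) (at (\<mu> * s) within {0..\<mu> * t})"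
      using s \<mu> by (intro leg_cost_deriv y2) auto
    then have "((\<lambda>s. leg_cost dr (u /\<^sub>R \<mu>) y2 s) has_real_derivative L (flow (1, u /\<^sub>R \<mu>) y2 (dr * (\<mu> * s))) (u /\<^sub>R \<mu>)) (at (\<mu> * s) within (\<lambda>s. \<mu> * s) ` {0..t})"
      by (rule has_field_derivative_subset) (use \<mu> in auto)
    then have "((\<lambda>s. leg_cost dr (u /\<^sub>R \<mu>) y2 (\<mu> * s)) has_real_derivative L (flow (1, u /\<^sub>R \<mu>) y2 (dr * (\<mu> * s))) (u /\<^sub>R \<mu>) * \<mu>) (at s within {0..t})"
      by (rule DERIV_image_chain[of "\<lambda>s. leg_cost dr (u /\<^sub>R \<mu>) y2 s" _ "\<lambda>s. \<mu> * s", unfolded o_def]) (auto intro!: derivative_eq_intros)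
    moreover have "((\<lambda>s. leg_cost dr u y s) has_real_derivative L (flow (1, u) y (dr * s)) u) (at s within {0..t})"
      using s by (intro leg_cost_deriv y) auto
    ultimately have "(?A has_real_derivative ?d s) (at s within {0..t})"
      by (auto intro!: derivative_eq_intros)
    then show ?thesis by (simp add: has_field_derivative_def)
  qed
  from mvt_simple[OF tp der] obtain s where s: "s \<in> {0<..<t}" "?A t - ?A 0 = ?d s * (t - 0)" by auto
  define p where "p = flow (1, u) y (dr * s)"
  define p2 where "p2 = flow (1, u /\<^sub>R \<mu>) y2 (dr * (\<mu> * s))"
  have pM: "p \<in> M" "p2 \<in> M" unfolding p_def p2_def by (intro flow_in y y2)+
  have dp: "dist p2 p \<le> D" unfolding p_def p2_def using near s by simp
  have n: "norm (u /\<^sub>R \<mu>) = norm u / \<mu>" using \<mu> by (simp add: divide_inverse mult.commute)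
  have "\<bar>L p2 (u /\<^sub>R \<mu>) - L p (u /\<^sub>R \<mu>)\<bar> \<le> CL * (norm u / \<mu>)^2 * dist p2 p"
    using L_lipschitz[OF pM(2,1), of "u /\<^sub>R \<mu>"] dp D unfolding n by simp
  also have "\<dots> \<le> CL * (norm u / \<mu>)^2 * D" using dp const_pos by (intro mult_left_mono) auto
  finally have l1: "L p2 (u /\<^sub>R \<mu>) \<le> L p (u /\<^sub>R \<mu>) + CL * (norm u / \<mu>)^2 * D" by linarith
  have "L p ((1 / \<mu>) *\<^sub>R u) \<le> (1 / \<mu>) * L p u + (1 - 1 / \<mu>) * L p 0" using \<mu> by (intro L_convex0 pM) auto
  then have l2: "L p (u /\<^sub>R \<mu>) \<le> (1 / \<mu>) * L p u + (1 - 1 / \<mu>) * L p 0" by (simp add: divide_inverse)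
  have l3: "(1 - 1 / \<mu>) * L p 0 \<le> (1 - 1 / \<mu>) * K2" using L_upper[OF pM(1), of 0] \<mu> by (intro mult_left_mono) auto
  have "\<mu> * L p2 (u /\<^sub>R \<mu>) \<le> \<mu> * ((1 / \<mu>) * L p u + (1 - 1 / \<mu>) * K2 + CL * (norm u / \<mu>)^2 * D)"
    using l1 l2 l3 \<mu> by (intro mult_left_mono) auto
  also have "\<dots> = L p u + (\<mu> - 1) * K2 + CL * (\<mu> * (norm u / \<mu>)^2) * D"
    using \<mu> by (simp add: algebra_simps)
  finally have "?d s \<le> (\<mu> - 1) * K2 + CL * (\<mu> * (norm u / \<mu>)^2) * D" unfolding p_def p2_def by simp
  from mult_right_mono[OF this t] have "?A t - ?A 0 \<le> t * ((\<mu> - 1) * K2 + CL * (\<mu> * (norm u / \<mu>)^2) * D)"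
    unfolding s(2) by (simp add: mult.commute)
  then show ?thesis by (simp add: leg_cost_def)
qed

text \<open>Controls larger than \<open>R\<close> are slowed down to size \<open>R\<close>: since the cost bounds \<open>\<integral>\<bar>u\<bar>\<^sup>q\<close>, this delays the path by \<open>O(R\<^bsup>-q\<^esup>)\<close>
  only, and afterwards the Lagrangian is Lipschitz in space with an integrable constant.\<close>

lemma path_truncate:
  assumes R: "R \<ge> 1" and dr: "\<bar>dr\<bar> = 1" and x2: "x2 \<in> M" and D: "D < \<rho>L"
  defines "Rq \<equiv> R powr (- q)"
  shows "path dr x y T c \<Longrightarrow> exp (\<Lambda> * (c / kk)) * (norm (x2 - x) + \<Lambda> * (Rq * (c / C1))) \<le> D \<Longrightarrow>
    \<exists>y2 T2 c2. path dr x2 y2 T2 c2 \<and> norm (y2 - y) \<le> exp (\<Lambda> * (c / kk)) * (norm (x2 - x) + \<Lambda> * (Rq * (c / C1)))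
      \<and> T \<le> T2 \<and> T2 \<le> T + Rq * (c / C1) \<and> c2 \<le> c + (K2 + CL * R\<^sup>2 * D) * (Rq * (c / C1))"
proof (induction rule: path.induct)
  case (path_refl x)
  then show ?case using path.path_refl[OF x2, of dr] by (intro exI[of _ x2] exI[of _ 0]) auto
next
  case (path_step x y T c t u)
  have y: "y \<in> M" using path_step.hyps path_in by blast
  define d where "d = leg_cost dr u y t"
  have c0: "c \<ge> 0" and d0: "d \<ge> 0"
    using path_nonneg[OF path_step.hyps(1)] leg_cost_nonneg[OF y path_step.hyps(2)] by (auto simp: d_def)
  define e0 where "e0 = norm (x2 - x)"
  \<comment> \<open>The Gronwall bound for the displacement after cost \<open>c\<close>. Adding the
    delay of a leg of cost \<open>d\<close> and multiplying by exp (\<Lambda> d / kk) gives at most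
    \<open>E (c + d)\<close>.\<close>
  define E where "E c = exp (\<Lambda> * (c / kk)) * (e0 + \<Lambda> * (Rq * (c / C1)))" for c
  have Rq: "Rq > 0" using R by (simp add: Rq_def)
  have e0: "e0 \<ge> 0" by (simp add: e0_def)
  have Emono: "E c \<le> E (c + d)"
    unfolding E_def using c0 d0 \<Lambda>_pos kk_pos Rq const_pos e0
    by (intro mult_mono) (auto intro!: add_mono mult_left_mono divide_right_mono)
  have Ecd: "E (c + d) \<le> D" using path_step.prems by (simp add: E_def e0_def d_def)
  then have "E c \<le> D" using Emono by simp
  then obtain y2 T2 c2 where p2: "path dr x2 y2 T2 c2" and yb: "norm (y2 - y) \<le> E c" and T2: "T \<le> T2" "T2 \<le> T + Rq * (c / C1)"
    and c2: "c2 \<le> c + (K2 + CL * R\<^sup>2 * D) * (Rq * (c / C1))"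
    using path_step.IH unfolding E_def e0_def by blast
  have y2: "y2 \<in> M" using p2 path_in by blast
  define \<mu> where "\<mu> = max 1 (norm u / R)"
  note tr = truncation_estimates[OF R const_pos(5) q_le_2 norm_ge_zero[of u], folded \<mu>_def Rq_def]
  have dC: "norm u powr q * t \<le> d / C1"
  proof -
    have "(C1 * norm u powr q) * t \<le> d" unfolding d_def
      by (rule leg_cost_ge[OF y path_step.hyps(2)]) (use L_lower[of _ u] const_pos in fastforce)
    then show ?thesis using const_pos by (simp add: field_simps)
  qed
  have th: "(\<mu> - 1) * t \<le> Rq * (d / C1)"
  proof -
    have "(\<mu> - 1) * t \<le> (Rq * norm u powr q) * t" using tr(2) path_step.hyps(2) by (intro mult_right_mono)
    also have "\<dots> \<le> Rq * (d / C1)" using mult_left_mono[OF dC, of Rq] Rq by (simp add: mult.assoc)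
    finally show ?thesis .
  qed
  have dist: "norm (flow (1, u /\<^sub>R \<mu>) y2 (dr * (\<mu> * s)) - flow (1, u) y (dr * s)) \<le> E (c + d)" if s: "0 \<le> s" "s \<le> t" for s
  proof -
    \<comment> \<open>The slowed leg applies the same accumulated control during a longer time, so
      the two driving vectors differ only in the drift coordinate.\<close>
    define w where "w = (dr * s, (dr * s) *\<^sub>R u)"
    define w2 where "w2 = (dr * (\<mu> * s), (dr * s) *\<^sub>R u)"
    have e1: "flow (1, u) y (dr * s) = flow w y 1" unfolding w_def by (rule leg_flow[OF y])
    have e2: "flow (1, u /\<^sub>R \<mu>) y2 (dr * (\<mu> * s)) = flow w2 y2 1"
    proof -
      have sc: "(dr * (\<mu> * s)) *\<^sub>R (u /\<^sub>R \<mu>) = (dr * s) *\<^sub>R u" using tr(1) by simp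
      show ?thesis unfolding w2_def sc[symmetric] by (rule leg_flow[OF y2])
    qed
    have nw: "norm w \<le> d / kk"
    proof -
      have "norm w \<le> s * (1 + norm u)" unfolding w_def using norm_leg[of "dr * s" u] s dr by (simp add: abs_mult)
      also have "\<dots> \<le> t * (1 + norm u)" using s by (intro mult_right_mono) auto
      also have "\<dots> \<le> d / kk" unfolding d_def by (rule leg_cost_kk[OF y path_step.hyps(2)])
      finally show ?thesis .
    qed
    have nd: "norm (w - w2) \<le> Rq * (d / C1)"
    proof -
      have "norm (w - w2) = \<bar>dr * s - dr * (\<mu> * s)\<bar>" by (simp add: w_def w2_def)
      also have "\<dots> = \<bar>dr * ((\<mu> - 1) * s)\<bar>" by (simp add: algebra_simps abs_minus_commute)
      also have "\<dots> = (\<mu> - 1) * s" using dr s tr(1) by (simp add: abs_mult)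
      also have "\<dots> \<le> (\<mu> - 1) * t" using s tr(1) by (intro mult_left_mono) auto
      finally show ?thesis using th by simp
    qed
    have "norm (flow w2 y2 1 - flow w y 1) \<le> exp (\<Lambda> * norm w) * (norm (y - y2) + \<Lambda> * norm (w - w2))"
      using flow_compare[OF y y2, of w 1 w2] by (simp add: norm_minus_commute)
    also have "\<dots> \<le> exp (\<Lambda> * (d / kk)) * (E c + \<Lambda> * (Rq * (d / C1)))"
    proof (rule mult_mono[OF _ add_mono])
      show "exp (\<Lambda> * norm w) \<le> exp (\<Lambda> * (d / kk))" using mult_left_mono[OF nw, of \<Lambda>] \<Lambda>_pos by simp
      show "norm (y - y2) \<le> E c" using yb by (simp add: norm_minus_commute)
      show "\<Lambda> * norm (w - w2) \<le> \<Lambda> * (Rq * (d / C1))" using mult_left_mono[OF nd, of \<Lambda>] \<Lambda>_pos by simp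
      show "0 \<le> norm (y - y2) + \<Lambda> * norm (w - w2)" using \<Lambda>_pos by simp
    qed simp
    also have "\<dots> \<le> exp (\<Lambda> * (d / kk)) * (exp (\<Lambda> * (c / kk)) * (e0 + \<Lambda> * (Rq * (c / C1))) + exp (\<Lambda> * (c / kk)) * (\<Lambda> * (Rq * (d / C1))))"
    proof (rule mult_left_mono[OF add_mono])
      have "0 \<le> \<Lambda> * (Rq * (d / C1))" using \<Lambda>_pos Rq d0 const_pos by simp
      moreover have "1 \<le> exp (\<Lambda> * (c / kk))" using \<Lambda>_pos c0 kk_pos by simp
      ultimately show "\<Lambda> * (Rq * (d / C1)) \<le> exp (\<Lambda> * (c / kk)) * (\<Lambda> * (Rq * (d / C1)))" using mult_right_mono by fastforce
    qed (auto simp: E_def)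
    also have "\<dots> = E (c + d)" unfolding E_def add_divide_distrib distrib_left exp_add by (simp add: algebra_simps)
    finally show ?thesis unfolding e1 e2 .
  qed
  have cost: "leg_cost dr (u /\<^sub>R \<mu>) y2 (\<mu> * t) \<le> d + (K2 + CL * R\<^sup>2 * D) * (Rq * (d / C1))"
  proof -
    have "leg_cost dr (u /\<^sub>R \<mu>) y2 (\<mu> * t) \<le> d + t * ((\<mu> - 1) * K2 + CL * (\<mu> * (norm u / \<mu>)^2) * D)"
      unfolding d_def
    proof (rule leg_cost_compare[OF y y2 path_step.hyps(2) tr(1) _ D])
      fix s assume "0 \<le> s" "s \<le> t"
      from dist[OF this] Ecd show "dist (flow (1, u /\<^sub>R \<mu>) y2 (dr * (\<mu> * s))) (flow (1, u) y (dr * s)) \<le> D" by (simp add: dist_norm)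
    qed
    moreover have "t * ((\<mu> - 1) * K2) \<le> K2 * (Rq * (d / C1))"
      using mult_left_mono[OF th, of K2] const_pos by (simp add: mult_ac)
    moreover have "t * (CL * (\<mu> * (norm u / \<mu>)^2) * D) \<le> CL * R\<^sup>2 * D * (Rq * (d / C1))"
    proof -
      have "0 \<le> E (c + d)" unfolding E_def using \<Lambda>_pos Rq c0 d0 e0 const_pos
        by (intro mult_nonneg_nonneg add_nonneg_nonneg divide_nonneg_pos) auto
      then have D0: "0 \<le> D" using Ecd by simp
      have "t * (\<mu> * (norm u / \<mu>)^2) \<le> t * (R\<^sup>2 * Rq * norm u powr q)" using tr(4) path_step.hyps(2) by (intro mult_left_mono)
      also have "\<dots> = R\<^sup>2 * Rq * (norm u powr q * t)" by simp
      also have "\<dots> \<le> R\<^sup>2 * Rq * (d / C1)" using dC Rq by (intro mult_left_mono) auto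
      finally have "CL * D * (t * (\<mu> * (norm u / \<mu>)^2)) \<le> CL * D * (R\<^sup>2 * Rq * (d / C1))"
        using D0 const_pos by (intro mult_left_mono) auto
      then show ?thesis by (simp add: mult_ac)
    qed
    ultimately show ?thesis unfolding distrib_left distrib_right by linarith
  qed
  show ?case
  proof (intro exI conjI)
    show "path dr x2 (flow (1, u /\<^sub>R \<mu>) y2 (dr * (\<mu> * t))) (T2 + \<mu> * t) (c2 + leg_cost dr (u /\<^sub>R \<mu>) y2 (\<mu> * t))"
      using tr(1) path_step.hyps(2) by (intro path.path_step p2) auto
    show "norm (flow (1, u /\<^sub>R \<mu>) y2 (dr * (\<mu> * t)) - flow (1, u) y (dr * t)) \<le> exp (\<Lambda> * ((c + leg_cost dr u y t) / kk)) * (norm (x2 - x) + \<Lambda> * (Rq * ((c + leg_cost dr u y t) / C1)))"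
      using dist[of t] path_step.hyps(2) by (simp add: E_def e0_def d_def)
    show "T + t \<le> T2 + \<mu> * t" using T2(1) tr(1) path_step.hyps(2) mult_right_mono[of 1 \<mu> t] by simp
    show "T2 + \<mu> * t \<le> T + t + Rq * ((c + leg_cost dr u y t) / C1)"
      using T2(2) th by (simp add: d_def[symmetric] algebra_simps add_divide_distrib)
    have "c2 + leg_cost dr (u /\<^sub>R \<mu>) y2 (\<mu> * t) \<le> c + d + ((K2 + CL * R\<^sup>2 * D) * (Rq * (c / C1)) + (K2 + CL * R\<^sup>2 * D) * (Rq * (d / C1)))"
      using c2 cost by linarith
    also have "\<dots> = c + d + (K2 + CL * R\<^sup>2 * D) * (Rq * ((c + d) / C1))"
      unfolding distrib_left[symmetric] add_divide_distrib ..
    finally show "c2 + leg_cost dr (u /\<^sub>R \<mu>) y2 (\<mu> * t) \<le> c + leg_cost dr u y t + (K2 + CL * R\<^sup>2 * D) * (Rq * ((c + leg_cost dr u y t) / C1))"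
      by (simp add: d_def)
  qed
qed

text \<open>A leg run for time \<open>\<tau>\<close> uses the control obtained by dividing its
  vector by \<open>\<tau>\<close>; this is where the quadratic upper bound on L prices a
  word.\<close>

lemma path_of_run:
  assumes \<tau>: "\<tau> > 0" and b: "b \<ge> 0"
  shows "(\<forall>l\<in>set ls. fst (leg_vector l) = \<tau> \<and> norm (snd (leg_vector l)) \<le> b) \<Longrightarrow> x \<in> M \<Longrightarrow>
    \<exists>c. path 1 x (run ls x) (real (length ls) * \<tau>) c \<and> c \<le> real (length ls) * (\<tau> * (C2 * (b / \<tau>)\<^sup>2 + K2))"
proof (induction ls arbitrary: x)
  case Nil
  then show ?case using path_refl[of x 1] by (intro exI[of _ 0]) auto
next
  case (Cons l ls)
  define u where "u = snd (leg_vector l) /\<^sub>R \<tau>"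
  have l: "fst (leg_vector l) = \<tau>" "norm (snd (leg_vector l)) \<le> b" using Cons.prems by auto
  have leg_vector: "leg_vector l = (\<tau>, \<tau> *\<^sub>R u)" using l \<tau> by (simp add: u_def prod_eq_iff)
  define x1 where "x1 = flow (leg_vector l) x 1"
  have x1: "x1 = flow (1, u) x (1 * \<tau>)" using leg_flow[OF Cons.prems(2), of u \<tau>] by (simp add: x1_def leg_vector)
  have p1: "path 1 x x1 \<tau> (leg_cost 1 u x \<tau>)" unfolding x1 using \<tau> by (intro path_single Cons.prems(2)) auto
  have nu: "norm u \<le> b / \<tau>" using l \<tau> by (simp add: u_def divide_inverse mult.commute mult_right_mono)
  have c1: "leg_cost 1 u x \<tau> \<le> (C2 * (b / \<tau>)\<^sup>2 + K2) * \<tau>"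
  proof (rule leg_cost_le[OF Cons.prems(2)])
    fix y assume "y \<in> M"
    then have "L y u \<le> C2 * (norm u)\<^sup>2 + K2" by (rule L_upper)
    also have "\<dots> \<le> C2 * (b / \<tau>)\<^sup>2 + K2" using nu const_pos by (intro add_right_mono mult_left_mono power_mono) auto
    finally show "L y u \<le> C2 * (b / \<tau>)\<^sup>2 + K2" .
  qed (use \<tau> in simp)
  have "x1 \<in> M" unfolding x1_def by (rule flow_in[OF Cons.prems(2)])
  then obtain c where c: "path 1 x1 (run ls x1) (real (length ls) * \<tau>) c" "c \<le> real (length ls) * (\<tau> * (C2 * (b / \<tau>)\<^sup>2 + K2))"
    using Cons.IH[of x1] Cons.prems by auto
  show ?case using path_trans[OF c(1) p1] c(2) c1
    by (intro exI[of _ "leg_cost 1 u x \<tau> + c"]) (auto simp: x1_def algebra_simps)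
qed

end

section \<open>Controllability and perturbation of the endpoint\<close>

fun eps_chain :: "'a::metric_space set \<Rightarrow> real \<Rightarrow> nat \<Rightarrow> 'a \<Rightarrow> 'a \<Rightarrow> bool" where
  "eps_chain M r 0 x z \<longleftrightarrow> x = z"
| "eps_chain M r (Suc n) x z \<longleftrightarrow> (\<exists>y\<in>M. eps_chain M r n x y \<and> dist y z < r)"

lemma eps_chain_stay: "eps_chain M r n x z \<Longrightarrow> z \<in> M \<Longrightarrow> r > 0 \<Longrightarrow> eps_chain M r (n + k) x z"
  by (induction k) auto

lemma eps_chain_trans: "eps_chain M r n y z \<Longrightarrow> eps_chain M r m x y \<Longrightarrow> eps_chain M r (m + n) x z"
  by (induction n arbitrary: z) auto

lemma eps_chain_step: "dist x z < r \<Longrightarrow> x \<in> M \<Longrightarrow> eps_chain M r 1 x z"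
  by auto

lemma eps_chain_sym: "eps_chain M r n x z \<Longrightarrow> x \<in> M \<Longrightarrow> z \<in> M \<Longrightarrow> eps_chain M r n z x"
proof (induction n arbitrary: z)
  case (Suc n)
  then obtain y where y: "y \<in> M" "eps_chain M r n x y" "dist y z < r" by auto
  have "eps_chain M r n y x" using Suc.IH y Suc.prems by blast
  moreover have "eps_chain M r 1 z y" using y Suc.prems by (auto simp: dist_commute)
  ultimately show ?case using eps_chain_trans[of M r n y x 1 z] by simp
qed auto

text \<open>Points that chains reach and points that they do not reach have disjoint neighbourhoods
  of radius r/2, which a connected set excludes.\<close>

lemma eps_chain_exists:
  fixes M :: "'a::metric_space set"
  assumes con: "connected M" and r: "r > 0" and x: "x \<in> M" and z: "z \<in> M"
  shows "\<exists>n. eps_chain M r n x z"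
proof (rule ccontr)
  assume no: "\<not> ?thesis"
  define A where "A = {y\<in>M. \<exists>n. eps_chain M r n x y}"
  define U where "U = (\<Union>a\<in>A. ball a (r / 2))"
  define W where "W = (\<Union>b\<in>M - A. ball b (r / 2))"
  have "U \<inter> W \<inter> M = {}"
  proof (rule ccontr)
    assume "U \<inter> W \<inter> M \<noteq> {}"
    then obtain p where "p \<in> U" "p \<in> W" by blast
    then obtain a b where p: "a \<in> A" "dist a p < r / 2" "b \<in> M - A" "dist b p < r / 2" unfolding U_def W_def by auto
    then have "dist a b < r" using dist_triangle_half_r[of p a r b] by (simp add: dist_commute)
    moreover obtain n where "eps_chain M r n x a" "a \<in> M" using p by (auto simp: A_def)
    ultimately have "eps_chain M r (Suc n) x b" by auto
    then show False using p by (auto simp: A_def simp del: eps_chain.simps)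
  qed
  moreover have "M \<subseteq> U \<union> W"
  proof
    fix m assume m: "m \<in> M"
    have mm: "m \<in> ball m (r / 2)" using r by simp
    show "m \<in> U \<union> W"
    proof (cases "m \<in> A")
      case True then show ?thesis unfolding U_def using mm by blast
    next
      case False then show ?thesis unfolding W_def using mm m by blast
    qed
  qed
  moreover have "open U" "open W" by (auto simp: U_def W_def)
  ultimately have "U \<inter> M = {} \<or> W \<inter> M = {}" using con by (metis connectedD)
  moreover have "x \<in> A" unfolding A_def using x by (auto intro: exI[of _ 0])
  moreover have "z \<in> M - A" using z no by (simp add: A_def)
  ultimately have "{x} \<subseteq> U \<inter> M \<and> {z} \<subseteq> W \<inter> M \<and> (U \<inter> M = {} \<or> W \<inter> M = {})"
    using r x z half_gt_zero[OF r] centre_in_ball[of x "r/2"] centre_in_ball[of z "r/2"] unfolding U_def W_def by blast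
  then show False by blast
qed

text \<open>One number of steps serves all pairs: a chain may pause, and by compactness it passes
  through a finite net and a base point.\<close>

lemma eps_chain_uniform:
  fixes M :: "'a::metric_space set"
  assumes con: "connected M" and com: "compact M" and ne: "M \<noteq> {}" and r: "r > 0"
  shows "\<exists>N. \<forall>x\<in>M. \<forall>z\<in>M. eps_chain M r N x z"
proof -
  obtain x0 where x0: "x0 \<in> M" using ne by blast
  have "M \<subseteq> (\<Union>d\<in>M. ball d r)" using r by auto
  then obtain D where D: "D \<subseteq> M" "finite D" "M \<subseteq> (\<Union>d\<in>D. ball d r)"
    using compactE_image[OF com, of M "\<lambda>d. ball d r"] by auto
  have "\<forall>d\<in>M. \<exists>n. eps_chain M r n x0 d" using eps_chain_exists[OF con r x0] by blast
  from bchoice[OF this] obtain n where n: "\<forall>d\<in>M. eps_chain M r (n d) x0 d" by blast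
  define N where "N = Max (n ` D)"
  have nd: "eps_chain M r N x0 d" if "d \<in> D" for d
  proof -
    have "n d \<le> N" using that D(2) by (simp add: N_def)
    moreover have "d \<in> M" using that D by blast
    ultimately show ?thesis using eps_chain_stay[of M r "n d" x0 d "N - n d"] n r by simp
  qed
  have "eps_chain M r (1 + N + (N + 1)) x z" if "x \<in> M" "z \<in> M" for x z
  proof -
    obtain d where "d \<in> D" "x \<in> ball d r" using D(3) \<open>x \<in> M\<close> by blast
    moreover obtain e where "e \<in> D" "z \<in> ball e r" using D(3) \<open>z \<in> M\<close> by blast
    ultimately have de: "d \<in> D" "dist d x < r" "e \<in> D" "dist e z < r" by auto
    have deM: "d \<in> M" "e \<in> M" using de D by blast+
    have "eps_chain M r 1 x d" using de that by (intro eps_chain_step) (auto simp: dist_commute)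
    moreover have "eps_chain M r N d x0" by (rule eps_chain_sym[OF nd[OF de(1)] x0 deM(1)])
    ultimately have "eps_chain M r (1 + N) x x0" using eps_chain_trans by blast
    moreover have "eps_chain M r (N + 1) x0 z"
      using eps_chain_trans[OF eps_chain_step[OF de(4) deM(2)] nd[OF de(3)]] .
    ultimately show ?thesis using eps_chain_trans by blast
  qed
  then show ?thesis by blast
qed

context lagrangian_system
begin

lemma path_reach_ball:
  "\<exists>\<kappa>>0. \<forall>Z\<ge>0. \<exists>s0>0. \<forall>s \<tau> w x z. 0 < s \<longrightarrow> s \<le> s0 \<longrightarrow> 0 < \<tau> \<longrightarrow> \<tau> \<le> Z * s^2 \<longrightarrow> norm w \<le> Z * s^2 \<longrightarrow> x \<in> M \<longrightarrow> z \<in> M \<longrightarrow>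
    norm (z - flow (real nlegs *\<^sub>R (\<tau>, w)) x 1) \<le> \<kappa> * s^3 \<longrightarrow>
    (\<exists>c. path 1 x z (real nlegs * \<tau>) c \<and> c \<le> real nlegs * (\<tau> * (C2 * ((norm w + real CARD('m) * s) / \<tau>)\<^sup>2 + K2)))"
proof -
  obtain \<kappa> where \<kappa>: "\<kappa> > 0" and rb: "\<forall>Z\<ge>0. \<exists>s0>0. \<forall>s f x z. 0 < s \<longrightarrow> s \<le> s0 \<longrightarrow> (\<forall>p. \<bar>f p\<bar> \<le> Z * s^2) \<longrightarrow> x \<in> M \<longrightarrow> z \<in> M \<longrightarrow>
    norm (z - flow (of_coords (\<lambda>p. real nlegs * f p)) x 1) \<le> \<kappa> * s^3 \<longrightarrow> (\<exists>c. (\<forall>\<alpha>. \<bar>c \<alpha>\<bar> \<le> 1) \<and> run (bracket_word s c f) x = z)"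
    using reach_ball by blast
  have "\<exists>s0>0. \<forall>s \<tau> w x z. 0 < s \<longrightarrow> s \<le> s0 \<longrightarrow> 0 < \<tau> \<longrightarrow> \<tau> \<le> Z * s^2 \<longrightarrow> norm w \<le> Z * s^2 \<longrightarrow> x \<in> M \<longrightarrow> z \<in> M \<longrightarrow>
    norm (z - flow (real nlegs *\<^sub>R (\<tau>, w)) x 1) \<le> \<kappa> * s^3 \<longrightarrow>
    (\<exists>c. path 1 x z (real nlegs * \<tau>) c \<and> c \<le> real nlegs * (\<tau> * (C2 * ((norm w + real CARD('m) * s) / \<tau>)\<^sup>2 + K2)))" if Z: "Z \<ge> 0" for Z
  proof -
    obtain s0 where s0: "s0 > 0" "\<And>s f x z. 0 < s \<Longrightarrow> s \<le> s0 \<Longrightarrow> (\<forall>p. \<bar>f p\<bar> \<le> Z * s^2) \<Longrightarrow> x \<in> M \<Longrightarrow> z \<in> M \<Longrightarrow>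
      norm (z - flow (of_coords (\<lambda>p. real nlegs * f p)) x 1) \<le> \<kappa> * s^3 \<Longrightarrow> \<exists>c. (\<forall>\<alpha>. \<bar>c \<alpha>\<bar> \<le> 1) \<and> run (bracket_word s c f) x = z"
      using rb Z by meson
    show ?thesis
    proof (rule exI[of _ "min s0 1"], intro conjI allI impI)
      show "0 < min s0 1" using s0 by simp
      fix s \<tau> :: real and w :: "real^'m" and x z :: 'a
      assume a: "0 < s" "s \<le> min s0 1" "0 < \<tau>" "\<tau> \<le> Z * s^2" "norm w \<le> Z * s^2" "x \<in> M" "z \<in> M"
        "norm (z - flow (real nlegs *\<^sub>R (\<tau>, w)) x 1) \<le> \<kappa> * s^3"
      have f: "\<bar>coords (\<tau>, w) p\<bar> \<le> Z * s^2" for p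
        using a(3-5) component_le_norm_cart[of w] by (auto simp: coords_def split: option.split intro: order_trans)
      have "of_coords (\<lambda>p. real nlegs * coords (\<tau>, w) p) = real nlegs *\<^sub>R (\<tau>, w)"
        by (simp add: of_coords_def coords_def vec_eq_iff)
      then obtain c where c: "\<forall>\<alpha>. \<bar>c \<alpha>\<bar> \<le> 1" "run (bracket_word s c (coords (\<tau>, w))) x = z"
        using s0(2)[of s "coords (\<tau>, w)" x z] a f by auto
      define b where "b = norm w + real CARD('m) * s"
      have "fst (leg_vector l) = \<tau> \<and> norm (snd (leg_vector l)) \<le> b" if l: "l \<in> set (bracket_word s c (coords (\<tau>, w)))" for l
      proof -
        have w: "fst (leg_vector l) = \<tau>" "norm (snd (leg_vector l) - w) \<le> real CARD('m) * s"
          using bracket_word_control[OF l] a(1,2) c(1) by auto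
        then show ?thesis using norm_triangle_sub[of "snd (leg_vector l)" w] by (simp add: b_def)
      qed
      then show "\<exists>c. path 1 x z (real nlegs * \<tau>) c \<and> c \<le> real nlegs * (\<tau> * (C2 * ((norm w + real CARD('m) * s) / \<tau>)\<^sup>2 + K2))"
        using path_of_run[OF a(3), of b "bracket_word s c (coords (\<tau>, w))" x] a(1,6) c(2) length_bracket_word by (simp add: b_def)
    qed
  qed
  then show ?thesis using \<kappa> by blast
qed

lemma rest_path: "x \<in> M \<Longrightarrow> t \<ge> 0 \<Longrightarrow> \<exists>y\<in>M. \<exists>c. path 1 x y t c \<and> c \<le> K2 * t"
  using path_single[of x t 1 0] leg_cost_le[of x t 0 K2 1] L_upper[of _ 0] flow_in[of x "(1, 0)"]
  by (intro bexI[of _ "flow (1, 0) x (1 * t)"] exI[of _ "leg_cost 1 0 x t"]) auto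

text \<open>At one fixed scale \<open>s\<close> every point within distance \<open>r\<close> is
  reached in a fixed short time at a fixed cost. Chains of uniform length then join any two points,
  and the time left over is spent beforehand with control 0.\<close>

theorem controllability:
  "\<exists>B\<ge>0. \<forall>x\<in>M. \<forall>z\<in>M. \<exists>c. path 1 x z 1 c \<and> c \<le> B"
proof -
  obtain \<kappa> where \<kappa>: "\<kappa> > 0" and rb: "\<forall>Z\<ge>0. \<exists>s0>0. \<forall>s \<tau> w x z. 0 < s \<longrightarrow> s \<le> s0 \<longrightarrow> 0 < \<tau> \<longrightarrow> \<tau> \<le> Z * s^2 \<longrightarrow> norm w \<le> Z * s^2 \<longrightarrow> x \<in> M \<longrightarrow> z \<in> M \<longrightarrow>
    norm (z - flow (real nlegs *\<^sub>R (\<tau>, w)) x 1) \<le> \<kappa> * s^3 \<longrightarrow>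
    (\<exists>c. path 1 x z (real nlegs * \<tau>) c \<and> c \<le> real nlegs * (\<tau> * (C2 * ((norm w + real CARD('m) * s) / \<tau>)\<^sup>2 + K2)))"
    using path_reach_ball by blast
  have "\<exists>s0>0. \<forall>s \<tau> w x z. 0 < s \<longrightarrow> s \<le> s0 \<longrightarrow> 0 < \<tau> \<longrightarrow> \<tau> \<le> 1 * s^2 \<longrightarrow> norm w \<le> 1 * s^2 \<longrightarrow> x \<in> M \<longrightarrow> z \<in> M \<longrightarrow>
    norm (z - flow (real nlegs *\<^sub>R (\<tau>, w)) x 1) \<le> \<kappa> * s^3 \<longrightarrow>
    (\<exists>c. path 1 x z (real nlegs * \<tau>) c \<and> c \<le> real nlegs * (\<tau> * (C2 * ((norm w + real CARD('m) * s) / \<tau>)\<^sup>2 + K2)))"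
    by (rule rb[rule_format, of 1]) simp
  then obtain s where s: "s > 0" and step0: "\<And>\<tau> w x z. 0 < \<tau> \<Longrightarrow> \<tau> \<le> 1 * s^2 \<Longrightarrow> norm w \<le> 1 * s^2 \<Longrightarrow> x \<in> M \<Longrightarrow> z \<in> M \<Longrightarrow>
    norm (z - flow (real nlegs *\<^sub>R (\<tau>, w)) x 1) \<le> \<kappa> * s^3 \<Longrightarrow>
    \<exists>c. path 1 x z (real nlegs * \<tau>) c \<and> c \<le> real nlegs * (\<tau> * (C2 * ((norm w + real CARD('m) * s) / \<tau>)\<^sup>2 + K2))"
    by (meson order_refl)
  define r where "r = \<kappa> * s^3 / 2"
  have r: "r > 0" using \<kappa> s by (simp add: r_def)
  obtain N where N: "\<forall>x\<in>M. \<forall>z\<in>M. eps_chain M r N x z"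
    using eps_chain_uniform[OF M_connected M_compact M_nonempty r] by blast
  define m where "m = real nlegs"
  have m: "m \<ge> 1" using nlegs_pos by (simp add: m_def)
  \<comment> \<open>The conditions are admissibility at scale \<open>s\<close>, drift displacement
    at most \<open>r\<close>, and room for \<open>N\<close> steps in unit time.\<close>
  define \<tau> where "\<tau> = min (s^2) (min (r / (\<Lambda> * m)) (1 / (m * (real N + 1))))"
  have \<tau>: "0 < \<tau>" "\<tau> \<le> s^2" "\<tau> \<le> r / (\<Lambda> * m)" "\<tau> \<le> 1 / (m * (real N + 1))"
    using s r \<Lambda>_pos m by (auto simp: \<tau>_def intro!: divide_pos_pos mult_pos_pos)
  define c1 where "c1 = m * (\<tau> * (C2 * ((norm (0::real^'m) + real CARD('m) * s) / \<tau>)\<^sup>2 + K2))"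
  have c1: "c1 \<ge> 0" using m \<tau> const_pos by (simp add: c1_def)
  have step: "\<exists>c. path 1 x z (m * \<tau>) c \<and> c \<le> c1" if "x \<in> M" "z \<in> M" "dist x z < r" for x z
  proof -
    have "norm (z - flow (m *\<^sub>R (\<tau>, 0)) x 1) \<le> norm (z - x) + norm (x - flow (m *\<^sub>R (\<tau>, 0)) x 1)"
      using norm_triangle_ineq[of "z - x" "x - flow (m *\<^sub>R (\<tau>, 0)) x 1"] by simp
    also have "norm (x - flow (m *\<^sub>R (\<tau>, 0)) x 1) \<le> \<Lambda> * norm (m *\<^sub>R (\<tau>, 0::real^'m))"
      using flow_move1[OF that(1), of "m *\<^sub>R (\<tau>, 0)"] by (simp add: norm_minus_commute)
    also have "norm (m *\<^sub>R (\<tau>, 0::real^'m)) = m * \<tau>" using m \<tau> by (simp add: norm_Pair)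
    also have "\<Lambda> * (m * \<tau>) \<le> r" using \<tau>(3) \<Lambda>_pos m by (simp add: field_simps)
    also have "norm (z - x) + r \<le> \<kappa> * s^3" using that(3) by (simp add: dist_norm norm_minus_commute r_def)
    finally have "norm (z - flow (m *\<^sub>R (\<tau>, 0)) x 1) \<le> \<kappa> * s^3" by simp
    then show ?thesis using step0[of \<tau> 0 x z] \<tau> that s by (simp add: m_def c1_def)
  qed
  have chain: "\<exists>c. path 1 x z (real n * (m * \<tau>)) c \<and> c \<le> real n * c1" if "eps_chain M r n x z" "x \<in> M" "z \<in> M" for n x z
    using that
  proof (induction n arbitrary: z)
    case 0
    then show ?case using path_refl[of x 1] by (intro exI[of _ 0]) auto
  next
    case (Suc n)
    then obtain y where y: "y \<in> M" "eps_chain M r n x y" "dist y z < r" by auto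
    obtain c where c: "path 1 x y (real n * (m * \<tau>)) c" "c \<le> real n * c1" using Suc.IH y Suc.prems by blast
    obtain d where d: "path 1 y z (m * \<tau>) d" "d \<le> c1" using step[OF y(1) Suc.prems(3) y(3)] by blast
    show ?case using path_trans[OF d(1) c(1)] c(2) d(2) by (intro exI[of _ "c + d"]) (auto simp: algebra_simps)
  qed
  have Nt: "real N * (m * \<tau>) \<le> 1"
  proof -
    have "(m * (real N + 1)) * \<tau> \<le> (m * (real N + 1)) * (1 / (m * (real N + 1)))" using \<tau>(4) m by (intro mult_left_mono) auto
    also have "\<dots> = 1" using m by simp
    finally have "real N * (m * \<tau>) + m * \<tau> \<le> 1" by (simp add: algebra_simps)
    moreover have "0 \<le> m * \<tau>" using m \<tau> by simp
    ultimately show ?thesis by linarith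
  qed
  show ?thesis
  proof (rule exI[of _ "K2 + real N * c1"], intro conjI ballI)
    show "0 \<le> K2 + real N * c1" using const_pos c1 by simp
    fix x z assume xz: "x \<in> M" "z \<in> M"
    obtain y c where y: "y \<in> M" "path 1 x y (1 - real N * (m * \<tau>)) c" "c \<le> K2 * (1 - real N * (m * \<tau>))"
      using rest_path[OF xz(1), of "1 - real N * (m * \<tau>)"] Nt by auto
    obtain d where d: "path 1 y z (real N * (m * \<tau>)) d" "d \<le> real N * c1" using chain N y(1) xz(2) by blast
    have "0 \<le> K2 * (real N * (m * \<tau>))" using const_pos m \<tau> by simp
    then have "c \<le> K2" using y(3) by (simp add: right_diff_distrib)
    then show "\<exists>c. path 1 x z 1 c \<and> c \<le> K2 + real N * c1"
      using path_trans[OF d(1) y(2)] d(2) by (intro exI[of _ "c + d"]) auto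
  qed
qed

section \<open>Cutting out a slot and perturbing the endpoint\<close>

text \<open>Pigeonhole: one of \<open>n\<close> consecutive slots costs at most the average. The
  induction also delivers the two pieces around the slot.\<close>

lemma cheap_slot:
  assumes e: "e \<ge> 0"
  shows "n \<ge> 1 \<Longrightarrow> path 1 x y (real n * e) c \<Longrightarrow>
    \<exists>z1 z2 t1 t3 c1 c2 c3. path 1 x z1 t1 c1 \<and> path 1 z1 z2 e c2 \<and> path 1 z2 y t3 c3 \<and> t1 + e + t3 = real n * e
      \<and> c = c1 + c2 + c3 \<and> c2 \<le> c / real n"
proof (induction n arbitrary: x c)
  case (Suc n)
  have xy: "x \<in> M" "y \<in> M" using Suc.prems path_in by blast+
  have "e \<le> real (Suc n) * e" using e by (simp add: algebra_simps)
  then obtain z ca cb where z: "path 1 x z e ca" "path 1 z y (real (Suc n) * e - e) cb" "c = ca + cb"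
    using path_split[OF Suc.prems(2) e] by blast
  have z2: "path 1 z y (real n * e) cb" using z(2) by (simp add: algebra_simps)
  show ?case
  proof (cases "ca \<le> c / real (Suc n)")
    case True
    show ?thesis
    proof (intro exI conjI)
      show "path 1 x x 0 0" by (rule path_refl[OF xy(1)])
      show "path 1 x z e ca" "path 1 z y (real n * e) cb" by (rule z z2)+
      show "c = 0 + ca + cb" using z by simp
      show "ca \<le> c / real (Suc n)" by (rule True)
    qed (simp add: algebra_simps)
  next
    case False
    have n: "n \<ge> 1"
    proof (rule ccontr)
      assume "\<not> 1 \<le> n"
      then have "n = 0" by simp
      moreover have "cb \<ge> 0" using path_nonneg[OF z(2)] by blast
      ultimately show False using False unfolding z(3) by simp
    qed
    obtain z1 z2 t1 t3 c1 c2 c3 where *: "path 1 z z1 t1 c1" "path 1 z1 z2 e c2" "path 1 z2 y t3 c3" "t1 + e + t3 = real n * e"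
      "cb = c1 + c2 + c3" "c2 \<le> cb / real n" using Suc.IH[OF n z2] by blast
    have "cb / real n \<le> c / real (Suc n)"
    proof -
      have "ca * real (Suc n) \<ge> c" using False by (simp add: field_simps)
      then have "cb * real (Suc n) \<le> c * real n" using z(3) by (simp add: algebra_simps)
      then show ?thesis using n by (simp add: field_simps)
    qed
    then have c2: "c2 \<le> c / real (Suc n)" using *(6) by linarith
    show ?thesis
    proof (intro exI conjI)
      show "path 1 x z1 (e + t1) (ca + c1)" by (rule path_trans[OF *(1) z(1)])
      show "path 1 z1 z2 e c2" "path 1 z2 y t3 c3" by (rule *)+
      show "e + t1 + e + t3 = real (Suc n) * e" using *(4) by (simp add: algebra_simps)
      show "c = ca + c1 + c2 + c3" using *(5) z(3) by simp
    qed (rule c2)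
  qed
qed simp

end

text \<open>With y = h / v^3 one has R = y^(1/q) and \<rho> = 1 / y, so R^2 \<rho>^2 = y^(2/q - 2),
  whose exponent is negative as q > 1. All quantities become small as \<open>n\<close> grows; v^2 =
  1/n is the slot length.\<close>

lemma slot_scales:
  fixes q a b c d e f g h :: real
  assumes q: "q > 1" and h: "h \<ge> 1" and pos: "b > 0" "d > 0" "f > 0"
  shows "\<exists>n::nat. n \<ge> 1 \<and> (let v = 1 / sqrt n; \<rho> = v^3 / h; R = (h / v^3) powr (1 / q) in
     R \<ge> 1 \<and> R powr (- q) = \<rho> \<and> a * v \<le> b \<and> c * (\<rho> / v^2) \<le> d \<and> (e + g * R^2 * \<rho>) * \<rho> \<le> f)"
proof -
  define v where "v n = 1 / sqrt (real n)" for n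
  define y where "y n = h / v n ^ 3" for n
  have v0: "v \<longlonglongrightarrow> 0" unfolding v_def[abs_def]
    by (intro tendsto_divide_0[OF tendsto_const] filterlim_at_top_imp_at_infinity
        filterlim_compose[OF sqrt_at_top] filterlim_real_sequentially)
  have y_eq: "y n = h * (sqrt n)^3" for n by (simp add: y_def v_def power_divide)
  have y_ge: "y n \<ge> real n" if "n \<ge> 1" for n
  proof -
    have s: "sqrt n \<ge> 1" using that by simp
    have "real n = sqrt n ^ 2" by simp
    also have "\<dots> \<le> sqrt n ^ 3" using s by (intro power_increasing) auto
    also have "\<dots> \<le> y n" unfolding y_eq using h s mult_right_mono[of 1 h "sqrt n ^ 3"] by simp
    finally show ?thesis .
  qed
  have y_top: "filterlim y at_top sequentially"
    by (rule filterlim_at_top_mono[OF filterlim_real_sequentially])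
       (use y_ge in \<open>auto simp: eventually_sequentially\<close>)
  define R where "R n = y n powr (1 / q)" for n
  define \<rho> where "\<rho> n = v n ^ 3 / h" for n
  have \<rho>y: "\<rho> n = y n powr (- 1)" if "n \<ge> 1" for n
    using that h by (simp add: \<rho>_def y_def v_def powr_minus field_simps)
  have \<rho>0: "\<rho> \<longlonglongrightarrow> 0" unfolding \<rho>_def[abs_def]
    using tendsto_divide[OF tendsto_power[OF v0, of 3] tendsto_const[of h]] h by simp
  have ev1: "eventually (\<lambda>n. a * v n < b) sequentially"
    using order_tendstoD(2)[OF tendsto_mult[OF tendsto_const[of a] v0]] pos by simp
  have "(\<lambda>n. c * (v n / h)) \<longlonglongrightarrow> c * (0 / h)" by (intro tendsto_intros v0) (use h in auto)
  then have ev2: "eventually (\<lambda>n. c * (v n / h) < d) sequentially"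
    using order_tendstoD(2) pos by fastforce
  have "(\<lambda>n. y n powr (2 / q - 2)) \<longlonglongrightarrow> 0"
    by (rule tendsto_neg_powr[OF _ y_top]) (use q in \<open>simp add: field_simps\<close>)
  then have "(\<lambda>n. e * \<rho> n + g * (y n powr (2 / q - 2))) \<longlonglongrightarrow> e * 0 + g * 0"
    by (intro tendsto_intros \<rho>0)
  then have ev3: "eventually (\<lambda>n. e * \<rho> n + g * (y n powr (2 / q - 2)) < f) sequentially"
    using order_tendstoD(2) pos by fastforce
  have "eventually (\<lambda>n. n \<ge> 1 \<and> a * v n < b \<and> c * (v n / h) < d \<and> e * \<rho> n + g * (y n powr (2 / q - 2)) < f) sequentially"
    using eventually_ge_at_top[of 1] ev1 ev2 ev3 by eventually_elim auto
  then obtain n where n: "n \<ge> 1" "a * v n < b" "c * (v n / h) < d" "e * \<rho> n + g * (y n powr (2 / q - 2)) < f"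
    using eventually_happens'[OF sequentially_bot] by blast
  have vn: "v n > 0" using n by (simp add: v_def)
  have yn: "y n \<ge> 1" using y_ge[OF n(1)] n(1) by linarith
  have 1: "R n \<ge> 1" unfolding R_def using yn q by (simp add: ge_one_powr_ge_zero)
  have 2: "R n powr (- q) = \<rho> n" unfolding R_def \<rho>y[OF n(1)] using q by (simp add: powr_powr)
  have 3: "c * (\<rho> n / v n ^ 2) \<le> d"
    using n(3) vn by (simp add: \<rho>_def power2_eq_square power3_eq_cube)
  have "R n ^ 2 * \<rho> n * \<rho> n = y n powr (2 / q - 2)"
  proof -
    have "R n ^ 2 = y n powr (2 / q)"
      unfolding R_def power2_eq_square using yn by (simp add: powr_add[symmetric])
    then have "R n ^ 2 * \<rho> n * \<rho> n = y n powr (2 / q) * y n powr (- 1) * y n powr (- 1)"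
      unfolding \<rho>y[OF n(1)] by (simp only:)
    also have "\<dots> = y n powr (2 / q + - 1 + - 1)" by (simp only: powr_add)
    also have "2 / q + - 1 + - 1 = 2 / q - 2" by linarith
    finally show ?thesis .
  qed
  then have 4: "(e + g * R n ^ 2 * \<rho> n) * \<rho> n \<le> f" using n(4) by (simp add: algebra_simps)
  show ?thesis
    by (rule exI[of _ n]) (use n 1 2 3 4 in \<open>simp add: Let_def v_def \<rho>_def R_def y_def\<close>)
qed

context lagrangian_system
begin

text \<open>A slot of duration \<open>e = v\<^sup>2\<close> with cost \<open>O(e)\<close> is cut out of the path. Outside it, the two remaining pieces are truncated at
  \<open>R\<^bsup>-q\<^esup> = \<rho> \<sim> v\<^sup>3\<close>, which displaces their inner endpoints by \<open>O(v\<^sup>3)\<close>. Bracket words of size \<open>s = K v\<close> fit into the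
  slot, cost \<open>O(K\<^sup>2)\<close>, and reach every point at distance at most \<open>\<kappa> s\<^sup>3\<close> of the drift endpoint, which closes the gap; here the
  generating condition of order \<open>3\<close> matches the quadratic growth of \<open>L\<close>.\<close>

theorem path_endpoint_perturbation:
  assumes A: "A > 0" and \<eta>: "\<eta> > 0"
  shows "\<exists>\<delta>>0. \<forall>x y y' c. path 1 x y 1 c \<longrightarrow> c \<le> A \<longrightarrow> y' \<in> M \<longrightarrow> dist y' y < \<delta> \<longrightarrow> (\<exists>c'. path 1 x y' 1 c' \<and> c' \<le> c + \<eta>)"
proof -
  define N where "N = real nlegs"
  define m where "m = real CARD('m)"
  have N: "N \<ge> 1" using nlegs_pos by (simp add: N_def)
  have m: "m > 0" by (simp add: m_def)
  define B0 where "B0 = A / kk"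
  define a0 where "a0 = A / C1"
  define G where "G = exp (\<Lambda> * B0)"
  have B0: "B0 > 0" using A kk_pos by (simp add: B0_def)
  have a0: "a0 > 0" using A const_pos by (simp add: a0_def)
  have G: "G \<ge> 1" using \<Lambda>_pos B0 by (simp add: G_def)
  \<comment> \<open>Makes the leading term of the cost of the bracket word, 4 N^2 C2 m^2 K^2, equal
    to \<eta> / 4.\<close>
  define K where "K = sqrt (\<eta> / (16 * N^2 * C2 * m^2))"
  have K: "K > 0" using \<eta> N m const_pos by (simp add: K_def)
  have K2eq: "4 * N^2 * C2 * m^2 * K^2 = \<eta> / 4"
    using \<eta> N m const_pos by (simp add: K_def)
  \<comment> \<open>Chosen such that Z s^2 = (1 + B0) e, which dominates time and drift of each leg
    in the slot.\<close>
  define Z where "Z = (1 + B0) / K^2"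
  have Z: "Z \<ge> 0" using B0 by (simp add: Z_def)
  obtain \<kappa> where \<kappa>: "\<kappa> > 0" and rb: "\<forall>Z\<ge>0. \<exists>s0>0. \<forall>s \<tau> w x z. 0 < s \<longrightarrow> s \<le> s0 \<longrightarrow> 0 < \<tau> \<longrightarrow> \<tau> \<le> Z * s^2 \<longrightarrow> norm w \<le> Z * s^2 \<longrightarrow> x \<in> M \<longrightarrow> z \<in> M \<longrightarrow>
    norm (z - flow (real nlegs *\<^sub>R (\<tau>, w)) x 1) \<le> \<kappa> * s^3 \<longrightarrow>
    (\<exists>c. path 1 x z (real nlegs * \<tau>) c \<and> c \<le> real nlegs * (\<tau> * (C2 * ((norm w + real CARD('m) * s) / \<tau>)\<^sup>2 + K2)))"
    using path_reach_ball by blast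
  obtain s0 where s0: "s0 > 0" and reach': "\<forall>s \<tau> w x z. 0 < s \<longrightarrow> s \<le> s0 \<longrightarrow> 0 < \<tau> \<longrightarrow> \<tau> \<le> Z * s^2 \<longrightarrow> norm w \<le> Z * s^2 \<longrightarrow> x \<in> M \<longrightarrow> z \<in> M \<longrightarrow>
    norm (z - flow (N *\<^sub>R (\<tau>, w)) x 1) \<le> \<kappa> * s^3 \<longrightarrow>
    (\<exists>c. path 1 x z (N * \<tau>) c \<and> c \<le> N * (\<tau> * (C2 * ((norm w + m * s) / \<tau>)\<^sup>2 + K2)))"
    using rb[THEN spec, THEN mp, OF Z, folded N_def m_def] by (elim exE conjE)
  note reach = reach'[rule_format]
  \<comment> \<open>\<open>g1 * \<rho>\<close> bounds the displacement of each truncated piece,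
    \<open>g2 * \<rho>\<close> the gap that these displacements and the shortened slot open, and
    \<open>g3 * e^2\<close> the error of linearising twice over the slot.\<close>
  define g1 where "g1 = G * (1 + \<Lambda> * a0)"
  define g2 where "g2 = g1 + G * (g1 + 2 * \<Lambda> * a0)"
  define g3 where "g3 = 2 * \<Lambda>^2 * B0^2"
  have g: "g1 \<ge> 1" "g2 > 0" "g3 \<ge> 0"
  proof -
    have p: "\<Lambda> * a0 > 0" using \<Lambda>_pos a0 by simp
    show "g1 \<ge> 1" unfolding g1_def using G p mult_mono[of 1 G 1 "1 + \<Lambda> * a0"] by simp
    then show "g2 > 0" unfolding g2_def using G p by (simp add: add_pos_pos)
    show "g3 \<ge> 0" by (simp add: g3_def)
  qed
  \<comment> \<open>Keeps g2 \<rho> below half of \<kappa> s^3, the distance that a bracket word can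
    bridge.\<close>
  define h where "h = max 1 (2 * g2 / (\<kappa> * K^3))"
  have h: "h \<ge> 1" by (simp add: h_def)
  have hg: "g2 / h \<le> \<kappa> * K^3 / 2"
  proof -
    have "2 * g2 / (\<kappa> * K^3) \<le> h" by (simp add: h_def)
    then show ?thesis using \<kappa> K h by (simp add: field_simps)
  qed
  \<comment> \<open>The single condition big v \<le> 1 gathers the smallness conditions on
    \<open>v\<close>: truncated pieces stay within \<open>\<rho>L\<close>, \<open>s\<close> is at
    most \<open>s0\<close>, the linearisation error fits into the other half of \<kappa> s^3, and
    the lower-order cost is at most \<eta> / 4.\<close>
  define big where "big = g1 / \<rho>L + K / s0 + g3 / (\<kappa> * K^3 / 2) + (4 * N^2 * C2 * B0^2 + K2) / (\<eta> / 4) + 1"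
  have bigs: "g1 \<le> big * \<rho>L - \<rho>L" "K \<le> big * s0" "g3 \<le> big * (\<kappa> * K^3 / 2)" "4 * N^2 * C2 * B0^2 + K2 \<le> big * (\<eta> / 4)" "big \<ge> 1"
  proof -
    have t: "0 \<le> g1 / \<rho>L" "0 \<le> K / s0" "0 \<le> g3 / (\<kappa> * K^3 / 2)" "0 \<le> (4 * N^2 * C2 * B0^2 + K2) / (\<eta> / 4)"
      using g const_pos K s0 \<kappa> \<eta> N by simp_all
    have "g1 / \<rho>L \<le> big - 1" "K / s0 \<le> big" "g3 / (\<kappa> * K^3 / 2) \<le> big" "(4 * N^2 * C2 * B0^2 + K2) / (\<eta> / 4) \<le> big" "big \<ge> 1"
      unfolding big_def using t by linarith+
    then show "g1 \<le> big * \<rho>L - \<rho>L" "K \<le> big * s0" "g3 \<le> big * (\<kappa> * K^3 / 2)" "4 * N^2 * C2 * B0^2 + K2 \<le> big * (\<eta> / 4)" "big \<ge> 1"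
      using const_pos s0 \<kappa> K \<eta> by (simp_all add: pos_divide_le_eq left_diff_distrib)
  qed
  obtain n :: nat and v \<rho> R where n: "n \<ge> 1" and v: "v = 1 / sqrt n" and \<rho>: "\<rho> = v^3 / h" and R: "R \<ge> 1" and R\<rho>: "R powr (- q) = \<rho>"
    and l1: "big * v \<le> 1" and l2: "4 * a0 * (\<rho> / v^2) \<le> 1"
    and l3: "(2 * a0 * K2 + 2 * a0 * CL * g1 * R^2 * \<rho>) * \<rho> \<le> \<eta> / 4"
    using slot_scales[OF const_pos(5) h, of 1 1 "\<eta> / 4" big "4 * a0" "2 * a0 * K2" "2 * a0 * CL * g1"] \<eta>
    by (auto simp: Let_def)
  have vp: "0 < v" using n v by simp
  have v1: "v \<le> 1" using mult_right_mono[OF bigs(5), of v] l1 vp by linarith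
  define e where "e = v^2"
  have e: "e = 1 / real n" using v n by (simp add: e_def power_divide)
  have ep: "0 < e" "e \<le> v" using vp v1 by (simp_all add: e_def power2_eq_square mult_left_le_one_le)
  have \<rho>p: "\<rho> > 0" using vp h by (simp add: \<rho>)
  have \<rho>v: "\<rho> \<le> v" unfolding \<rho>
  proof -
    have "v^3 / h \<le> v^3 / 1" using vp h by (intro divide_left_mono) auto
    moreover have "v^3 \<le> v^1" using vp v1 by (intro power_decreasing) auto
    ultimately show "v^3 / h \<le> v" by simp
  qed
  have small: "c * v \<le> d" if "c \<le> big * d" "d > 0" for c d
  proof -
    have "c * v \<le> big * d * v" using that vp by (intro mult_right_mono) auto
    also have "\<dots> = d * (big * v)" by simp
    also have "\<dots> \<le> d * 1" using l1 that by (intro mult_left_mono) auto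
    finally show ?thesis by simp
  qed
  define D where "D = g1 * \<rho>"
  have D: "D < \<rho>L"
  proof -
    have "g1 * \<rho> \<le> g1 * v" using \<rho>v g by (intro mult_left_mono) auto
    also have "\<dots> \<le> (big * \<rho>L - \<rho>L) * v" using bigs(1) vp by (intro mult_right_mono) auto
    also have "\<dots> = \<rho>L * (big * v) - \<rho>L * v" by (simp add: algebra_simps)
    also have "\<dots> < \<rho>L * 1" using mult_left_mono[OF l1, of \<rho>L] const_pos vp mult_pos_pos[of \<rho>L v] by linarith
    finally show ?thesis by (simp add: D_def)
  qed
  define s where "s = K * v"
  have s: "0 < s" "s \<le> s0" using K vp small[OF bigs(2) s0] by (simp_all add: s_def)
  have s3: "\<kappa> * s^3 = \<kappa> * K^3 * v^3" by (simp add: s_def power_mult_distrib)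
  have Zs: "Z * s^2 = (1 + B0) * e" using K by (simp add: Z_def s_def power_mult_distrib e_def)
  have target: "g2 * \<rho> + g3 * e^2 \<le> \<kappa> * s^3"
  proof -
    have "g2 * \<rho> = g2 / h * v^3" by (simp add: \<rho>)
    also have "\<dots> \<le> \<kappa> * K^3 / 2 * v^3" using hg vp by (intro mult_right_mono) auto
    finally have 1: "g2 * \<rho> \<le> \<kappa> * K^3 / 2 * v^3" .
    have "g3 * e^2 = (g3 * v) * v^3" by (simp add: e_def power2_eq_square power3_eq_cube)
    also have "\<dots> \<le> (\<kappa> * K^3 / 2) * v^3" using small[OF bigs(3)] \<kappa> K vp by (intro mult_right_mono) auto
    finally show ?thesis using 1 unfolding s3 by simp
  qed
  have trb: "exp (\<Lambda> * (c / kk)) * (d + \<Lambda> * (\<rho> * (c / C1))) \<le> D" if "0 \<le> c" "c \<le> A" "0 \<le> d" "d \<le> \<rho>" for c d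
  proof -
    have c1: "c / kk \<le> B0" "c / C1 \<le> a0" using that kk_pos const_pos by (simp_all add: B0_def a0_def divide_right_mono)
    have "exp (\<Lambda> * (c / kk)) * (d + \<Lambda> * (\<rho> * (c / C1))) \<le> G * (\<rho> + \<Lambda> * (\<rho> * a0))"
    proof (rule mult_mono[OF _ add_mono])
      show "exp (\<Lambda> * (c / kk)) \<le> G" unfolding G_def using mult_left_mono[OF c1(1), of \<Lambda>] \<Lambda>_pos by simp
      show "\<Lambda> * (\<rho> * (c / C1)) \<le> \<Lambda> * (\<rho> * a0)" using c1(2) \<rho>p \<Lambda>_pos by (intro mult_left_mono) auto
      show "0 \<le> d + \<Lambda> * (\<rho> * (c / C1))" using that \<rho>p \<Lambda>_pos const_pos by simp
    qed (use that G in auto)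
    also have "\<dots> = D" by (simp add: D_def g1_def algebra_simps)
    finally show ?thesis .
  qed
  have main: "\<exists>c'. path 1 x y' 1 c' \<and> c' \<le> c + \<eta>"
    if p: "path 1 x y 1 c" and cA: "c \<le> A" and y': "y' \<in> M" and dy: "dist y' y < \<rho>" for x y y' c
  proof -
    have "real n * e = 1" using e n by simp
    then obtain z1 z2 t1 t3 c1 c2 c3 where cs: "path 1 x z1 t1 c1" "path 1 z1 z2 e c2" "path 1 z2 y t3 c3" "t1 + e + t3 = 1"
      "c = c1 + c2 + c3" "c2 \<le> c / real n"
      using cheap_slot[of e n x y c] ep n p by auto
    have xM: "x \<in> M" "z1 \<in> M" "z2 \<in> M" using cs path_in by blast+
    have c0: "c1 \<ge> 0" "c2 \<ge> 0" "c3 \<ge> 0" using cs path_nonneg by blast+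
    then have cb: "c1 \<le> A" "c3 \<le> A" using cs(5) cA by auto
    have c1a: "c1 / C1 \<le> a0" "c3 / C1 \<le> a0" using cb const_pos by (simp_all add: a0_def divide_right_mono)
    have D0: "0 \<le> D" using g \<rho>p by (simp add: D_def)
    define Q where "Q = (K2 + CL * R\<^sup>2 * D) * (\<rho> * a0)"
    have KD: "0 \<le> K2 + CL * R\<^sup>2 * D" using const_pos D0 by simp
    have Qle: "2 * Q \<le> \<eta> / 4" using l3 by (simp add: Q_def D_def algebra_simps)
    have "exp (\<Lambda> * (c1 / kk)) * (norm (x - x) + \<Lambda> * (R powr (- q) * (c1 / C1))) \<le> D"
      unfolding R\<rho> using trb[OF c0(1) cb(1), of 0] \<rho>p by simp
    from path_truncate[OF R _ xM(1) D cs(1) this]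
    obtain xt T1 c1' where 1: "path 1 x xt T1 c1'" "norm (xt - z1) \<le> exp (\<Lambda> * (c1 / kk)) * (norm (x - x) + \<Lambda> * (R powr (- q) * (c1 / C1)))"
      "t1 \<le> T1" "T1 \<le> t1 + R powr (- q) * (c1 / C1)" "c1' \<le> c1 + (K2 + CL * R\<^sup>2 * D) * (R powr (- q) * (c1 / C1))"
      by auto
    have 1: "path 1 x xt T1 c1'" "norm (xt - z1) \<le> D" "t1 \<le> T1" "T1 \<le> t1 + \<rho> * a0" "c1' \<le> c1 + Q"
    proof -
      show "path 1 x xt T1 c1'" "t1 \<le> T1" by (rule 1)+
      show "norm (xt - z1) \<le> D" using 1(2) unfolding R\<rho> using trb[OF c0(1) cb(1), of 0] \<rho>p by simp
      have *: "\<rho> * (c1 / C1) \<le> \<rho> * a0" using c1a \<rho>p by (intro mult_left_mono) auto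
      then show "T1 \<le> t1 + \<rho> * a0" using 1(4) unfolding R\<rho> by linarith
      show "c1' \<le> c1 + Q" using 1(5) mult_left_mono[OF * KD] unfolding R\<rho> Q_def by linarith
    qed
    \<comment> \<open>The tail is truncated backwards from the new endpoint, so that its
      displacement appears at the end of the slot.\<close>
    have r3: "path (- 1) y z2 t3 c3" by (rule path_rev[OF cs(3)])
    have nd: "norm (y' - y) \<le> \<rho>" using dy by (simp add: dist_norm)
    have "exp (\<Lambda> * (c3 / kk)) * (norm (y' - y) + \<Lambda> * (R powr (- q) * (c3 / C1))) \<le> D"
      unfolding R\<rho> by (rule trb[OF c0(3) cb(2) norm_ge_zero nd])
    from path_truncate[OF R _ y' D r3 this]
    obtain zs T3 c3' where 3: "path (- 1) y' zs T3 c3'" "norm (zs - z2) \<le> exp (\<Lambda> * (c3 / kk)) * (norm (y' - y) + \<Lambda> * (R powr (- q) * (c3 / C1)))"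
      "t3 \<le> T3" "T3 \<le> t3 + R powr (- q) * (c3 / C1)" "c3' \<le> c3 + (K2 + CL * R\<^sup>2 * D) * (R powr (- q) * (c3 / C1))"
      by auto
    have 3: "path 1 zs y' T3 c3'" "norm (zs - z2) \<le> D" "t3 \<le> T3" "T3 \<le> t3 + \<rho> * a0" "c3' \<le> c3 + Q"
    proof -
      show "path 1 zs y' T3 c3'" using path_rev[OF 3(1)] by simp
      show "t3 \<le> T3" by (rule 3)
      show "norm (zs - z2) \<le> D" using 3(2) unfolding R\<rho> using trb[OF c0(3) cb(2) norm_ge_zero nd] by linarith
      have *: "\<rho> * (c3 / C1) \<le> \<rho> * a0" using c1a \<rho>p by (intro mult_left_mono) auto
      then show "T3 \<le> t3 + \<rho> * a0" using 3(4) unfolding R\<rho> by linarith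
      show "c3' \<le> c3 + Q" using 3(5) mult_left_mono[OF * KD] unfolding R\<rho> Q_def by linarith
    qed
    have M2: "xt \<in> M" "zs \<in> M" using 1 3 path_in by blast+
    obtain U where U: "e + norm U \<le> c2 / kk" "norm (z2 - z1 - V (1 * e, 1 *\<^sub>R U) z1) \<le> \<Lambda>\<^sup>2 * (c2 / kk)\<^sup>2"
      using path_second_order[OF cs(2)] by auto
    have c2e: "c2 / kk \<le> B0 * e"
    proof -
      have "c / real n \<le> A / real n" using cA by (simp add: divide_right_mono)
      then have "c2 \<le> A * e" using cs(6) by (simp add: e)
      then show ?thesis using kk_pos by (simp add: B0_def divide_right_mono)
    qed
    \<comment> \<open>Both delays are recovered by shortening the slot, of which at least half
      remains.\<close>
    define e' where "e' = 1 - T1 - T3"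
    have a\<rho>: "4 * (\<rho> * a0) \<le> e"
      using l2 vp by (simp add: e_def divide_le_eq mult_ac)
    have e': "e' \<le> e" "e / 2 \<le> e'" "\<bar>e - e'\<bar> \<le> 2 * (\<rho> * a0)"
      using 1(3,4) 3(3,4) cs(4) a\<rho> unfolding e'_def by auto
    have e'p: "e' > 0" using e' ep by linarith
    \<comment> \<open>The word gets the accumulated control of the removed piece as its drift: its
      total drift (e', U) nearly reproduces that piece, and only an error of order v^3 is left for
      the brackets.\<close>
    define \<tau> where "\<tau> = e' / N"
    define w where "w = U /\<^sub>R N"
    have \<tau>p: "\<tau> > 0" using e'p N by (simp add: \<tau>_def)
    have Nw: "N *\<^sub>R (\<tau>, w) = (e', U)" using N by (simp add: \<tau>_def w_def)
    have N\<tau>: "N * \<tau> = e'" using N by (simp add: \<tau>_def)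
    have nU: "norm U \<le> B0 * e" using U(1) c2e ep by linarith
    have nw: "norm w \<le> B0 * e"
    proof -
      have "norm w \<le> norm U" unfolding w_def using N mult_left_le_one_le[of "norm U" "inverse N"] by (simp add: inverse_le_1_iff)
      then show ?thesis using nU by linarith
    qed
    have \<tau>e: "\<tau> \<le> e"
  proof -
    have "e' / N \<le> e' / 1" using e'p N by (intro divide_left_mono) auto
    then show ?thesis using e'(1) by (simp add: \<tau>_def)
  qed
    have "norm (zs - flow (e', U) xt 1) \<le> \<kappa> * s^3"
    proof -
      define W0 where "W0 = (e, U)"
      have nW: "norm W0 \<le> B0 * e"
        using norm_Pair_le[of e U] U(1) c2e ep by (simp add: W0_def)
      have a: "norm (z2 - z1 - V W0 z1) \<le> \<Lambda>\<^sup>2 * (B0 * e)\<^sup>2"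
      proof -
        have "(c2 / kk)\<^sup>2 \<le> (B0 * e)\<^sup>2" using c2e c0 kk_pos by (intro power_mono) auto
        then have "\<Lambda>\<^sup>2 * (c2 / kk)\<^sup>2 \<le> \<Lambda>\<^sup>2 * (B0 * e)\<^sup>2" by (intro mult_left_mono) auto
        then show ?thesis using U(2) by (simp add: W0_def)
      qed
      have b: "norm (flow W0 z1 1 - z1 - V W0 z1) \<le> \<Lambda>\<^sup>2 * (B0 * e)\<^sup>2"
      proof -
        have "norm (flow W0 z1 1 - z1 - V W0 z1) \<le> \<Lambda>\<^sup>2 * (norm W0)\<^sup>2" by (rule flow_second_order[OF xM(2)])
        also have "\<dots> \<le> \<Lambda>\<^sup>2 * (B0 * e)\<^sup>2" using nW by (intro mult_left_mono power_mono) auto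
        finally show ?thesis .
      qed
      have c: "norm (flow W0 z1 1 - flow (e', U) xt 1) \<le> G * (D + \<Lambda> * (2 * (\<rho> * a0)))"
      proof -
        have "norm (flow W0 z1 1 - flow (e', U) xt 1) \<le> exp (\<Lambda> * norm W0 * \<bar>1\<bar>) * (norm (z1 - xt) + \<Lambda> * norm (W0 - (e', U)) * \<bar>1\<bar>)"
          by (rule flow_compare[OF xM(2) M2(1)])
        also have "\<dots> \<le> G * (D + \<Lambda> * (2 * (\<rho> * a0)))"
        proof (rule mult_mono[OF _ add_mono])
          have "B0 * e \<le> B0 * 1" using ep v1 B0 by (intro mult_left_mono) auto
          then have "norm W0 \<le> B0" using nW by linarith
          then show "exp (\<Lambda> * norm W0 * \<bar>1\<bar>) \<le> G" using \<Lambda>_pos by (simp add: G_def mult_left_mono)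
          show "norm (z1 - xt) \<le> D" using 1(2) by (simp add: norm_minus_commute)
          have "norm (W0 - (e', U)) \<le> 2 * (\<rho> * a0)" using e'(3) by (simp add: W0_def)
          then show "\<Lambda> * norm (W0 - (e', U)) * \<bar>1\<bar> \<le> \<Lambda> * (2 * (\<rho> * a0))" using \<Lambda>_pos by (simp add: mult_left_mono)
        qed (use G \<Lambda>_pos in auto)
        finally show ?thesis .
      qed
      \<comment> \<open>The removed piece and the drift flow are compared through their common
        linearisation at \<open>z1\<close>.\<close>
      have eq: "zs - flow (e', U) xt 1 = (z2 - z1 - V W0 z1) - (flow W0 z1 1 - z1 - V W0 z1) + (zs - z2) + (flow W0 z1 1 - flow (e', U) xt 1)"
        by simp
      have "norm (zs - flow (e', U) xt 1) \<le> \<Lambda>\<^sup>2 * (B0 * e)\<^sup>2 + \<Lambda>\<^sup>2 * (B0 * e)\<^sup>2 + D + G * (D + \<Lambda> * (2 * (\<rho> * a0)))"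
        unfolding eq by (rule order_trans[OF norm_diff_add3_le]) (use a b c 3(2) in linarith)
      also have "\<dots> = g2 * \<rho> + g3 * e^2" by (simp add: g2_def g3_def D_def power_mult_distrib algebra_simps)
      also have "\<dots> \<le> \<kappa> * s^3" by (rule target)
      finally show ?thesis .
    qed
    moreover have "\<tau> \<le> Z * s^2" "norm w \<le> Z * s^2"
      unfolding Zs distrib_right using \<tau>e nw ep(1) mult_pos_pos[OF B0 ep(1)] by linarith+
    ultimately obtain cm where cm: "path 1 xt zs (N * \<tau>) cm" "cm \<le> N * (\<tau> * (C2 * ((norm w + m * s) / \<tau>)\<^sup>2 + K2))"
      using reach[OF s \<tau>p _ _ M2, of w] unfolding Nw by blast
    have cm2: "cm \<le> \<eta> / 2"
    proof -
      define b where "b = norm w + m * s"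
      have b0: "0 \<le> b" using m s by (simp add: b_def)
      have "b^2 \<le> 2 * (norm w)^2 + 2 * (m * s)^2" unfolding b_def
        using zero_le_power2[of "norm w - m * s"] by (simp add: power2_eq_square algebra_simps)
      also have "\<dots> \<le> 2 * (B0 * e)^2 + 2 * (m * s)^2" using nw by (intro add_right_mono mult_left_mono power_mono) auto
      also have "\<dots> = (2 * B0^2 * e + 2 * m^2 * K^2) * e" by (simp add: s_def e_def power_mult_distrib power2_eq_square algebra_simps)
      finally have b2: "b^2 \<le> (2 * B0^2 * e + 2 * m^2 * K^2) * e" .
      have inv\<tau>: "1 / \<tau> \<le> 2 * N / e"
      proof -
        have "e / (2 * N) \<le> \<tau>" using e'(2) N by (simp add: \<tau>_def field_simps)
        then show ?thesis using \<tau>p ep N by (simp add: field_simps)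
      qed
      have "N * (\<tau> * (C2 * (b / \<tau>)\<^sup>2 + K2)) = N * C2 * (b^2 * (1 / \<tau>)) + K2 * (N * \<tau>)"
        using \<tau>p by (simp add: power2_eq_square field_simps)
      also have "\<dots> \<le> N * C2 * ((2 * B0^2 * e + 2 * m^2 * K^2) * e * (2 * N / e)) + K2 * e"
      proof (intro add_mono mult_left_mono)
        show "b\<^sup>2 * (1 / \<tau>) \<le> (2 * B0\<^sup>2 * e + 2 * m\<^sup>2 * K\<^sup>2) * e * (2 * N / e)"
          using b2 inv\<tau> \<tau>p ep by (intro mult_mono) auto
      qed (use N const_pos e' N\<tau> in auto)
      also have "\<dots> = 4 * N^2 * C2 * m^2 * K^2 + (4 * N^2 * C2 * B0^2 + K2) * e"
        using ep by (simp add: power2_eq_square algebra_simps)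
      also have "\<dots> \<le> \<eta> / 4 + \<eta> / 4"
      proof (rule add_mono)
        show "4 * N\<^sup>2 * C2 * m\<^sup>2 * K\<^sup>2 \<le> \<eta> / 4" using K2eq by simp
        have "(4 * N\<^sup>2 * C2 * B0\<^sup>2 + K2) * e \<le> (4 * N\<^sup>2 * C2 * B0\<^sup>2 + K2) * v"
          using ep const_pos by (intro mult_left_mono) auto
        also have "\<dots> \<le> \<eta> / 4" using small[OF bigs(4)] \<eta> by simp
        finally show "(4 * N\<^sup>2 * C2 * B0\<^sup>2 + K2) * e \<le> \<eta> / 4" .
      qed
      finally show ?thesis using cm(2) by (simp add: b_def)
    qed
    have "path 1 x y' (T1 + N * \<tau> + T3) (c1' + cm + c3')"
      by (rule path_trans[OF 3(1) path_trans[OF cm(1) 1(1)]])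
    moreover have "T1 + N * \<tau> + T3 = 1" by (simp add: N\<tau> e'_def)
    moreover have "c1' + cm + c3' \<le> c + \<eta>" using 1(5) 3(5) cm2 Qle cs(5) c0 \<eta> by linarith
    ultimately show ?thesis by auto
  qed
  show ?thesis using main \<rho>p by (intro exI[of _ \<rho>]) blast
qed

end

section \<open>The weak KAM solution\<close>

text \<open>Evaluating at the product m n shows that every (w n - B) / n lies below every (w m + B)
  / m; \<open>h\<close> separates the two families.\<close>

lemma quasi_additive_slope:
  fixes w :: "nat \<Rightarrow> real"
  assumes w: "\<And>m n. m \<ge> 1 \<Longrightarrow> n \<ge> 1 \<Longrightarrow> \<bar>w (m + n) - w m - w n\<bar> \<le> B"
  shows "\<exists>h::real. \<forall>n\<ge>1. \<bar>w n - h * real n\<bar> \<le> B"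
proof -
  have mult: "\<bar>w (k * n) - k * w n\<bar> \<le> (real k - 1) * B" if "k \<ge> 1" "n \<ge> 1" for k n
    using that(1)
  proof (induction k rule: nat_induct_at_least)
    case (Suc k)
    have "\<bar>w (k * n + n) - w (k * n) - w n\<bar> \<le> B" using w[of "k * n" n] Suc.hyps that(2) by simp
    moreover have "Suc k * n = k * n + n" "real (Suc k) * w n = real k * w n + w n" "(real (Suc k) - 1) * B = (real k - 1) * B + B"
      by (simp_all add: algebra_simps)
    ultimately show ?case using Suc.IH by (simp only:)
  qed simp
  have B: "B \<ge> 0" using w[of 1 1] by simp
  have cmp: "(w n - B) / n \<le> (w m + B) / m" if "n \<ge> 1" "m \<ge> 1" for m n
  proof -
    have "m * (w n - B) \<le> w (m * n) - B" using mult[OF that(2,1)] by (simp add: abs_le_iff algebra_simps)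
    also have "\<dots> \<le> w (n * m) + B" using B by (simp add: mult.commute)
    also have "\<dots> \<le> n * (w m + B)" using mult[OF that] by (simp add: abs_le_iff algebra_simps)
    finally show ?thesis using that by (simp add: divide_simps mult_ac)
  qed
  define h where "h = (SUP n\<in>{1..}. (w n - B) / real n)"
  have bdd: "bdd_above ((\<lambda>n. (w n - B) / real n) ` {1..})"
    by (rule bdd_aboveI2[of _ _ "(w 1 + B) / real 1"]) (use cmp[of _ 1] in auto)
  show ?thesis
  proof (intro exI[of _ h] allI impI)
    fix n :: nat assume n: "n \<ge> 1"
    have "(w n - B) / real n \<le> h" unfolding h_def by (rule cSUP_upper[OF _ bdd]) (use n in auto)
    moreover have "h \<le> (w n + B) / real n" unfolding h_def by (rule cSUP_least) (use cmp n in auto)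
    ultimately show "\<bar>w n - h * real n\<bar> \<le> B" using n by (simp add: field_simps abs_le_iff)
  qed
qed

text \<open>The limit inferior at infinity, split into the two halves in which it is used.\<close>

lemma bounded_lower_limit_exists:
  fixes \<phi> :: "real \<Rightarrow> real"
  assumes \<phi>: "\<And>T. T \<ge> 1 \<Longrightarrow> \<bar>\<phi> T\<bar> \<le> K"
  shows "\<exists>l. (\<forall>\<epsilon>>0. \<exists>S\<ge>1. \<forall>T\<ge>S. \<phi> T \<ge> l - \<epsilon>) \<and> (\<forall>\<epsilon>>0. \<forall>S\<ge>1. \<exists>T\<ge>S. \<phi> T \<le> l + \<epsilon>)"
proof -
  define m where "m S = (INF T\<in>{S..}. \<phi> T)" for S
  have bd: "bdd_below (\<phi> ` {S..})" if "S \<ge> 1" for S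
  proof (rule bdd_belowI2)
    fix T assume "T \<in> {S..}"
    then show "- K \<le> \<phi> T" using \<phi>[of T] that by auto
  qed
  have m_le: "m S \<le> \<phi> T" if "1 \<le> S" "S \<le> T" for S T
    unfolding m_def by (rule cINF_lower[OF bd]) (use that in auto)
  define l where "l = (SUP S\<in>{1..}. m S)"
  have bda: "bdd_above (m ` {1..})"
  proof (rule bdd_aboveI2[of _ _ K])
    fix S :: real assume "S \<in> {1..}"
    then show "m S \<le> K" using m_le[of S S] \<phi>[of S] by auto
  qed
  have 1: "\<exists>S\<ge>1. \<forall>T\<ge>S. \<phi> T \<ge> l - \<epsilon>" if "\<epsilon> > 0" for \<epsilon>
  proof -
    have "l - \<epsilon> < (SUP S\<in>{1..}. m S)" using that by (simp add: l_def)
    then obtain S where "S \<ge> 1" "l - \<epsilon> < m S" by (subst (asm) less_cSUP_iff[OF _ bda]) auto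
    then show ?thesis using m_le[of S] by (intro exI[of _ S]) (meson less_imp_le order_trans)
  qed
  have 2: "\<exists>T\<ge>S. \<phi> T \<le> l + \<epsilon>" if "\<epsilon> > 0" and S: "S \<ge> 1" for \<epsilon> S
  proof -
    have "m S \<le> l" unfolding l_def by (rule cSUP_upper[OF _ bda]) (use that in auto)
    then have "(INF T\<in>{S..}. \<phi> T) < l + \<epsilon>" using that by (simp add: m_def)
    then obtain T where "T \<ge> S" "\<phi> T < l + \<epsilon>" by (subst (asm) cINF_less_iff[OF _ bd[OF S]]) auto
    then show ?thesis by (intro exI[of _ T]) simp
  qed
  show ?thesis by (intro exI[of _ l] conjI allI impI 1 2)
qed

context lagrangian_system
begin

section \<open>The least cost of reaching a point\<close>

text \<open>The starting point is free, so this is the Lax-Oleinik semigroup applied to the zero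
  function.\<close>

definition least_cost :: "real \<Rightarrow> 'a \<Rightarrow> real" where
  "least_cost T y = Inf {c. \<exists>x. path 1 x y T c}"

lemma path_to_exists: assumes y: "y \<in> M" and T: "T \<ge> 0" shows "\<exists>x c. path 1 x y T c \<and> c \<le> K2 * T"
proof -
  have "path (-1) y (flow (1, 0) y (-1 * T)) T (leg_cost (-1) 0 y T)" by (rule path_single[OF y T])
  then have "path 1 (flow (1, 0) y (-1 * T)) y T (leg_cost (-1) 0 y T)" using path_rev by fastforce
  moreover have "leg_cost (-1) 0 y T \<le> K2 * T" by (rule leg_cost_le[OF y T]) (use L_upper[of _ 0] in auto)
  ultimately show ?thesis by blast
qed

lemma least_cost_le: "path 1 x y T c \<Longrightarrow> least_cost T y \<le> c"
  unfolding least_cost_def by (rule cInf_lower) (auto intro!: bdd_belowI[of _ 0] dest: path_nonneg)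

lemma least_cost_near: assumes "y \<in> M" "T \<ge> 0" "\<eta> > 0" shows "\<exists>x c. path 1 x y T c \<and> c < least_cost T y + \<eta>"
proof -
  have ne: "{c. \<exists>x. path 1 x y T c} \<noteq> {}" using path_to_exists[OF assms(1,2)] by blast
  have "Inf {c. \<exists>x. path 1 x y T c} < least_cost T y + \<eta>" using assms(3) by (simp add: least_cost_def)
  from cInf_lessD[OF ne this] show ?thesis by blast
qed

lemma least_cost_bounds: assumes "y \<in> M" "T \<ge> 0" shows "0 \<le> least_cost T y" "least_cost T y \<le> K2 * T"
proof -
  have ne: "{c. \<exists>x. path 1 x y T c} \<noteq> {}" using path_to_exists[OF assms] by blast
  show "0 \<le> least_cost T y" unfolding least_cost_def by (rule cInf_greatest[OF ne]) (auto dest: path_nonneg)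
  show "least_cost T y \<le> K2 * T" using path_to_exists[OF assms] least_cost_le by fastforce
qed

lemma least_cost_step: assumes p: "path 1 x y S c" and T: "T \<ge> 0" shows "least_cost (T + S) y \<le> least_cost T x + c"
proof (rule field_le_epsilon)
  fix \<eta> :: real assume \<eta>: "\<eta> > 0"
  have "x \<in> M" using p path_in by blast
  then obtain z d where d: "path 1 z x T d" "d < least_cost T x + \<eta>" using least_cost_near T \<eta> by blast
  show "least_cost (T + S) y \<le> least_cost T x + c + \<eta>" using least_cost_le[OF path_trans[OF p d(1)]] d(2) by linarith
qed

lemma least_cost_split:
  assumes y: "y \<in> M" and T: "T \<ge> 0" and S: "S \<ge> 0" and \<eta>: "\<eta> > 0"
  shows "\<exists>x c. path 1 x y S c \<and> least_cost T x + c \<le> least_cost (T + S) y + \<eta>"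
proof -
  obtain z d where d: "path 1 z y (T + S) d" "d < least_cost (T + S) y + \<eta>" using least_cost_near[OF y _ \<eta>, of "T + S"] T S by auto
  obtain x c1 c2 where x: "path 1 z x T c1" "path 1 x y (T + S - T) c2" "d = c1 + c2"
    using path_split[OF d(1) T] S by auto
  then show ?thesis using least_cost_le[OF x(1)] d(2) by (intro exI[of _ x] exI[of _ c2]) auto
qed

definition osc :: real where "osc = (SOME B. B \<ge> 0 \<and> (\<forall>x\<in>M. \<forall>z\<in>M. \<exists>c. path 1 x z 1 c \<and> c \<le> B))"

lemma osc: "osc \<ge> 0" "x \<in> M \<Longrightarrow> z \<in> M \<Longrightarrow> \<exists>c. path 1 x z 1 c \<and> c \<le> osc"
  using someI_ex[OF controllability] unfolding osc_def by blast+

lemma least_cost_osc: assumes T: "T \<ge> 1" and x: "x \<in> M" and y: "y \<in> M" shows "least_cost T y \<le> least_cost T x + osc"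
proof (rule field_le_epsilon)
  fix \<eta> :: real assume \<eta>: "\<eta> > 0"
  obtain z c where z: "path 1 z x 1 c" "least_cost (T - 1) z + c \<le> least_cost (T - 1 + 1) x + \<eta>"
    using least_cost_split[OF x _ _ \<eta>, of "T - 1" 1] T by auto
  have "z \<in> M" "c \<ge> 0" using z path_in path_nonneg by blast+
  then obtain d where d: "path 1 z y 1 d" "d \<le> osc" using osc y by blast
  show "least_cost T y \<le> least_cost T x + osc + \<eta>" using least_cost_step[OF d(1), of "T - 1"] T d z \<open>c \<ge> 0\<close> by simp
qed

text \<open>Only the last unit of time of a nearly optimal path is perturbed. By controllability
  that part costs at most \<open>osc + 1\<close>, so the modulus does not depend on
  \<open>T\<close>.\<close>

lemma least_cost_equicontinuous:
  assumes \<eta>: "\<eta> > 0"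
  shows "\<exists>\<delta>>0. \<forall>T\<ge>1. \<forall>y\<in>M. \<forall>y'\<in>M. dist y' y < \<delta> \<longrightarrow> \<bar>least_cost T y' - least_cost T y\<bar> \<le> \<eta>"
proof -
  obtain \<delta> where \<delta>: "\<delta> > 0" and pert: "\<forall>x y y' c. path 1 x y 1 c \<longrightarrow> c \<le> osc + 1 \<longrightarrow> y' \<in> M \<longrightarrow> dist y' y < \<delta> \<longrightarrow> (\<exists>c'. path 1 x y' 1 c' \<and> c' \<le> c + \<eta> / 2)"
    using path_endpoint_perturbation[of "osc + 1" "\<eta> / 2"] osc \<eta> by auto
  have le: "least_cost T y' \<le> least_cost T y + \<eta>" if T: "T \<ge> 1" and y: "y \<in> M" "y' \<in> M" "dist y' y < \<delta>" for T y y'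
  proof -
    obtain x c where x: "path 1 x y 1 c" "least_cost (T - 1) x + c \<le> least_cost (T - 1 + 1) y + min (\<eta> / 2) 1"
      using least_cost_split[OF y(1), of "T - 1" 1 "min (\<eta> / 2) 1"] T \<eta> by auto
    have "x \<in> M" using x path_in by blast
    then obtain d where d: "path 1 x y 1 d" "d \<le> osc" using osc y by blast
    have "least_cost T y \<le> least_cost (T - 1) x + osc" using least_cost_step[OF d(1), of "T - 1"] T d by simp
    then have "c \<le> osc + 1" using x(2) by simp
    then obtain c' where c': "path 1 x y' 1 c'" "c' \<le> c + \<eta> / 2" using pert x(1) y by blast
    show ?thesis using least_cost_step[OF c'(1), of "T - 1"] T c' x(2) by simp
  qed
  have "\<bar>least_cost T y' - least_cost T y\<bar> \<le> \<eta>" if "T \<ge> 1" "y \<in> M" "y' \<in> M" "dist y' y < \<delta>" for T y y'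
    using le[OF that] le[of T y' y] that by (simp add: dist_commute abs_le_iff)
  then show ?thesis using \<delta> by blast
qed

text \<open>Splitting a nearly optimal path and joining two of them both change the cost by at most
  \<open>osc\<close>. The slope comes from integer times; fractional parts and other endpoints
  contribute bounded errors.\<close>

lemma least_cost_linear_growth: "\<exists>h K. \<forall>T\<ge>1. \<forall>x\<in>M. \<bar>least_cost T x - h * T\<bar> \<le> K"
proof -
  obtain y0 where y0: "y0 \<in> M" using M_nonempty by blast
  have quasi: "\<bar>least_cost (T + S) y0 - least_cost T y0 - least_cost S y0\<bar> \<le> osc" if T: "T \<ge> 1" and S: "S \<ge> 0" for T S
  proof -
    have "least_cost T y0 + least_cost S y0 - osc \<le> least_cost (T + S) y0"
    proof (rule field_le_epsilon)
      fix \<eta> :: real assume \<eta>: "\<eta> > 0"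
      obtain x c where x: "path 1 x y0 S c" "least_cost T x + c \<le> least_cost (T + S) y0 + \<eta>" using least_cost_split[OF y0 _ S \<eta>, of T] T by auto
      have "x \<in> M" using x path_in by blast
      then show "least_cost T y0 + least_cost S y0 - osc \<le> least_cost (T + S) y0 + \<eta>" using least_cost_osc[OF T _ y0] least_cost_le[OF x(1)] x(2) by fastforce
    qed
    moreover have "least_cost (T + S) y0 \<le> least_cost T y0 + least_cost S y0 + osc"
    proof (rule field_le_epsilon)
      fix \<eta> :: real assume \<eta>: "\<eta> > 0"
      obtain x c where x: "path 1 x y0 S c" "c < least_cost S y0 + \<eta>" using least_cost_near[OF y0 S \<eta>] by blast
      have "x \<in> M" using x path_in by blast
      then show "least_cost (T + S) y0 \<le> least_cost T y0 + least_cost S y0 + osc + \<eta>"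
        using least_cost_step[OF x(1), of T] least_cost_osc[OF T y0] T x(2) by fastforce
    qed
    ultimately show ?thesis by (simp add: abs_le_iff)
  qed
  have "\<exists>h::real. \<forall>n\<ge>1. \<bar>least_cost (real n) y0 - h * real n\<bar> \<le> osc"
    by (rule quasi_additive_slope) (use quasi in auto)
  then obtain h :: real where h: "\<And>n. n \<ge> 1 \<Longrightarrow> \<bar>least_cost (real n) y0 - h * real n\<bar> \<le> osc" by blast
  have "\<bar>least_cost T x - h * T\<bar> \<le> 3 * osc + K2 + \<bar>h\<bar>" if T: "T \<ge> 1" and x: "x \<in> M" for T x
  proof -
    define n where "n = nat \<lfloor>T\<rfloor>"
    define r where "r = T - real n"
    have n: "n \<ge> 1" "0 \<le> r" "r \<le> 1" using T unfolding n_def r_def by linarith+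
    have Tr: "T = real n + r" by (simp add: r_def)
    have "\<bar>least_cost T y0 - least_cost (real n) y0 - least_cost r y0\<bar> \<le> osc" unfolding Tr using quasi n by simp
    moreover have "0 \<le> least_cost r y0" "least_cost r y0 \<le> K2 * r" using least_cost_bounds[OF y0 n(2)] .
    moreover have "K2 * r \<le> K2" using n const_pos by simp
    moreover have "\<bar>h * r\<bar> \<le> \<bar>h\<bar>" using n by (simp add: abs_mult mult_left_le)
    moreover have "h * T = h * real n + h * r" by (simp add: Tr algebra_simps)
    moreover have "\<bar>least_cost T x - least_cost T y0\<bar> \<le> osc" using least_cost_osc[OF T x y0] least_cost_osc[OF T y0 x] by simp
    ultimately show ?thesis using h[OF n(1)] by linarith
  qed
  then show ?thesis by blast
qed

text \<open>Domination follows from the least cost along any path. Calibration is asserted up to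
  \<epsilon>, so that no minimising path has to exist.\<close>

theorem weak_kam_solution:
  "\<exists>h f Kf. continuous_on M f \<and> (\<forall>x\<in>M. \<bar>f x\<bar> \<le> Kf) \<and> (\<forall>x y t c. path 1 x y t c \<longrightarrow> f y \<le> f x + c - h * t)
     \<and> (\<forall>y\<in>M. \<forall>t\<ge>0. \<forall>\<epsilon>>0. \<exists>x c. path 1 x y t c \<and> f x + c - h * t \<le> f y + \<epsilon>)"
proof -
  obtain h K where hK: "\<And>T x. T \<ge> 1 \<Longrightarrow> x \<in> M \<Longrightarrow> \<bar>least_cost T x - h * T\<bar> \<le> K" using least_cost_linear_growth by blast
  define \<phi> where "\<phi> T x = least_cost T x - h * T" for T x
  have "\<forall>x\<in>M. \<exists>l. (\<forall>\<epsilon>>0. \<exists>S\<ge>1. \<forall>T\<ge>S. \<phi> T x \<ge> l - \<epsilon>) \<and> (\<forall>\<epsilon>>0. \<forall>S\<ge>1. \<exists>T\<ge>S. \<phi> T x \<le> l + \<epsilon>)"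
    by (intro ballI bounded_lower_limit_exists[of _ K]) (use hK \<phi>_def in auto)
  from bchoice[OF this] obtain f where f: "\<And>x \<epsilon>. x \<in> M \<Longrightarrow> \<epsilon> > 0 \<Longrightarrow> \<exists>S\<ge>1. \<forall>T\<ge>S. \<phi> T x \<ge> f x - \<epsilon>"
    "\<And>x \<epsilon> S. x \<in> M \<Longrightarrow> \<epsilon> > 0 \<Longrightarrow> S \<ge> 1 \<Longrightarrow> \<exists>T\<ge>S. \<phi> T x \<le> f x + \<epsilon>" by blast
  have bd: "\<bar>f x\<bar> \<le> K + 1" if x: "x \<in> M" for x
  proof -
    obtain S where S: "S \<ge> 1" "\<phi> S x \<ge> f x - 1" using f(1)[OF x, of 1] by auto
    obtain T where T: "T \<ge> 1" "\<phi> T x \<le> f x + 1" using f(2)[OF x, of 1 1] by auto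
    show ?thesis using S T hK[OF S(1) x] hK[OF T(1) x] by (simp add: \<phi>_def)
  qed
  have equi: "\<exists>\<delta>>0. (\<forall>T\<ge>1. \<forall>y\<in>M. \<forall>y'\<in>M. dist y' y < \<delta> \<longrightarrow> \<bar>\<phi> T y' - \<phi> T y\<bar> \<le> \<eta>) \<and> (\<forall>y\<in>M. \<forall>y'\<in>M. dist y' y < \<delta> \<longrightarrow> f y' \<le> f y + \<eta>)"
    if \<eta>: "\<eta> > 0" for \<eta>
  proof -
    obtain \<delta> where \<delta>: "\<delta> > 0" "\<And>T y y'. T \<ge> 1 \<Longrightarrow> y \<in> M \<Longrightarrow> y' \<in> M \<Longrightarrow> dist y' y < \<delta> \<Longrightarrow> \<bar>\<phi> T y' - \<phi> T y\<bar> \<le> \<eta>"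
      using least_cost_equicontinuous[OF \<eta>] unfolding \<phi>_def by auto
    have "f y' \<le> f y + \<eta>" if y: "y \<in> M" "y' \<in> M" "dist y' y < \<delta>" for y y'
    proof (rule field_le_epsilon)
      fix \<epsilon> :: real assume \<epsilon>: "\<epsilon> > 0"
      obtain S where S: "S \<ge> 1" "\<forall>T\<ge>S. \<phi> T y' \<ge> f y' - \<epsilon> / 2" using f(1)[OF y(2), of "\<epsilon> / 2"] \<epsilon> by auto
      obtain T where T: "T \<ge> S" "\<phi> T y \<le> f y + \<epsilon> / 2" using f(2)[OF y(1), of "\<epsilon> / 2" S] \<epsilon> S by auto
      have "\<phi> T y' \<ge> f y' - \<epsilon> / 2" using S T by blast
      moreover have "\<bar>\<phi> T y' - \<phi> T y\<bar> \<le> \<eta>" using \<delta>(2)[OF _ y, of T] S T by simp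
      ultimately show "f y' \<le> f y + \<eta> + \<epsilon>" using T(2) by linarith
    qed
    then show ?thesis using \<delta> by blast
  qed
  have cont: "continuous_on M f"
  proof (rule continuous_onI)
    fix x e assume x: "x \<in> M" and e: "(e::real) > 0"
    obtain \<delta> where \<delta>: "\<delta> > 0" "\<And>y y'. y \<in> M \<Longrightarrow> y' \<in> M \<Longrightarrow> dist y' y < \<delta> \<Longrightarrow> f y' \<le> f y + e"
      using equi[OF e] by blast
    show "\<exists>d>0. \<forall>x'\<in>M. dist x' x < d \<longrightarrow> dist (f x') (f x) \<le> e"
      using \<delta> x by (intro exI[of _ \<delta>]) (auto simp: dist_real_def abs_le_iff dist_commute algebra_simps)
  qed
  \<comment> \<open>Calibration evaluates the lower bound at a starting point that changes with
    \<open>T\<close>, hence it has to hold uniformly on M; equicontinuity and a finite net provide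
    this.\<close>
  have unif: "\<exists>S\<ge>1. \<forall>T\<ge>S. \<forall>x\<in>M. \<phi> T x \<ge> f x - \<epsilon>" if \<epsilon>: "\<epsilon> > 0" for \<epsilon>
  proof -
    have e3: "\<epsilon> / 3 > 0" using \<epsilon> by simp
    obtain \<delta> where \<delta>: "\<delta> > 0" "\<And>T y y'. T \<ge> 1 \<Longrightarrow> y \<in> M \<Longrightarrow> y' \<in> M \<Longrightarrow> dist y' y < \<delta> \<Longrightarrow> \<bar>\<phi> T y' - \<phi> T y\<bar> \<le> \<epsilon> / 3"
      "\<And>y y'. y \<in> M \<Longrightarrow> y' \<in> M \<Longrightarrow> dist y' y < \<delta> \<Longrightarrow> f y' \<le> f y + \<epsilon> / 3" using equi[OF e3] by blast
    have "M \<subseteq> (\<Union>d\<in>M. ball d \<delta>)" using \<delta> by auto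
    then obtain D where D: "D \<subseteq> M" "finite D" "M \<subseteq> (\<Union>d\<in>D. ball d \<delta>)"
      using compactE_image[OF M_compact, of M "\<lambda>d. ball d \<delta>"] by auto
    have "\<forall>d\<in>D. \<exists>S. S \<ge> 1 \<and> (\<forall>T\<ge>S. \<phi> T d \<ge> f d - \<epsilon> / 3)" using f(1)[OF _ e3] D by blast
    from bchoice[OF this] obtain S where S: "\<And>d. d \<in> D \<Longrightarrow> S d \<ge> 1" "\<And>d T. d \<in> D \<Longrightarrow> T \<ge> S d \<Longrightarrow> \<phi> T d \<ge> f d - \<epsilon> / 3" by blast
    define S0 where "S0 = 1 + (\<Sum>d\<in>D. S d)"
    have S0: "S0 \<ge> S d" if "d \<in> D" for d
      using member_le_sum[of d D S] that D(2) S(1) unfolding S0_def by (smt (verit) Diff_iff)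
    have "S0 \<ge> 1" unfolding S0_def using S(1) by (smt (verit) sum_nonneg)
    moreover have "\<phi> T x \<ge> f x - \<epsilon>" if T: "T \<ge> S0" and x: "x \<in> M" for T x
    proof -
      obtain d where d: "d \<in> D" "dist d x < \<delta>" using D(3) x by auto
      have dM: "d \<in> M" using d D by blast
      have "\<bar>\<phi> T x - \<phi> T d\<bar> \<le> \<epsilon> / 3" using \<delta>(2)[of T d x] T \<open>S0 \<ge> 1\<close> dM x d by (simp add: dist_commute)
      moreover have "\<phi> T d \<ge> f d - \<epsilon> / 3" using S(2)[OF d(1)] S0[OF d(1)] T by simp
      moreover have "f x \<le> f d + \<epsilon> / 3" using \<delta>(3)[of d x] dM x d by (simp add: dist_commute)
      ultimately show ?thesis by linarith
    qed
    ultimately show ?thesis by blast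
  qed
  have sub: "f y \<le> f x + c - h * t" if p: "path 1 x y t c" for x y t c
  proof (rule field_le_epsilon)
    fix \<epsilon> :: real assume \<epsilon>: "\<epsilon> > 0"
    have xy: "x \<in> M" "y \<in> M" "t \<ge> 0" using p path_in path_nonneg by blast+
    obtain S where S: "S \<ge> 1" "\<forall>T\<ge>S. \<phi> T y \<ge> f y - \<epsilon> / 2" using f(1)[OF xy(2), of "\<epsilon> / 2"] \<epsilon> by auto
    obtain T where T: "T \<ge> S" "\<phi> T x \<le> f x + \<epsilon> / 2" using f(2)[OF xy(1), of "\<epsilon> / 2" S] \<epsilon> S by auto
    have "\<phi> (T + t) y \<ge> f y - \<epsilon> / 2" using S T xy by simp
    moreover have "\<phi> (T + t) y \<le> \<phi> T x + c - h * t"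
      using least_cost_step[OF p, of T] S T by (simp add: \<phi>_def algebra_simps)
    ultimately show "f y \<le> f x + c - h * t + \<epsilon>" using T(2) by linarith
  qed
  have super: "\<exists>x c. path 1 x y t c \<and> f x + c - h * t \<le> f y + \<epsilon>" if y: "y \<in> M" and t: "t \<ge> 0" and \<epsilon>: "\<epsilon> > 0" for y t \<epsilon>
  proof -
    have e3: "\<epsilon> / 3 > 0" using \<epsilon> by simp
    obtain S where S: "S \<ge> 1" "\<And>T x. T \<ge> S \<Longrightarrow> x \<in> M \<Longrightarrow> \<phi> T x \<ge> f x - \<epsilon> / 3" using unif[OF e3] by blast
    obtain T' where T': "T' \<ge> S + t" "\<phi> T' y \<le> f y + \<epsilon> / 3" using f(2)[OF y e3, of "S + t"] S t by auto
    define T where "T = T' - t"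
    have T: "T \<ge> S" "T' = T + t" using T' by (simp_all add: T_def)
    obtain x c where x: "path 1 x y t c" "least_cost T x + c \<le> least_cost (T + t) y + \<epsilon> / 3" using least_cost_split[OF y _ t e3, of T] T S by auto
    have "x \<in> M" using x path_in by blast
    then have "\<phi> T x \<ge> f x - \<epsilon> / 3" using S T by blast
    then show ?thesis using x T' unfolding T(2) \<phi>_def by (intro exI[of _ x] exI[of _ c]) (simp add: algebra_simps)
  qed
  show ?thesis using cont bd sub super by blast
qed

end

section \<open>Viscosity property\<close>

lemma smooth_on_derivative:
  assumes "smooth_on U g"
  shows "open U" "y \<in> U \<Longrightarrow> (g has_derivative frechet_derivative g (at y)) (at y)"
    "continuous_on U (\<lambda>y. frechet_derivative g (at y) v)"
proof -
  have s: "smooth_k (Suc 0) U g" using assms unfolding smooth_on_def by blast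
  show "open U" using assms by (simp add: smooth_on_def)
  show "y \<in> U \<Longrightarrow> (g has_derivative frechet_derivative g (at y)) (at y)" using s frechet_derivative_works by auto
  show "continuous_on U (\<lambda>y. frechet_derivative g (at y) v)" using s by simp
qed

lemma frechet_uniform_modulus:
  fixes g :: "'a::euclidean_space \<Rightarrow> real"
  assumes g: "smooth_on U g" and x: "x \<in> U" and e: "e > 0"
  shows "\<exists>r>0. ball x r \<subseteq> U \<and> (\<forall>y\<in>ball x r. \<forall>w. \<bar>frechet_derivative g (at y) w - frechet_derivative g (at x) w\<bar> \<le> e * norm w)"
proof -
  note sd = smooth_on_derivative[OF g]
  define S where "S y = (\<Sum>b\<in>(Basis::'a set). \<bar>frechet_derivative g (at y) b - frechet_derivative g (at x) b\<bar>)" for y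
  have "continuous_on U S" unfolding S_def by (intro continuous_intros sd(3))
  then have "isCont S x" using sd(1) x continuous_on_eq_continuous_at by blast
  then obtain r1 where r1: "r1 > 0" "\<And>y. dist y x < r1 \<Longrightarrow> dist (S y) (S x) < e"
    unfolding continuous_at_eps_delta using e by metis
  have S0: "S x = 0" by (simp add: S_def)
  obtain r2 where r2: "r2 > 0" "ball x r2 \<subseteq> U" using sd(1) x open_contains_ball by blast
  show ?thesis
  proof (intro exI[of _ "min r1 r2"] conjI ballI allI)
    show "min r1 r2 > 0" "ball x (min r1 r2) \<subseteq> U" using r1 r2 by auto
    fix y w assume y: "y \<in> ball x (min r1 r2)"
    then have yU: "y \<in> U" using r2 by auto
    have lin: "linear (\<lambda>w. frechet_derivative g (at y) w - frechet_derivative g (at x) w)"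
      by (intro linear_compose_sub has_derivative_linear[OF sd(2)] yU x)
    let ?D = "\<lambda>w. frechet_derivative g (at y) w - frechet_derivative g (at x) w"
    have "?D w = ?D (\<Sum>b\<in>Basis. (w \<bullet> b) *\<^sub>R b)" by (simp add: euclidean_representation)
    also have "\<dots> = (\<Sum>b\<in>Basis. (w \<bullet> b) * ?D b)"
      using linear_sum[OF lin, of "\<lambda>b. (w \<bullet> b) *\<^sub>R b" Basis] linear_scale[OF lin] by simp
    finally have "\<bar>?D w\<bar> \<le> (\<Sum>b\<in>Basis. \<bar>(w \<bullet> b) * ?D b\<bar>)" using sum_abs by metis
    also have "\<dots> \<le> (\<Sum>b\<in>Basis. norm w * \<bar>?D b\<bar>)"
      unfolding abs_mult by (intro sum_mono mult_right_mono Basis_le_norm) auto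
    also have "\<dots> = S y * norm w" by (simp add: S_def sum_distrib_left mult.commute)
    also have "\<dots> \<le> e * norm w" using r1(2)[of y] y S0 by (intro mult_right_mono) (auto simp: dist_commute)
    finally show "\<bar>?D w\<bar> \<le> e * norm w" .
  qed
qed

lemma norm_pair_one: "norm (1::real, u::'b::real_normed_vector) \<le> 1 + norm u"
  using norm_Pair_le[of "1::real" u] by simp

context lagrangian_system
begin

text \<open>Beyond \<open>n0\<close> the power C1 |u|^q exceeds a |u|, because q > 1; below it the
  constant takes over.\<close>

lemma L_superlinear:
  assumes a: "a \<ge> 0" shows "\<exists>C\<ge>0. \<forall>x\<in>M. \<forall>u. a * (1 + norm u) \<le> L x u + C"
proof -
  define n0 where "n0 = (a / C1) powr (1 / (q - 1))"
  have n0: "n0 \<ge> 0" by (simp add: n0_def)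
  have "a * (1 + norm u) \<le> L x u + (a + a * n0)" if x: "x \<in> M" for x u
  proof (cases "norm u \<le> n0")
    case True
    then have "a * norm u \<le> a * n0" using a by (intro mult_left_mono) auto
    moreover have "0 \<le> L x u" using L_ge_kk[OF x, of u] kk_pos by (smt (verit) mult_nonneg_nonneg norm_ge_zero)
    ultimately show ?thesis by (simp add: algebra_simps)
  next
    case False
    then have un: "norm u > 0" using n0 by linarith
    have "a / C1 = n0 powr (q - 1)" unfolding n0_def using const_pos a by (simp add: powr_powr)
    also have "\<dots> \<le> norm u powr (q - 1)" using False n0 const_pos by (intro powr_mono2) auto
    finally have "a \<le> C1 * norm u powr (q - 1)" using const_pos by (simp add: field_simps)
    then have "a * norm u \<le> C1 * norm u powr (q - 1) * norm u" using un by (intro mult_right_mono) auto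
    also have "\<dots> = C1 * norm u powr q" using un powr_add[of "norm u" "q - 1" 1] by simp
    also have "\<dots> \<le> L x u" using L_lower[OF x, of u] const_pos by linarith
    finally show ?thesis using a mult_nonneg_nonneg[OF a n0] unfolding distrib_left by linarith
  qed
  then show ?thesis using a n0 by (intro exI[of _ "a + a * n0"]) auto
qed

text \<open>Superlinearity makes the displacement an arbitrarily small multiple of the cost, up to a
  term linear in time. Short paths of bounded cost therefore stay near their start.\<close>

lemma path_displacement_small:
  assumes \<delta>: "\<delta> > 0"
  shows "\<exists>C\<ge>0. \<forall>x y T c. path (-1) x y T c \<longrightarrow> norm (y - x) \<le> \<delta> * c + C * T"
proof -
  obtain C where C: "C \<ge> 0" "\<And>x u. x \<in> M \<Longrightarrow> \<Lambda> / \<delta> * (1 + norm u) \<le> L x u + C"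
    using L_superlinear[of "\<Lambda> / \<delta>"] \<delta> \<Lambda>_pos by (auto simp: less_imp_le)
  have "norm (y - x) \<le> \<delta> * c + \<delta> * C * T" if "path (-1) x y T c" for x y T c
    using that
  proof (induction rule: path.induct)
    case (path_step x y T c t u)
    have y: "y \<in> M" using path_step.hyps path_in by blast
    have "(\<Lambda> / \<delta> * (1 + norm u) - C) * t \<le> leg_cost (-1) u y t"
      by (rule leg_cost_ge[OF y path_step.hyps(2)]) (use C in \<open>simp add: algebra_simps\<close>)
    then have "\<delta> * ((\<Lambda> / \<delta> * (1 + norm u) - C) * t) \<le> \<delta> * leg_cost (-1) u y t" using \<delta> by (intro mult_left_mono) auto
    then have 1: "\<Lambda> * ((1 + norm u) * t) \<le> \<delta> * leg_cost (-1) u y t + \<delta> * C * t"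
    proof -
      have "\<delta> * ((\<Lambda> / \<delta> * (1 + norm u) - C) * t) = \<Lambda> * ((1 + norm u) * t) - \<delta> * C * t" using \<delta> by (simp add: field_simps)
      then show ?thesis using \<open>\<delta> * ((\<Lambda> / \<delta> * (1 + norm u) - C) * t) \<le> \<delta> * leg_cost (-1) u y t\<close> by linarith
    qed
    have "norm (flow (1, u) y (-1 * t) - y) \<le> \<Lambda> * (norm (1::real, u) * \<bar>-1 * t\<bar>)" by (rule flow_move[OF y])
    also have "\<dots> \<le> \<Lambda> * ((1 + norm u) * t)"
      using \<Lambda>_pos path_step.hyps(2) norm_pair_one[of u] by (simp add: mult_right_mono)
    finally have "norm (flow (1, u) y (-1 * t) - y) \<le> \<delta> * leg_cost (-1) u y t + \<delta> * C * t" using 1 by linarith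
    then show ?case using path_step.IH norm_triangle_ineq[of "flow (1, u) y (-1 * t) - y" "y - x"] by (simp add: algebra_simps)
  qed simp
  then show ?thesis using \<delta> C by (intro exI[of _ "\<delta> * C"]) auto
qed

lemma derivative_along_flow:
  assumes g: "smooth_on U g" and z: "z \<in> M" and U: "flow w z (-s) \<in> U"
  shows "((\<lambda>s. g (flow w z (-s))) has_real_derivative - frechet_derivative g (at (flow w z (-s))) (V w (flow w z (-s)))) (at s within S)"
proof -
  let ?y = "flow w z (-s)"
  have D: "(g has_derivative frechet_derivative g (at ?y)) (at ?y)" by (rule smooth_on_derivative(2)[OF g U])
  have f: "(\<lambda>s. flow w z (-s)) = flow (- w) z" by (rule ext) (rule flow_minus[OF z, symmetric])
  have "((\<lambda>s. flow w z (-s)) has_vector_derivative V (- w) ?y) (at s within S)"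
    using flow_deriv_within[OF z, of "- w" s S] unfolding f by (simp add: flow_minus[OF z])
  from vector_derivative_diff_chain_within[OF this has_derivative_at_withinI[OF D]]
  have "(g \<circ> (\<lambda>s. flow w z (-s)) has_vector_derivative frechet_derivative g (at ?y) (V (- w) ?y)) (at s within S)" .
  moreover have "frechet_derivative g (at ?y) (V (- w) ?y) = - frechet_derivative g (at ?y) (V w ?y)"
    unfolding vf_minus by (rule linear_neg[OF has_derivative_linear[OF D]])
  ultimately show ?thesis by (simp add: has_real_derivative_iff_has_vector_derivative o_def)
qed

text \<open>Every constant control is run backwards from \<open>x\<close>. A violated inequality
  would make the right derivative of \<open>\<psi>\<close> at 0 negative and contradict domination
  on a short piece.\<close>

lemma weak_kam_subsolution:
  assumes dom: "\<And>x y t c. path 1 x y t c \<Longrightarrow> f y \<le> f x + c - h * t"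
    and x: "x \<in> M" and g: "smooth_on U g" "x \<in> U" "g x = f x" "\<forall>y\<in>M \<inter> U. f y \<le> g y"
  shows "hamiltonian X0 X L x (frechet_derivative g (at x)) + h \<le> 0"
proof -
  have "frechet_derivative g (at x) (ctrl X0 X x u) - L x u \<le> - h" for u
  proof (rule ccontr)
    assume neg: "\<not> ?thesis"
    define \<psi> where "\<psi> t = leg_cost (-1) u x t - h * t + g (flow (1, u) x (- t))" for t
    have f0: "flow (1, u) x 0 = x" by (rule flow(1)[OF x])
    have d1: "((\<lambda>t. leg_cost (-1) u x t) has_real_derivative L x u) (at 0 within {0..1})"
      using leg_cost_deriv[OF x, of 0 1 "-1" u] f0 by simp
    have d2: "((\<lambda>t. g (flow (1, u) x (- t))) has_real_derivative - frechet_derivative g (at x) (V (1, u) x)) (at 0 within {0..1})"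
      using derivative_along_flow[OF g(1) x, of "(1, u)" 0] f0 g(2) by simp
    have der: "(\<psi> has_real_derivative L x u - h * 1 + - frechet_derivative g (at x) (V (1, u) x)) (at 0 within {0..1})"
      unfolding \<psi>_def[abs_def] by (rule DERIV_add[OF DERIV_diff[OF d1 DERIV_cmult[OF DERIV_ident]] d2])
    have "L x u - h * 1 + - frechet_derivative g (at x) (V (1, u) x) < 0" using neg by (simp add: ctrl_eq_vf)
    from has_real_derivative_neg_dec_right[OF der this]
    obtain d where d: "d > 0" "\<And>r. r > 0 \<Longrightarrow> 0 + r \<in> {0..1} \<Longrightarrow> r < d \<Longrightarrow> \<psi> (0 + r) < \<psi> 0" by blast
    obtain \<rho> where \<rho>: "\<rho> > 0" "ball x \<rho> \<subseteq> U" using smooth_on_derivative(1)[OF g(1)] g(2) open_contains_ball by blast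
    define a where "a = \<Lambda> * norm (1::real, u) + 1"
    have a: "a > 0" using \<Lambda>_pos by (simp add: a_def add_nonneg_pos)
    define r where "r = min (1/2) (min (d / 2) (\<rho> / (2 * a)))"
    have r: "r > 0" "r \<le> 1" "r < d" "r < \<rho> / a"
    proof -
      have p: "\<rho> / (2 * a) > 0" "\<rho> / a = 2 * (\<rho> / (2 * a))" using \<rho> a by simp_all
      then show "r > 0" "r \<le> 1" "r < d" "r < \<rho> / a" unfolding r_def p(2) using d by linarith+
    qed
    define z where "z = flow (1, u) x (- r)"
    have z: "z \<in> M" unfolding z_def by (rule flow_in[OF x])
    have "norm (z - x) \<le> \<Lambda> * (norm (1::real, u) * \<bar>- r\<bar>)" unfolding z_def by (rule flow_move[OF x])
    also have "\<dots> \<le> a * r" using r by (simp add: a_def algebra_simps)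
    also have "\<dots> < \<rho>" using r(4) a by (simp add: field_simps)
    finally have "z \<in> U" using \<rho>(2) by (auto simp: dist_norm norm_minus_commute)
    then have "f z \<le> g z" using g(4) z by blast
    have "path (-1) x z r (leg_cost (-1) u x r)" using path_single[OF x, of r "-1" u] r by (simp add: z_def)
    then have "path 1 z x r (leg_cost (-1) u x r)" using path_rev by fastforce
    then have "f x \<le> f z + leg_cost (-1) u x r - h * r" by (rule dom)
    moreover have "\<psi> r < \<psi> 0" using d(2)[of r] r by simp
    ultimately show False using \<open>f z \<le> g z\<close> g(3) f0 by (simp add: \<psi>_def z_def leg_cost_def)
  qed
  then have "hamiltonian X0 X L x (frechet_derivative g (at x)) \<le> - h"
    unfolding hamiltonian_def by (intro cSUP_least) auto
  then show ?thesis by simp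
qed

section \<open>The super-solution property\<close>

text \<open>Superlinearity bounds the set whose supremum is the Hamiltonian; without such a bound
  \<open>SUP\<close> carries no information.\<close>

lemma hamiltonian_upper:
  assumes x: "x \<in> M" and p: "\<And>w. \<bar>p w\<bar> \<le> K * norm w" and K: "K \<ge> 0"
  shows "p (ctrl X0 X x u) - L x u \<le> hamiltonian X0 X L x p"
proof -
  obtain C where C: "C \<ge> 0" "\<And>u. K * \<Lambda> * (1 + norm u) \<le> L x u + C"
    using L_superlinear[of "K * \<Lambda>"] K \<Lambda>_pos x by auto
  have "p (ctrl X0 X x u) - L x u \<le> C" for u
  proof -
    have "p (ctrl X0 X x u) \<le> K * norm (ctrl X0 X x u)" using p by (smt (verit))
    also have "\<dots> \<le> K * (\<Lambda> * (1 + norm u))"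
      unfolding ctrl_eq_vf using K \<Lambda>_pos V_bound[OF x, of "(1, u)"] norm_pair_one[of u]
      by (intro mult_left_mono) (auto intro: order_trans mult_left_mono)
    finally show ?thesis using C(2)[of u] by simp
  qed
  then show ?thesis unfolding hamiltonian_def
    by (intro cSUP_upper bdd_aboveI2[of _ _ C]) auto
qed

text \<open>The strict inequality at \<open>x\<close> must persist nearby for all controls at once.
  Large controls are handled by superlinearity alone, bounded ones by continuity of the fields, the
  derivative and L.\<close>

lemma hamiltonian_upper_semicontinuous:
  assumes x: "x \<in> M" and g: "smooth_on U g" "x \<in> U"
    and neg: "hamiltonian X0 X L x (frechet_derivative g (at x)) + h < 0"
  shows "\<exists>\<eta>>0. \<exists>r>0. ball x r \<subseteq> U \<and> (\<forall>y\<in>M \<inter> ball x r. \<forall>u. frechet_derivative g (at y) (V (1, u) y) \<le> L y u - (h + \<eta>))"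
proof -
  let ?p = "frechet_derivative g (at x)"
  define \<eta> where "\<eta> = (- hamiltonian X0 X L x ?p - h) / 2"
  have \<eta>: "\<eta> > 0" using neg by (simp add: \<eta>_def)
  obtain Kp where Kp: "Kp > 0" "\<And>w. \<bar>?p w\<bar> \<le> norm w * Kp"
    using bounded_linear.pos_bounded[OF has_derivative_bounded_linear[OF smooth_on_derivative(2)[OF g]]] by auto
  have lin: "linear ?p" by (rule has_derivative_linear[OF smooth_on_derivative(2)[OF g]])
  have at_x: "?p (V (1, u) x) - L x u \<le> - h - 2 * \<eta>" for u
  proof -
    have "?p (ctrl X0 X x u) - L x u \<le> hamiltonian X0 X L x ?p"
      by (rule hamiltonian_upper[OF x, of ?p Kp]) (use Kp in \<open>simp_all add: mult.commute\<close>)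
    moreover have "H = - h - 2 * ((- H - h) / 2)" for H :: real by (simp add: field_simps)
    then have "hamiltonian X0 X L x ?p = - h - 2 * \<eta>" unfolding \<eta>_def .
    ultimately show ?thesis by (simp add: ctrl_eq_vf)
  qed
  obtain r1 where r1: "r1 > 0" "ball x r1 \<subseteq> U" "\<And>y w. y \<in> ball x r1 \<Longrightarrow> \<bar>frechet_derivative g (at y) w - ?p w\<bar> \<le> 1 * norm w"
    using frechet_uniform_modulus[OF g zero_less_one] by blast
  obtain C where C: "C \<ge> 0" "\<And>y u. y \<in> M \<Longrightarrow> ((Kp + 1) * \<Lambda> + 1) * (1 + norm u) \<le> L y u + C"
    using L_superlinear[of "(Kp + 1) * \<Lambda> + 1"] Kp \<Lambda>_pos by auto
  \<comment> \<open>From 1 + |u| \<ge> R0 on, the surplus 1 + |u| in the superlinear bound already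
    exceeds all other terms.\<close>
  define R0 where "R0 = C + \<bar>h\<bar> + \<eta>"
  have R0: "R0 > 0" using C \<eta> by (simp add: R0_def)
  define e where "e = \<eta> / (2 * (\<Lambda> * R0 + 1))"
  have e: "e > 0" using \<eta> \<Lambda>_pos R0 by (simp add: e_def add_pos_pos)
  have eR: "e * (\<Lambda> * R0) \<le> \<eta> / 2"
  proof -
    have "\<eta> / (2 * D) * D = \<eta> / 2" if "D > 0" for D :: real using that by simp
    then have "e * (\<Lambda> * R0 + 1) = \<eta> / 2" unfolding e_def by (meson \<Lambda>_pos R0 mult_pos_pos add_pos_pos zero_less_one)
    then show ?thesis using e by (simp add: algebra_simps)
  qed
  obtain r2 where r2: "r2 > 0" "\<And>y w. y \<in> ball x r2 \<Longrightarrow> \<bar>frechet_derivative g (at y) w - ?p w\<bar> \<le> e * norm w"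
    using frechet_uniform_modulus[OF g e] by blast
  define B where "B = Kp * (\<Lambda> * R0) + CL * R0^2 + 1"
  have B: "B > 0" using Kp \<Lambda>_pos R0 const_pos by (simp add: B_def add_nonneg_pos)
  define r where "r = min (min r1 r2) (min \<rho>L (\<eta> / (2 * B)))"
  have r: "r > 0" using r1 r2 const_pos \<eta> B by (simp add: r_def)
  have main: "frechet_derivative g (at y) (V (1, u) y) \<le> L y u - (h + \<eta>)" if y: "y \<in> M" "y \<in> ball x r" for y u
  proof -
    have yr: "y \<in> ball x r1" "y \<in> ball x r2" "dist y x < \<rho>L" "dist y x \<le> \<eta> / (2 * B)"
      using y(2) by (auto simp: r_def dist_commute)
    let ?D = "frechet_derivative g (at y)"
    have nV: "norm (V (1, u) y) \<le> \<Lambda> * (1 + norm u)"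
      using V_bound[OF y(1), of "(1, u)"] mult_left_mono[OF norm_pair_one[of u], of \<Lambda>] \<Lambda>_pos by linarith
    show ?thesis
    proof (cases "1 + norm u \<ge> R0")
      case True
      have "?D (V (1, u) y) \<le> ?p (V (1, u) y) + 1 * norm (V (1, u) y)" using r1(3)[OF yr(1), of "V (1, u) y"] by linarith
      also have "\<dots> \<le> (Kp + 1) * norm (V (1, u) y)" using Kp(2)[of "V (1, u) y"] by (simp add: algebra_simps)
      also have "\<dots> \<le> (Kp + 1) * (\<Lambda> * (1 + norm u))" using nV Kp by (intro mult_left_mono) auto
      also have "\<dots> \<le> L y u + C - (1 + norm u)" using C(2)[OF y(1), of u] by (simp add: algebra_simps)
      finally show ?thesis using True by (simp add: R0_def)
    next
      case False
      then have u: "1 + norm u \<le> R0" by simp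
      have nV2: "norm (V (1, u) y) \<le> \<Lambda> * R0" using nV u \<Lambda>_pos by (meson mult_left_mono order_trans less_imp_le)
      have 1: "?D (V (1, u) y) - ?p (V (1, u) y) \<le> \<eta> / 2"
      proof -
        have "?D (V (1, u) y) - ?p (V (1, u) y) \<le> e * norm (V (1, u) y)" using r2(2)[OF yr(2), of "V (1, u) y"] by linarith
        also have "\<dots> \<le> e * (\<Lambda> * R0)" using nV2 e by (intro mult_left_mono) auto
        finally show ?thesis using eR by linarith
      qed
      have 2: "?p (V (1, u) y) - ?p (V (1, u) x) \<le> Kp * (\<Lambda> * R0) * dist y x"
      proof -
        have "?p (V (1, u) y) - ?p (V (1, u) x) = ?p (V (1, u) y - V (1, u) x)" using linear_diff[OF lin] by simp
        also have "\<dots> \<le> norm (V (1, u) y - V (1, u) x) * Kp" using Kp(2) by (smt (verit))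
        also have "\<dots> \<le> (\<Lambda> * norm (1::real, u) * norm (y - x)) * Kp" using V_lipschitz[OF y(1) x] Kp by (intro mult_right_mono) auto
        also have "\<dots> \<le> (\<Lambda> * R0 * norm (y - x)) * Kp"
          using norm_pair_one[of u] u \<Lambda>_pos Kp by (intro mult_right_mono mult_left_mono) auto
        finally show ?thesis by (simp add: dist_norm mult_ac)
      qed
      have 3: "L x u - L y u \<le> CL * R0^2 * dist y x"
      proof -
        have "L x u - L y u \<le> CL * (norm u)\<^sup>2 * dist y x" using L_lipschitz[OF y(1) x yr(3), of u] by linarith
        also have "\<dots> \<le> CL * R0^2 * dist y x" using u const_pos by (intro mult_right_mono mult_left_mono power_mono) auto
        finally show ?thesis .
      qed
      have "(Kp * (\<Lambda> * R0) + CL * R0^2) * dist y x \<le> B * (\<eta> / (2 * B))"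
        unfolding B_def[symmetric] using yr(4) B Kp \<Lambda>_pos R0 const_pos by (intro mult_mono) (auto simp: B_def)
      also have "\<dots> = \<eta> / 2" using B by simp
      finally have "Kp * (\<Lambda> * R0) * dist y x + CL * R0^2 * dist y x \<le> \<eta> / 2" by (simp add: algebra_simps)
      then show ?thesis using 1 2 3 at_x[of u] by linarith
    qed
  qed
  have "ball x r \<subseteq> U" using r1(2) by (auto simp: r_def)
  then show ?thesis using \<eta> r main by (intro exI[of _ \<eta>] conjI exI[of _ r]) auto
qed

lemma leg_cost_mono: "x \<in> M \<Longrightarrow> 0 \<le> s \<Longrightarrow> s \<le> t \<Longrightarrow> leg_cost dr u x s \<le> leg_cost dr u x t"
  using leg_cost_add[of x s "t - s" dr u] leg_cost_nonneg[of "flow (1, u) x (dr * s)" "t - s" dr u] flow_in[of x] by auto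

text \<open>The pointwise inequality is integrated along a backward path; the smallness condition on
  cost and time keeps the whole path in the ball where it holds.\<close>

lemma path_derivative_lower_bound:
  assumes g: "smooth_on U g" and r: "ball x0 r \<subseteq> U"
    and b: "\<And>y u. y \<in> M \<Longrightarrow> y \<in> ball x0 r \<Longrightarrow> frechet_derivative g (at y) (V (1, u) y) \<le> L y u - b"
    and disp: "\<And>x y T c. path (-1) x y T c \<Longrightarrow> norm (y - x) \<le> \<delta> * c + C * T" and \<delta>: "\<delta> \<ge> 0" "C \<ge> 0"
  shows "path (-1) x0 y T c \<Longrightarrow> \<delta> * c + C * T < r \<Longrightarrow> g x0 - c + b * T \<le> g y"
proof (induction x0\<equiv>x0 y T c rule: path.induct)
  case (path_step y T c t u)
  have y: "y \<in> M" using path_step.hyps path_in by blast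
  have lt0: "leg_cost (-1) u y t \<ge> 0" by (rule leg_cost_nonneg[OF y path_step.hyps(3)])
  have "\<delta> * c + C * T \<le> \<delta> * (c + leg_cost (-1) u y t) + C * (T + t)"
    using lt0 path_step.hyps(3) \<delta> by (intro add_mono mult_left_mono) auto
  then have IH: "g x0 - c + b * T \<le> g y" using path_step.hyps(2) path_step.prems by simp
  show ?case
  proof (cases "t = 0")
    case True then show ?thesis using IH flow(1)[OF y] by (simp add: leg_cost_def)
  next
    case False
    then have t: "t > 0" using path_step.hyps(3) by simp
    have inb: "flow (1, u) y (- s) \<in> ball x0 r" if s: "0 \<le> s" "s \<le> t" for s
    proof -
      have "path (-1) x0 (flow (1, u) y (-1 * s)) (T + s) (c + leg_cost (-1) u y s)" by (rule path.path_step[OF path_step.hyps(1) s(1)])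
      from disp[OF this] have "norm (flow (1, u) y (- s) - x0) \<le> \<delta> * (c + leg_cost (-1) u y s) + C * (T + s)" by simp
      also have "\<dots> \<le> \<delta> * (c + leg_cost (-1) u y t) + C * (T + t)"
        using s leg_cost_mono[OF y s, of "-1" u] \<delta> by (intro add_mono mult_left_mono) auto
      also have "\<dots> < r" by (rule path_step.prems)
      finally show ?thesis by (simp add: dist_norm norm_minus_commute)
    qed
    let ?A = "\<lambda>s. g (flow (1, u) y (- s)) + leg_cost (-1) u y s - b * s"
    let ?z = "\<lambda>s. flow (1, u) y (- s)"
    let ?d = "\<lambda>s. - frechet_derivative g (at (?z s)) (V (1, u) (?z s)) + L (?z s) u - b * 1"
    have der: "(?A has_derivative (\<lambda>h. ?d s * h)) (at s within {0..t})" if s: "0 \<le> s" "s \<le> t" for s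
    proof -
      have d2: "((\<lambda>t. leg_cost (-1) u y t) has_real_derivative L (?z s) u) (at s within {0..t})"
        using leg_cost_deriv[OF y s, of "-1" u] by simp
      have d1: "((\<lambda>s. g (?z s)) has_real_derivative - frechet_derivative g (at (?z s)) (V (1, u) (?z s))) (at s within {0..t})"
        by (rule derivative_along_flow[OF g y]) (use inb[OF s] r in blast)
      have "(?A has_real_derivative ?d s) (at s within {0..t})" by (rule DERIV_diff[OF DERIV_add[OF d1 d2] DERIV_cmult[OF DERIV_ident]])
      then show ?thesis by (simp add: has_field_derivative_def)
    qed
    obtain s where s: "s \<in> {0<..<t}" "?A t - ?A 0 = ?d s * (t - 0)" using mvt_simple[OF t der] by blast
    have "?d s \<ge> 0" using b[OF flow_in[OF y] inb[of s], of u] s by simp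
    then have "?A t - ?A 0 \<ge> 0" unfolding s(2) using t by simp
    then show ?thesis using IH flow(1)[OF y] by (simp add: leg_cost_def algebra_simps)
  qed
qed simp

text \<open>A nearly calibrated path of short duration \<open>t\<close> enters \<open>x\<close>.
  Integrating a strictly violated inequality along it gains \<eta> t, more than the calibration
  error \<eta> t / 2.\<close>

lemma weak_kam_supersolution:
  assumes bd: "\<And>x. x \<in> M \<Longrightarrow> \<bar>f x\<bar> \<le> Kf"
    and attain: "\<And>y t \<epsilon>. y \<in> M \<Longrightarrow> t \<ge> 0 \<Longrightarrow> \<epsilon> > 0 \<Longrightarrow> \<exists>x c. path 1 x y t c \<and> f x + c - h * t \<le> f y + \<epsilon>"
    and x: "x \<in> M" and g: "smooth_on U g" "x \<in> U" "g x = f x" "\<forall>y\<in>M \<inter> U. f y \<ge> g y"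
  shows "hamiltonian X0 X L x (frechet_derivative g (at x)) + h \<ge> 0"
proof (rule ccontr)
  assume "\<not> ?thesis"
  then have "hamiltonian X0 X L x (frechet_derivative g (at x)) + h < 0" by simp
  from hamiltonian_upper_semicontinuous[OF x g(1,2) this]
  obtain \<eta> r where \<eta>: "\<eta> > 0" and r: "r > 0" "ball x r \<subseteq> U"
    and b: "\<And>y u. y \<in> M \<Longrightarrow> y \<in> ball x r \<Longrightarrow> frechet_derivative g (at y) (V (1, u) y) \<le> L y u - (h + \<eta>)" by blast
  have Kf: "Kf \<ge> 0" using bd[OF x] by linarith
  define A where "A = 2 * Kf + \<bar>h\<bar> + \<eta>"
  have A: "A > 0" using Kf \<eta> by (simp add: A_def)
  \<comment> \<open>The path will cost at most \<open>A\<close>, so the cost accounts for at most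
    half of the radius \<open>r\<close>.\<close>
  define \<delta> where "\<delta> = r / (2 * A)"
  have \<delta>: "\<delta> > 0" using r A by (simp add: \<delta>_def)
  obtain C where C: "C \<ge> 0" "\<And>x y T c. path (-1) x y T c \<Longrightarrow> norm (y - x) \<le> \<delta> * c + C * T"
    using path_displacement_small[OF \<delta>] by blast
  define t where "t = min 1 (r / (4 * (C + 1)))"
  have t: "t > 0" "t \<le> 1" using r C by (auto simp: t_def)
  have Ct: "C * t < r / 2"
  proof -
    have "C * t \<le> (C + 1) * (r / (4 * (C + 1)))" using C r t by (intro mult_mono) (auto simp: t_def)
    also have "\<dots> = r / 4" using C by (simp add: field_simps)
    finally show ?thesis using r by linarith
  qed
  obtain z c where z: "path 1 z x t c" "f z + c - h * t \<le> f x + \<eta> * t / 2" using attain[OF x, of t "\<eta> * t / 2"] t \<eta> by auto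
  have zM: "z \<in> M" using z path_in by blast
  have p: "path (-1) x z t c" using path_rev[OF z(1)] by simp
  have "h * t \<le> \<bar>h\<bar>" "\<eta> * t \<le> \<eta>"
    using t \<eta> mult_mono[of h "\<bar>h\<bar>" t 1] mult_left_mono[of t 1 \<eta>] by auto
  then have "c \<le> A" using z(2) bd[OF x] bd[OF zM] \<eta> unfolding A_def by linarith
  then have "\<delta> * c \<le> \<delta> * A" using \<delta> by (intro mult_left_mono) auto
  also have "\<dots> = r / 2" using A by (simp add: \<delta>_def)
  finally have small: "\<delta> * c + C * t < r" using Ct by linarith
  have "g x - c + (h + \<eta>) * t \<le> g z"
    by (rule path_derivative_lower_bound[OF g(1) r(2) b C(2) _ C(1) p small]) (use \<delta> in auto)
  moreover have "z \<in> U" using C(2)[OF p] small r(2) by (auto simp: dist_norm norm_minus_commute)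
  then have "g z \<le> f z" using g(4) zM by blast
  moreover have "\<eta> * t > 0" using \<eta> t by simp
  ultimately show False using z(2) g(3) by (simp add: algebra_simps)
qed

theorem viscosity_solution_exists: "\<exists>h f. viscosity_solution M X0 X L h f"
proof -
  obtain h f Kf where f: "continuous_on M f" "\<And>x. x \<in> M \<Longrightarrow> \<bar>f x\<bar> \<le> Kf" "\<And>x y t c. path 1 x y t c \<Longrightarrow> f y \<le> f x + c - h * t"
    "\<And>y t \<epsilon>. y \<in> M \<Longrightarrow> t \<ge> 0 \<Longrightarrow> \<epsilon> > 0 \<Longrightarrow> \<exists>x c. path 1 x y t c \<and> f x + c - h * t \<le> f y + \<epsilon>"
    using weak_kam_solution by blast
  have "viscosity_solution M X0 X L h f"
    unfolding viscosity_solution_def subdiff_def superdiff_def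
    using f(1) weak_kam_subsolution[of f h] weak_kam_supersolution[of f Kf h] f(2-4) by auto
  then show ?thesis by blast
qed

end

section \<open>Comparison of sub- and super-solutions\<close>

lemma smooth_quadratic: "smooth (\<lambda>y::'a::euclidean_space. c + k * (norm (x - y))\<^sup>2)"
proof -
  have "smooth (\<lambda>y::'a. y)" by (rule smooth_bounded_linear[OF bounded_linear_ident])
  then have "smooth (\<lambda>y. x - y)" by (intro smooth_diff smooth_const)
  then have "smooth (\<lambda>y. c + k * (\<Sum>b\<in>(Basis::'a set). ((x - y) \<bullet> b) * ((x - y) \<bullet> b)))"
    by (intro smooth_add smooth_const smooth_mult smooth_sum smooth_inner_const)
  moreover have "(\<lambda>y. c + k * (\<Sum>b\<in>(Basis::'a set). ((x - y) \<bullet> b) * ((x - y) \<bullet> b))) = (\<lambda>y. c + k * (norm (x - y))\<^sup>2)"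
    by (simp only: power2_norm_eq_inner euclidean_inner[symmetric])
  ultimately show ?thesis by simp
qed

lemma frechet_derivative_quadratic:
  "frechet_derivative (\<lambda>y::'a::euclidean_space. c + k * (norm (x - y))\<^sup>2) (at y) = (\<lambda>w. - 2 * k * ((x - y) \<bullet> w))"
proof (rule frechet_derivative_at[symmetric])
  have "((\<lambda>y. c + k * ((x - y) \<bullet> (x - y))) has_derivative (\<lambda>w. - 2 * k * ((x - y) \<bullet> w))) (at y)"
    by (auto intro!: derivative_eq_intros simp: inner_commute algebra_simps)
  then show "((\<lambda>y. c + k * (norm (x - y))\<^sup>2) has_derivative (\<lambda>w. - 2 * k * ((x - y) \<bullet> w))) (at y)"
    by (simp add: power2_norm_eq_inner)
qed

text \<open>Both convolutions are compared across an Euler step with the optimal point frozen, so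
  only the quadratic penalty changes, and its change is exact.\<close>

lemma quadratic_step:
  fixes x y F :: "'a::real_inner"
  assumes "\<epsilon> > 0"
  shows "(norm (x - \<tau> *\<^sub>R F - y))\<^sup>2 / (2 * \<epsilon>)
    = (norm (x - y))\<^sup>2 / (2 * \<epsilon>) - \<tau> * (((x - y) \<bullet> F) / \<epsilon>) + \<tau> * (\<tau> * ((norm F)\<^sup>2 / (2 * \<epsilon>)))"
proof -
  have "(norm (x - \<tau> *\<^sub>R F - y))\<^sup>2 = (norm (x - y))\<^sup>2 - 2 * \<tau> * ((x - y) \<bullet> F) + \<tau>\<^sup>2 * (norm F)\<^sup>2"
    unfolding power2_norm_eq_inner by (simp add: inner_diff_left inner_diff_right inner_commute algebra_simps power2_eq_square)
  then show ?thesis using assms by (simp add: field_simps power2_eq_square)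
qed

lemma discrete_gronwall:
  fixes D \<alpha> \<beta> :: "nat \<Rightarrow> real"
  assumes D0: "D 0 \<le> 0" and step: "\<And>k. k < n \<Longrightarrow> D (Suc k) \<le> (1 + \<alpha> k) * D k + \<beta> k"
    and pos: "\<And>k. \<alpha> k \<ge> 0" "\<And>k. \<beta> k \<ge> 0"
  shows "k \<le> n \<Longrightarrow> D k \<le> exp (\<Sum>i<k. \<alpha> i) * (\<Sum>i<k. \<beta> i)"
proof (induction k)
  case (Suc k)
  let ?a = "\<Sum>i<k. \<alpha> i" and ?b = "\<Sum>i<k. \<beta> i"
  have b: "?b \<ge> 0" by (intro sum_nonneg pos)
  have a: "?a + \<alpha> k \<ge> 0" using sum_nonneg[of "{..<k}" \<alpha>] pos by (simp add: add_nonneg_nonneg)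
  have "D (Suc k) \<le> (1 + \<alpha> k) * (exp ?a * ?b) + \<beta> k"
  proof -
    have "(1 + \<alpha> k) * D k \<le> (1 + \<alpha> k) * (exp ?a * ?b)" using Suc pos(1)[of k] by (intro mult_left_mono) auto
    then show ?thesis using step[of k] Suc.prems by simp
  qed
  also have "\<dots> \<le> exp (\<alpha> k) * (exp ?a * ?b) + exp (?a + \<alpha> k) * \<beta> k"
  proof (rule add_mono)
    show "(1 + \<alpha> k) * (exp ?a * ?b) \<le> exp (\<alpha> k) * (exp ?a * ?b)"
      using exp_ge_add_one_self[of "\<alpha> k"] b by (intro mult_right_mono) auto
    show "\<beta> k \<le> exp (?a + \<alpha> k) * \<beta> k" using a pos(2)[of k] mult_right_mono[of 1 "exp (?a + \<alpha> k)" "\<beta> k"] by simp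
  qed
  also have "\<dots> = exp (?a + \<alpha> k) * (?b + \<beta> k)" by (simp add: exp_add algebra_simps)
  finally show ?case by simp
qed (use D0 in simp)

text \<open>The exponents -q and 2 - 2q are negative, so all three expressions tend to 0 as
  \<open>R\<close> grows.\<close>

lemma truncation_radius_exists:
  fixes q a b c d :: real
  assumes q: "q > 1" and d: "d > 0"
  shows "\<exists>R\<ge>1. a * R powr (- q) \<le> 1 \<and> b * (R^2 * R powr (- q) * R powr (- q)) \<le> 1 \<and> c * R powr (- q) < d"
proof -
  have l1: "((\<lambda>R. R powr (- q)) \<longlongrightarrow> 0) at_top" by (rule tendsto_neg_powr[OF _ filterlim_ident]) (use q in simp)
  have l2: "((\<lambda>R. R powr (2 - 2 * q)) \<longlongrightarrow> 0) at_top" by (rule tendsto_neg_powr[OF _ filterlim_ident]) (use q in simp)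
  have e1: "eventually (\<lambda>R. a * R powr (- q) < 1) at_top" using order_tendstoD(2)[OF tendsto_mult[OF tendsto_const[of a] l1], of 1] by simp
  have e2: "eventually (\<lambda>R. b * R powr (2 - 2 * q) < 1) at_top" using order_tendstoD(2)[OF tendsto_mult[OF tendsto_const[of b] l2], of 1] by simp
  have e3: "eventually (\<lambda>R. c * R powr (- q) < d) at_top" using order_tendstoD(2)[OF tendsto_mult[OF tendsto_const[of c] l1], of d] d by simp
  have "eventually (\<lambda>R. R \<ge> 1 \<and> a * R powr (- q) < 1 \<and> b * R powr (2 - 2 * q) < 1 \<and> c * R powr (- q) < d) at_top"
    using eventually_ge_at_top[of 1] e1 e2 e3 by eventually_elim auto
  then obtain R where R: "R \<ge> 1" "a * R powr (- q) < 1" "b * R powr (2 - 2 * q) < 1" "c * R powr (- q) < d"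
    using eventually_happens'[OF trivial_limit_at_top_linorder] by blast
  have "R^2 = R powr 2" using R by (simp add: powr_numeral)
  then have "R^2 * R powr (- q) * R powr (- q) = R powr (2 + - q + - q)" by (simp only: powr_add)
  also have "2 + - q + - q = 2 - 2 * q" by simp
  finally show ?thesis using R by (intro exI[of _ R]) auto
qed

lemma sqrt_two_scale_exists:
  fixes A J e0 :: real
  assumes "A \<ge> 0" "J \<ge> 0" "e0 > 0"
  shows "\<exists>\<epsilon>>0. sqrt (2 * \<epsilon> * A) + sqrt (2 * \<epsilon> * J) \<le> e0"
proof -
  define \<epsilon> where "\<epsilon> = e0^2 / (8 * (A + J + 1))"
  have p: "A + J + 1 > 0" using assms by simp
  have \<epsilon>: "\<epsilon> > 0" using assms p by (simp add: \<epsilon>_def)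
  have le: "sqrt (2 * \<epsilon> * B) \<le> e0 / 2" if B: "B \<le> A + J + 1" for B
  proof -
    have "2 * \<epsilon> * B \<le> 2 * \<epsilon> * (A + J + 1)" using \<epsilon> B by simp
    also have "\<dots> = (e0 / 2)^2" using p by (simp add: \<epsilon>_def power_divide field_simps)
    finally have "sqrt (2 * \<epsilon> * B) \<le> sqrt ((e0 / 2)^2)" by (rule real_sqrt_le_mono)
    then show ?thesis using assms by simp
  qed
  show ?thesis using \<epsilon> le[of A] le[of J] assms by (intro exI[of _ \<epsilon>]) auto
qed

context lagrangian_system
begin

section \<open>Inf- and sup-convolutions in the ambient space\<close>

text \<open>At the minimiser a concave quadratic touches \<open>g\<close> from below, so (x - y) /
  \<epsilon> represents a super-differential. \<open>\<theta>\<close> pays for a control that only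
  nearly attains the supremum. The selection is made for all ambient \<open>x\<close>, since Euler
  polygons leave M.\<close>

lemma supersolution_inf_convolution:
  assumes g: "continuous_on M g" and super: "\<And>x p. x \<in> M \<Longrightarrow> p \<in> superdiff M g x \<Longrightarrow> hamiltonian X0 X L x p + h \<ge> 0"
    and \<epsilon>: "\<epsilon> > 0" and \<theta>: "\<theta> > 0"
  shows "\<exists>Y U. \<forall>x. Y x \<in> M \<and> (\<forall>y\<in>M. g (Y x) + (norm (x - Y x))\<^sup>2 / (2 * \<epsilon>) \<le> g y + (norm (x - y))\<^sup>2 / (2 * \<epsilon>))
     \<and> L (Y x) (U x) - h - \<theta> \<le> ((x - Y x) \<bullet> V (1, U x) (Y x)) / \<epsilon>"
proof -
  have "\<exists>y u. y \<in> M \<and> (\<forall>y'\<in>M. g y + (norm (x - y))\<^sup>2 / (2 * \<epsilon>) \<le> g y' + (norm (x - y'))\<^sup>2 / (2 * \<epsilon>))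
     \<and> L y u - h - \<theta> \<le> ((x - y) \<bullet> V (1, u) y) / \<epsilon>" for x
  proof -
    have "continuous_on M (\<lambda>y. g y + (norm (x - y))\<^sup>2 / (2 * \<epsilon>))" using \<epsilon> by (intro continuous_intros g) auto
    from continuous_attains_inf[OF M_compact M_nonempty this]
    obtain y where y: "y \<in> M" "\<forall>y'\<in>M. g y + (norm (x - y))\<^sup>2 / (2 * \<epsilon>) \<le> g y' + (norm (x - y'))\<^sup>2 / (2 * \<epsilon>)" by blast
    define k where "k = - 1 / (2 * \<epsilon>)"
    define \<phi> where "\<phi> = (\<lambda>y'. (g y + (norm (x - y))\<^sup>2 / (2 * \<epsilon>)) + k * (norm (x - y'))\<^sup>2)"
    have s: "smooth_on UNIV \<phi>" unfolding \<phi>_def smooth_iff_smooth_on[symmetric] by (rule smooth_quadratic)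
    have e: "\<phi> y = g y" "\<forall>y'\<in>M \<inter> UNIV. g y' \<ge> \<phi> y'" using y by (auto simp: \<phi>_def k_def algebra_simps)
    have "frechet_derivative \<phi> (at y) \<in> superdiff M g y"
      unfolding superdiff_def mem_Collect_eq by (intro exI[of _ \<phi>] exI[of _ UNIV] conjI refl UNIV_I s e)
    then have H: "hamiltonian X0 X L y (frechet_derivative \<phi> (at y)) + h \<ge> 0" by (rule super[OF y(1)])
    have D: "frechet_derivative \<phi> (at y) w = ((x - y) \<bullet> w) / \<epsilon>" for w
      unfolding \<phi>_def frechet_derivative_quadratic by (simp add: k_def)
    have "\<exists>u. L y u - h - \<theta> \<le> ((x - y) \<bullet> V (1, u) y) / \<epsilon>"
    proof (rule ccontr)
      assume neg: "\<not> ?thesis"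
      have "frechet_derivative \<phi> (at y) (ctrl X0 X y u) - L y u \<le> - h - \<theta>" for u
      proof -
        have "\<not> (L y u - h - \<theta> \<le> ((x - y) \<bullet> V (1, u) y) / \<epsilon>)" using neg by blast
        then show ?thesis unfolding D ctrl_eq_vf by linarith
      qed
      then have "hamiltonian X0 X L y (frechet_derivative \<phi> (at y)) \<le> - h - \<theta>"
        unfolding hamiltonian_def by (intro cSUP_least) auto
      then show False using H \<theta> by simp
    qed
    then show ?thesis using y by blast
  qed
  then show ?thesis by metis
qed

text \<open>Here the inequality holds for every control, as the supremum itself is bounded. The
  controls can therefore be borrowed from the chain of the inf-convolution.\<close>

lemma subsolution_sup_convolution:
  assumes f: "continuous_on M f" and sub: "\<And>x p. x \<in> M \<Longrightarrow> p \<in> subdiff M f x \<Longrightarrow> hamiltonian X0 X L x p + h \<le> 0"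
    and \<epsilon>: "\<epsilon> > 0"
  shows "\<exists>Y. \<forall>z. Y z \<in> M \<and> (\<forall>y\<in>M. f y - (norm (z - y))\<^sup>2 / (2 * \<epsilon>) \<le> f (Y z) - (norm (z - Y z))\<^sup>2 / (2 * \<epsilon>))
     \<and> (\<forall>u. h - L (Y z) u \<le> ((z - Y z) \<bullet> V (1, u) (Y z)) / \<epsilon>)"
proof -
  have "\<exists>y. y \<in> M \<and> (\<forall>y'\<in>M. f y' - (norm (z - y'))\<^sup>2 / (2 * \<epsilon>) \<le> f y - (norm (z - y))\<^sup>2 / (2 * \<epsilon>))
     \<and> (\<forall>u. h - L y u \<le> ((z - y) \<bullet> V (1, u) y) / \<epsilon>)" for z
  proof -
    have "continuous_on M (\<lambda>y. f y - (norm (z - y))\<^sup>2 / (2 * \<epsilon>))" using \<epsilon> by (intro continuous_intros f) auto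
    from continuous_attains_sup[OF M_compact M_nonempty this]
    obtain y where y: "y \<in> M" "\<forall>y'\<in>M. f y' - (norm (z - y'))\<^sup>2 / (2 * \<epsilon>) \<le> f y - (norm (z - y))\<^sup>2 / (2 * \<epsilon>)" by blast
    define k where "k = 1 / (2 * \<epsilon>)"
    define \<phi> where "\<phi> = (\<lambda>y'. (f y - (norm (z - y))\<^sup>2 / (2 * \<epsilon>)) + k * (norm (z - y'))\<^sup>2)"
    have s: "smooth_on UNIV \<phi>" unfolding \<phi>_def smooth_iff_smooth_on[symmetric] by (rule smooth_quadratic)
    have e: "\<phi> y = f y" "\<forall>y'\<in>M \<inter> UNIV. f y' \<le> \<phi> y'" using y by (auto simp: \<phi>_def k_def algebra_simps)
    have "frechet_derivative \<phi> (at y) \<in> subdiff M f y"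
      unfolding subdiff_def mem_Collect_eq by (intro exI[of _ \<phi>] exI[of _ UNIV] conjI refl UNIV_I s e)
    then have H: "hamiltonian X0 X L y (frechet_derivative \<phi> (at y)) + h \<le> 0" by (rule sub[OF y(1)])
    have D: "frechet_derivative \<phi> (at y) w = - (((z - y) \<bullet> w) / \<epsilon>)" for w
      unfolding \<phi>_def frechet_derivative_quadratic by (simp add: k_def)
    have bd: "\<bar>frechet_derivative \<phi> (at y) w\<bar> \<le> norm (z - y) / \<epsilon> * norm w" for w
      unfolding D using Cauchy_Schwarz_ineq2[of "z - y" w] \<epsilon> by (simp add: abs_divide divide_right_mono)
    have "h - L y u \<le> ((z - y) \<bullet> V (1, u) y) / \<epsilon>" for u
      using hamiltonian_upper[OF y(1) bd, of u] H \<epsilon> unfolding D ctrl_eq_vf by simp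
    then show ?thesis using y by blast
  qed
  then show ?thesis by metis
qed

text \<open>A minimising chain for the inf-convolution of \<open>g\<close> is shadowed by a truncated chain for the sup-convolution of \<open>f\<close>. If
  \<open>h > h'\<close>, the difference of the two convolutions grows linearly in time, although it is bounded. The parameters are chosen
  in the order \<open>T\<close>, \<open>R\<close>, \<open>\<epsilon>\<close>, \<open>\<tau>\<close>.\<close>

theorem viscosity_comparison:
  assumes f: "continuous_on M f" and sub: "\<And>x p. x \<in> M \<Longrightarrow> p \<in> subdiff M f x \<Longrightarrow> hamiltonian X0 X L x p + h \<le> 0"
    and g: "continuous_on M g" and super: "\<And>x p. x \<in> M \<Longrightarrow> p \<in> superdiff M g x \<Longrightarrow> hamiltonian X0 X L x p + h' \<ge> 0"
  shows "h \<le> h'"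
proof (rule ccontr)
  define \<gamma> where "\<gamma> = h - h'"
  assume "\<not> h \<le> h'"
  then have \<gamma>: "\<gamma> > 0" by (simp add: \<gamma>_def)
  obtain x0 where x0: "x0 \<in> M" using M_nonempty by blast
  obtain Kf where Kf: "\<And>x. x \<in> M \<Longrightarrow> \<bar>f x\<bar> \<le> Kf"
    using compact_imp_bounded[OF compact_continuous_image[OF f M_compact]] unfolding bounded_iff by auto
  obtain Kg where Kg: "\<And>x. x \<in> M \<Longrightarrow> \<bar>g x\<bar> \<le> Kg"
    using compact_imp_bounded[OF compact_continuous_image[OF g M_compact]] unfolding bounded_iff by auto
  define K where "K = max Kf Kg"
  have K: "\<And>x. x \<in> M \<Longrightarrow> \<bar>f x\<bar> \<le> K" "\<And>x. x \<in> M \<Longrightarrow> \<bar>g x\<bar> \<le> K" using Kf Kg by (auto simp: K_def le_max_iff_disj)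
  have K0: "K \<ge> 0" using K(1)[OF x0] by linarith
  \<comment> \<open>Per unit of time the chain for \<open>G\<close> loses two
    \<open>\<theta>\<close> and the chain for \<open>\<Phi>\<close> one; together they may consume
    half of \<open>\<gamma>\<close>.\<close>
  define \<theta> where "\<theta> = min (1 / 2) (\<gamma> / 6)"
  have \<theta>: "\<theta> > 0" "\<theta> \<le> 1 / 2" "3 * \<theta> \<le> \<gamma> / 2" using \<gamma> by (auto simp: \<theta>_def)
  \<comment> \<open>The growth over time \<open>T\<close> is at least T \<gamma> / 2 = 4 K + 4. With
    initial value at least -2 K and truncation errors at most 3, it exceeds the bound 2 K on the
    difference.\<close>
  define T where "T = (8 * K + 8) / \<gamma>"
  have T: "T > 0" "T * \<gamma> = 8 * K + 8" using \<gamma> K0 by (simp_all add: T_def)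
  \<comment> \<open>Bounds the running cost of the minimising chain and also each of its
    penalties.\<close>
  define A where "A = 2 * K + (\<bar>h'\<bar> + 1) * T"
  have A: "A \<ge> 0" using K0 T by (simp add: A_def)
  define a where "a = A / C1"
  define b where "b = A / kk"
  have ab: "a \<ge> 0" "b \<ge> 0" using A const_pos kk_pos by (simp_all add: a_def b_def)
  \<comment> \<open>Gronwall constants: the two chains will stay within c1 \<rho> + (c2 - 1) E of
    each other.\<close>
  define c1 where "c1 = exp (\<Lambda> * b) * (\<Lambda> * a)"
  define c2 where "c2 = 1 + exp (\<Lambda> * b) * (\<Lambda> * b)"
  have c: "c1 \<ge> 0" "c2 \<ge> 1" using ab \<Lambda>_pos by (simp_all add: c1_def c2_def)
  \<comment> \<open>\<open>R\<close> settles the errors that do not involve \<epsilon>: the delay,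
    the product of R^2 R^(-q) with the displacement R^(-q), and half of the room within
    \<open>\<rho>L\<close>.\<close>
  obtain R where R: "R \<ge> 1" and R1: "(\<bar>h\<bar> + K2) * a * R powr (- q) \<le> 1"
    and R2: "CL * a * c1 * (R^2 * R powr (- q) * R powr (- q)) \<le> 1" and R3: "c1 * R powr (- q) < \<rho>L / 2"
    using truncation_radius_exists[of q "\<rho>L / 2" "(\<bar>h\<bar> + K2) * a" "CL * a * c1" c1] const_pos by auto
  define \<rho> where "\<rho> = R powr (- q)"
  have \<rho>: "\<rho> > 0" "\<rho> \<le> 1" using R const_pos powr_mono[of "- q" 0 R] by (simp_all add: \<rho>_def)
  \<comment> \<open>Bounds the penalty along the chain of the sup-convolution; together with
    \<open>A\<close> it determines how far both chains are from M.\<close>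
  define J where "J = 2 * K + T * (\<bar>h\<bar> + K2 + 1) + (\<bar>h\<bar> + K2) * a + C2 * R^2 * a"
  have J: "J \<ge> 0" using K0 T ab const_pos by (simp add: J_def)
  define W where "W = CL * R^2 * \<rho> * a * c2"
  have W: "W \<ge> 0" using const_pos \<rho> ab c by (simp add: W_def)
  define e0 where "e0 = min (1 / (W + 1)) (\<rho>L / (4 * c2))"
  have e0: "e0 > 0" using W const_pos c by (simp add: e0_def)
  obtain \<epsilon> where \<epsilon>: "\<epsilon> > 0" and E0: "sqrt (2 * \<epsilon> * A) + sqrt (2 * \<epsilon> * J) \<le> e0" using sqrt_two_scale_exists[OF A J e0] by blast
  define E where "E = sqrt (2 * \<epsilon> * A) + sqrt (2 * \<epsilon> * J)"
  have E: "E \<ge> 0" "W * E \<le> 1" "c2 * E < \<rho>L / 2"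
  proof -
    show "E \<ge> 0" using A J \<epsilon> by (simp add: E_def)
    have E1: "E \<le> 1 / (W + 1)" "E \<le> \<rho>L / (4 * c2)" using E0 by (simp_all add: E_def e0_def)
    have "W * E \<le> (W + 1) * (1 / (W + 1))" using E1 W \<open>E \<ge> 0\<close> by (intro mult_mono) auto
    then show "W * E \<le> 1" using W by simp
    have "c2 * E \<le> c2 * (\<rho>L / (4 * c2))" using E1 c by (intro mult_left_mono) auto
    also have "\<dots> = \<rho>L / 4" using c by simp
    finally show "c2 * E < \<rho>L / 2" using const_pos by linarith
  qed
  \<comment> \<open>The slope of the penalty is large but fixed before the time step. By
    superlinearity it bounds the controls by \<open>R'\<close>, hence the quadratic error of an
    Euler step.\<close>
  define P where "P = sqrt (2 * \<epsilon> * A) / \<epsilon>"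
  have P: "P \<ge> 0" using A \<epsilon> by (simp add: P_def)
  obtain C where C: "C \<ge> 0" "\<And>y u. y \<in> M \<Longrightarrow> (P * \<Lambda> + 1) * (1 + norm u) \<le> L y u + C"
    using L_superlinear[of "P * \<Lambda> + 1"] P \<Lambda>_pos by auto
  define R' where "R' = C + \<bar>h'\<bar> + 1"
  have R': "R' > 0" using C by (simp add: R'_def)
  define Q where "Q = (2 * \<Lambda> * R')^2 / (2 * \<epsilon>)"
  have Q: "Q \<ge> 0" using \<epsilon> by (simp add: Q_def)
  \<comment> \<open>The number of steps makes the second-order error \<tau> Q of a step at most
    \<open>\<theta>\<close>.\<close>
  obtain N :: nat where N: "N > T * Q / \<theta>" using reals_Archimedean2 by blast
  have N0: "N \<ge> 1" using N T Q \<theta> by (smt (verit) One_nat_def Suc_leI divide_nonneg_pos gr0I mult_nonneg_nonneg of_nat_0)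
  define \<tau> where "\<tau> = T / N"
  have \<tau>: "\<tau> > 0" "N * \<tau> = T" using T N0 by (simp_all add: \<tau>_def)
  have \<tau>Q: "\<tau> * Q \<le> \<theta>"
  proof -
    have "T * Q \<le> \<theta> * N" using N \<theta> by (simp add: pos_divide_less_eq mult.commute)
    then show ?thesis using N0 by (simp add: \<tau>_def divide_le_eq)
  qed
  obtain Y U where YU: "\<forall>x. Y x \<in> M \<and> (\<forall>y\<in>M. g (Y x) + (norm (x - Y x))\<^sup>2 / (2 * \<epsilon>) \<le> g y + (norm (x - y))\<^sup>2 / (2 * \<epsilon>))
     \<and> L (Y x) (U x) - h' - \<theta> \<le> ((x - Y x) \<bullet> V (1, U x) (Y x)) / \<epsilon>"
    using supersolution_inf_convolution[OF g super \<epsilon> \<theta>(1)] by blast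
  obtain Y' where Y': "\<forall>z. Y' z \<in> M \<and> (\<forall>y\<in>M. f y - (norm (z - y))\<^sup>2 / (2 * \<epsilon>) \<le> f (Y' z) - (norm (z - Y' z))\<^sup>2 / (2 * \<epsilon>))
     \<and> (\<forall>u. h - L (Y' z) u \<le> ((z - Y' z) \<bullet> V (1, u) (Y' z)) / \<epsilon>)"
    using subsolution_sup_convolution[OF f sub \<epsilon>] by blast
  \<comment> \<open>An Euler polygon run backwards in the ambient space; its velocity is taken at
    the optimal point, which lies in M.\<close>
  define x where "x = rec_nat x0 (\<lambda>k x. x - \<tau> *\<^sub>R V (1, U x) (Y x))"
  define y where "y k = Y (x k)" for k
  define u where "u k = U (x k)" for k
  define \<mu> where "\<mu> k = max 1 (norm (u k) / R)" for k
  define v where "v k = u k /\<^sub>R \<mu> k" for k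
  \<comment> \<open>The shadowing chain applies the same control \<open>u k\<close> while the drift
    is multiplied by \<open>\<mu> k\<close>: this is the slowed control run for time \<tau>
    \<mu>.\<close>
  define z where "z = rec_nat x0 (\<lambda>k z. z - \<tau> *\<^sub>R V (\<mu> k, u k) (Y' z))"
  define y' where "y' k = Y' (z k)" for k
  have x_Suc: "x (Suc k) = x k - \<tau> *\<^sub>R V (1, u k) (y k)" for k by (simp add: x_def u_def y_def)
  have z_Suc: "z (Suc k) = z k - \<tau> *\<^sub>R V (\<mu> k, u k) (y' k)" for k by (simp add: z_def y'_def)
  have x_0: "x 0 = x0" "z 0 = x0" by (simp_all add: x_def z_def)
  define G where "G k = g (y k) + (norm (x k - y k))\<^sup>2 / (2 * \<epsilon>)" for k
  define \<Phi> where "\<Phi> k = f (y' k) - (norm (z k - y' k))\<^sup>2 / (2 * \<epsilon>)" for k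
  define l where "l k = L (y k) (u k)" for k
  have yM: "y k \<in> M" "y' k \<in> M" for k using YU Y' by (auto simp: y_def y'_def)
  have G_le: "G k \<le> g w + (norm (x k - w))\<^sup>2 / (2 * \<epsilon>)" if "w \<in> M" for k w
    using YU that by (simp add: G_def y_def)
  have \<Phi>_ge: "f w - (norm (z k - w))\<^sup>2 / (2 * \<epsilon>) \<le> \<Phi> k" if "w \<in> M" for k w
    using Y' that by (simp add: \<Phi>_def y'_def)
  have G_opt: "l k - h' - \<theta> \<le> ((x k - y k) \<bullet> V (1, u k) (y k)) / \<epsilon>" for k
    using YU by (simp add: l_def y_def u_def)
  have \<Phi>_opt: "h - L (y' k) w \<le> ((z k - y' k) \<bullet> V (1, w) (y' k)) / \<epsilon>" for k w
    using Y' by (simp add: y'_def)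
  have l0: "kk * (1 + norm (u k)) \<le> l k" "l k \<ge> 0" "C1 * norm (u k) powr q \<le> l k" for k
  proof -
    show 1: "kk * (1 + norm (u k)) \<le> l k" unfolding l_def by (rule L_ge_kk[OF yM(1)])
    then show "l k \<ge> 0" using kk_pos by (smt (verit) mult_nonneg_nonneg norm_ge_zero)
    show "C1 * norm (u k) powr q \<le> l k" using L_lower[OF yM(1)[of k], of "u k"] const_pos by (simp add: l_def)
  qed
  have G_ge: "G k \<ge> - K" "\<Phi> k \<le> K" for k
  proof -
    have "(norm (x k - y k))\<^sup>2 / (2 * \<epsilon>) \<ge> 0" "(norm (z k - y' k))\<^sup>2 / (2 * \<epsilon>) \<ge> 0" using \<epsilon> by simp_all
    then show "G k \<ge> - K" "\<Phi> k \<le> K" using K(2)[OF yM(1), of k] K(1)[OF yM(2), of k] unfolding G_def \<Phi>_def by linarith+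
  qed
  have u_bound: "1 + norm (u k) \<le> R'" if Gk: "G k \<le> K + (\<bar>h'\<bar> + 1) * T" for k
  proof -
    have "(norm (x k - y k))\<^sup>2 / (2 * \<epsilon>) \<le> A" using Gk K(2)[OF yM(1), of k] unfolding G_def A_def by linarith
    then have "(norm (x k - y k))\<^sup>2 \<le> 2 * \<epsilon> * A" using \<epsilon> by (simp add: pos_divide_le_eq mult.commute)
    then have p: "norm (x k - y k) \<le> sqrt (2 * \<epsilon> * A)" by (rule real_le_rsqrt)
    have "l k - h' - \<theta> \<le> (norm (x k - y k) * norm (V (1, u k) (y k))) / \<epsilon>"
      using G_opt[of k] norm_cauchy_schwarz[of "x k - y k" "V (1, u k) (y k)"] \<epsilon> by (meson divide_right_mono less_imp_le order_trans)
    also have "\<dots> \<le> (sqrt (2 * \<epsilon> * A) * (\<Lambda> * (1 + norm (u k)))) / \<epsilon>"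
    proof (intro divide_right_mono mult_mono p)
      show "norm (V (1, u k) (y k)) \<le> \<Lambda> * (1 + norm (u k))"
        using V_bound[OF yM(1), of "(1, u k)" k] mult_left_mono[OF norm_pair_one[of "u k"], of \<Lambda>] \<Lambda>_pos by linarith
    qed (use \<epsilon> A in auto)
    also have "\<dots> = P * \<Lambda> * (1 + norm (u k))" by (simp add: P_def)
    finally have "l k - h' - \<theta> \<le> P * \<Lambda> * (1 + norm (u k))" .
    then show ?thesis using C(2)[OF yM(1), of "u k" k] \<theta> unfolding R'_def l_def by (simp add: distrib_right)
  qed
  have V_small: "\<tau> * ((norm (V (s, u k) w))\<^sup>2 / (2 * \<epsilon>)) \<le> \<theta>" if "1 + norm (u k) \<le> R'" "w \<in> M" "\<bar>s\<bar> \<le> 1 + norm (u k)" for s k w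
  proof -
    have "norm (V (s, u k) w) \<le> \<Lambda> * norm (s, u k)" by (rule V_bound[OF that(2)])
    also have "\<dots> \<le> \<Lambda> * (2 * R')" using norm_Pair_le[of s "u k"] that \<Lambda>_pos by (intro mult_left_mono) auto
    finally have "(norm (V (s, u k) w))\<^sup>2 \<le> (2 * \<Lambda> * R')^2" by (intro power_mono) (auto simp: mult_ac)
    then have "(norm (V (s, u k) w))\<^sup>2 / (2 * \<epsilon>) \<le> Q" unfolding Q_def using \<epsilon> by (intro divide_right_mono) auto
    then have "\<tau> * ((norm (V (s, u k) w))\<^sup>2 / (2 * \<epsilon>)) \<le> \<tau> * Q" using \<tau> by (intro mult_left_mono) auto
    then show ?thesis using \<tau>Q by linarith
  qed
  have k\<tau>: "real k * \<tau> \<le> T" if "k \<le> N" for k using that \<tau> by (metis mult_right_mono of_nat_le_iff less_imp_le)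
  have G_step: "G (Suc k) \<le> G k - \<tau> * (l k - h' - 2 * \<theta>)" if Gk: "G k \<le> K + (\<bar>h'\<bar> + 1) * T" for k
  proof -
    have "G (Suc k) \<le> g (y k) + (norm (x (Suc k) - y k))\<^sup>2 / (2 * \<epsilon>)" by (rule G_le[OF yM(1)])
    also have "\<dots> = G k - \<tau> * (((x k - y k) \<bullet> V (1, u k) (y k)) / \<epsilon>) + \<tau> * (\<tau> * ((norm (V (1, u k) (y k)))\<^sup>2 / (2 * \<epsilon>)))"
      unfolding x_Suc quadratic_step[OF \<epsilon>] by (simp add: G_def)
    also have "\<dots> \<le> G k - \<tau> * (l k - h' - \<theta>) + \<tau> * \<theta>"
      using mult_left_mono[OF G_opt[of k], of \<tau>] mult_left_mono[OF V_small[OF u_bound[OF Gk] yM(1)[of k], of 1], of \<tau>] \<tau> by simp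
    finally show ?thesis by (simp add: algebra_simps)
  qed
  \<comment> \<open>\<open>G_step\<close> presupposes a bound on \<open>G k\<close>; it follows from
    the induction hypothesis because the accumulated cost is nonnegative.\<close>
  have energy: "G k + \<tau> * (\<Sum>i<k. l i) \<le> K + (\<bar>h'\<bar> + 1) * (real k * \<tau>)" if "k \<le> N" for k
    using that
  proof (induction k)
    case 0
    show ?case using G_le[OF x0, of 0] K(2)[OF x0] by (simp add: x_0)
  next
    case (Suc k)
    then have IH: "G k + \<tau> * (\<Sum>i<k. l i) \<le> K + (\<bar>h'\<bar> + 1) * (real k * \<tau>)" by simp
    have "\<tau> * (\<Sum>i<k. l i) \<ge> 0" using \<tau> l0 by (simp add: sum_nonneg)
    moreover have "(\<bar>h'\<bar> + 1) * (real k * \<tau>) \<le> (\<bar>h'\<bar> + 1) * T" using k\<tau>[of k] Suc.prems by (intro mult_left_mono) auto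
    ultimately have "G k \<le> K + (\<bar>h'\<bar> + 1) * T" using IH by linarith
    from G_step[OF this] have "G (Suc k) + \<tau> * l k \<le> G k + \<tau> * (h' + 2 * \<theta>)" by (simp add: algebra_simps)
    moreover have "\<tau> * (h' + 2 * \<theta>) \<le> \<tau> * (\<bar>h'\<bar> + 1)" using \<theta> \<tau> by (intro mult_left_mono) auto
    ultimately show ?case using IH by (simp add: algebra_simps)
  qed
  have Gk: "G k \<le> K + (\<bar>h'\<bar> + 1) * T" and sum_l: "\<tau> * (\<Sum>i<k. l i) \<le> A" if "k \<le> N" for k
  proof -
    have "\<tau> * (\<Sum>i<k. l i) \<ge> 0" using \<tau> l0 by (simp add: sum_nonneg)
    moreover have "(\<bar>h'\<bar> + 1) * (real k * \<tau>) \<le> (\<bar>h'\<bar> + 1) * T" using k\<tau>[OF that] by (intro mult_left_mono) auto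
    ultimately show "G k \<le> K + (\<bar>h'\<bar> + 1) * T" "\<tau> * (\<Sum>i<k. l i) \<le> A"
      using energy[OF that] G_ge(1)[of k] unfolding A_def by linarith+
  qed
  have sum_q: "\<tau> * (\<Sum>i<k. norm (u i) powr q) \<le> a" and sum_1: "\<tau> * (\<Sum>i<k. 1 + norm (u i)) \<le> b" if "k \<le> N" for k
  proof -
    have "C1 * (\<tau> * (\<Sum>i<k. norm (u i) powr q)) = \<tau> * (\<Sum>i<k. C1 * norm (u i) powr q)" by (simp add: sum_distrib_left mult.left_commute)
    also have "\<dots> \<le> \<tau> * (\<Sum>i<k. l i)" using l0 \<tau> by (intro mult_left_mono sum_mono) auto
    also have "\<dots> \<le> A" by (rule sum_l[OF that])
    finally show "\<tau> * (\<Sum>i<k. norm (u i) powr q) \<le> a" using const_pos by (simp add: a_def pos_le_divide_eq mult.commute)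
    have "kk * (\<tau> * (\<Sum>i<k. 1 + norm (u i))) = \<tau> * (\<Sum>i<k. kk * (1 + norm (u i)))" by (simp add: sum_distrib_left mult.left_commute)
    also have "\<dots> \<le> \<tau> * (\<Sum>i<k. l i)" using l0 \<tau> by (intro mult_left_mono sum_mono) auto
    also have "\<dots> \<le> A" by (rule sum_l[OF that])
    finally show "\<tau> * (\<Sum>i<k. 1 + norm (u i)) \<le> b" using kk_pos by (simp add: b_def pos_le_divide_eq mult.commute)
  qed
  have tr: "\<mu> k \<ge> 1" "\<mu> k - 1 \<le> \<rho> * norm (u k) powr q" "norm (u k) / \<mu> k \<le> R" "\<mu> k * (norm (u k) / \<mu> k)^2 \<le> R^2 * \<rho> * norm (u k) powr q" for k
    using truncation_estimates[OF R const_pos(5) q_le_2 norm_ge_zero[of "u k"]] unfolding \<mu>_def \<rho>_def by auto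
  have sum_\<mu>: "\<tau> * (\<Sum>i<k. \<mu> i - 1) \<le> \<rho> * a" and sum_v: "\<tau> * (\<Sum>i<k. \<mu> i * (norm (u i) / \<mu> i)^2) \<le> R^2 * \<rho> * a" if "k \<le> N" for k
  proof -
    have "\<tau> * (\<Sum>i<k. \<mu> i - 1) \<le> \<tau> * (\<Sum>i<k. \<rho> * norm (u i) powr q)" using tr \<tau> by (intro mult_left_mono sum_mono) auto
    also have "\<dots> = \<rho> * (\<tau> * (\<Sum>i<k. norm (u i) powr q))" by (simp add: sum_distrib_left mult_ac)
    also have "\<dots> \<le> \<rho> * a" using sum_q[OF that] \<rho> by (intro mult_left_mono) auto
    finally show "\<tau> * (\<Sum>i<k. \<mu> i - 1) \<le> \<rho> * a" .
    have "\<tau> * (\<Sum>i<k. \<mu> i * (norm (u i) / \<mu> i)^2) \<le> \<tau> * (\<Sum>i<k. R^2 * \<rho> * norm (u i) powr q)" using tr \<tau> by (intro mult_left_mono sum_mono) auto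
    also have "\<dots> = R^2 * \<rho> * (\<tau> * (\<Sum>i<k. norm (u i) powr q))" by (simp add: sum_distrib_left mult_ac)
    also have "\<dots> \<le> R^2 * \<rho> * a" using sum_q[OF that] \<rho> by (intro mult_left_mono) auto
    finally show "\<tau> * (\<Sum>i<k. \<mu> i * (norm (u i) / \<mu> i)^2) \<le> R^2 * \<rho> * a" .
  qed
  have V\<mu>: "V (\<mu> k, u k) w = \<mu> k *\<^sub>R V (1, v k) w" for k w
  proof -
    have "(\<mu> k, u k) = \<mu> k *\<^sub>R (1, v k)" using tr(1)[of k] by (simp add: v_def)
    then show ?thesis by (simp only: vf_scaleR)
  qed
  have nv: "norm (v k) = norm (u k) / \<mu> k" for k using tr(1)[of k] by (simp add: v_def divide_inverse mult.commute)
  have \<Phi>_step: "\<Phi> (Suc k) \<ge> \<Phi> k + \<tau> * (\<mu> k * (h - L (y' k) (v k)) - \<theta>)" if k: "k \<le> N" for k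
  proof -
    have \<mu>u: "\<bar>\<mu> k\<bar> \<le> 1 + norm (u k)"
    proof -
      have "norm (u k) / R \<le> norm (u k) / 1" using R by (intro divide_left_mono) auto
      then show ?thesis by (simp add: \<mu>_def)
    qed
    have "\<mu> k * (h - L (y' k) (v k)) \<le> ((z k - y' k) \<bullet> V (\<mu> k, u k) (y' k)) / \<epsilon>"
      unfolding V\<mu> using mult_left_mono[OF \<Phi>_opt[of k "v k"], of "\<mu> k"] tr(1)[of k] by simp
    then have 1: "\<tau> * (\<mu> k * (h - L (y' k) (v k))) \<le> \<tau> * (((z k - y' k) \<bullet> V (\<mu> k, u k) (y' k)) / \<epsilon>)" using \<tau> by (intro mult_left_mono) auto
    have 2: "\<tau> * (\<tau> * ((norm (V (\<mu> k, u k) (y' k)))\<^sup>2 / (2 * \<epsilon>))) \<le> \<tau> * \<theta>"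
      using V_small[OF u_bound[OF Gk[OF k]] yM(2)[of k] \<mu>u] \<tau> by (intro mult_left_mono) auto
    have "f (y' k) - (norm (z (Suc k) - y' k))\<^sup>2 / (2 * \<epsilon>) \<le> \<Phi> (Suc k)" by (rule \<Phi>_ge[OF yM(2)])
    then show ?thesis using 1 2 unfolding z_Suc quadratic_step[OF \<epsilon>] \<Phi>_def by (simp add: right_diff_distrib)
  qed
  \<comment> \<open>A crude bound, using only the quadratic upper bound on L. It yields the distance
    of the shadowing chain from M, which has to be known before the costs of the chains can be
    compared.\<close>
  have \<Phi>_energy: "\<Phi> k \<ge> - K - \<tau> * (\<Sum>i<k. (\<bar>h\<bar> + K2 + 1) + (\<bar>h\<bar> + K2) * (\<mu> i - 1) + C2 * (\<mu> i * (norm (u i) / \<mu> i)^2))" if "k \<le> N" for k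
    using that
  proof (induction k)
    case 0
    show ?case using \<Phi>_ge[OF x0, of 0] K(1)[OF x0] by (simp add: x_0)
  next
    case (Suc k)
    have "\<mu> k * L (y' k) (v k) \<le> \<mu> k * (C2 * (norm (u k) / \<mu> k)^2 + K2)"
      using L_upper[OF yM(2)[of k], of "v k"] tr(1)[of k] unfolding nv by (intro mult_left_mono) auto
    moreover have "\<mu> k * (- h) \<le> \<mu> k * \<bar>h\<bar>" using tr(1)[of k] by (intro mult_left_mono) auto
    ultimately have "- ((\<bar>h\<bar> + K2 + 1) + (\<bar>h\<bar> + K2) * (\<mu> k - 1) + C2 * (\<mu> k * (norm (u k) / \<mu> k)^2)) \<le> \<mu> k * (h - L (y' k) (v k)) - \<theta>"
      using \<theta>(2) by (simp add: algebra_simps)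
    from mult_left_mono[OF this, of \<tau>] \<tau>
    show ?case using \<Phi>_step[of k] Suc by (simp add: algebra_simps)
  qed
  have zy: "norm (z k - y' k) \<le> sqrt (2 * \<epsilon> * J)" if k: "k \<le> N" for k
  proof -
    have "\<tau> * (\<Sum>i<k. (\<bar>h\<bar> + K2 + 1) + (\<bar>h\<bar> + K2) * (\<mu> i - 1) + C2 * (\<mu> i * (norm (u i) / \<mu> i)^2))
      = (\<bar>h\<bar> + K2 + 1) * (real k * \<tau>) + (\<bar>h\<bar> + K2) * (\<tau> * (\<Sum>i<k. \<mu> i - 1)) + C2 * (\<tau> * (\<Sum>i<k. \<mu> i * (norm (u i) / \<mu> i)^2))"
      by (simp only: sum.distrib sum_distrib_left[symmetric] sum_constant card_lessThan) (simp add: algebra_simps)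
    also have "\<dots> \<le> (\<bar>h\<bar> + K2 + 1) * T + (\<bar>h\<bar> + K2) * (1 * a) + C2 * (R^2 * 1 * a)"
    proof (intro add_mono mult_left_mono)
      show "real k * \<tau> \<le> T" by (rule k\<tau>[OF k])
      show "\<tau> * (\<Sum>i<k. \<mu> i - 1) \<le> 1 * a" using sum_\<mu>[OF k] mult_right_mono[OF \<rho>(2) ab(1)] by linarith
      show "\<tau> * (\<Sum>i<k. \<mu> i * (norm (u i) / \<mu> i)^2) \<le> R^2 * 1 * a"
        using sum_v[OF k] mult_right_mono[OF mult_left_mono[OF \<rho>(2), of "R^2"] ab(1)] by simp
    qed (use const_pos in auto)
    finally have "(norm (z k - y' k))\<^sup>2 / (2 * \<epsilon>) \<le> J"
      using \<Phi>_energy[OF k] K(1)[OF yM(2), of k] unfolding \<Phi>_def J_def by (simp add: algebra_simps)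
    then have "(norm (z k - y' k))\<^sup>2 \<le> 2 * \<epsilon> * J" using \<epsilon> by (simp add: pos_divide_le_eq mult.commute)
    then show ?thesis by (rule real_le_rsqrt)
  qed
  have xy: "norm (x k - y k) \<le> sqrt (2 * \<epsilon> * A)" if k: "k \<le> N" for k
  proof -
    have "(norm (x k - y k))\<^sup>2 / (2 * \<epsilon>) \<le> A" using Gk[OF k] K(2)[OF yM(1), of k] unfolding G_def A_def by linarith
    then have "(norm (x k - y k))\<^sup>2 \<le> 2 * \<epsilon> * A" using \<epsilon> by (simp add: pos_divide_le_eq mult.commute)
    then show ?thesis by (rule real_le_rsqrt)
  qed
  have yy: "norm (y' k - y k) \<le> norm (z k - x k) + E" if k: "k \<le> N" for k
  proof -
    have "y' k - y k = (z k - x k) - (z k - y' k) + (x k - y k) + 0" by simp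
    then have "norm (y' k - y k) \<le> norm (z k - x k) + norm (z k - y' k) + norm (x k - y k) + norm (0::'a)"
      using norm_diff_add3_le by metis
    then show ?thesis using xy[OF k] zy[OF k] by (simp add: E_def)
  qed
  have D_step: "norm (z (Suc k) - x (Suc k)) \<le> (1 + \<Lambda> * (\<tau> * (1 + norm (u k)))) * norm (z k - x k) + \<Lambda> * (\<tau> * (\<mu> k - 1) + E * (\<tau> * (1 + norm (u k))))"
    if k: "k < N" for k
  proof -
    \<comment> \<open>The excess drift and the change of base point are separated; the former is
      summed through \<open>sum_\<mu>\<close>, the latter feeds the Gronwall inequality.\<close>
    have eq: "z (Suc k) - x (Suc k) = (z k - x k) - \<tau> *\<^sub>R (V (\<mu> k - 1, 0) (y' k) + (V (1, u k) (y' k) - V (1, u k) (y k)))"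
    proof -
      have "V (\<mu> k, u k) (y' k) = V (\<mu> k - 1, 0) (y' k) + V (1, u k) (y' k)" by (simp add: vf_add[symmetric])
      then show ?thesis unfolding x_Suc z_Suc by (simp add: algebra_simps)
    qed
    have 1: "norm (V (\<mu> k - 1, 0) (y' k)) \<le> \<Lambda> * (\<mu> k - 1)" using V_bound[OF yM(2), of "(\<mu> k - 1, 0)" k] tr(1)[of k] by simp
    have 2: "norm (V (1, u k) (y' k) - V (1, u k) (y k)) \<le> \<Lambda> * (1 + norm (u k)) * (norm (z k - x k) + E)"
    proof -
      have "norm (V (1, u k) (y' k) - V (1, u k) (y k)) \<le> \<Lambda> * norm (1::real, u k) * norm (y' k - y k)" by (rule V_lipschitz[OF yM(2,1)])
      also have "\<dots> \<le> \<Lambda> * (1 + norm (u k)) * (norm (z k - x k) + E)"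
        using yy[of k] k norm_pair_one[of "u k"] \<Lambda>_pos by (intro mult_mono) auto
      finally show ?thesis .
    qed
    have "norm (z (Suc k) - x (Suc k)) \<le> norm (z k - x k) + \<tau> * norm (V (\<mu> k - 1, 0) (y' k) + (V (1, u k) (y' k) - V (1, u k) (y k)))"
      unfolding eq by (rule order_trans[OF norm_triangle_ineq4]) (use \<tau> in simp)
    also have "\<dots> \<le> norm (z k - x k) + \<tau> * (\<Lambda> * (\<mu> k - 1) + \<Lambda> * (1 + norm (u k)) * (norm (z k - x k) + E))"
      using \<tau> 1 2 by (intro add_left_mono mult_left_mono order_trans[OF norm_triangle_ineq] add_mono) auto
    finally show ?thesis by (simp add: algebra_simps)
  qed
  define D where "D = c1 * \<rho> + (c2 - 1) * E"
  have zx: "norm (z k - x k) \<le> D" if k: "k \<le> N" for k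
  proof -
    have "norm (z k - x k) \<le> exp (\<Sum>i<k. \<Lambda> * (\<tau> * (1 + norm (u i)))) * (\<Sum>i<k. \<Lambda> * (\<tau> * (\<mu> i - 1) + E * (\<tau> * (1 + norm (u i)))))"
    proof (rule discrete_gronwall[where n = N and D = "\<lambda>k. norm (z k - x k)" and \<alpha> = "\<lambda>i. \<Lambda> * (\<tau> * (1 + norm (u i)))"
          and \<beta> = "\<lambda>i. \<Lambda> * (\<tau> * (\<mu> i - 1) + E * (\<tau> * (1 + norm (u i))))"])
      show "norm (z (Suc i) - x (Suc i)) \<le> (1 + \<Lambda> * (\<tau> * (1 + norm (u i)))) * norm (z i - x i) + \<Lambda> * (\<tau> * (\<mu> i - 1) + E * (\<tau> * (1 + norm (u i))))"
        if "i < N" for i by (rule D_step[OF that])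
    qed (use x_0 \<Lambda>_pos \<tau> E tr(1) k in auto)
    also have "\<dots> = exp (\<Lambda> * (\<tau> * (\<Sum>i<k. 1 + norm (u i)))) * (\<Lambda> * (\<tau> * (\<Sum>i<k. \<mu> i - 1) + E * (\<tau> * (\<Sum>i<k. 1 + norm (u i)))))"
      by (simp only: sum.distrib[symmetric] sum_distrib_left)
    also have "\<dots> \<le> exp (\<Lambda> * b) * (\<Lambda> * (\<rho> * a + E * b))"
    proof (rule mult_mono)
      show "exp (\<Lambda> * (\<tau> * (\<Sum>i<k. 1 + norm (u i)))) \<le> exp (\<Lambda> * b)" using sum_1[OF k] \<Lambda>_pos by simp
      show "\<Lambda> * (\<tau> * (\<Sum>i<k. \<mu> i - 1) + E * (\<tau> * (\<Sum>i<k. 1 + norm (u i)))) \<le> \<Lambda> * (\<rho> * a + E * b)"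
        using sum_1[OF k] sum_\<mu>[OF k] \<Lambda>_pos E(1) by (intro mult_left_mono add_mono) auto
      show "0 \<le> \<Lambda> * (\<tau> * (\<Sum>i<k. \<mu> i - 1) + E * (\<tau> * (\<Sum>i<k. 1 + norm (u i))))"
        using \<Lambda>_pos \<tau> E(1) tr(1) by (intro mult_nonneg_nonneg add_nonneg_nonneg sum_nonneg) auto
    qed simp
    also have "\<dots> = D" by (simp add: D_def c1_def c2_def algebra_simps)
    finally show ?thesis .
  qed
  define D' where "D' = c1 * \<rho> + c2 * E"
  have D': "D' \<ge> 0" "D' < \<rho>L" using c \<rho> E R3 by (simp_all add: D'_def \<rho>_def)
  have dy: "dist (y' k) (y k) \<le> D'" if "k \<le> N" for k
    using yy[OF that] zx[OF that] by (simp add: dist_norm D_def D'_def algebra_simps)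
  have cost: "\<mu> k * L (y' k) (v k) \<le> l k + (\<mu> k - 1) * K2 + CL * D' * (\<mu> k * (norm (u k) / \<mu> k)^2)" if k: "k \<le> N" for k
  proof -
    have "L (y' k) (v k) - L (y k) (v k) \<le> CL * (norm (v k))\<^sup>2 * dist (y' k) (y k)"
      using L_lipschitz[OF yM(2)[of k] yM(1)[of k], of "v k"] dy[OF k] D'(2) by linarith
    also have "\<dots> \<le> CL * (norm (v k))\<^sup>2 * D'" using dy[OF k] const_pos by (intro mult_left_mono) auto
    finally have 1: "\<mu> k * (L (y' k) (v k) - L (y k) (v k)) \<le> \<mu> k * (CL * (norm (u k) / \<mu> k)\<^sup>2 * D')"
      unfolding nv[symmetric] using tr(1)[of k] by (intro mult_left_mono) auto
    have "L (y k) ((1 / \<mu> k) *\<^sub>R u k) \<le> (1 / \<mu> k) * L (y k) (u k) + (1 - 1 / \<mu> k) * L (y k) 0"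
      by (rule L_convex0[OF yM(1)]) (use tr(1)[of k] in auto)
    also have "(1 / \<mu> k) *\<^sub>R u k = v k" by (simp add: v_def divide_inverse)
    finally have "\<mu> k * L (y k) (v k) \<le> \<mu> k * ((1 / \<mu> k) * L (y k) (u k) + (1 - 1 / \<mu> k) * L (y k) 0)"
      using tr(1)[of k] by (intro mult_left_mono) auto
    also have "\<dots> = l k + (\<mu> k - 1) * L (y k) 0" using tr(1)[of k] by (simp add: l_def field_simps)
    also have "\<dots> \<le> l k + (\<mu> k - 1) * K2" using L_upper[OF yM(1)[of k], of 0] tr(1)[of k] by (intro add_left_mono mult_left_mono) auto
    finally show ?thesis using 1 by (simp add: algebra_simps)
  qed
  \<comment> \<open>The costs of the two chains cancel up to the delay and the Lipschitz error, so
    each step leaves a gain of \<gamma> - 3 \<theta> per unit of time.\<close>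
  have diff: "\<Phi> k - G k \<ge> - 2 * K + \<tau> * (\<Sum>i<k. (\<gamma> - 3 * \<theta>) - (\<bar>h\<bar> + K2) * (\<mu> i - 1) - CL * D' * (\<mu> i * (norm (u i) / \<mu> i)^2))" if "k \<le> N" for k
    using that
  proof (induction k)
    case 0
    show ?case using \<Phi>_ge[OF x0, of 0] K[OF x0] G_le[OF x0, of 0] by (simp add: x_0)
  next
    case (Suc k)
    have "(\<mu> k - 1) * (- h) \<le> (\<mu> k - 1) * \<bar>h\<bar>" using tr(1)[of k] by (intro mult_left_mono) auto
    then have "(\<gamma> - 3 * \<theta>) - (\<bar>h\<bar> + K2) * (\<mu> k - 1) - CL * D' * (\<mu> k * (norm (u k) / \<mu> k)^2) \<le> (\<mu> k * (h - L (y' k) (v k)) - \<theta>) + (l k - h' - 2 * \<theta>)"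
      using cost[of k] Suc.prems unfolding \<gamma>_def by (simp add: algebra_simps)
    from mult_left_mono[OF this, of \<tau>] \<tau>
    show ?case using \<Phi>_step[of k] G_step[OF Gk[of k]] Suc by (simp add: algebra_simps)
  qed
  have "\<tau> * (\<Sum>i<N. (\<gamma> - 3 * \<theta>) - (\<bar>h\<bar> + K2) * (\<mu> i - 1) - CL * D' * (\<mu> i * (norm (u i) / \<mu> i)^2))
    = (\<gamma> - 3 * \<theta>) * (real N * \<tau>) - (\<bar>h\<bar> + K2) * (\<tau> * (\<Sum>i<N. \<mu> i - 1)) - CL * D' * (\<tau> * (\<Sum>i<N. \<mu> i * (norm (u i) / \<mu> i)^2))"
    by (simp only: sum_subtractf[of "\<lambda>i. (\<gamma> - 3 * \<theta>) - (\<bar>h\<bar> + K2) * (\<mu> i - 1)"] sum_subtractf[of "\<lambda>i. \<gamma> - 3 * \<theta>"] sum_distrib_left[symmetric] sum_constant card_lessThan) (simp add: algebra_simps)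
  moreover have "(\<gamma> - 3 * \<theta>) * (real N * \<tau>) \<ge> 4 * K + 4"
  proof -
    have "\<gamma> / 2 * T \<le> (\<gamma> - 3 * \<theta>) * T" using \<theta>(3) T by (intro mult_right_mono) auto
    then show ?thesis using T(2) \<tau>(2) by (simp add: mult.commute)
  qed
  moreover have "(\<bar>h\<bar> + K2) * (\<tau> * (\<Sum>i<N. \<mu> i - 1)) \<le> 1"
  proof -
    have "(\<bar>h\<bar> + K2) * (\<tau> * (\<Sum>i<N. \<mu> i - 1)) \<le> (\<bar>h\<bar> + K2) * (\<rho> * a)" using sum_\<mu>[of N] const_pos by (intro mult_left_mono) auto
    also have "\<dots> \<le> 1" using R1 by (simp add: \<rho>_def mult_ac)
    finally show ?thesis .
  qed
  moreover have "CL * D' * (\<tau> * (\<Sum>i<N. \<mu> i * (norm (u i) / \<mu> i)^2)) \<le> 2"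
  proof -
    have "CL * D' * (\<tau> * (\<Sum>i<N. \<mu> i * (norm (u i) / \<mu> i)^2)) \<le> CL * D' * (R^2 * \<rho> * a)" using sum_v[of N] const_pos D' by (intro mult_left_mono) auto
    also have "\<dots> = CL * a * c1 * (R^2 * \<rho> * \<rho>) + W * E" by (simp add: D'_def W_def algebra_simps)
    also have "\<dots> \<le> 1 + 1" using R2 E(2) unfolding \<rho>_def by (rule add_mono)
    finally show ?thesis by simp
  qed
  ultimately show False using diff[of N] G_ge[of N] K0 by linarith
qed

end

section \<open>The main theorem\<close>

lemma smooth_k_affine:
  fixes f :: "'b::real_normed_vector \<Rightarrow> 'c::real_normed_vector"
  assumes T: "bounded_linear T"
  shows "smooth_k k UNIV f \<Longrightarrow> smooth_k k UNIV (\<lambda>u. f (a + T u))"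
proof (induction k arbitrary: f)
  case 0
  then have "continuous_on UNIV f" by simp
  moreover have "continuous_on UNIV (\<lambda>u. a + T u)" by (intro continuous_intros bounded_linear.continuous_on[OF T])
  ultimately show ?case using continuous_on_compose2[of UNIV f UNIV "\<lambda>u. a + T u"] by simp
next
  case (Suc k)
  have D: "((\<lambda>u. f (a + T u)) has_derivative (\<lambda>v. frechet_derivative f (at (a + T u)) (T v))) (at u)" for u
  proof -
    have "((\<lambda>u. a + T u) has_derivative T) (at u)"
      using has_derivative_add[OF has_derivative_const bounded_linear_imp_has_derivative[OF T]] by simp
    moreover have "(f has_derivative frechet_derivative f (at (a + T u))) (at (a + T u))"
      using Suc.prems frechet_derivative_works by auto
    ultimately show ?thesis using has_derivative_compose by blast
  qed
  have "frechet_derivative (\<lambda>u. f (a + T u)) (at u) v = frechet_derivative f (at (a + T u)) (T v)" for u v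
    using frechet_derivative_at[OF D[of u]] by metis
  then show ?case using D Suc.IH[of "\<lambda>x. frechet_derivative f (at x) (T _)"] Suc.prems
    by (auto intro: differentiableI)
qed

lemma smooth_affine: "bounded_linear T \<Longrightarrow> smooth f \<Longrightarrow> smooth (\<lambda>u. f (a + T u))"
  by (simp add: smooth_def smooth_k_affine)

lemma smooth_pair_sections:
  assumes "smooth (\<lambda>z. L (fst z) (snd z))"
  shows "smooth (L x)" "smooth (\<lambda>x. L x u)"
proof -
  show "smooth (L x)"
    using smooth_affine[OF bounded_linear_Pair[OF bounded_linear_zero bounded_linear_ident] assms, of "(x, 0)"] by simp
  show "smooth (\<lambda>x. L x u)"
    using smooth_affine[OF bounded_linear_Pair[OF bounded_linear_ident bounded_linear_zero] assms, of "(0, u)"] by simp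
qed

lemma positive_hessian_convex_at_zero:
  fixes l :: real
  assumes f: "smooth f" and pos: "\<And>u w. w \<noteq> 0 \<Longrightarrow> frechet_derivative (\<lambda>v. frechet_derivative f (at v) w) (at u) w > 0"
    and l: "0 \<le> l" "l \<le> 1"
  shows "f (l *\<^sub>R u) \<le> l * f u + (1 - l) * f (0::'b::real_normed_vector)"
proof (cases "u = 0")
  case True then show ?thesis by (simp add: algebra_simps)
next
  case False
  have "convex_on UNIV (\<lambda>r. f (0 + r *\<^sub>R u))"
  proof (rule f''_ge0_imp_convex[OF convex_UNIV])
    show "((\<lambda>r. f (0 + r *\<^sub>R u)) has_real_derivative frechet_derivative f (at (0 + r *\<^sub>R u)) u) (at r)" for r
      by (rule has_real_derivative_line[OF f])
    show "((\<lambda>r. frechet_derivative f (at (0 + r *\<^sub>R u)) u) has_real_derivative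
        frechet_derivative (\<lambda>v. frechet_derivative f (at v) u) (at (0 + r *\<^sub>R u)) u) (at r)" for r
      by (rule has_real_derivative_line[OF smooth_frechet_derivative[OF f]])
    show "0 \<le> frechet_derivative (\<lambda>v. frechet_derivative f (at v) u) (at (0 + r *\<^sub>R u)) u" for r
      using pos[OF False] by (simp add: less_imp_le)
  qed
  from convex_onD[OF this l, of 0 1] show ?thesis by (simp add: algebra_simps)
qed

text \<open>The bound concerns tangential directions and M is not convex, so it is integrated along
  curves in M. A finite cover then gives one constant and one radius, as with a Lebesgue
  number.\<close>

lemma tangential_bound_imp_lipschitz:
  fixes L :: "'a::euclidean_space \<Rightarrow> 'b::real_normed_vector \<Rightarrow> real"
  assumes M: "smooth_submanifold M" and com: "compact M" and L: "\<And>u. smooth (\<lambda>x. L x u)" and C3: "C3 > 0"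
    and dx: "\<forall>x\<in>M. \<forall>u. \<forall>v\<in>tangent_space M x. \<bar>frechet_derivative (\<lambda>y. L y u) (at x) v\<bar> \<le> C3 * (norm u)\<^sup>2 * norm v"
  shows "\<exists>CL\<ge>0. \<exists>\<rho>>0. \<forall>x\<in>M. \<forall>y\<in>M. \<forall>u. dist x y < \<rho> \<longrightarrow> \<bar>L x u - L y u\<bar> \<le> CL * (norm u)\<^sup>2 * dist x y"
proof -
  have "\<forall>p\<in>M. \<exists>\<rho> C. \<rho> > 0 \<and> C \<ge> 0 \<and> (\<forall>y\<in>M. \<forall>z\<in>M. dist y p < \<rho> \<longrightarrow> dist z p < \<rho> \<longrightarrow>
    (\<forall>u. \<bar>L y u - L z u\<bar> \<le> C * (norm u)\<^sup>2 * dist y z))"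
  proof
    fix p assume "p \<in> M"
    from submanifold_local_paths[OF M this] obtain \<rho> C where \<rho>: "\<rho> > 0" and C: "C \<ge> 0"
      and paths: "\<And>y z. y \<in> M \<Longrightarrow> z \<in> M \<Longrightarrow> dist y p < \<rho> \<Longrightarrow> dist z p < \<rho> \<Longrightarrow> \<exists>c. c 0 = y \<and> c 1 = z \<and>
        (\<forall>t\<in>{0..1::real}. c t \<in> M \<and> (\<exists>v\<in>tangent_space M (c t). (c has_vector_derivative v) (at t) \<and> norm v \<le> C * norm (y - z)))"
      by metis
    have "\<bar>L y u - L z u\<bar> \<le> (C3 * C) * (norm u)\<^sup>2 * dist y z" if yz: "y \<in> M" "z \<in> M" "dist y p < \<rho>" "dist z p < \<rho>" for y z u
    proof -
      obtain c where c: "c 0 = y" "c 1 = z" "\<forall>t\<in>{0..1::real}. c t \<in> M \<and> (\<exists>v\<in>tangent_space M (c t). (c has_vector_derivative v) (at t) \<and> norm v \<le> C * norm (y - z))"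
        using paths[OF yz] by blast
      have "\<forall>t\<in>{0..1::real}. \<exists>v. v \<in> tangent_space M (c t) \<and> (c has_vector_derivative v) (at t) \<and> norm v \<le> C * norm (y - z)"
        using c(3) by blast
      from bchoice[OF this] obtain v where v: "\<And>t. t \<in> {0..1} \<Longrightarrow> v t \<in> tangent_space M (c t)"
        "\<And>t. t \<in> {0..1} \<Longrightarrow> (c has_vector_derivative v t) (at t)" "\<And>t. t \<in> {0..1} \<Longrightarrow> norm (v t) \<le> C * norm (y - z)" by blast
      let ?D = "\<lambda>t. frechet_derivative (\<lambda>y. L y u) (at (c t)) (v t)"
      have "norm (L (c 1) u - L (c 0) u) \<le> (C3 * C) * (norm u)\<^sup>2 * dist y z * (1 - 0)"
      proof (rule vector_derivative_bound)
        fix t :: real assume "0 \<le> t" "t \<le> 1"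
        then have t: "t \<in> {0..1}" by simp
        have "((\<lambda>y. L y u) \<circ> c has_vector_derivative ?D t) (at t within {0..1})"
          by (rule vector_derivative_diff_chain_within[OF has_vector_derivative_at_within[OF v(2)[OF t]]
                has_derivative_at_withinI[OF smooth_has_derivative[OF L]]])
        then show "((\<lambda>t. L (c t) u) has_vector_derivative ?D t) (at t within {0..1})" by (simp add: o_def)
        have "norm (?D t) \<le> C3 * (norm u)\<^sup>2 * norm (v t)" using dx c(3) v(1)[OF t] t by auto
        also have "\<dots> \<le> C3 * (norm u)\<^sup>2 * (C * norm (y - z))" using v(3)[OF t] C3 by (intro mult_left_mono) auto
        finally show "norm (?D t) \<le> (C3 * C) * (norm u)\<^sup>2 * dist y z" by (simp add: dist_norm mult_ac)
      qed simp
      then show ?thesis by (simp add: c abs_minus_commute)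
    qed
    then show "\<exists>\<rho> C. \<rho> > 0 \<and> C \<ge> 0 \<and> (\<forall>y\<in>M. \<forall>z\<in>M. dist y p < \<rho> \<longrightarrow> dist z p < \<rho> \<longrightarrow>
      (\<forall>u. \<bar>L y u - L z u\<bar> \<le> C * (norm u)\<^sup>2 * dist y z))"
      using \<rho> C C3 by (intro exI[of _ \<rho>] exI[of _ "C3 * C"]) auto
  qed
  from bchoice[OF this] obtain \<rho> where "\<forall>p\<in>M. \<exists>C. \<rho> p > 0 \<and> C \<ge> 0 \<and> (\<forall>y\<in>M. \<forall>z\<in>M. dist y p < \<rho> p \<longrightarrow> dist z p < \<rho> p \<longrightarrow>
    (\<forall>u. \<bar>L y u - L z u\<bar> \<le> C * (norm u)\<^sup>2 * dist y z))" by blast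
  from bchoice[OF this] obtain C where \<rho>: "\<And>p. p \<in> M \<Longrightarrow> \<rho> p > 0" and C: "\<And>p. p \<in> M \<Longrightarrow> C p \<ge> 0"
    and lip: "\<And>p y z u. p \<in> M \<Longrightarrow> y \<in> M \<Longrightarrow> z \<in> M \<Longrightarrow> dist y p < \<rho> p \<Longrightarrow> dist z p < \<rho> p \<Longrightarrow> \<bar>L y u - L z u\<bar> \<le> C p * (norm u)\<^sup>2 * dist y z"
    by blast
  have "M \<subseteq> (\<Union>p\<in>M. ball p (\<rho> p / 2))" using \<rho> by auto
  then obtain D where D: "D \<subseteq> M" "finite D" "M \<subseteq> (\<Union>p\<in>D. ball p (\<rho> p / 2))"
    using compactE_image[OF com, of M "\<lambda>p. ball p (\<rho> p / 2)"] by auto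
  define r where "r = Min (insert 1 ((\<lambda>p. \<rho> p / 2) ` D))"
  have r: "r > 0" "\<And>p. p \<in> D \<Longrightarrow> r \<le> \<rho> p / 2"
  proof -
    show "r > 0" unfolding r_def using D \<rho> by auto
    show "r \<le> \<rho> p / 2" if "p \<in> D" for p unfolding r_def by (rule Min_le) (use D that in auto)
  qed
  define CL where "CL = (\<Sum>p\<in>D. C p)"
  have CL: "CL \<ge> 0" unfolding CL_def using D C by (intro sum_nonneg) auto
  have Cp: "C p \<le> CL" if "p \<in> D" for p unfolding CL_def by (rule member_le_sum[OF that _ D(2)]) (use C D in auto)
  have "\<bar>L x u - L y u\<bar> \<le> CL * (norm u)\<^sup>2 * dist x y" if xy: "x \<in> M" "y \<in> M" "dist x y < r" for x y u
  proof -
    obtain p where p: "p \<in> D" "dist p x < \<rho> p / 2" using D(3) xy by auto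
    have pM: "p \<in> M" using p D by blast
    have "dist y p < \<rho> p" "dist x p < \<rho> p"
      using dist_triangle[of y p x] r(2)[OF p(1)] xy(3) p(2) \<rho>[OF pM] by (auto simp: dist_commute)
    then have "\<bar>L x u - L y u\<bar> \<le> C p * (norm u)\<^sup>2 * dist x y" using lip[OF pM xy(1,2)] by blast
    also have "\<dots> \<le> CL * (norm u)\<^sup>2 * dist x y" using Cp[OF p(1)] by (intro mult_right_mono) auto
    finally show ?thesis .
  qed
  then show ?thesis using CL r(1) by blast
qed

theorem mainTheorem2:
  fixes M :: "'a::euclidean_space set"
    and X0 :: "'a \<Rightarrow> 'a"
    and X :: "'m::finite \<Rightarrow> 'a \<Rightarrow> 'a"
    and L :: "'a \<Rightarrow> real^'m \<Rightarrow> real"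
    and C1 C2 C3 K1 K2 q :: real
  assumes M_manifold: "smooth_submanifold M"
    and M_compact: "compact M" and M_connected: "connected M" and M_nonempty: "M \<noteq> {}"
    and X0_smooth: "smooth_on UNIV X0" and X0_tangent: "\<forall>x\<in>M. X0 x \<in> tangent_space M x"
    and X_smooth: "\<forall>i. smooth_on UNIV (X i)"
    and X_tangent: "\<forall>i. \<forall>x\<in>M. X i x \<in> tangent_space M x"
    and L_smooth: "smooth_on UNIV (\<lambda>z. L (fst z) (snd z))"
    and constants_pos: "C1 > 0" "C2 > 0" "C3 > 0" "K1 > 0" "K2 > 0" "q > 1"
    and L_bounds: "\<forall>x\<in>M. \<forall>u. C1 * norm u powr q + K1 \<le> L x u \<and> L x u \<le> C2 * (norm u)\<^sup>2 + K2"
    and L_dx: "\<forall>x\<in>M. \<forall>u. \<forall>v\<in>tangent_space M x.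
                 \<bar>frechet_derivative (\<lambda>y. L y u) (at x) v\<bar> \<le> C3 * (norm u)\<^sup>2 * norm v"
    and L_convex: "\<forall>x\<in>M. \<forall>u. \<forall>w. w \<noteq> 0 \<longrightarrow>
                 frechet_derivative (\<lambda>u'. frechet_derivative (L x) (at u') w) (at u) w > 0"
    and X_gen: "k_generating M 3 X"
  shows "\<exists>!h::real. \<exists>f. viscosity_solution M X0 X L h f"
proof -
  have sX: "smooth X0" "\<And>i. smooth (X i)" and sL: "smooth (\<lambda>z. L (fst z) (snd z))"
    using X0_smooth X_smooth L_smooth by (simp_all add: smooth_iff_smooth_on)
  note sections = smooth_pair_sections[OF sL]
  obtain CL \<rho>L where CL: "CL \<ge> 0" "\<rho>L > 0"
    "\<forall>x\<in>M. \<forall>y\<in>M. \<forall>u. dist x y < \<rho>L \<longrightarrow> \<bar>L x u - L y u\<bar> \<le> CL * (norm u)\<^sup>2 * dist x y"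
    using tangential_bound_imp_lipschitz[OF M_manifold M_compact sections(2) constants_pos(3) L_dx] by blast
  interpret lagrangian_system M X0 X L C1 C2 K1 K2 q CL \<rho>L
  proof
    show "vf X0 X y x \<in> tangent_space M x" if x: "x \<in> M" for x y
      unfolding vf_def using X0_tangent X_tangent x
      by (intro subspace_add subspace_scale subspace_sum tangent_space_subspace[OF M_manifold x]) auto
    show "L x (l *\<^sub>R u) \<le> l * L x u + (1 - l) * L x 0" if "x \<in> M" "0 \<le> l" "l \<le> 1" for x u l
      by (rule positive_hessian_convex_at_zero[OF sections(1)]) (use L_convex that in auto)
    show "continuous_on (M \<times> UNIV) (\<lambda>z. L (fst z) (snd z))" by (rule smooth_continuous_on[OF sL])
  qed (use M_manifold M_compact M_connected M_nonempty sX constants_pos L_bounds X_gen CL in auto)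
  \<comment> \<open>Each solution is both a sub- and a super-solution, so comparison applies in both
    orders.\<close>
  have "h \<le> h'" if "viscosity_solution M X0 X L h f" "viscosity_solution M X0 X L h' f'" for h h' f f'
    using that unfolding viscosity_solution_def by (intro viscosity_comparison[of f h f' h']) auto
  then show ?thesis using viscosity_solution_exists by (metis order_antisym)
qed

end
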